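(* Let $X_n$ be the size of a random catastrophe among all excursions with catastrophes of length $n$, with distribution $\Pr(X_n=k)=[z^nu^k]A(z,u)/[z^n]A(z,1)$ where $A(z,u)=E(z)+Q(z,u)D(z)^2E(z)$. Then $X_n$ admits a discrete limit distribution $\lim_{n\to\infty}\Pr(X_n=k)=[u^k]\,\omega(u)$, where $\omega(u)=Q(\rho_0,u)$ if $\rho_0\le\rho$, and, if $\rho_0$ does not exist, \[\omega(u)=\frac{\frac C\tau+\big(\frac C\tau D(\rho)^2+2\eta D(\rho)^3\big)Q(\rho,u)+\eta(u)D(\rho)^2}{\frac C\tau+\big(\frac C\tau D(\rho)^2+2\eta D(\rho)^3\big)Q(\rho,1)+\eta D(\rho)^2},\] with $C=\sqrt{2P(\tau)/P''(\tau)}$.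
   Context: Fix integers $c,d\ge1$ and non-negative real weights $p_{-c},\dots,p_d$ with $p_{-c}\neq0\neq p_d$; jump set $\mathcal J=\{i: p_i\neq0\}$, jump polynomial $P(u)=\sum_{i=-c}^dp_iu^i$. Standing assumption: $P$ is aperiodic (there are no integer $b$, integer $p\ge2$ and Laurent polynomial $H$ with $P(u)=u^bH(u^p)$). A catastrophe is a step from an altitude $h>0$ with $-h\notin\mathcal J$ directly to altitude $0$; its size is $h$ and its weight is $q>0$. Paths start at altitude $0$; each step is a jump $i\in\mathcal J$ (weight $p_i$) or a catastrophe; the weight of a path is the product of its step weights. Meanders never go below $0$; excursions are meanders ending at $0$. Let $M(z,u)=\sum m_{n,k}z^nu^k$, with $m_{n,k}$ the total weight of catastrophe-free meanders of length $n$ ending at altitude $k$; $M_k(z)=[u^k]M(z,u)$, $M(z)=M(z,1)$, $E(z)=M_0(z)$. Let $Q(z,u)=zq\big(M(z,u)-E(z)-\sum_{j>0,-j\in\mathcal J}u^jM_j(z)\big)$, $Q(z)=Q(z,1)$, $D(z)=1/(1-Q(z))$. Let $\tau>0$ be the minimal positive real solution of $P'(\tau)=0$ and $\rho=1/P(\tau)$. Let $\rho_0$ be the smallest positive real zero of $1-Q(z)$ satisfying $\rho_0\le\rho$, if it exists ("$\rho_0$ does not exist" otherwise). For $0\le u\le 1$, $\eta(u)$ is defined by $Q(z,u)=Q(\rho,u)-\eta(u)\sqrt{1-z/\rho}+O(1-z/\rho)$ as $z\to\rho^-$, and $\eta=\eta(1)$. *)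

theory Defs
  imports "HOL-Analysis.Analysis" "HOL-Computational_Algebra.Formal_Power_Series"
          "HOL-Library.Landau_Symbols"
begin

text \<open>Weights p : int => real (p i = weight of jump i), jump set {i. p i \<noteq> 0}.
 Bivariate series in (z,u) are represented as real fps fps: the outer variable is z,
 the inner variable is u, so [z^n u^k] F = fps_nth (fps_nth F n) k.\<close>

definition jump_poly :: "(int \<Rightarrow> real) \<Rightarrow> nat \<Rightarrow> nat \<Rightarrow> real \<Rightarrow> real" where
  "jump_poly p c d x = (\<Sum>i\<in>{-int c..int d}. p i * x powi i)"

definition aperiodic :: "(int \<Rightarrow> real) \<Rightarrow> bool" where
  "aperiodic p \<longleftrightarrow> \<not> (\<exists>(b::int) (per::nat) (h::int \<Rightarrow> real). per \<ge> 2 \<and>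
      (\<forall>i. p i = (if (i - b) mod int per = 0 then h ((i - b) div int per) else 0)))"

definition meanders :: "(int \<Rightarrow> real) \<Rightarrow> nat \<Rightarrow> int \<Rightarrow> int list set" where
  "meanders p n k = {js. length js = n \<and> (\<forall>j\<in>set js. p j \<noteq> 0) \<and>
      (\<forall>i\<le>n. 0 \<le> sum_list (take i js)) \<and> sum_list js = k}"

definition mw :: "(int \<Rightarrow> real) \<Rightarrow> nat \<Rightarrow> nat \<Rightarrow> real" where
  "mw p n k = (\<Sum>js\<in>meanders p n (int k). prod_list (map p js))"

definition Mser :: "(int \<Rightarrow> real) \<Rightarrow> real fps fps" where
  "Mser p = Abs_fps (\<lambda>n. Abs_fps (\<lambda>k. mw p n k))"

definition Mk :: "(int \<Rightarrow> real) \<Rightarrow> nat \<Rightarrow> real fps" where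
  "Mk p k = Abs_fps (\<lambda>n. mw p n k)"

definition Eser :: "(int \<Rightarrow> real) \<Rightarrow> real fps" where
  "Eser p = Mk p 0"

definition liftz :: "real fps \<Rightarrow> real fps fps" where
  "liftz f = Abs_fps (\<lambda>n. fps_const (fps_nth f n))"

definition Qser :: "(int \<Rightarrow> real) \<Rightarrow> real \<Rightarrow> real fps fps" where
  "Qser p q = fps_X * fps_const (fps_const q) *
     (Mser p - liftz (Eser p)
      - (\<Sum>j\<in>{j::nat. 0 < j \<and> p (- int j) \<noteq> 0}. fps_const (fps_X ^ j) * liftz (Mk p j)))"

text \<open>F(z,1) for a bivariate series with finitely supported coefficients in u\<close>
definition at_u1 :: "real fps fps \<Rightarrow> real fps" where
  "at_u1 F = Abs_fps (\<lambda>n. (\<Sum>k. fps_nth (fps_nth F n) k))"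

definition Dser :: "(int \<Rightarrow> real) \<Rightarrow> real \<Rightarrow> real fps" where
  "Dser p q = inverse (1 - at_u1 (Qser p q))"

definition Aser :: "(int \<Rightarrow> real) \<Rightarrow> real \<Rightarrow> real fps fps" where
  "Aser p q = liftz (Eser p) + Qser p q * liftz ((Dser p q)\<^sup>2 * Eser p)"

definition prob_X :: "(int \<Rightarrow> real) \<Rightarrow> real \<Rightarrow> nat \<Rightarrow> nat \<Rightarrow> real" where
  "prob_X p q n k = fps_nth (fps_nth (Aser p q) n) k / fps_nth (at_u1 (Aser p q)) n"

definition Qfun :: "(int \<Rightarrow> real) \<Rightarrow> real \<Rightarrow> real \<Rightarrow> real \<Rightarrow> real" where
  "Qfun p q z u = (\<Sum>n. (\<Sum>k. fps_nth (fps_nth (Qser p q) n) k * u ^ k) * z ^ n)"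

definition tau :: "(int \<Rightarrow> real) \<Rightarrow> nat \<Rightarrow> nat \<Rightarrow> real" where
  "tau p c d = Inf {t. 0 < t \<and> deriv (jump_poly p c d) t = 0}"

definition rho :: "(int \<Rightarrow> real) \<Rightarrow> nat \<Rightarrow> nat \<Rightarrow> real" where
  "rho p c d = 1 / jump_poly p c d (tau p c d)"

definition rho0_exists :: "(int \<Rightarrow> real) \<Rightarrow> nat \<Rightarrow> nat \<Rightarrow> real \<Rightarrow> bool" where
  "rho0_exists p c d q \<longleftrightarrow> (\<exists>z. 0 < z \<and> z \<le> rho p c d \<and> 1 - Qfun p q z 1 = 0)"

definition rho0 :: "(int \<Rightarrow> real) \<Rightarrow> nat \<Rightarrow> nat \<Rightarrow> real \<Rightarrow> real" where
  "rho0 p c d q = Inf {z. 0 < z \<and> z \<le> rho p c d \<and> 1 - Qfun p q z 1 = 0}"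

definition eta :: "(int \<Rightarrow> real) \<Rightarrow> nat \<Rightarrow> nat \<Rightarrow> real \<Rightarrow> real \<Rightarrow> real" where
  "eta p c d q u = (THE e. (\<lambda>z. Qfun p q z u -
       (Qfun p q (rho p c d) u - e * sqrt (1 - z / rho p c d)))
     \<in> O[at_left (rho p c d)](\<lambda>z. 1 - z / rho p c d))"

definition omega :: "(int \<Rightarrow> real) \<Rightarrow> nat \<Rightarrow> nat \<Rightarrow> real \<Rightarrow> real \<Rightarrow> real" where
  "omega p c d q u =
    (if rho0_exists p c d q then Qfun p q (rho0 p c d q) u
     else (let t = tau p c d; r = rho p c d;
               P = jump_poly p c d;
               C = sqrt (2 * P t / deriv (deriv P) t);
               Dr = 1 / (1 - Qfun p q r 1);
               et = eta p c d q 1 in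
       (C / t + (C / t * Dr\<^sup>2 + 2 * et * Dr ^ 3) * Qfun p q r u + eta p c d q u * Dr\<^sup>2) /
       (C / t + (C / t * Dr\<^sup>2 + 2 * et * Dr ^ 3) * Qfun p q r 1 + et * Dr\<^sup>2)))"

end

theory Submission
  imports Defs "HOL-Real_Asymp.Real_Asymp" "HOL-Computational_Algebra.Formal_Laurent_Series"
begin

text \<open>
  Tilting the weights to \<open>p i * \<tau> powi i * \<rho>\<close> turns the walk into a centred random walk. The kernel
  equation and a Wiener-Hopf argument express the generating function of its meanders as the
  exponential of \<open>\<Sum>n. z^n / n * [u^\<ge>0] P(u)^n\<close>. A local limit theorem with error term, obtained by comparing
  the characteristic function with that of the walk with steps \<open>-1, 0, 1\<close> of weights \<open>1/4, 1/2, 1/4\<close>, makes the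
  coefficients of this exponent \<open>n powr (-3/2)\<close> times a constant, up to \<open>n powr (-5/2)\<close>. Series
  with such coefficients have a square-root expansion at their radius of convergence, and this class is stable
  under sums, products, exponentials and subcritical quasi-inverses, which settles the
  case without \<open>\<rho>\<^sub>0\<close>. If \<open>Q\<close> takes the value 1 inside its disc of convergence, \<open>D\<close> is a renewal
  sequence of finite mean and the renewal theorem gives the double pole. If \<open>Q(\<rho>) = 1\<close>, the
  sequence \<open>D\<close> is of order \<open>n powr (-1/2)\<close>, its convolution square is bounded, bounded away from 0 and slowly
  varying, and this suffices for the quotient of coefficients. For \<open>\<tau> \<le> 1\<close> the drift at
  \<open>u = 1\<close> is non-negative, so \<open>Q\<close> diverges at \<open>1 / P(1)\<close> and one is in the double-pole case.
\<close>

section \<open>Power series with coefficients of order n to the minus three halves\<close>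

text \<open>\<open>eta\<close> is defined by the behaviour of Q(z,u) as z tends to \<rho> along the
  reals, whereas the limit law concerns coefficients. No transfer theorem in the complex plane links
  the two: the predicate \<open>sqrt_sing\<close> carries a coefficient asymptotic and a real
  expansion with one common \<eta>, and every construction preserves both. This dictates the error
  \<open>n powr (-5/2)\<close>: a remainder of this size has a finite first moment, which makes its
  expansion O(1 - x). It also explains the comparison walk, whose return probabilities divided by n
  are, up to that error, twice the coefficients of \<open>- sqrt (1 - x)\<close>, so that the model
  singularity is explicit. Aperiodicity enters by excluding further points where the characteristic
  function has modulus 1. The factor C/\<tau> is twice \<open>kap\<close>, the constant in the local
  limit theorem of the tilted walk. Evaluating Q at u means evaluating the tilted meanders at
  u/\<tau>, where the sum over altitudes is controlled only for u < \<tau>; this is the source of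
  the split at \<tau> = 1.\<close>

definition coeff_asymp :: "real fps \<Rightarrow> real \<Rightarrow> bool" where
  "coeff_asymp f l \<longleftrightarrow> (\<lambda>n. fps_nth f n * real n powr (3/2)) \<longlonglongrightarrow> l"

definition abs_sum :: "real fps \<Rightarrow> bool" where
  "abs_sum f \<longleftrightarrow> summable (\<lambda>n. \<bar>fps_nth f n\<bar>)"

definition fps_total :: "real fps \<Rightarrow> real" where
  "fps_total f = (\<Sum>n. fps_nth f n)"

text \<open>Dominated convergence for series, in the form used whenever a limit in n passes through
  a sum: the bound M does not depend on n.\<close>

lemma tannery_seq:
  fixes a :: "nat \<Rightarrow> nat \<Rightarrow> real"
  assumes "\<And>i. (\<lambda>n. a n i) \<longlonglongrightarrow> b i" "\<And>n i. \<bar>a n i\<bar> \<le> M i" "summable M"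
  shows "(\<lambda>n. \<Sum>i. a n i) \<longlonglongrightarrow> (\<Sum>i. b i)" "summable (\<lambda>i. \<bar>b i\<bar>)"
proof -
  have "\<forall>\<^sub>F (k,n) in at_top \<times>\<^sub>F sequentially. norm (a n k) \<le> M k"
    using assms(2) by (intro always_eventually) auto
  from tannerys_theorem[OF assms(1) this assms(3)]
  show "(\<lambda>n. \<Sum>i. a n i) \<longlonglongrightarrow> (\<Sum>i. b i)" "summable (\<lambda>i. \<bar>b i\<bar>)" by auto
qed

lemma convergent_powr_bound:
  fixes f :: "nat \<Rightarrow> real"
  assumes "(\<lambda>n. f n * real n powr a) \<longlonglongrightarrow> l"
  obtains C where "C > 0" "\<And>n. n \<ge> 1 \<Longrightarrow> \<bar>f n\<bar> \<le> C * real n powr (-a)"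
proof -
  from assms have "Bseq (\<lambda>n. f n * real n powr a)"
    using convergent_imp_Bseq convergentI by blast
  then obtain C where C: "C > 0" "\<And>n. \<bar>f n * real n powr a\<bar> \<le> C"
    unfolding Bseq_def by auto
  have "\<bar>f n\<bar> \<le> C * real n powr (-a)" if "n \<ge> 1" for n
  proof -
    have "\<bar>f n\<bar> * real n powr a \<le> C" using C(2)[of n] by (simp add: abs_mult)
    thus ?thesis using that by (simp add: powr_minus field_simps)
  qed
  with C(1) show ?thesis using that by blast
qed

lemma summable_powr_bound:
  fixes f :: "nat \<Rightarrow> real"
  assumes "\<And>n. n \<ge> 1 \<Longrightarrow> \<bar>f n\<bar> \<le> C * real n powr (-a)" "a > 1"
  shows "summable (\<lambda>n. \<bar>f n\<bar>)"
proof (rule summable_comparison_test')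
  show "summable (\<lambda>n. C * real n powr (-a))"
    using assms(2) by (intro summable_mult) (simp add: summable_real_powr_iff)
  show "norm \<bar>f n\<bar> \<le> C * real n powr (-a)" if "n \<ge> 1" for n using assms(1)[OF that] by simp
qed

lemma coeff_asymp_abs_sum: "coeff_asymp f l \<Longrightarrow> abs_sum f"
  unfolding coeff_asymp_def abs_sum_def
  by (erule convergent_powr_bound, rule summable_powr_bound) auto

text \<open>For i \<le> n/2 the index n - i is at least n/2, so g (n - i) times
  \<open>real n powr a\<close> stays below a constant independent of i and the limit can be taken
  term by term. Applied to both halves of a Cauchy product.\<close>

lemma half_conv:
  fixes f g :: "nat \<Rightarrow> real"
  assumes f: "summable (\<lambda>n. \<bar>f n\<bar>)" and g: "(\<lambda>n. g n * real n powr a) \<longlonglongrightarrow> \<mu>" and a: "a \<ge> 0"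
    and h: "\<And>n. h n \<le> n div 2 + 1" "filterlim h at_top sequentially"
  shows "(\<lambda>n. (\<Sum>i<h n. f i * g (n - i)) * real n powr a) \<longlonglongrightarrow> \<mu> * (\<Sum>i. f i)"
proof -
  obtain C where C: "C > 0" "\<And>n. n \<ge> 1 \<Longrightarrow> \<bar>g n\<bar> \<le> C * real n powr (-a)"
    using convergent_powr_bound[OF g] by blast
  define T where "T n i = (if i < h n then f i * g (n - i) * real n powr a else 0)" for n i
  have "(\<lambda>n. \<Sum>i. T n i) \<longlonglongrightarrow> (\<Sum>i. f i * \<mu>)"
  proof (rule tannery_seq)
    show "(\<lambda>n. T n i) \<longlonglongrightarrow> f i * \<mu>" for i
    proof -
      have "(\<lambda>n. g (n + i - i) * real (n + i - i) powr a * (real (n + i) / real n) powr a) \<longlonglongrightarrow> \<mu> * 1 powr a"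
      proof (intro tendsto_mult tendsto_powr)
        show "(\<lambda>n. g (n + i - i) * real (n + i - i) powr a) \<longlonglongrightarrow> \<mu>" using g by simp
        show "(\<lambda>n. real (n + i) / real n) \<longlonglongrightarrow> 1"
          by real_asymp
      qed auto
      moreover have "\<forall>\<^sub>F n in sequentially. g (n + i - i) * real (n + i - i) powr a * (real (n + i) / real n) powr a
            = g (n + i - i) * real (n + i) powr a"
        using eventually_gt_at_top[of 0] by eventually_elim (auto simp: powr_divide)
      ultimately have "(\<lambda>n. g (n + i - i) * real (n + i) powr a) \<longlonglongrightarrow> \<mu>"
        using Lim_transform_eventually by fastforce
      hence "(\<lambda>n. g (n - i) * real n powr a) \<longlonglongrightarrow> \<mu>" by (rule LIMSEQ_offset[where k=i])
      hence 1: "(\<lambda>n. f i * (g (n - i) * real n powr a)) \<longlonglongrightarrow> f i * \<mu>" by (intro tendsto_intros)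
      have "\<forall>\<^sub>F n in sequentially. i < h n" using h(2)[unfolded filterlim_at_top, rule_format, of "Suc i"] by (simp add: Suc_le_eq)
      hence "\<forall>\<^sub>F n in sequentially. f i * (g (n - i) * real n powr a) = T n i"
        by eventually_elim (simp add: T_def)
      with 1 show ?thesis by (simp add: tendsto_cong)
    qed
    show "\<bar>T n i\<bar> \<le> \<bar>f i\<bar> * (C * 2 powr a)" for n i
    proof (cases "i < h n \<and> n \<ge> 1")
      case True
      hence i: "i \<le> n div 2" using h(1)[of n] by linarith
      hence i2: "n - i \<ge> 1" "2 * real (n - i) \<ge> real n" using True by linarith+
      have "\<bar>g (n - i)\<bar> * real n powr a \<le> (C * real (n - i) powr (-a)) * (2 * real (n - i)) powr a"
        using C(2)[OF i2(1)] i2(2) a C(1) by (intro mult_mono powr_mono2) auto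
      also have "\<dots> = C * 2 powr a" 
      proof -
        define m where "m = real (n - i)"
        have "m > 0" using i2 by (simp add: m_def)
        thus ?thesis unfolding m_def[symmetric] by (simp add: powr_mult powr_minus)
      qed
      finally show ?thesis using True unfolding T_def
        by (simp add: abs_mult mult.assoc mult_left_mono)
    next
      case False
      thus ?thesis using C(1) by (cases "n = 0") (auto simp: T_def)
    qed
    show "summable (\<lambda>i. \<bar>f i\<bar> * (C * 2 powr a))" using f by (rule summable_mult2)
  qed
  moreover have "(\<Sum>i. T n i) = (\<Sum>i<h n. f i * g (n - i)) * real n powr a" for n
  proof -
    have "(\<Sum>i. T n i) = (\<Sum>i<h n. T n i)" by (rule suminf_finite) (auto simp: T_def)
    also have "\<dots> = (\<Sum>i<h n. f i * g (n - i) * real n powr a)" by (rule sum.cong) (auto simp: T_def)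
    finally show ?thesis by (simp add: sum_distrib_right)
  qed
  moreover have "(\<Sum>i. f i * \<mu>) = \<mu> * (\<Sum>i. f i)"
    using f suminf_mult2[of f \<mu>] by (simp add: summable_rabs_cancel mult.commute)
  ultimately show ?thesis by simp
qed

text \<open>The cuts \<open>n div 2 + 1\<close> and \<open>(n + 1) div 2\<close> add up to n + 1, so
  the middle term of an even n is counted once.\<close>

lemma conv_split:
  fixes f g :: "nat \<Rightarrow> real"
  shows "(\<Sum>i\<le>n. f i * g (n - i)) = (\<Sum>i<n div 2 + 1. f i * g (n - i)) + (\<Sum>j<(n+1) div 2. g j * f (n - j))"
proof -
  have "{..n} = {..<n div 2 + 1} \<union> {n div 2 + 1..n}" by auto
  hence "(\<Sum>i\<le>n. f i * g (n - i)) = (\<Sum>i<n div 2 + 1. f i * g (n - i)) + (\<Sum>i\<in>{n div 2 + 1..n}. f i * g (n - i))"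
    by (simp add: sum.union_disjoint ivl_disj_int)
  also have "(\<Sum>i\<in>{n div 2 + 1..n}. f i * g (n - i)) = (\<Sum>j<(n+1) div 2. g j * f (n - j))"
    by (rule sum.reindex_bij_witness[of _ "\<lambda>j. n - j" "\<lambda>i. n - i"]) auto
  finally show ?thesis .
qed

lemma half_cut_lims:
  "filterlim (\<lambda>n::nat. n div 2 + 1) at_top sequentially"
  "filterlim (\<lambda>n::nat. (n+1) div 2) at_top sequentially"
proof -
  show "filterlim (\<lambda>n::nat. n div 2 + 1) at_top sequentially"
    unfolding filterlim_at_top eventually_at_top_linorder
  proof (intro allI exI impI)
    fix Z n :: nat assume "2 * Z \<le> n" thus "Z \<le> n div 2 + 1" by linarith
  qed
  show "filterlim (\<lambda>n::nat. (n+1) div 2) at_top sequentially"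
    unfolding filterlim_at_top eventually_at_top_linorder
  proof (intro allI exI impI)
    fix Z n :: nat assume "2 * Z \<le> n" thus "Z \<le> (n + 1) div 2" by linarith
  qed
qed

lemma fps_mult_nth_atMost: "fps_nth (f * g) n = (\<Sum>i\<le>n. fps_nth f i * fps_nth g (n - i))"
  by (simp add: fps_mult_nth atLeast0AtMost)

text \<open>A high coefficient of the product comes from one factor at a high index and the other at
  a low one; each half of the split contributes one of the two terms.\<close>

lemma coeff_asymp_mult:
  assumes "coeff_asymp f l" "coeff_asymp g m"
  shows "coeff_asymp (f * g) (l * fps_total g + m * fps_total f)"
proof -
  have "(\<lambda>n. (\<Sum>i<n div 2 + 1. fps_nth f i * fps_nth g (n - i)) * real n powr (3/2)) \<longlonglongrightarrow> m * fps_total f"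
    unfolding fps_total_def using assms coeff_asymp_abs_sum[OF assms(1)] half_cut_lims
    by (intro half_conv) (auto simp: coeff_asymp_def abs_sum_def)
  moreover have "(\<lambda>n. (\<Sum>i<(n+1) div 2. fps_nth g i * fps_nth f (n - i)) * real n powr (3/2)) \<longlonglongrightarrow> l * fps_total g"
    unfolding fps_total_def using assms coeff_asymp_abs_sum[OF assms(2)] half_cut_lims
    by (intro half_conv) (auto simp: coeff_asymp_def abs_sum_def)
  ultimately have "(\<lambda>n. (\<Sum>i<n div 2 + 1. fps_nth f i * fps_nth g (n - i)) * real n powr (3/2) +
     (\<Sum>i<(n+1) div 2. fps_nth g i * fps_nth f (n - i)) * real n powr (3/2)) \<longlonglongrightarrow> m * fps_total f + l * fps_total g"
    by (rule tendsto_add)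
  thus ?thesis unfolding coeff_asymp_def fps_mult_nth_atMost conv_split by (simp add: algebra_simps)
qed

lemma abs_sum_mult: "abs_sum f \<Longrightarrow> abs_sum g \<Longrightarrow> abs_sum (f * g)"
proof -
  assume f: "abs_sum f" and g: "abs_sum g"
  have "summable (\<lambda>n. \<Sum>i\<le>n. \<bar>fps_nth f i\<bar> * \<bar>fps_nth g (n - i)\<bar>)"
    using f g unfolding abs_sum_def by (intro summable_Cauchy_product) auto
  thus ?thesis unfolding abs_sum_def
    by (rule summable_comparison_test'[where N=0])
       (auto simp: fps_mult_nth_atMost abs_mult[symmetric] intro!: sum_abs)
qed

lemma fps_total_mult: "abs_sum f \<Longrightarrow> abs_sum g \<Longrightarrow> fps_total (f * g) = fps_total f * fps_total g"
  unfolding abs_sum_def fps_total_def fps_mult_nth_atMost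
  by (subst Cauchy_product) auto

lemma abs_sum_summable: "abs_sum f \<Longrightarrow> summable (fps_nth f)"
  unfolding abs_sum_def by (rule summable_rabs_cancel)

lemma coeff_asymp_add: "coeff_asymp f l \<Longrightarrow> coeff_asymp g m \<Longrightarrow> coeff_asymp (f + g) (l + m)"
  unfolding coeff_asymp_def by (drule (1) tendsto_add) (simp add: algebra_simps)

lemma coeff_asymp_cmult: "coeff_asymp f l \<Longrightarrow> coeff_asymp (fps_const c * f) (c * l)"
  unfolding coeff_asymp_def by (drule tendsto_mult_left[where c=c]) (simp add: mult.assoc)

lemma coeff_asymp_finite: 
  assumes "\<And>n. n \<ge> N \<Longrightarrow> fps_nth f n = 0" shows "coeff_asymp f 0"
  unfolding coeff_asymp_def
  by (rule tendsto_eventually) (use assms in \<open>auto simp: eventually_at_top_linorder intro!: exI[of _ N]\<close>)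

section \<open>Bootstrapping the decay of coefficients\<close>

lemma sum_inverse_sqrt_le: "(\<Sum>i=1..n. real i powr (-1/2)) \<le> 2 * sqrt (real n)"
proof (induction n)
  case (Suc n)
  define a b where "a = sqrt (real (Suc n))" and "b = sqrt (real n)"
  have ab: "a * a = b * b + 1" "a > 0" "b \<ge> 0" "b \<le> a" by (auto simp: a_def b_def)
  have "real (Suc n) powr (-1/2) = 1 / a"
    using powr_minus_divide[of "real (Suc n)" "1/2"] by (simp add: a_def powr_half_sqrt)
  moreover have "1 / a \<le> 2 * (a - b)"
  proof -
    have "(a - b) * (a + b) = 1" using ab by (simp add: algebra_simps)
    moreover have "(a - b) * (a + b) \<le> (a - b) * (2 * a)" using ab by (intro mult_left_mono) auto
    ultimately have "1 \<le> 2 * (a - b) * a" by (simp only: mult_ac)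
    thus ?thesis using ab by (subst pos_divide_le_eq) simp_all
  qed
  moreover have "(\<Sum>i=1..n. real i powr (-1/2)) \<le> 2 * b" using Suc by (simp add: b_def)
  ultimately show ?case unfolding a_def[symmetric] by simp
qed simp

lemma powr_half_shift:
  assumes "2 * m \<ge> n" "m \<ge> 1" "n \<ge> 1" "a \<ge> 0"
  shows "real m powr (-a) \<le> 2 powr a * real n powr (-a)"
proof -
  have "real n powr a \<le> (2 * real m) powr a" using assms by (intro powr_mono2) auto
  thus ?thesis using assms by (simp add: powr_minus powr_mult field_simps)
qed

text \<open>One of i and n - i is at least n/2. If it is i, then l i is of order
  \<open>n powr (-1/2)\<close> and G is summed; otherwise G is of order \<open>n powr (-a)\<close>
  and l sums to order sqrt n. Division by n gives the exponents 3/2 and a + 1/2, hence the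
  restriction a \<le> 1.\<close>

lemma decay_step:
  fixes F G l :: "nat \<Rightarrow> real"
  assumes rec: "\<And>n. real n * F n = (\<Sum>i=1..n. l i * G (n - i))"
    and l: "\<And>n. 0 \<le> l n" "\<And>n. n \<ge> 1 \<Longrightarrow> l n \<le> C0 * real n powr (-1/2)"
    and G: "\<And>n. 0 \<le> G n" "summable G" "\<And>n. n \<ge> 1 \<Longrightarrow> G n \<le> C * real n powr (-a)" and a: "0 \<le> a" "a \<le> 1"
  shows "\<exists>C'. \<forall>n\<ge>1. F n \<le> C' * real n powr (-(a + 1/2))"
proof -
  have C0: "C0 \<ge> 0" using l(1)[of 1] l(2)[of 1] by simp
  have C: "C \<ge> 0" using G(1)[of 1] G(3)[of 1] by simp
  define K1 where "K1 = C0 * 2 powr (1/2)"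
  define K2 where "K2 = C * 2 powr a"
  have K: "K1 \<ge> 0" "K2 \<ge> 0" using C0 C by (auto simp: K1_def K2_def)
  have "F n \<le> (K1 * suminf G + K2 * 2 * C0) * real n powr (-(a + 1/2))" if n: "n \<ge> 1" for n
  proof -
    have pt: "l i * G (n - i) \<le> K1 * real n powr (-1/2) * G (n - i) + K2 * real n powr (-a) * l i"
      if i: "i \<in> {1..n}" for i
    proof (cases "2 * i \<ge> n")
      case True
      have "l i \<le> C0 * real i powr (-1/2)" using l(2) i by auto
      also have "\<dots> \<le> C0 * (2 powr (1/2) * real n powr (-1/2))"
        using powr_half_shift[of n i "1/2"] True i C0 n by (intro mult_left_mono) auto
      finally have "l i \<le> K1 * real n powr (-1/2)" by (simp add: K1_def)
      hence "l i * G (n - i) \<le> K1 * real n powr (-1/2) * G (n - i)" using G(1) by (rule mult_right_mono)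
      moreover have "0 \<le> K2 * real n powr (-a) * l i" using K l(1) by auto
      ultimately show ?thesis by linarith
    next
      case False
      have "G (n - i) \<le> C * real (n - i) powr (-a)" using G(3)[of "n - i"] False by auto
      also have "\<dots> \<le> C * (2 powr a * real n powr (-a))"
        using powr_half_shift[of n "n - i" a] False C a n by (intro mult_left_mono) auto
      finally have "G (n - i) \<le> K2 * real n powr (-a)" by (simp add: K2_def)
      hence "l i * G (n - i) \<le> K2 * real n powr (-a) * l i" using l(1)[of i] 
        by (metis mult.commute mult_right_mono)
      moreover have "0 \<le> K1 * real n powr (-1/2) * G (n - i)" using K G(1) by auto
      ultimately show ?thesis by linarith
    qed
    have S1: "(\<Sum>i=1..n. G (n - i)) \<le> suminf G"
    proof -
      have "(\<Sum>i=1..n. G (n - i)) = (\<Sum>j<n. G j)"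
        by (rule sum.reindex_bij_witness[of _ "\<lambda>j. n - j" "\<lambda>i. n - i"]) auto
      thus ?thesis using G(1,2) by (simp add: sum_le_suminf)
    qed
    have S2: "(\<Sum>i=1..n. l i) \<le> C0 * (2 * sqrt (real n))"
    proof -
      have "(\<Sum>i=1..n. l i) \<le> (\<Sum>i=1..n. C0 * real i powr (-1/2))" using l(2) by (intro sum_mono) auto
      also have "\<dots> = C0 * (\<Sum>i=1..n. real i powr (-1/2))" by (simp add: sum_distrib_left)
      also have "\<dots> \<le> C0 * (2 * sqrt (real n))" using sum_inverse_sqrt_le C0 by (intro mult_left_mono) auto
      finally show ?thesis .
    qed
    have "real n * F n \<le> (\<Sum>i=1..n. K1 * real n powr (-1/2) * G (n - i) + K2 * real n powr (-a) * l i)"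
      unfolding rec by (intro sum_mono pt)
    also have "\<dots> = K1 * real n powr (-1/2) * (\<Sum>i=1..n. G (n - i)) + K2 * real n powr (-a) * (\<Sum>i=1..n. l i)"
      by (simp add: sum.distrib sum_distrib_left)
    also have "\<dots> \<le> K1 * real n powr (-1/2) * suminf G + K2 * real n powr (-a) * (C0 * (2 * sqrt (real n)))"
      using S1 S2 K by (intro add_mono mult_left_mono) auto
    also have "\<dots> \<le> K1 * real n powr (1/2 - a) * suminf G + K2 * real n powr (-a) * (C0 * (2 * sqrt (real n)))"
    proof -
      have "real n powr (-1/2) \<le> real n powr (1/2 - a)" using a n by (intro powr_mono) auto
      thus ?thesis using K G suminf_nonneg[OF G(2,1)] by (auto intro!: mult_left_mono mult_right_mono)
    qed
    also have "real n powr (-a) * (C0 * (2 * sqrt (real n))) = 2 * C0 * real n powr (1/2 - a)"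
      using n by (simp add: powr_half_sqrt[symmetric] powr_add[symmetric])
    hence "K2 * real n powr (-a) * (C0 * (2 * sqrt (real n))) = K2 * (2 * C0 * real n powr (1/2 - a))"
      by (simp add: mult.assoc)
    finally have "real n * F n \<le> (K1 * suminf G + K2 * 2 * C0) * real n powr (1/2 - a)"
      by (simp add: algebra_simps)
    also have "real n powr (1/2 - a) = real n * real n powr (-(a + 1/2))"
      using n powr_mult_base[of "real n" "-(a + 1/2)"] by simp
    finally have "real n * F n \<le> real n * ((K1 * suminf G + K2 * 2 * C0) * real n powr (-(a + 1/2)))"
      by (simp add: mult_ac)
    thus ?thesis using n by simp
  qed
  thus ?thesis by blast
qed

text \<open>The main part sits at low indices of G. In the other half G (n - i) is of order
  \<open>n powr (-3/2)\<close> while the l i sum to order sqrt n, which is negligible against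
  \<open>n powr (-1/2)\<close>.\<close>

lemma conv_sqrt_asymp:
  fixes G l :: "nat \<Rightarrow> real"
  assumes l: "\<And>n. 0 \<le> l n" "l 0 = 0" "(\<lambda>n. l n * real n powr (1/2)) \<longlonglongrightarrow> ll"
    and G: "\<And>n. 0 \<le> G n" "summable G" "\<And>n. n \<ge> 1 \<Longrightarrow> G n \<le> C * real n powr (-3/2)"
  shows "(\<lambda>n. (\<Sum>i\<le>n. l i * G (n - i)) * real n powr (1/2)) \<longlonglongrightarrow> ll * suminf G"
proof -
  have 1: "(\<lambda>n. (\<Sum>i<(n+1) div 2. G i * l (n - i)) * real n powr (1/2)) \<longlonglongrightarrow> ll * suminf G"
    using G l half_cut_lims by (intro half_conv) auto
  obtain C0 where C0: "C0 > 0" "\<And>n. n \<ge> 1 \<Longrightarrow> \<bar>l n\<bar> \<le> C0 * real n powr (-(1/2))"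
    using convergent_powr_bound[OF l(3)] by blast
  have C: "C \<ge> 0" using G(1)[of 1] G(3)[of 1] by simp
  define K where "K = C * 2 powr (3/2) * (C0 * 2)"
  have 2: "(\<lambda>n. (\<Sum>i<n div 2 + 1. l i * G (n - i)) * real n powr (1/2)) \<longlonglongrightarrow> 0"
  proof (rule Lim_null_comparison)
    show "\<forall>\<^sub>F n in sequentially. norm ((\<Sum>i<n div 2 + 1. l i * G (n - i)) * real n powr (1/2)) \<le> K * real n powr (-1/2)"
      using eventually_ge_at_top[of 1]
    proof eventually_elim
      case (elim n)
      have "(\<Sum>i<n div 2 + 1. l i * G (n - i)) \<le> (\<Sum>i<n div 2 + 1. l i * (C * (2 powr (3/2) * real n powr (-3/2))))"
      proof (intro sum_mono mult_left_mono l)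
        fix i assume "i \<in> {..<n div 2 + 1}"
        hence i: "n - i \<ge> 1" "2 * (n - i) \<ge> n" using elim by auto
        have "G (n - i) \<le> C * real (n - i) powr (-3/2)" using G(3)[of "n - i"] i by simp
        also have "\<dots> \<le> C * (2 powr (3/2) * real n powr (-3/2))"
          using powr_half_shift[of n "n - i" "3/2"] i C elim by (intro mult_left_mono) auto
        finally show "G (n - i) \<le> C * (2 powr (3/2) * real n powr (-3/2))" .
      qed
      also have "\<dots> = (\<Sum>i<n div 2 + 1. l i) * (C * 2 powr (3/2) * real n powr (-3/2))"
        unfolding sum_distrib_right by (simp only: mult_ac)
      also have "(\<Sum>i<n div 2 + 1. l i) \<le> (\<Sum>i=1..n. l i)"
      proof -
        have "(\<Sum>i<n div 2 + 1. l i) \<le> (\<Sum>i\<in>{0..n}. l i)" using elim l by (intro sum_mono2) auto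
        also have "\<dots> = (\<Sum>i=1..n. l i)" using l(2) by (simp add: sum.atLeast_Suc_atMost)
        finally show ?thesis .
      qed
      also have "(\<Sum>i=1..n. l i) \<le> (\<Sum>i=1..n. C0 * real i powr (-(1/2)))" 
      proof (intro sum_mono)
        fix i assume "i \<in> {1..n}" thus "l i \<le> C0 * real i powr (-(1/2))" using C0(2)[of i] by simp
      qed
      also have "\<dots> \<le> C0 * (2 * sqrt (real n))" using sum_inverse_sqrt_le C0 
        by (simp add: sum_distrib_left[symmetric])
      finally have "(\<Sum>i<n div 2 + 1. l i * G (n - i)) \<le> C0 * (2 * sqrt (real n)) * (C * 2 powr (3/2) * real n powr (-3/2))"
        using C by (simp add: mult_right_mono)
      hence "(\<Sum>i<n div 2 + 1. l i * G (n - i)) * real n powr (1/2) \<le> 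
         C0 * (2 * sqrt (real n)) * (C * 2 powr (3/2) * real n powr (-3/2)) * real n powr (1/2)"
        by (rule mult_right_mono) simp
      also have "\<dots> = K * (real n powr (1/2) * real n powr (-3/2) * real n powr (1/2))"
        by (simp add: K_def powr_half_sqrt)
      also have "real n powr (1/2) * real n powr (-3/2) * real n powr (1/2) = real n powr (-1/2)"
        by (simp only: powr_add[symmetric]) simp
      finally show ?case using l G by (simp add: sum_nonneg)
    qed
    show "(\<lambda>n. K * real n powr (-1/2)) \<longlonglongrightarrow> 0" by real_asymp
  qed
  from tendsto_add[OF 2 1] show ?thesis unfolding conv_split by (simp add: algebra_simps)
qed

text \<open>
  For \<open>G = F\<close> the series \<open>F\<close> is an exponential of \<open>f\<close>, for \<open>G = F\<^sup>2\<close> a quasi-inverse. Boundedness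
  of the coefficients is bootstrapped to \<open>n powr (-3/2)\<close> in three applications of \<open>decay_step\<close>.
\<close>
lemma log_deriv_asymp:
  fixes F G f :: "real fps"
  assumes D: "fps_deriv F = fps_deriv f * G"
    and f: "\<And>n. 0 \<le> fps_nth f n" "coeff_asymp f ll"
    and F: "\<And>n. 0 \<le> fps_nth F n" "summable (fps_nth F)"
    and G: "\<And>n. 0 \<le> fps_nth G n" "summable (fps_nth G)"
    and FG: "\<And>a C. a \<ge> 0 \<Longrightarrow> \<forall>n\<ge>1. fps_nth F n \<le> C * real n powr (-a) \<Longrightarrow> \<exists>C'. \<forall>n\<ge>1. fps_nth G n \<le> C' * real n powr (-a)"
  shows "coeff_asymp F (ll * fps_total G)"
proof -
  define l where "l n = real n * fps_nth f n" for n
  have rec0: "real n * fps_nth F n = (\<Sum>i\<le>n. l i * fps_nth G (n - i))" for n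
  proof -
    have "fps_X * fps_deriv F = (fps_X * fps_deriv f) * G" using D by (simp add: mult.assoc)
    from arg_cong[OF this, of "\<lambda>h. fps_nth h n"] 
    have "real n * fps_nth F n = (\<Sum>i\<le>n. fps_nth (fps_X * fps_deriv f) i * fps_nth G (n - i))"
      unfolding fps_mult_nth_atMost[of "fps_X * fps_deriv f"] by (cases n) auto
    moreover have "fps_nth (fps_X * fps_deriv f) i = l i" for i by (cases i) (auto simp: l_def)
    ultimately show ?thesis by simp
  qed
  have rec: "real n * fps_nth F n = (\<Sum>i=1..n. l i * fps_nth G (n - i))" for n
    unfolding rec0 atLeast0AtMost[symmetric] by (subst sum.atLeast_Suc_atMost) (auto simp: l_def)
  have l0: "0 \<le> l n" for n using f by (simp add: l_def)
  have llim: "(\<lambda>n. l n * real n powr (1/2)) \<longlonglongrightarrow> ll"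
  proof -
    have "real n * real n powr (1/2) = real n powr (3/2)" for n
      using powr_mult_base[of "real n" "1/2"] by simp
    hence "l n * real n powr (1/2) = fps_nth f n * real n powr (3/2)" for n
      unfolding l_def by (metis mult.assoc mult.commute)
    thus ?thesis using f(2) unfolding coeff_asymp_def by simp
  qed
  obtain C0 where C0: "C0 > 0" "\<And>n. n \<ge> 1 \<Longrightarrow> \<bar>l n\<bar> \<le> C0 * real n powr (-(1/2))"
    using convergent_powr_bound[OF llim] by blast
  have step: "\<exists>C'. \<forall>n\<ge>1. fps_nth F n \<le> C' * real n powr (-(a + 1/2))"
    if ex: "\<exists>C. \<forall>n\<ge>1. fps_nth F n \<le> C * real n powr (-a)" and a: "0 \<le> a" "a \<le> 1" for a
  proof -
    from ex obtain CF where CF: "\<forall>n\<ge>1. fps_nth F n \<le> CF * real n powr (-a)" ..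
    obtain C where "\<forall>n\<ge>1. fps_nth G n \<le> C * real n powr (-a)" using FG[OF a(1) CF] ..
    hence C: "fps_nth G n \<le> C * real n powr (-a)" if "n \<ge> 1" for n using that by blast
    have C0': "l n \<le> C0 * real n powr (-1/2)" if "n \<ge> 1" for n using C0(2)[OF that] by simp
    show ?thesis by (rule decay_step[OF rec l0 C0' G C \<open>0 \<le> a\<close> \<open>a \<le> 1\<close>])
  qed
  have "\<exists>C. \<forall>n\<ge>1. fps_nth F n \<le> C * real n powr (-0)"
  proof -
    have "Bseq (fps_nth F)" using F(2) summable_imp_Bseq by blast
    then obtain C where "\<And>n. \<bar>fps_nth F n\<bar> \<le> C" unfolding Bseq_def by auto
    thus ?thesis by (intro exI[of _ C]) (auto simp: abs_le_iff)
  qed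
  from step[OF step[OF step[OF this]]] 
  have F32: "\<exists>C. \<forall>n\<ge>1. fps_nth F n \<le> C * real n powr (-(3/2))" by simp
  then obtain CF where "\<forall>n\<ge>1. fps_nth F n \<le> CF * real n powr (-(3/2))" ..
  from FG[OF _ this] obtain C where "\<forall>n\<ge>1. fps_nth G n \<le> C * real n powr (-(3/2))" by auto
  hence C: "\<forall>n\<ge>1. fps_nth G n \<le> C * real n powr (-3/2)" by simp
  have "(\<lambda>n. (\<Sum>i\<le>n. l i * fps_nth G (n - i)) * real n powr (1/2)) \<longlonglongrightarrow> ll * suminf (fps_nth G)"
    using l0 llim G C by (intro conv_sqrt_asymp) (auto simp: l_def)
  moreover have "(real n * fps_nth F n) * real n powr (1/2) = fps_nth F n * real n powr (3/2)" for n
    using powr_mult_base[of "real n" "1/2"] by simp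
  ultimately show ?thesis unfolding coeff_asymp_def fps_total_def rec0[symmetric] by simp
qed

lemma coeff_asymp_exp:
  assumes "fps_deriv F = fps_deriv f * F" "\<And>n. 0 \<le> fps_nth f n" "coeff_asymp f ll"
    "\<And>n. 0 \<le> fps_nth F n" "summable (fps_nth F)"
  shows "coeff_asymp F (ll * fps_total F)"
  using assms by (intro log_deriv_asymp[of F f F]) auto

text \<open>Supplies the transfer of decay that \<open>log_deriv_asymp\<close> asks for when G is
  the square of F: the factor with index at least n/2 decays, the other one is summed.\<close>

lemma square_decay:
  fixes D :: "real fps"
  assumes D: "\<And>n. 0 \<le> fps_nth D n" "summable (fps_nth D)" and a: "a \<ge> 0"
    "\<forall>n\<ge>1. fps_nth D n \<le> C * real n powr (-a)"
  shows "\<exists>C'. \<forall>n\<ge>1. fps_nth (D^2) n \<le> C' * real n powr (-a)"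
proof -
  have C: "C \<ge> 0" using D(1)[of 1] a(2)[rule_format, of 1] by simp
  define K where "K = C * 2 powr a"
  have "fps_nth (D^2) n \<le> (K * 2 * suminf (fps_nth D)) * real n powr (-a)" if n: "n \<ge> 1" for n
  proof -
    have b: "fps_nth D m \<le> K * real n powr (-a)" if "2 * m \<ge> n" "m \<ge> 1" for m
    proof -
      have "fps_nth D m \<le> C * real m powr (-a)" using a(2) that by auto
      also have "\<dots> \<le> C * (2 powr a * real n powr (-a))"
        using powr_half_shift[of n m a] that C a n by (intro mult_left_mono) auto
      finally show ?thesis by (simp add: K_def)
    qed
    have "fps_nth D i * fps_nth D (n - i) \<le> K * real n powr (-a) * (fps_nth D i + fps_nth D (n - i))"
      if i: "i \<le> n" for i
    proof -
      have "2 * i \<ge> n \<and> i \<ge> 1 \<or> 2 * (n - i) \<ge> n \<and> n - i \<ge> 1" using n i by auto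
      thus ?thesis
      proof
        assume "2 * i \<ge> n \<and> i \<ge> 1"
        hence "fps_nth D i * fps_nth D (n - i) \<le> K * real n powr (-a) * fps_nth D (n - i)"
          using b D(1) by (intro mult_right_mono) auto
        moreover have "0 \<le> K * real n powr (-a) * fps_nth D i" using C D(1) by (simp add: K_def)
        ultimately show ?thesis by (simp add: algebra_simps)
      next
        assume "2 * (n - i) \<ge> n \<and> n - i \<ge> 1"
        hence "fps_nth D i * fps_nth D (n - i) \<le> fps_nth D i * (K * real n powr (-a))"
          using b D(1) by (intro mult_left_mono) auto
        moreover have "0 \<le> K * real n powr (-a) * fps_nth D (n - i)" using C D(1) by (simp add: K_def)
        ultimately show ?thesis by (simp add: algebra_simps)
      qed
    qed
    hence "fps_nth (D^2) n \<le> (\<Sum>i\<le>n. K * real n powr (-a) * (fps_nth D i + fps_nth D (n - i)))"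
      unfolding power2_eq_square fps_mult_nth_atMost by (intro sum_mono) auto
    also have "\<dots> = K * real n powr (-a) * ((\<Sum>i\<le>n. fps_nth D i) + (\<Sum>i\<le>n. fps_nth D (n - i)))"
      by (simp add: sum.distrib[symmetric] sum_distrib_left)
    also have "(\<Sum>i\<le>n. fps_nth D (n - i)) = (\<Sum>i\<le>n. fps_nth D i)"
      by (rule sum.reindex_bij_witness[of _ "\<lambda>j. n - j" "\<lambda>i. n - i"]) auto
    also have "(\<Sum>i\<le>n. fps_nth D i) + (\<Sum>i\<le>n. fps_nth D i) \<le> 2 * suminf (fps_nth D)"
      using sum_le_suminf[OF D(2), of "{..n}"] D(1) by simp
    finally have "fps_nth (D^2) n \<le> K * real n powr (-a) * (2 * suminf (fps_nth D))"
      using C by (simp add: K_def mult_left_mono)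
    thus ?thesis by (simp only: mult_ac)
  qed
  thus ?thesis by blast
qed

section \<open>Quasi-inverses of subcritical series\<close>

lemma renewal_rec:
  fixes Q :: "real fps"
  assumes "fps_nth Q 0 = 0"
  shows "inverse (1 - Q) = 1 + Q * inverse (1 - Q)"
proof -
  have "inverse (1 - Q) * (1 - Q) = 1" using assms by (intro inverse_mult_eq_1) simp
  thus ?thesis by (simp add: algebra_simps)
qed

lemma renewal_nonneg:
  fixes Q :: "real fps"
  assumes "fps_nth Q 0 = 0" "\<And>n. 0 \<le> fps_nth Q n"
  shows "0 \<le> fps_nth (inverse (1 - Q)) n"
proof (induction n rule: less_induct)
  case (less n)
  have "fps_nth (inverse (1 - Q)) n = fps_nth 1 n + (\<Sum>i\<le>n. fps_nth Q i * fps_nth (inverse (1 - Q)) (n - i))"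
    by (subst renewal_rec[OF assms(1)]) (simp add: fps_mult_nth_atMost)
  also have "\<dots> \<ge> 0"
  proof (intro add_nonneg_nonneg sum_nonneg)
    fix i assume "i \<in> {..n}"
    thus "0 \<le> fps_nth Q i * fps_nth (inverse (1 - Q)) (n - i)"
      using less[of "n - i"] assms by (cases "i = 0") auto
  qed simp
  finally show ?case .
qed

text \<open>Enlarging the triangle i + j < N to a square turns the recurrence into
  \<open>S \<le> 1 + fps_total Q * S\<close> for partial sums S, which bounds them; the value then
  follows by summing the recurrence.\<close>

lemma renewal_summable:
  fixes Q :: "real fps"
  assumes Q: "fps_nth Q 0 = 0" "\<And>n. 0 \<le> fps_nth Q n" "summable (fps_nth Q)" "fps_total Q < 1"
  shows "summable (fps_nth (inverse (1 - Q)))" "fps_total (inverse (1 - Q)) = 1 / (1 - fps_total Q)"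
proof -
  let ?D = "inverse (1 - Q)"
  have D0: "0 \<le> fps_nth ?D n" for n by (rule renewal_nonneg[OF Q(1,2)])
  have Dr: "fps_nth ?D n = (if n = 0 then 1 else 0) + (\<Sum>i\<le>n. fps_nth Q i * fps_nth ?D (n - i))" for n
    by (subst renewal_rec[OF Q(1)]) (simp add: fps_mult_nth_atMost)
  have "(\<Sum>n<N. fps_nth ?D n) \<le> 1 / (1 - fps_total Q)" for N
  proof -
    define S where "S = (\<Sum>n<N. fps_nth ?D n)"
    have S0: "S \<ge> 0" unfolding S_def by (intro sum_nonneg D0)
    have "S \<le> 1 + (\<Sum>n<N. \<Sum>i\<le>n. fps_nth Q i * fps_nth ?D (n - i))"
    proof -
      have "S = (\<Sum>n<N. (if n = 0 then 1 else 0)) + (\<Sum>n<N. \<Sum>i\<le>n. fps_nth Q i * fps_nth ?D (n - i))"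
        unfolding S_def sum.distrib[symmetric] by (intro sum.cong refl Dr)
      also have "(\<Sum>n<N. (if n = 0 then 1 else 0::real)) \<le> 1" by (simp add: sum.delta)
      finally show ?thesis by simp
    qed
    also have "(\<Sum>n<N. \<Sum>i\<le>n. fps_nth Q i * fps_nth ?D (n - i)) 
        = (\<Sum>(i,j)\<in>{(i,j). i + j < N}. fps_nth Q i * fps_nth ?D j)"
      by (rule sum.triangle_reindex[symmetric])
    also have "\<dots> \<le> (\<Sum>(i,j)\<in>{..<N} \<times> {..<N}. fps_nth Q i * fps_nth ?D j)"
      using Q D0 by (intro sum_mono2) auto
    also have "\<dots> = (\<Sum>i<N. fps_nth Q i) * S"
      unfolding S_def by (simp add: sum.cartesian_product[symmetric] sum_product)
    also have "\<dots> \<le> fps_total Q * S"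
      using S0 Q sum_le_suminf[OF Q(3), of "{..<N}"] unfolding fps_total_def by (intro mult_right_mono) auto
    finally have "S * (1 - fps_total Q) \<le> 1" by (simp add: algebra_simps)
    thus ?thesis using Q(4) by (simp add: S_def field_simps)
  qed
  thus s: "summable (fps_nth ?D)" using D0 by (intro summableI_nonneg_bounded) auto
  have aD: "abs_sum ?D" using s D0 by (simp add: abs_sum_def)
  have aQ: "abs_sum Q" using Q by (simp add: abs_sum_def)
  have "fps_total ?D = fps_total 1 + fps_total (Q * ?D)"
  proof -
    have "fps_total ?D = fps_total (1 + Q * ?D)" by (rule arg_cong[OF renewal_rec[OF Q(1)]])
    also have "\<dots> = fps_total 1 + fps_total (Q * ?D)"
      unfolding fps_total_def fps_add_nth
      using abs_sum_summable[OF abs_sum_mult[OF aQ aD]] by (intro suminf_add[symmetric]) (auto intro: summable_finite[of "{0}"])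
    finally show ?thesis .
  qed
  also have "fps_total 1 = 1" unfolding fps_total_def by (subst suminf_finite[of "{0}"]) auto
  also have "fps_total (Q * ?D) = fps_total Q * fps_total ?D" by (rule fps_total_mult[OF aQ aD])
  finally have "fps_total ?D - fps_total Q * fps_total ?D = 1" by linarith
  thus "fps_total ?D = 1 / (1 - fps_total Q)" using Q(4) by (simp add: field_simps)
qed

text \<open>The derivative of 1/(1 - Q) is Q'/(1 - Q)^2, so \<open>log_deriv_asymp\<close> applies
  with the square of the quasi-inverse as G.\<close>

lemma coeff_asymp_renewal:
  fixes Q :: "real fps"
  assumes Q: "fps_nth Q 0 = 0" "\<And>n. 0 \<le> fps_nth Q n" "coeff_asymp Q ll" "fps_total Q < 1"
  shows "coeff_asymp (inverse (1 - Q)) (ll * (fps_total (inverse (1 - Q)))\<^sup>2)"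
proof -
  let ?D = "inverse (1 - Q)"
  have sQ: "summable (fps_nth Q)" by (rule abs_sum_summable[OF coeff_asymp_abs_sum[OF Q(3)]])
  have D0: "0 \<le> fps_nth ?D n" for n by (rule renewal_nonneg[OF Q(1,2)])
  have sD: "summable (fps_nth ?D)" by (rule renewal_summable[OF Q(1,2) sQ Q(4)])
  have aD: "abs_sum ?D" using sD D0 by (simp add: abs_sum_def)
  have aD2: "abs_sum (?D^2)" using aD abs_sum_mult by (simp add: power2_eq_square)
  have "coeff_asymp ?D (ll * fps_total (?D^2))"
  proof (rule log_deriv_asymp)
    have "fps_deriv ?D = - fps_deriv (1 - Q) * ?D\<^sup>2" using Q(1) by (intro fps_inverse_deriv) simp
    thus "fps_deriv ?D = fps_deriv Q * ?D\<^sup>2" by simp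
    show "0 \<le> fps_nth (?D^2) n" for n 
      unfolding power2_eq_square fps_mult_nth_atMost using D0 by (intro sum_nonneg) auto
    show "\<exists>C'. \<forall>n\<ge>1. fps_nth (?D^2) n \<le> C' * real n powr - a" if "a \<ge> 0" "\<forall>n\<ge>1. fps_nth ?D n \<le> C * real n powr - a" for a C
      using square_decay[OF D0 sD that] .
    show "summable (fps_nth (?D^2))" using aD2 by (rule abs_sum_summable)
  qed (fact Q D0 sD)+
  thus ?thesis using fps_total_mult[OF aD aD] by (simp add: power2_eq_square)
qed

section \<open>Square-root singularities\<close>

text \<open>The coefficients of \<open>- sqrt (1 - x)\<close>; all but the constant one are positive.\<close>
definition sqrt_coeff :: "nat \<Rightarrow> real" where
  "sqrt_coeff n = - ((-1) ^ n * ((1/2) gchoose n))"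

text \<open>Equal to 1/(2 sqrt pi). It cancels in the quotient of coefficients, so only its sign is
  established.\<close>

definition sqrt_const :: real where
  "sqrt_const = - inverse (Gamma (-1/2))"

lemma sqrt_coeff_0: "sqrt_coeff 0 = -1"
  by (simp add: sqrt_coeff_def)

lemma sqrt_coeff_Suc: "sqrt_coeff (Suc n) = sqrt_coeff n * (real n - 1/2) / (real n + 1)"
proof -
  have "(1/2::real) * (1/2 gchoose n) = real n * (1/2 gchoose n) + real (Suc n) * (1/2 gchoose Suc n)"
    using gbinomial_mult_1[of "1/2::real" n] by simp
  hence "((1/2::real) gchoose Suc n) = (1/2 gchoose n) * (1/2 - real n) / (real n + 1)"
    by (simp add: field_simps)
  hence "sqrt_coeff (Suc n) = - ((-1) ^ Suc n * ((1/2 gchoose n) * (1/2 - real n) / (real n + 1)))"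
    unfolding sqrt_coeff_def by simp
  also have "\<dots> = sqrt_coeff n * (real n - 1/2) / (real n + 1)"
    unfolding sqrt_coeff_def by (simp add: divide_simps) (simp add: algebra_simps)
  finally show ?thesis .
qed

lemma sqrt_coeff_pos: "sqrt_coeff (Suc n) > 0"
proof (induction n)
  case 0 show ?case by (simp add: sqrt_coeff_Suc sqrt_coeff_0)
next
  case (Suc n) 
  show ?case by (subst sqrt_coeff_Suc) (use Suc in \<open>simp add: zero_less_mult_iff\<close>)
qed

lemma sqrt_coeff_lim: "(\<lambda>n. sqrt_coeff n * real n powr (3/2)) \<longlonglongrightarrow> sqrt_const"
proof -
  have "(\<lambda>n. - (((1/2::real) gchoose n) / ((-1)^n / exp ((1/2+1) * of_real (ln (real n)))))) \<longlonglongrightarrow> sqrt_const"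
    unfolding sqrt_const_def by (intro tendsto_minus) (use gbinomial_asymptotic[of "1/2::real"] in simp)
  moreover have "\<forall>\<^sub>F n in sequentially. - (((1/2::real) gchoose n) / ((-1)^n / exp ((1/2+1) * of_real (ln (real n)))))
     = sqrt_coeff n * real n powr (3/2)"
    using eventually_gt_at_top[of 0]
    by eventually_elim (auto simp: sqrt_coeff_def powr_def minus_one_power_iff)
  ultimately show ?thesis by (rule Lim_transform_eventually)
qed

lemma sqrt_const_pos: "sqrt_const > 0"
proof -
  have "sqrt_const \<ge> 0"
  proof (rule tendsto_lowerbound[OF sqrt_coeff_lim])
    show "\<forall>\<^sub>F n in sequentially. 0 \<le> sqrt_coeff n * real n powr (3/2)"
      using eventually_gt_at_top[of 0]
    proof eventually_elim
      case (elim n) thus ?case using sqrt_coeff_pos[of "n - 1"] by simp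
    qed
  qed simp
  moreover have "Gamma (-1/2::real) \<noteq> 0"
  proof (rule Gamma_nonzero)
    have "(-1/2::real) \<notin> \<int>"
    proof
      assume "(-1/2::real) \<in> \<int>"
      then obtain k where "(-1/2::real) = of_int k" by (elim Ints_cases)
      hence "2 * k = -1" by linarith
      thus False by presburger
    qed
    thus "(-1/2::real) \<notin> \<int>\<^sub>\<le>\<^sub>0" by (meson nonpos_Ints_Int)
  qed
  ultimately show ?thesis unfolding sqrt_const_def by (simp add: less_le)
qed

lemma abs_sum_conv_radius: "abs_sum f \<Longrightarrow> 1 \<le> fps_conv_radius f"
  unfolding fps_conv_radius_def
  using conv_radius_geI[of "fps_nth f" 1] abs_sum_summable[of f] by (simp add: one_ereal_def)

lemma conv_radius_unit:
  assumes "1 \<le> fps_conv_radius f" "0 < x" "x < (1::real)" shows "ereal (norm x) < fps_conv_radius f"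
proof -
  have "ereal (norm x) < 1" using assms by simp
  thus ?thesis using assms(1) by (rule less_le_trans)
qed

lemma bounded_coeff_conv_radius:
  fixes F :: "real fps"
  assumes "\<And>n. \<bar>fps_nth F n\<bar> \<le> B"
  shows "1 \<le> fps_conv_radius F"
proof -
  have "ereal r \<le> fps_conv_radius F" if "0 < r" "ereal r < 1" for r
    unfolding fps_conv_radius_def
  proof (rule order_trans[OF _ conv_radius_geI[of _ r]])
    have "summable (\<lambda>n. B * r ^ n)" using that by (intro summable_mult summable_geometric) auto
    thus "summable (\<lambda>n. fps_nth F n * r ^ n)"
      by (rule summable_comparison_test'[of _ 0]) (use assms that in \<open>auto simp: abs_mult intro!: mult_right_mono\<close>)
    show "ereal r \<le> ereal (norm r)" using that by auto
  qed
  moreover have "\<exists>r. 0 < r \<and> ereal r < 1 \<and> fps_conv_radius F < ereal r" if "\<not> 1 \<le> fps_conv_radius F"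
  proof -
    have "max 0 (fps_conv_radius F) < 1" using that by auto
    then obtain r where "max 0 (fps_conv_radius F) < ereal r" "ereal r < 1" using ereal_dense2 by blast
    thus ?thesis by auto
  qed
  ultimately show ?thesis by (meson leD)
qed

text \<open>Abel's limit theorem in the easy case of absolute convergence at 1, where Tannery's
  theorem suffices.\<close>

lemma eval_fps_tendsto_total:
  assumes "abs_sum f" shows "(eval_fps f \<longlongrightarrow> fps_total f) (at_left 1)"
proof -
  have 1: "\<forall>\<^sub>F x in at_left (1::real). 0 < x \<and> x < 1"
    by (auto simp: eventually_at_left_field intro: exI[of _ 0])
  have "((\<lambda>x. \<Sum>k. fps_nth f k * x ^ k) \<longlongrightarrow> (\<Sum>k. fps_nth f k * 1 ^ k)) (at_left 1)"
  proof (rule tannerys_theorem[THEN conjunct2, THEN conjunct2])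
    show "((\<lambda>x. fps_nth f k * x ^ k) \<longlongrightarrow> fps_nth f k * 1 ^ k) (at_left 1)" for k
      by (intro tendsto_intros)
    have "\<forall>\<^sub>F z in (at_top :: nat filter) \<times>\<^sub>F at_left (1::real). True \<and> (0 < snd z \<and> snd z < 1)"
      using eventually_prodI[of "\<lambda>_. True" "at_top :: nat filter", OF _ 1] by simp
    thus "\<forall>\<^sub>F (k,x) in at_top \<times>\<^sub>F at_left (1::real). norm (fps_nth f k * x ^ k) \<le> \<bar>fps_nth f k\<bar>"
      by eventually_elim (auto simp: abs_mult power_le_one mult_left_le)
    show "summable (\<lambda>k. \<bar>fps_nth f k\<bar>)" using assms by (simp add: abs_sum_def)
  qed auto
  thus ?thesis by (simp add: eval_fps_def[abs_def] fps_total_def)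
qed

text \<open>Both halves share the same \<eta>: the coefficient half feeds the quotient of
  coefficients, the function half identifies \<eta> with \<open>eta\<close>. Series are rescaled to
  have their singularity at 1.\<close>

definition sqrt_sing :: "real fps \<Rightarrow> real \<Rightarrow> bool" where
  "sqrt_sing f \<eta> \<longleftrightarrow> coeff_asymp f (\<eta> * sqrt_const) \<and>
     (\<exists>C. \<forall>x. 0 < x \<and> x < 1 \<longrightarrow> \<bar>eval_fps f x - (fps_total f - \<eta> * sqrt (1 - x))\<bar> \<le> C * (1 - x))"

lemma sqrt_sing_abs_sum: "sqrt_sing f \<eta> \<Longrightarrow> abs_sum f"
  using coeff_asymp_abs_sum by (auto simp: sqrt_sing_def)

lemma sqrt_singE:
  assumes "sqrt_sing f \<eta>"
  obtains C where "C \<ge> 0" "\<And>x. 0 < x \<Longrightarrow> x < 1 \<Longrightarrow> \<bar>eval_fps f x - (fps_total f - \<eta> * sqrt (1 - x))\<bar> \<le> C * (1 - x)"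
proof -
  from assms obtain C where C: "\<And>x. 0 < x \<Longrightarrow> x < 1 \<Longrightarrow> \<bar>eval_fps f x - (fps_total f - \<eta> * sqrt (1 - x))\<bar> \<le> C * (1 - x)"
    by (auto simp: sqrt_sing_def)
  have "C * (1 - 1/2) \<ge> 0" using C[of "1/2"] by (intro order_trans[OF abs_ge_zero]) auto
  thus ?thesis using C that by auto
qed

lemma sqrt_sing_add:
  assumes "sqrt_sing f a" "sqrt_sing g b" shows "sqrt_sing (f + g) (a + b)"
proof -
  note s = assms[THEN sqrt_sing_abs_sum]
  obtain C1 where C1: "C1 \<ge> 0" "\<And>x. 0 < x \<Longrightarrow> x < 1 \<Longrightarrow> \<bar>eval_fps f x - (fps_total f - a * sqrt (1 - x))\<bar> \<le> C1 * (1 - x)"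
    using sqrt_singE[OF assms(1)] by blast
  obtain C2 where C2: "C2 \<ge> 0" "\<And>x. 0 < x \<Longrightarrow> x < 1 \<Longrightarrow> \<bar>eval_fps g x - (fps_total g - b * sqrt (1 - x))\<bar> \<le> C2 * (1 - x)"
    using sqrt_singE[OF assms(2)] by blast
  have t: "fps_total (f + g) = fps_total f + fps_total g"
    unfolding fps_total_def fps_add_nth
    by (rule suminf_add[symmetric, OF abs_sum_summable[OF s(1)] abs_sum_summable[OF s(2)]])
  have "\<bar>eval_fps (f + g) x - (fps_total (f + g) - (a + b) * sqrt (1 - x))\<bar> \<le> (C1 + C2) * (1 - x)"
    if x: "0 < x" "x < 1" for x
  proof -
    have "eval_fps (f + g) x = eval_fps f x + eval_fps g x"
      using s[THEN abs_sum_conv_radius] x by (intro eval_fps_add conv_radius_unit) auto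
    thus ?thesis using C1(2)[OF x] C2(2)[OF x] unfolding t by (simp add: algebra_simps)
  qed
  moreover have "coeff_asymp (f + g) ((a + b) * sqrt_const)"
    using coeff_asymp_add[of f "a * sqrt_const" g "b * sqrt_const"] assms by (simp add: sqrt_sing_def distrib_right)
  ultimately show ?thesis unfolding sqrt_sing_def by blast
qed

text \<open>In (A - a s)(B - b s) with s = sqrt (1 - x) the last term a b s^2 is of order 1 - x and
  joins the error.\<close>

lemma sqrt_sing_mult:
  assumes "sqrt_sing f a" "sqrt_sing g b" shows "sqrt_sing (f * g) (a * fps_total g + b * fps_total f)"
proof -
  note s = assms[THEN sqrt_sing_abs_sum]
  obtain C1 where C1: "C1 \<ge> 0" "\<And>x. 0 < x \<Longrightarrow> x < 1 \<Longrightarrow> \<bar>eval_fps f x - (fps_total f - a * sqrt (1 - x))\<bar> \<le> C1 * (1 - x)"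
    using sqrt_singE[OF assms(1)] by blast
  obtain C2 where C2: "C2 \<ge> 0" "\<And>x. 0 < x \<Longrightarrow> x < 1 \<Longrightarrow> \<bar>eval_fps g x - (fps_total g - b * sqrt (1 - x))\<bar> \<le> C2 * (1 - x)"
    using sqrt_singE[OF assms(2)] by blast
  have t: "fps_total (f * g) = fps_total f * fps_total g" using s by (rule fps_total_mult)
  define A where "A = fps_total f"
  define B where "B = fps_total g"
  define C where "C = C1 * (\<bar>B\<bar> + \<bar>b\<bar>) + C2 * (\<bar>A\<bar> + \<bar>a\<bar>) + C1 * C2 + \<bar>a * b\<bar>"
  have "\<bar>eval_fps (f * g) x - (fps_total (f * g) - (a * fps_total g + b * fps_total f) * sqrt (1 - x))\<bar> \<le> C * (1 - x)"
    if x: "0 < x" "x < 1" for x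
  proof -
    define s where "s = sqrt (1 - x)"
    define u where "u = eval_fps f x - (A - a * s)"
    define v where "v = eval_fps g x - (B - b * s)"
    have s: "0 \<le> s" "s \<le> 1" "s * s = 1 - x" using x by (auto simp: s_def)
    have u: "\<bar>u\<bar> \<le> C1 * (1 - x)" and v: "\<bar>v\<bar> \<le> C2 * (1 - x)"
      using C1(2)[OF x] C2(2)[OF x] by (auto simp: u_def v_def A_def B_def s_def)
    have bd: "\<bar>y - z * s\<bar> \<le> \<bar>y\<bar> + \<bar>z\<bar>" for y z :: real
    proof -
      have "\<bar>z * s\<bar> \<le> \<bar>z\<bar>" using s by (simp add: abs_mult mult_left_le)
      thus ?thesis by linarith
    qed
    have "eval_fps (f * g) x = eval_fps f x * eval_fps g x"
      using \<open>abs_sum f\<close> \<open>abs_sum g\<close> x by (intro eval_fps_mult conv_radius_unit abs_sum_conv_radius) auto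
    hence "eval_fps (f * g) x - (A * B - (a * B + b * A) * s) = (u + (A - a * s)) * (v + (B - b * s)) - (A * B - (a * B + b * A) * s)"
      by (simp add: u_def v_def)
    also have "\<dots> = u * (B - b * s) + v * (A - a * s) + u * v + a * b * (s * s)"
      by (simp add: algebra_simps)
    also have "\<bar>\<dots>\<bar> \<le> \<bar>u * (B - b * s)\<bar> + \<bar>v * (A - a * s)\<bar> + \<bar>u * v\<bar> + \<bar>a * b * (s * s)\<bar>" by linarith
    also have "\<dots> \<le> C1 * (1 - x) * (\<bar>B\<bar> + \<bar>b\<bar>) + C2 * (1 - x) * (\<bar>A\<bar> + \<bar>a\<bar>) + C1 * (1 - x) * C2 + \<bar>a * b\<bar> * (1 - x)"
    proof -
      have "\<bar>u * (B - b * s)\<bar> \<le> C1 * (1 - x) * (\<bar>B\<bar> + \<bar>b\<bar>)" unfolding abs_mult using u bd C1(1) x by (intro mult_mono) auto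
      moreover have "\<bar>v * (A - a * s)\<bar> \<le> C2 * (1 - x) * (\<bar>A\<bar> + \<bar>a\<bar>)" unfolding abs_mult using v bd C2(1) x by (intro mult_mono) auto
      moreover have "\<bar>u * v\<bar> \<le> C1 * (1 - x) * C2"
      proof -
        have "\<bar>v\<bar> \<le> C2" using v C2(1) x mult_left_le[of "1 - x" C2] by linarith
        thus ?thesis unfolding abs_mult using u C1(1) x by (intro mult_mono) auto
      qed
      moreover have "\<bar>a * b * (s * s)\<bar> = \<bar>a * b\<bar> * (1 - x)" using s(3) x by (simp add: abs_mult)
      ultimately show ?thesis by linarith
    qed
    also have "\<dots> = C * (1 - x)" by (simp add: C_def algebra_simps)
    finally show ?thesis unfolding t A_def B_def s_def .
  qed
  moreover have "coeff_asymp (f * g) ((a * fps_total g + b * fps_total f) * sqrt_const)"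
    using coeff_asymp_mult[of f "a * sqrt_const" g "b * sqrt_const"] assms by (simp add: sqrt_sing_def algebra_simps)
  ultimately show ?thesis unfolding sqrt_sing_def by blast
qed

text \<open>By Bernoulli's inequality 1 - x^n \<le> n (1 - x), so a finite first moment of the
  coefficients gives an error linear in 1 - x.\<close>

lemma sqrt_sing_remainder:
  assumes "summable (\<lambda>n. real n * \<bar>fps_nth f n\<bar>)" "(\<lambda>n. fps_nth f n * real n powr (3/2)) \<longlonglongrightarrow> 0"
  shows "sqrt_sing f 0"
proof -
  have ca: "coeff_asymp f 0" using assms(2) by (simp add: coeff_asymp_def)
  hence ab: "abs_sum f" by (rule coeff_asymp_abs_sum)
  have "\<bar>eval_fps f x - fps_total f\<bar> \<le> (\<Sum>n. real n * \<bar>fps_nth f n\<bar>) * (1 - x)" if x: "0 < x" "x < 1" for x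
  proof -
    have b: "\<bar>fps_nth f n * x ^ n - fps_nth f n\<bar> \<le> real n * \<bar>fps_nth f n\<bar> * (1 - x)" for n
    proof -
      have "1 + real n * (x - 1) \<le> x ^ n" using Bernoulli_inequality[of "x - 1" n] x by simp
      moreover have "x ^ n \<le> 1" using x by (simp add: power_le_one)
      ultimately have "\<bar>x ^ n - 1\<bar> \<le> real n * (1 - x)" by (simp add: algebra_simps)
      hence "\<bar>fps_nth f n\<bar> * \<bar>x ^ n - 1\<bar> \<le> \<bar>fps_nth f n\<bar> * (real n * (1 - x))" by (rule mult_left_mono) simp
      thus ?thesis by (simp add: abs_mult[symmetric] algebra_simps)
    qed
    have s2: "summable (\<lambda>n. \<bar>fps_nth f n * x ^ n - fps_nth f n\<bar>)"
      by (rule summable_comparison_test'[OF summable_mult2[OF assms(1)], of 0 _ "1 - x"]) (use b in simp)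
    have s1: "summable (\<lambda>n. fps_nth f n * x ^ n)"
      using conv_radius_unit[OF abs_sum_conv_radius[OF ab] x] summable_fps by blast
    have "eval_fps f x - fps_total f = (\<Sum>n. fps_nth f n * x ^ n - fps_nth f n)"
      unfolding eval_fps_def fps_total_def by (rule suminf_diff[OF s1 abs_sum_summable[OF ab]])
    also have "\<bar>\<dots>\<bar> \<le> (\<Sum>n. \<bar>fps_nth f n * x ^ n - fps_nth f n\<bar>)"
      by (rule summable_rabs[OF s2])
    also have "\<dots> \<le> (\<Sum>n. real n * \<bar>fps_nth f n\<bar> * (1 - x))"
      by (rule suminf_le[OF b s2 summable_mult2[OF assms(1)]])
    also have "\<dots> = (\<Sum>n. real n * \<bar>fps_nth f n\<bar>) * (1 - x)" using assms(1) by (rule suminf_mult2[symmetric])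
    finally show ?thesis .
  qed
  with ca show ?thesis unfolding sqrt_sing_def by auto
qed

lemma sqrt_sing_finite:
  assumes "\<And>n. n \<ge> N \<Longrightarrow> fps_nth f n = 0" shows "sqrt_sing f 0"
proof (rule sqrt_sing_remainder)
  show "summable (\<lambda>n. real n * \<bar>fps_nth f n\<bar>)" by (rule summable_finite[of "{..<N}"]) (use assms in auto)
  show "(\<lambda>n. fps_nth f n * real n powr (3/2)) \<longlonglongrightarrow> 0"
    using coeff_asymp_finite[of N f] assms by (auto simp: coeff_asymp_def)
qed

lemma fps_total_const: "fps_total (fps_const c) = c"
  unfolding fps_total_def by (subst suminf_finite[of "{0}"]) auto

lemma fps_total_X: "fps_total fps_X = 1"
  unfolding fps_total_def by (subst suminf_finite[of "{1}"]) auto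

lemma sqrt_sing_cmult: "sqrt_sing f a \<Longrightarrow> sqrt_sing (fps_const c * f) (c * a)"
  using sqrt_sing_mult[OF sqrt_sing_finite[of 1 "fps_const c"], of f a] by (simp add: fps_total_const mult.commute)

lemma sqrt_sing_X_mult: "sqrt_sing f a \<Longrightarrow> sqrt_sing (fps_X * f) a"
  using sqrt_sing_mult[OF sqrt_sing_finite[of 2 "fps_X"], of f a] by (simp add: fps_total_X)

lemma sqrt_sing_sum:
  assumes "\<And>i. i \<in> I \<Longrightarrow> sqrt_sing (f i) (a i)" shows "sqrt_sing (\<Sum>i\<in>I. f i) (\<Sum>i\<in>I. a i)"
proof (cases "finite I")
  case True
  from this assms show ?thesis
    by (induction I rule: finite_induct) (auto intro: sqrt_sing_add sqrt_sing_finite[of 0])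
qed (auto intro: sqrt_sing_finite[of 0])

text \<open>The model singularity. Its total is 0 because the function tends to 0 at 1 and Abel's
  theorem identifies this limit with the total.\<close>

lemma sqrt_sing_sqrt: "sqrt_sing (Abs_fps sqrt_coeff) 1"
proof -
  have ca: "coeff_asymp (Abs_fps sqrt_coeff) sqrt_const" using sqrt_coeff_lim by (simp add: coeff_asymp_def)
  have ev: "eval_fps (Abs_fps sqrt_coeff) x = - sqrt (1 - x)" if "0 < x" "x < 1" for x
  proof -
    have "(\<lambda>n. (1/2 gchoose n) * (-x) ^ n) sums (1 + (-x)) powr (1/2)" using that by (intro gen_binomial_real) auto
    hence "(\<lambda>n. - ((1/2 gchoose n) * (-x) ^ n)) sums - ((1 + (-x)) powr (1/2))" by (rule sums_minus)
    moreover have "- ((1/2 gchoose n) * (-x) ^ n) = sqrt_coeff n * x ^ n" for n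
      by (simp add: sqrt_coeff_def power_minus[of x])
    ultimately show ?thesis using that unfolding eval_fps_def by (simp add: sums_iff powr_half_sqrt)
  qed
  have "fps_total (Abs_fps sqrt_coeff) = 0"
  proof (rule tendsto_unique[OF _ eval_fps_tendsto_total[OF coeff_asymp_abs_sum[OF ca]]])
    have "((\<lambda>x. - sqrt (1 - x)) \<longlongrightarrow> - sqrt (1 - 1)) (at_left (1::real))" by (intro tendsto_intros)
    moreover have "\<forall>\<^sub>F x in at_left (1::real). - sqrt (1 - x) = eval_fps (Abs_fps sqrt_coeff) x"
      using ev by (auto simp: eventually_at_left_field intro!: exI[of _ 0])
    ultimately show "(eval_fps (Abs_fps sqrt_coeff) \<longlongrightarrow> 0) (at_left 1)"
      using Lim_transform_eventually by fastforce
  qed simp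
  thus ?thesis unfolding sqrt_sing_def using ca ev by (auto intro!: exI[of _ 0])
qed

text \<open>After subtracting \<eta> times the model singularity, the remainder is of order
  \<open>n powr (-5/2)\<close> and hence has a finite first moment.\<close>

lemma sqrt_singI:
  assumes "\<And>n. n \<ge> 1 \<Longrightarrow> \<bar>fps_nth f n - \<eta> * sqrt_coeff n\<bar> \<le> K * real n powr (-5/2)"
  shows "sqrt_sing f \<eta>"
proof -
  define r where "r = f - fps_const \<eta> * Abs_fps sqrt_coeff"
  have rb: "\<bar>fps_nth r n\<bar> \<le> K * real n powr (-5/2)" if "n \<ge> 1" for n using assms[OF that] by (simp add: r_def)
  have "sqrt_sing r 0"
  proof (rule sqrt_sing_remainder)
    have "summable (\<lambda>n. \<bar>real n * \<bar>fps_nth r n\<bar>\<bar>)"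
    proof (rule summable_powr_bound)
      show "\<bar>real n * \<bar>fps_nth r n\<bar>\<bar> \<le> K * real n powr (-(3/2))" if "n \<ge> 1" for n
      proof -
        have "real n * \<bar>fps_nth r n\<bar> \<le> real n * (K * real n powr (-5/2))" using rb[OF that] by (intro mult_left_mono) auto
        also have "\<dots> = K * real n powr (-(3/2))" using powr_mult_base[of "real n" "-5/2"] by simp
        finally show ?thesis by simp
      qed
    qed simp
    thus "summable (\<lambda>n. real n * \<bar>fps_nth r n\<bar>)" by simp
    show "(\<lambda>n. fps_nth r n * real n powr (3/2)) \<longlonglongrightarrow> 0"
    proof (rule Lim_null_comparison)
      show "\<forall>\<^sub>F n in sequentially. norm (fps_nth r n * real n powr (3/2)) \<le> K * real n powr (-1)"
        using eventually_ge_at_top[of 1]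
      proof eventually_elim
        case (elim n)
        have "norm (fps_nth r n * real n powr (3/2)) \<le> (K * real n powr (-5/2)) * real n powr (3/2)"
          using rb[OF elim] by (simp add: abs_mult mult_right_mono)
        also have "\<dots> = K * (real n powr (-5/2) * real n powr (3/2))" by simp
        also have "real n powr (-5/2) * real n powr (3/2) = real n powr (-1)" by (simp only: powr_add[symmetric]) simp
        finally show ?case .
      qed
      show "(\<lambda>n. K * real n powr (-1)) \<longlonglongrightarrow> 0" by real_asymp
    qed
  qed
  from sqrt_sing_add[OF sqrt_sing_cmult[OF sqrt_sing_sqrt, of \<eta>] this] show ?thesis by (simp add: r_def)
qed

text \<open>The differential equation makes F exp(-f) constant on [0,1), where F converges thanks to
  its bounded coefficients. The coefficient half comes from \<open>coeff_asymp_exp\<close>, the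
  expansion from a second-order Taylor bound: f - f(1) is of order sqrt (1 - x), so its square is of
  order 1 - x.\<close>

lemma sqrt_sing_exp:
  assumes D: "fps_deriv F = fps_deriv f * F" and F0: "fps_nth F 0 = 1" and f0: "fps_nth f 0 = 0"
    and f: "\<And>n. 0 \<le> fps_nth f n" and F: "\<And>n. 0 \<le> fps_nth F n" "\<And>n. fps_nth F n \<le> 1" and s: "sqrt_sing f \<eta>"
  shows "sqrt_sing F (\<eta> * fps_total F)" "fps_total F = exp (fps_total f)"
proof -
  have af: "abs_sum f" using s by (rule sqrt_sing_abs_sum)
  have rf: "1 \<le> fps_conv_radius f" using af by (rule abs_sum_conv_radius)
  have rF: "1 \<le> fps_conv_radius F"
    by (rule bounded_coeff_conv_radius[of _ 1]) (use F in simp)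
  have evF: "eval_fps F x = exp (eval_fps f x)" if x: "0 < x" "x < 1" for x
  proof -
    define h where "h y = eval_fps F y * exp (- eval_fps f y)" for y
    have "h x = h 0"
    proof (rule DERIV_isconst2[of 0 x h])
      show "continuous_on {0..x} h"
      proof -
        have "continuous_on {0..x} (eval_fps g)" if "1 \<le> fps_conv_radius g" for g
        proof (rule continuous_on_subset[OF continuous_on_eval_fps])
          show "{0..x} \<subseteq> eball 0 (fps_conv_radius g)"
          proof
            fix y assume "y \<in> {0..x}"
            hence "ereal (norm y) < 1" using x by auto
            hence "ereal (norm y) < fps_conv_radius g" using that by (rule less_le_trans)
            thus "y \<in> eball 0 (fps_conv_radius g)" by (simp add: in_eball_iff)
          qed
        qed
        from this[OF rf] this[OF rF] show ?thesis unfolding h_def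
          by (intro continuous_on_mult continuous_on_exp continuous_on_minus)
      qed
      show "(h has_real_derivative 0) (at y)" if y: "0 < y" "y < x" for y
      proof -
        have y1: "y < 1" using x y by simp
        note c = conv_radius_unit[OF rf y(1) y1] conv_radius_unit[OF rF y(1) y1]
        have d1: "(eval_fps F has_real_derivative eval_fps (fps_deriv F) y) (at y)"
          by (rule has_field_derivative_eval_fps[OF c(2)])
        have d2: "(eval_fps f has_real_derivative eval_fps (fps_deriv f) y) (at y)"
          by (rule has_field_derivative_eval_fps[OF c(1)])
        have "ereal (norm y) < fps_conv_radius (fps_deriv f)"
          using c(1) fps_conv_radius_deriv[of f] by (rule less_le_trans)
        hence e: "eval_fps (fps_deriv F) y = eval_fps (fps_deriv f) y * eval_fps F y"
          unfolding D using c by (intro eval_fps_mult) auto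
        show ?thesis unfolding h_def
          by (rule DERIV_cong[OF DERIV_mult[OF d1 DERIV_fun_exp[OF DERIV_minus[OF d2]]]]) (simp add: e)
      qed
    qed (use x in auto)
    moreover have "h 0 = 1" by (simp add: h_def eval_fps_at_0 F0 f0)
    ultimately have "h x = 1" by simp
    thus ?thesis unfolding h_def by (simp add: exp_minus field_simps)
  qed
  have evf: "eval_fps f x \<le> fps_total f" if x: "0 < x" "x < 1" for x
    unfolding eval_fps_def fps_total_def
  proof (rule suminf_le)
    show "fps_nth f n * x ^ n \<le> fps_nth f n" for n using f x by (simp add: mult_left_le power_le_one)
    show "summable (\<lambda>n. fps_nth f n * x ^ n)" using conv_radius_unit[OF rf x] summable_fps by blast
    show "summable (fps_nth f)" using af by (rule abs_sum_summable)
  qed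
  \<comment> \<open>Summability of F at 1 is not known beforehand: each partial sum is the limit of
    its values at x < 1, which are bounded by exp of the total of f because the coefficients are
    non-negative.\<close>
  have "(\<Sum>n<N. fps_nth F n) \<le> exp (fps_total f)" for N
  proof -
    have "(\<Sum>n<N. fps_nth F n * 1 ^ n) \<le> exp (fps_total f)"
    proof (rule tendsto_upperbound)
      show "((\<lambda>x. \<Sum>n<N. fps_nth F n * x ^ n) \<longlongrightarrow> (\<Sum>n<N. fps_nth F n * 1 ^ n)) (at_left 1)"
        by (intro tendsto_intros)
      have "(\<Sum>n<N. fps_nth F n * x ^ n) \<le> exp (fps_total f)" if x: "0 < x" "x < 1" for x
      proof -
        have "(\<Sum>n<N. fps_nth F n * x ^ n) \<le> eval_fps F x" unfolding eval_fps_def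
          using conv_radius_unit[OF rF x] F x by (intro sum_le_suminf summable_fps) auto
        also have "\<dots> \<le> exp (fps_total f)" using evF[OF x] evf[OF x] by simp
        finally show ?thesis .
      qed
      thus "\<forall>\<^sub>F x in at_left 1. (\<Sum>n<N. fps_nth F n * x ^ n) \<le> exp (fps_total f)"
        by (auto simp: eventually_at_left_field intro!: exI[of _ 0])
    qed simp
    thus ?thesis by simp
  qed
  hence sF: "summable (fps_nth F)" using F by (intro summableI_nonneg_bounded) auto
  hence aF: "abs_sum F" using F by (simp add: abs_sum_def)
  show tot: "fps_total F = exp (fps_total f)"
  proof (rule tendsto_unique[OF _ eval_fps_tendsto_total[OF aF]])
    have "((\<lambda>x. exp (eval_fps f x)) \<longlongrightarrow> exp (fps_total f)) (at_left 1)"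
      by (intro tendsto_intros eval_fps_tendsto_total af)
    moreover have "\<forall>\<^sub>F x in at_left 1. exp (eval_fps f x) = eval_fps F x"
      using evF by (auto simp: eventually_at_left_field intro!: exI[of _ 0])
    ultimately show "(eval_fps F \<longlongrightarrow> exp (fps_total f)) (at_left 1)" by (rule Lim_transform_eventually)
  qed simp
  have ca: "coeff_asymp F (\<eta> * fps_total F * sqrt_const)"
    using coeff_asymp_exp[OF D f _ F(1) sF, of "\<eta> * sqrt_const"] s by (simp add: sqrt_sing_def mult_ac)
  obtain C where C: "C \<ge> 0" "\<And>x. 0 < x \<Longrightarrow> x < 1 \<Longrightarrow> \<bar>eval_fps f x - (fps_total f - \<eta> * sqrt (1 - x))\<bar> \<le> C * (1 - x)"
    using sqrt_singE[OF s] by blast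
  define K where "K = C + (\<bar>\<eta>\<bar> + C)\<^sup>2 * exp (\<bar>\<eta>\<bar> + C)"
  have "\<bar>eval_fps F x - (fps_total F - \<eta> * fps_total F * sqrt (1 - x))\<bar> \<le> fps_total F * K * (1 - x)"
    if x: "0 < x" "x < 1" for x
  proof -
    define s where "s = sqrt (1 - x)"
    define y where "y = eval_fps f x - fps_total f"
    have s: "0 \<le> s" "s \<le> 1" "s\<^sup>2 = 1 - x" using x by (auto simp: s_def)
    have y1: "\<bar>y + \<eta> * s\<bar> \<le> C * s\<^sup>2" using C(2)[OF x] unfolding s(3) by (simp add: y_def s_def algebra_simps)
    have "\<bar>y\<bar> \<le> \<bar>y + \<eta> * s\<bar> + \<bar>\<eta> * s\<bar>" by linarith
    also have "\<dots> \<le> C * s\<^sup>2 + \<bar>\<eta>\<bar> * s" using y1 s by (simp add: abs_mult)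
    also have "C * s\<^sup>2 \<le> C * s" using C(1) s(1,2) by (intro mult_left_mono) (auto simp: power2_eq_square mult_left_le)
    finally have y2: "\<bar>y\<bar> \<le> (\<bar>\<eta>\<bar> + C) * s" by (simp add: algebra_simps)
    have y3: "\<bar>y\<bar> \<le> \<bar>\<eta>\<bar> + C" using y2 s C(1) mult_left_le[of s "\<bar>\<eta>\<bar> + C"] by linarith
    obtain t where t: "\<bar>t\<bar> \<le> \<bar>y\<bar>" "exp y = (\<Sum>m<2. y ^ m / fact m) + exp t / fact 2 * y ^ 2"
      using Maclaurin_exp_le[of y 2] by blast
    have e: "\<bar>exp y - 1 - y\<bar> \<le> (\<bar>\<eta>\<bar> + C)\<^sup>2 * exp (\<bar>\<eta>\<bar> + C) * s\<^sup>2"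
    proof -
      have "exp y - 1 - y = exp t / 2 * y\<^sup>2" using t(2) by (simp add: numeral_2_eq_2)
      hence "\<bar>exp y - 1 - y\<bar> = exp t / 2 * y\<^sup>2" by (simp only: abs_mult) simp
      also have "\<dots> \<le> exp (\<bar>\<eta>\<bar> + C) * ((\<bar>\<eta>\<bar> + C) * s)\<^sup>2"
      proof (rule mult_mono)
        have "exp t \<le> exp (\<bar>\<eta>\<bar> + C)" using t(1) y3 by simp
        thus "exp t / 2 \<le> exp (\<bar>\<eta>\<bar> + C)" using exp_gt_zero[of t] by linarith
        show "y\<^sup>2 \<le> ((\<bar>\<eta>\<bar> + C) * s)\<^sup>2" using y2 by (metis abs_ge_zero power2_abs power_mono)
      qed auto
      finally show ?thesis by (simp add: power_mult_distrib mult_ac)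
    qed
    have "eval_fps F x = fps_total F * exp y" unfolding tot evF[OF x] y_def by (simp add: exp_diff)
    hence "eval_fps F x - (fps_total F - \<eta> * fps_total F * s) = fps_total F * ((exp y - 1 - y) + (y + \<eta> * s))"
      by (simp add: algebra_simps)
    also have "\<bar>\<dots>\<bar> = fps_total F * \<bar>(exp y - 1 - y) + (y + \<eta> * s)\<bar>" unfolding tot by (simp add: abs_mult)
    also have "\<dots> \<le> fps_total F * (K * s\<^sup>2)"
    proof (rule mult_left_mono)
      have "\<bar>(exp y - 1 - y) + (y + \<eta> * s)\<bar> \<le> \<bar>exp y - 1 - y\<bar> + \<bar>y + \<eta> * s\<bar>" by (rule abs_triangle_ineq)
      also have "\<dots> \<le> K * s\<^sup>2" using e y1 by (simp add: K_def algebra_simps)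
      finally show "\<bar>(exp y - 1 - y) + (y + \<eta> * s)\<bar> \<le> K * s\<^sup>2" .
    qed (simp add: tot)
    finally show ?thesis unfolding s(3) s_def[symmetric] by (simp add: mult_ac)
  qed
  thus "sqrt_sing F (\<eta> * fps_total F)" using ca unfolding sqrt_sing_def by blast
qed

section \<open>Wiener-Hopf factorization\<close>

text \<open>Series in z with Laurent coefficients in u: the kernel 1 - z P(u) involves negative
  powers of u, and the factorization separates its factors by the sign of the exponents.\<close>

definition supp_in :: "int set \<Rightarrow> real fls fps \<Rightarrow> bool" where
  "supp_in X f \<longleftrightarrow> (\<forall>n k. k \<notin> X \<longrightarrow> fls_nth (fps_nth f n) k = 0)"

lemma fls_mult_supp:
  fixes f g :: "real fls"
  assumes "\<And>k. k \<notin> X \<Longrightarrow> fls_nth f k = 0" "\<And>k. k \<notin> Y \<Longrightarrow> fls_nth g k = 0" "\<And>a b. a \<in> X \<Longrightarrow> b \<in> Y \<Longrightarrow> a + b \<in> Z" "k \<notin> Z"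
  shows "fls_nth (f * g) k = 0"
  unfolding fls_times_nth(2)
proof (rule sum.neutral, rule ballI)
  fix i
  have "i \<notin> X \<or> k - i \<notin> Y" using assms(3)[of i "k - i"] assms(4) by auto
  thus "fls_nth f i * fls_nth g (k - i) = 0" using assms(1,2) by auto
qed

lemma fls_nth_sum: "fls_nth (\<Sum>i\<in>I. f i) k = (\<Sum>i\<in>I. fls_nth (f i) k)"
  by (induction I rule: infinite_finite_induct) auto

lemma supp_in_mult:
  assumes "supp_in X f" "supp_in Y g" "\<And>a b. a \<in> X \<Longrightarrow> b \<in> Y \<Longrightarrow> a + b \<in> Z"
  shows "supp_in Z (f * g)"
  unfolding supp_in_def fps_mult_nth fls_nth_sum
proof (intro allI impI sum.neutral ballI)
  fix n k i assume "k \<notin> Z"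
  thus "fls_nth (fps_nth f i * fps_nth g (n - i)) k = 0"
    using assms by (intro fls_mult_supp[of X _ Y _ Z]) (auto simp: supp_in_def)
qed

lemma supp_in_diff: "supp_in X f \<Longrightarrow> supp_in X g \<Longrightarrow> supp_in X (f - g)"
  by (simp add: supp_in_def)

text \<open>The recurrence for the coefficients of an inverse only multiplies coefficients, so
  exponents stay in a set that contains 0 and is closed under addition.\<close>

lemma supp_in_inverse:
  assumes f: "supp_in X f" "fps_nth f 0 = 1" and X: "0 \<in> X" "\<And>a b. a \<in> X \<Longrightarrow> b \<in> X \<Longrightarrow> a + b \<in> X"
  shows "supp_in X (inverse f)"
proof -
  have "\<forall>k. k \<notin> X \<longrightarrow> fls_nth (fps_nth (inverse f) n) k = 0" for n
  proof (induction n rule: less_induct)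
    case (less n)
    show ?case
    proof (cases "n = 0")
      case True
      thus ?thesis using f(2) X(1) by auto
    next
      case False
      have "fps_nth (inverse f * f) n = 0" using f(2) False by (subst inverse_mult_eq_1) auto
      hence "(\<Sum>i=0..n. fps_nth f i * fps_nth (inverse f) (n - i)) = 0"
        by (simp add: mult.commute[of "inverse f"] fps_mult_nth)
      hence e: "fps_nth (inverse f) n = - (\<Sum>i=1..n. fps_nth f i * fps_nth (inverse f) (n - i))"
        using f(2) by (simp add: sum.atLeast_Suc_atMost add_eq_0_iff)
      show ?thesis
      proof (intro allI impI)
        fix k assume k: "k \<notin> X"
        have "fls_nth (fps_nth f i * fps_nth (inverse f) (n - i)) k = 0" if "i \<in> {1..n}" for i
          using f(1) less[of "n - i"] that k X(2) by (intro fls_mult_supp[of X _ X _ X]) (auto simp: supp_in_def)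
        thus "fls_nth (fps_nth (inverse f) n) k = 0" unfolding e by (simp add: fls_nth_sum)
      qed
    qed
  qed
  thus ?thesis by (simp add: supp_in_def)
qed

text \<open>The two sides of \<open>inverse M * dM - Sp = Sm - dN * inverse (1 - N)\<close> have disjoint supports.\<close>
lemma wiener_hopf:
  fixes M K N dM dN S Sp Sm :: "real fls fps"
  assumes MK: "M * K = 1 - N" and d: "dM * K - M * (S * K) = - dN"
    and M0: "fps_nth M 0 = 1" and N0: "fps_nth N 0 = 0" and K0: "fps_nth K 0 = 1"
    and pos: "supp_in {0..} M" "supp_in {0..} dM" "supp_in {0..} Sp"
    and neg: "supp_in {..<0} N" "supp_in {..<0} dN" "supp_in {..<0} Sm" and S: "S = Sp + Sm"
  shows "dM = M * Sp"
proof -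
  define W where "W = inverse M * dM - Sp"
  define V where "V = Sm - dN * inverse (1 - N)"
  have iM: "M * inverse M = 1" using M0 by (metis inverse_mult_eq_1' zero_neq_one)
  have iN: "(1 - N) * inverse (1 - N) = 1" using N0 by (intro inverse_mult_eq_1') simp
  have "(M * K) * W = (M * inverse M) * (K * dM) - M * K * Sp" by (simp add: W_def algebra_simps)
  also have "\<dots> = dM * K - M * K * Sp" by (simp add: iM mult.commute)
  also have "\<dots> = M * K * Sm - dN" using d unfolding S by (simp add: algebra_simps)
  also have "\<dots> = (1 - N) * Sm - dN * ((1 - N) * inverse (1 - N))" by (simp add: MK iN)
  also have "\<dots> = (1 - N) * V" by (simp add: V_def algebra_simps)
  finally have "(M * K) * W = (M * K) * V" by (simp add: MK)
  moreover have "M * K \<noteq> 0"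
  proof
    assume "M * K = 0"
    hence "fps_nth (M * K) 0 = 0" by (simp only: fps_zero_nth)
    thus False using M0 K0 by (simp only: fps_mult_nth_0) simp
  qed
  ultimately have WV: "W = V" by simp
  have "supp_in {0..} (inverse M)" using pos(1) M0 by (rule supp_in_inverse) auto
  hence W: "supp_in {0..} W" unfolding W_def using pos 
    by (intro supp_in_diff supp_in_mult[of "{0..}" _ "{0..}"]) auto
  have "supp_in {..0} (1 - N)" using neg(1) by (auto simp: supp_in_def fps_one_nth)
  hence "supp_in {..0} (inverse (1 - N))" using N0 by (intro supp_in_inverse) auto
  hence V: "supp_in {..<0} V" unfolding V_def using neg
    by (intro supp_in_diff supp_in_mult[of "{..<0}" _ "{..0}"]) auto
  have "W = 0"
  proof (rule fps_ext, rule fls_eqI)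
    fix n k
    show "fls_nth (fps_nth W n) k = fls_nth (fps_nth 0 n) k"
      using W V unfolding WV supp_in_def by (cases "k < 0") auto
  qed
  hence "M * (inverse M * dM) = M * Sp" by (simp add: W_def)
  thus ?thesis by (simp add: mult.assoc[symmetric] iM)
qed

lemma fps_to_fls_sum: "fps_to_fls (\<Sum>i\<in>I. f i) = (\<Sum>i\<in>I. fps_to_fls (f i))"
  by (induction I rule: infinite_finite_induct) auto

section \<open>The kernel equation for meanders\<close>

locale walk =
  fixes p :: "int \<Rightarrow> real" and c d :: nat
  assumes supp: "i < - int c \<or> i > int d \<Longrightarrow> p i = 0"
begin

definition steps :: "int set" where "steps = {-int c..int d}"

lemma finite_meanders: "finite (meanders p n k)"
proof (rule finite_subset)
  show "meanders p n k \<subseteq> {js. set js \<subseteq> steps \<and> length js = n}"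
  proof
    fix js assume "js \<in> meanders p n k"
    hence "length js = n" "\<And>j. j \<in> set js \<Longrightarrow> p j \<noteq> 0" by (auto simp: meanders_def)
    moreover have "j \<in> steps" if "p j \<noteq> 0" for j using supp[of j] that unfolding steps_def atLeastAtMost_iff by linarith
    ultimately show "js \<in> {js. set js \<subseteq> steps \<and> length js = n}" by blast
  qed
  show "finite {js. set js \<subseteq> steps \<and> length js = n}"
    by (rule finite_lists_length_eq) (simp add: steps_def)
qed

lemma meanders_neg: "k < 0 \<Longrightarrow> meanders p n k = {}"
  by (auto simp: meanders_def dest: spec[of _ n])

lemma meanders_Suc:
  assumes "k \<ge> 0"
  shows "meanders p (Suc n) k = (\<lambda>(i,js). js @ [i]) ` (SIGMA i:{i\<in>steps. p i \<noteq> 0}. meanders p n (k - i))"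
proof (intro equalityI subsetI)
  fix x assume x: "x \<in> meanders p (Suc n) k"
  hence "length x = Suc n" by (simp add: meanders_def)
  then obtain js i where xe: "x = js @ [i]" "length js = n" 
    by (metis length_Suc_conv_rev)
  have "p i \<noteq> 0" using x xe by (simp add: meanders_def)
  moreover from this have "i \<in> steps" using supp[of i] unfolding steps_def atLeastAtMost_iff by linarith
  moreover have "js \<in> meanders p n (k - i)"
  proof -
    have "0 \<le> sum_list (take m js)" if "m \<le> n" for m
    proof -
      have "0 \<le> sum_list (take m x)" using x that by (simp add: meanders_def)
      thus ?thesis using xe that by simp
    qed
    thus ?thesis using x xe by (auto simp: meanders_def)
  qed
  ultimately show "x \<in> (\<lambda>(i,js). js @ [i]) ` (SIGMA i:{i\<in>steps. p i \<noteq> 0}. meanders p n (k - i))"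
    using xe by force
next
  fix x assume "x \<in> (\<lambda>(i,js). js @ [i]) ` (SIGMA i:{i\<in>steps. p i \<noteq> 0}. meanders p n (k - i))"
  then obtain i js where x: "x = js @ [i]" "p i \<noteq> 0" "js \<in> meanders p n (k - i)" by auto
  have "0 \<le> sum_list (take m x)" if "m \<le> Suc n" for m
    using x that assms by (cases "m = Suc n") (auto simp: meanders_def)
  thus "x \<in> meanders p (Suc n) k" using x by (auto simp: meanders_def)
qed

lemma mw_0: "mw p 0 k = (if k = 0 then 1 else 0)"
proof -
  have "meanders p 0 (int k) = (if k = 0 then {[]} else {})" by (auto simp: meanders_def)
  thus ?thesis by (simp add: mw_def)
qed

lemma mw_Suc: "mw p (Suc n) k = (\<Sum>i\<in>steps. p i * (if int k - i \<ge> 0 then mw p n (nat (int k - i)) else 0))"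
proof -
  have "mw p (Suc n) k = (\<Sum>x\<in>(SIGMA i:{i\<in>steps. p i \<noteq> 0}. meanders p n (int k - i)). case x of (i,js) \<Rightarrow> prod_list (map p (js @ [i])))"
    unfolding mw_def
    by (subst meanders_Suc) (auto simp: sum.reindex inj_on_def intro!: sum.cong)
  also have "\<dots> = (\<Sum>i\<in>{i\<in>steps. p i \<noteq> 0}. \<Sum>js\<in>meanders p n (int k - i). prod_list (map p (js @ [i])))"
    by (subst sum.Sigma) (auto simp: finite_meanders steps_def intro: finite_subset[of _ "{-int c..int d}"])
  also have "\<dots> = (\<Sum>i\<in>{i\<in>steps. p i \<noteq> 0}. p i * (if int k - i \<ge> 0 then mw p n (nat (int k - i)) else 0))"
    by (intro sum.cong refl) (auto simp: mw_def sum_distrib_left meanders_neg mult.commute)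
  also have "\<dots> = (\<Sum>i\<in>steps. p i * (if int k - i \<ge> 0 then mw p n (nat (int k - i)) else 0))"
    by (intro sum.mono_neutral_left) (auto simp: steps_def)
  finally show ?thesis .
qed

lemma finite_steps [simp]: "finite steps" by (simp add: steps_def)

definition step_fls :: "real fls" where
  "step_fls = (\<Sum>i\<in>steps. fls_const (p i) * fls_X_intpow i)"

text \<open>The total weight of all walks of n steps from 0 to k, without the constraint of staying
  non-negative.\<close>

definition bridge :: "nat \<Rightarrow> int \<Rightarrow> real" where
  "bridge n k = fls_nth (step_fls ^ n) k"

definition meander_poly :: "nat \<Rightarrow> real fps" where
  "meander_poly n = Abs_fps (mw p n)"

definition bridge_pos :: "nat \<Rightarrow> real fps" where
  "bridge_pos n = Abs_fps (\<lambda>k. bridge n (int k))"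

lemma step_fls_mult: "fls_nth (step_fls * f) k = (\<Sum>i\<in>steps. p i * fls_nth f (k - i))"
proof -
  have "step_fls * f = (\<Sum>i\<in>steps. fls_const (p i) * (fls_X_intpow i * f))"
    unfolding step_fls_def by (simp add: sum_distrib_right mult.assoc)
  thus ?thesis by (simp add: fls_nth_sum fls_X_intpow_times_conv_shift)
qed

lemma bridge_0: "bridge 0 k = (if k = 0 then 1 else 0)"
  by (simp add: bridge_def)

lemma bridge_Suc: "bridge (Suc n) k = (\<Sum>i\<in>steps. p i * bridge n (k - i))"
  by (simp add: bridge_def step_fls_mult)

lemma meander_fls_nth: "fls_nth (fps_to_fls (meander_poly n)) k = (if k \<ge> 0 then mw p n (nat k) else 0)"
  by (simp add: meander_poly_def fps_to_fls_nth)

definition Mf :: "real fls fps" where "Mf = Abs_fps (\<lambda>n. fps_to_fls (meander_poly n))"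
definition Kf :: "real fls fps" where "Kf = 1 - fps_X * fps_const step_fls"
text \<open>In the kernel equation M(z,u)(1 - z P(u)) = 1 - N the series N collects the walks whose
  last step is the first to go below 0; hence its exponents in u are negative.\<close>

definition Nf :: "real fls fps" where "Nf = 1 - Mf * Kf"

lemma mult_Kf_nth: "fps_nth (f * Kf) n = fps_nth f n - (if n = 0 then 0 else step_fls * fps_nth f (n - 1))"
proof -
  have "f * Kf = f - fps_X * (fps_const step_fls * f)" by (simp add: Kf_def algebra_simps)
  thus ?thesis by (cases n) auto
qed

lemma Mf_0: "fps_nth Mf 0 = 1"
proof -
  have "meander_poly 0 = 1" by (rule fps_ext) (simp add: meander_poly_def mw_0)
  thus ?thesis by (simp add: Mf_def)
qed

lemma Nf_nth: "fps_nth Nf n = (if n = 0 then 0 else step_fls * fps_nth Mf (n - 1) - fps_nth Mf n)"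
  unfolding Nf_def fps_sub_nth mult_Kf_nth by (cases n) (auto simp: Mf_0)

lemma supp_Mf: "supp_in {0..} Mf"
  by (auto simp: supp_in_def Mf_def meander_fls_nth)

lemma supp_Nf: "supp_in {..<0} Nf"
  unfolding supp_in_def
proof (intro allI impI)
  fix n k assume "k \<notin> {..<0::int}"
  hence k: "k \<ge> 0" by simp
  show "fls_nth (fps_nth Nf n) k = 0"
  proof (cases n)
    case (Suc m)
    show ?thesis using k unfolding Nf_nth Suc
      by (simp add: step_fls_mult Mf_def meander_poly_def mw_Suc) (intro sum.cong, auto)
  qed (simp add: Nf_nth)
qed

text \<open>\<open>wiener_hopf\<close> for the derivation z d/dz. There S is the logarithmic
  derivative of 1/(1 - z P), that is, the sum of z^n P^n over n \<ge> 1, and Sp is its part with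
  non-negative powers of u; the hypothesis on the derivatives is the differentiated kernel
  equation.\<close>

lemma wiener_hopf_z: "of_nat n * meander_poly n = (\<Sum>i=1..n. bridge_pos i * meander_poly (n - i))"
proof -
  define S where "S = Abs_fps (\<lambda>n. if n = 0 then 0 else step_fls ^ n)"
  define Sp where "Sp = Abs_fps (\<lambda>n. if n = 0 then 0 else fps_to_fls (bridge_pos n))"
  define dM where "dM = Abs_fps (\<lambda>n. of_nat n * fps_nth Mf n)"
  define dN where "dN = Abs_fps (\<lambda>n. of_nat n * fps_nth Nf n)"
  have SK: "S * Kf = fps_X * fps_const step_fls"
  proof (rule fps_ext)
    fix n show "fps_nth (S * Kf) n = fps_nth (fps_X * fps_const step_fls) n"
      unfolding mult_Kf_nth by (cases n; cases "n - 1") (auto simp: S_def)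
  qed
  have nat_nth: "fls_nth (of_nat n * f) k = real n * fls_nth f k" for n k and f :: "real fls"
    unfolding fls_of_nat by simp
  have "dM = Mf * Sp"
  proof (rule wiener_hopf[of Mf Kf Nf dM S dN Sp "S - Sp"])
    show "Mf * Kf = 1 - Nf" by (simp add: Nf_def)
    show "dM * Kf - Mf * (S * Kf) = - dN"
    proof (rule fps_ext)
      fix n show "fps_nth (dM * Kf - Mf * (S * Kf)) n = fps_nth (- dN) n"
      proof (cases n)
        case (Suc m)
        have "fps_nth (Mf * (S * Kf)) (Suc m) = step_fls * fps_nth Mf m"
          unfolding SK by (simp add: mult.commute mult.left_commute[of Mf])
        thus ?thesis unfolding Suc fps_sub_nth mult_Kf_nth
          by (simp add: dM_def dN_def Nf_nth algebra_simps)
      qed (simp add: SK mult_Kf_nth dM_def dN_def)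
    qed
    show "fps_nth Mf 0 = 1" by (rule Mf_0)
    show "fps_nth Nf 0 = 0" by (simp add: Nf_nth)
    show "fps_nth Kf 0 = 1" by (simp add: Kf_def)
    show "supp_in {0..} dM" "supp_in {..<0} dN" using supp_Mf supp_Nf by (auto simp: supp_in_def dM_def dN_def nat_nth)
    show "supp_in {0..} Sp" by (auto simp: supp_in_def Sp_def fps_to_fls_nth)
    show "supp_in {..<0} (S - Sp)" by (auto simp: supp_in_def Sp_def S_def fps_to_fls_nth bridge_pos_def bridge_def)
  qed (auto intro: supp_Mf supp_Nf)
  hence "fps_nth dM n = (\<Sum>i=0..n. fps_nth Sp i * fps_nth Mf (n - i))" by (simp add: mult.commute[of Mf] fps_mult_nth)
  also have "\<dots> = (\<Sum>i=1..n. fps_nth Sp i * fps_nth Mf (n - i))"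
    by (simp add: sum.atLeast_Suc_atMost Sp_def)
  also have "\<dots> = fps_to_fls (\<Sum>i=1..n. bridge_pos i * meander_poly (n - i))"
    by (auto simp: fps_to_fls_sum Sp_def Mf_def fls_times_fps_to_fls intro!: sum.cong)
  finally have "fps_to_fls (of_nat n * meander_poly n) = fps_to_fls (\<Sum>i=1..n. bridge_pos i * meander_poly (n - i))"
    by (simp add: dM_def Mf_def fls_times_fps_to_fls fps_to_fls_of_nat)
  thus ?thesis by simp
qed

text \<open>The same for the derivation u d/du, where S is the sum of z^n/n times u d/du P^n. This
  form gives the coefficients of u^k recursively, whereas the form in z serves a fixed value of
  u.\<close>

lemma wiener_hopf_u: 
  "fps_X * fps_deriv (meander_poly n) = 
     (\<Sum>i=1..n. fps_const (1 / real i) * (fps_X * fps_deriv (bridge_pos i)) * meander_poly (n - i))"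
proof -
  define D where "D f = fls_X * fls_deriv f" for f :: "real fls"
  have Dm: "D (f * g) = D f * g + f * D g" for f g by (simp add: D_def algebra_simps)
  have Dd: "D (f - g) = D f - D g" for f g by (simp add: D_def algebra_simps)
  have Dn: "fls_nth (D f) k = of_int k * fls_nth f k" for f k by (simp add: D_def fls_X_times_conv_shift)
  have Dp: "fls_const (1 / real (Suc n)) * D (step_fls ^ Suc n) = step_fls ^ n * D step_fls" for n
  proof -
    have "D (step_fls ^ Suc n) = of_nat (Suc n) * (step_fls ^ n * D step_fls)"
      unfolding D_def fls_deriv_power by (simp add: algebra_simps)
    moreover have "fls_const (1 / real (Suc n)) * (of_nat (Suc n) :: real fls) = 1"
      unfolding fls_of_nat by (simp del: of_nat_Suc)
    ultimately show ?thesis by (simp add: mult.assoc[symmetric] del: of_nat_Suc)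
  qed
  define S where "S = Abs_fps (\<lambda>n. if n = 0 then 0 else fls_const (1 / real n) * D (step_fls ^ n))"
  define Sp where "Sp = Abs_fps (\<lambda>n. if n = 0 then 0 else fls_const (1 / real n) * D (fps_to_fls (bridge_pos n)))"
  define dM where "dM = Abs_fps (\<lambda>n. D (fps_nth Mf n))"
  define dN where "dN = Abs_fps (\<lambda>n. D (fps_nth Nf n))"
  have S_Suc: "fps_nth S (Suc n) = step_fls ^ n * D step_fls" for n
    using Dp[of n] by (simp add: S_def del: of_nat_Suc power_Suc)
  have SK: "S * Kf = fps_X * fps_const (D step_fls)"
  proof (rule fps_ext)
    fix n show "fps_nth (S * Kf) n = fps_nth (fps_X * fps_const (D step_fls)) n"
    proof (cases n)
      case 0 thus ?thesis unfolding mult_Kf_nth by (simp add: S_def)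
    next
      case (Suc m)
      show ?thesis
      proof (cases m)
        case 0 thus ?thesis unfolding mult_Kf_nth Suc S_Suc by (simp add: S_def)
      next
        case (Suc l) thus ?thesis using \<open>n = Suc m\<close> unfolding mult_Kf_nth by (simp add: S_Suc)
      qed
    qed
  qed
  have "dM = Mf * Sp"
  proof (rule wiener_hopf[of Mf Kf Nf dM S dN Sp "S - Sp"])
    show "Mf * Kf = 1 - Nf" by (simp add: Nf_def)
    show "dM * Kf - Mf * (S * Kf) = - dN"
    proof (rule fps_ext)
      fix n show "fps_nth (dM * Kf - Mf * (S * Kf)) n = fps_nth (- dN) n"
      proof (cases n)
        case (Suc m)
        have "fps_nth (Mf * (S * Kf)) (Suc m) = D step_fls * fps_nth Mf m"
          unfolding SK by (simp add: mult.commute mult.left_commute[of Mf])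
        thus ?thesis unfolding Suc fps_sub_nth mult_Kf_nth
          by (simp add: dM_def dN_def Nf_nth Dd Dm algebra_simps)
      qed (simp add: SK mult_Kf_nth dM_def dN_def Mf_0 Nf_nth D_def)
    qed
    show "fps_nth Mf 0 = 1" by (rule Mf_0)
    show "fps_nth Nf 0 = 0" by (simp add: Nf_nth)
    show "fps_nth Kf 0 = 1" by (simp add: Kf_def)
    show "supp_in {0..} dM" "supp_in {..<0} dN" using supp_Mf supp_Nf by (auto simp: supp_in_def dM_def dN_def Dn)
    show "supp_in {0..} Sp" by (auto simp: supp_in_def Sp_def fps_to_fls_nth Dn)
    show "supp_in {..<0} (S - Sp)" by (auto simp: supp_in_def Sp_def S_def fps_to_fls_nth bridge_pos_def bridge_def Dn)
  qed (auto intro: supp_Mf supp_Nf)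
  hence "fps_nth dM n = (\<Sum>i=0..n. fps_nth Sp i * fps_nth Mf (n - i))" by (simp add: mult.commute[of Mf] fps_mult_nth)
  also have "\<dots> = (\<Sum>i=1..n. fps_nth Sp i * fps_nth Mf (n - i))"
    by (simp add: sum.atLeast_Suc_atMost Sp_def)
  also have "\<dots> = fps_to_fls (\<Sum>i=1..n. fps_const (1 / real i) * (fps_X * fps_deriv (bridge_pos i)) * meander_poly (n - i))"
    by (auto simp: fps_to_fls_sum Sp_def Mf_def D_def fls_times_fps_to_fls fls_deriv_fps_to_fls intro!: sum.cong)
  finally have "fps_to_fls (fps_X * fps_deriv (meander_poly n)) = 
     fps_to_fls (\<Sum>i=1..n. fps_const (1 / real i) * (fps_X * fps_deriv (bridge_pos i)) * meander_poly (n - i))"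
    by (simp add: dM_def Mf_def D_def fls_times_fps_to_fls fls_deriv_fps_to_fls)
  thus ?thesis by simp
qed

end

section \<open>Local limit theorem\<close>

lemma one_minus_cos_ge: fixes x :: real assumes "\<bar>x\<bar> \<le> 2" shows "1 - cos x \<ge> x\<^sup>2 / 4"
proof -
  obtain t where t: "cos x = (\<Sum>m<4. cos_coeff m * x ^ m) + (cos (t + 1/2 * real (4::nat) * pi) / fact 4) * x ^ 4"
    using Maclaurin_cos_expansion[of x 4] by blast
  have s: "(\<Sum>m<4. cos_coeff m * x ^ m) = 1 - x\<^sup>2 / 2"
  proof -
    have "{..<4::nat} = {0,1,2,3}" by auto
    thus ?thesis by (simp add: cos_coeff_def)
  qed
  have "(cos (t + 1/2 * real (4::nat) * pi) / fact 4) * x ^ 4 \<le> 1 / 24 * x ^ 4"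
    by (intro mult_right_mono) (auto simp: fact_numeral)
  hence "cos x \<le> 1 - x\<^sup>2 / 2 + x ^ 4 / 24" using t s by simp
  moreover have "x ^ 4 \<le> 4 * x\<^sup>2"
  proof -
    have "x\<^sup>2 \<le> 2\<^sup>2" using assms by (metis abs_ge_zero power2_abs power_mono)
    hence "x\<^sup>2 * x\<^sup>2 \<le> 4 * x\<^sup>2" by (intro mult_right_mono) auto
    thus ?thesis by (simp add: power2_eq_square power4_eq_xxxx mult.assoc)
  qed
  moreover have "0 \<le> x\<^sup>2" by simp
  ultimately show ?thesis by linarith
qed

lemma cos_approx: "\<bar>cos x - (1 - x\<^sup>2 / 2)\<bar> \<le> x ^ 4" for x :: real
proof -
  obtain t where t: "cos x = (\<Sum>m<4. cos_coeff m * x ^ m) + (cos (t + 1/2 * real (4::nat) * pi) / fact 4) * x ^ 4"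
    using Maclaurin_cos_expansion[of x 4] by blast
  have s: "(\<Sum>m<4. cos_coeff m * x ^ m) = 1 - x\<^sup>2 / 2"
  proof -
    have "{..<4::nat} = {0,1,2,3}" by auto
    thus ?thesis by (simp add: cos_coeff_def)
  qed
  have "\<bar>cos x - (1 - x\<^sup>2 / 2)\<bar> = \<bar>cos (t + 1/2 * real (4::nat) * pi)\<bar> / 24 * x ^ 4"
    using t s by (simp add: abs_mult fact_numeral)
  also have "\<dots> \<le> 1 * x ^ 4"
  proof (rule mult_right_mono)
    have "\<bar>cos (t + 1/2 * real (4::nat) * pi)\<bar> \<le> 1" by (rule abs_cos_le_one)
    thus "\<bar>cos (t + 1/2 * real (4::nat) * pi)\<bar> / 24 \<le> 1" by linarith
  qed auto
  finally show ?thesis by simp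
qed

lemma sin_approx: "\<bar>sin x - x\<bar> \<le> \<bar>x\<bar> ^ 3" for x :: real
proof -
  have "(\<Sum>m<3. sin_coeff m * x ^ m) = x" by (simp add: sin_coeff_def numeral_eq_Suc)
  hence "\<bar>sin x - x\<bar> \<le> inverse (fact 3) * \<bar>x\<bar> ^ 3" using Maclaurin_sin_bound[of x 3] by simp
  also have "\<dots> \<le> 1 * \<bar>x\<bar> ^ 3" by (intro mult_right_mono) (auto simp: fact_numeral)
  finally show ?thesis by simp
qed

lemma power_le_exp: fixes T a :: real assumes "T \<ge> 0" "a > 0" shows "T ^ j \<le> fact j / a ^ j * exp (a * T)"
proof -
  have "(a * T) ^ j /\<^sub>R fact j \<le> exp (a * T)"
    using sum_le_suminf[OF sums_summable[OF exp_converges[of "a * T"]], of "{j}"] assms 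
    by (simp add: exp_def)
  thus ?thesis using assms by (simp add: field_simps power_mult_distrib)
qed

text \<open>Applied with T = n t^2: polynomial factors are absorbed into 1/(1 + T), whose integral
  over a period is an arctangent of order \<open>n powr (-1/2)\<close>.\<close>

lemma poly_exp_bound:
  assumes "a > (0::real)"
  obtains K where "K > 0" "\<And>T. T \<ge> 0 \<Longrightarrow> (T + T^2 + T^3) * exp (- a * T) \<le> K / (1 + T)"
proof -
  define K where "K = 1 + (fact 1 / a ^ 1 + 2 * (fact 2 / a ^ 2) + 2 * (fact 3 / a ^ 3) + fact 4 / a ^ 4)"
  have "(T + T^2 + T^3) * exp (- a * T) \<le> K / (1 + T)" if T: "T \<ge> 0" for T
  proof -
    have "(T + T^2 + T^3) * (1 + T) = T ^ 1 + 2 * T ^ 2 + 2 * T ^ 3 + T ^ 4"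
      by (simp add: algebra_simps power2_eq_square power3_eq_cube power4_eq_xxxx)
    also have "\<dots> \<le> (fact 1 / a ^ 1 * exp (a * T)) + 2 * (fact 2 / a ^ 2 * exp (a * T)) + 2 * (fact 3 / a ^ 3 * exp (a * T)) + (fact 4 / a ^ 4 * exp (a * T))"
      using T assms by (intro add_mono mult_left_mono power_le_exp) auto
    also have "\<dots> \<le> K * exp (a * T)" by (simp add: K_def algebra_simps)
    finally show ?thesis using T by (simp add: exp_minus field_simps)
  qed
  moreover have "K > 0" unfolding K_def using assms by (intro add_pos_nonneg) auto
  ultimately show ?thesis using that by blast
qed

text \<open>The estimate with r^(n-1), multiplied by r so that n = 0 is covered. It is linear in the
  imaginary part, which for a centred walk is only cubic in t.\<close>

lemma Im_power_bound:
  assumes "cmod z \<le> r" "r > 0" shows "\<bar>Im (z ^ n)\<bar> * r \<le> real n * \<bar>Im z\<bar> * r ^ n"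
proof (induction n)
  case (Suc n)
  have "\<bar>Im (z ^ Suc n)\<bar> * r \<le> (\<bar>Re z * Im (z ^ n)\<bar> + \<bar>Im z * Re (z ^ n)\<bar>) * r"
    using assms by (intro mult_right_mono) auto
  also have "\<dots> = \<bar>Re z\<bar> * (\<bar>Im (z ^ n)\<bar> * r) + \<bar>Im z\<bar> * \<bar>Re (z ^ n)\<bar> * r" by (simp add: abs_mult algebra_simps)
  also have "\<dots> \<le> r * (real n * \<bar>Im z\<bar> * r ^ n) + \<bar>Im z\<bar> * r ^ n * r"
  proof (rule add_mono)
    have "\<bar>Re z\<bar> \<le> r" using assms abs_Re_le_cmod order_trans by blast
    thus "\<bar>Re z\<bar> * (\<bar>Im (z ^ n)\<bar> * r) \<le> r * (real n * \<bar>Im z\<bar> * r ^ n)"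
      using Suc assms by (intro mult_mono[of "\<bar>Re z\<bar>"]) auto
    have "\<bar>Re (z ^ n)\<bar> \<le> r ^ n" 
      using abs_Re_le_cmod[of "z ^ n"] power_mono[OF assms(1), of n] by (simp add: norm_power)
    thus "\<bar>Im z\<bar> * \<bar>Re (z ^ n)\<bar> * r \<le> \<bar>Im z\<bar> * r ^ n * r"
      using assms by (intro mult_right_mono mult_left_mono) auto
  qed
  also have "\<dots> = real (Suc n) * \<bar>Im z\<bar> * r ^ Suc n" by (simp add: algebra_simps)
  finally show ?case .
qed simp

text \<open>Passing from the power of z to the power of its real part costs only the square of the
  imaginary part; the left side is multiplied by r^2 to avoid the exponent n - 2.\<close>

lemma Re_power_bound:
  assumes "cmod z \<le> r" "r > 0" shows "\<bar>Re (z ^ n) - Re z ^ n\<bar> * r\<^sup>2 \<le> (real n)\<^sup>2 * (Im z)\<^sup>2 * r ^ n"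
proof (induction n)
  case (Suc n)
  have Re: "\<bar>Re z\<bar> \<le> r" using assms abs_Re_le_cmod order_trans by blast
  have "Re (z ^ Suc n) - Re z ^ Suc n = Re z * (Re (z ^ n) - Re z ^ n) - Im z * Im (z ^ n)" by (simp add: algebra_simps)
  hence "\<bar>Re (z ^ Suc n) - Re z ^ Suc n\<bar> \<le> \<bar>Re z\<bar> * \<bar>Re (z ^ n) - Re z ^ n\<bar> + \<bar>Im z\<bar> * \<bar>Im (z ^ n)\<bar>"
    by (metis abs_mult abs_triangle_ineq4)
  hence "\<bar>Re (z ^ Suc n) - Re z ^ Suc n\<bar> * r\<^sup>2 \<le> (\<bar>Re z\<bar> * \<bar>Re (z ^ n) - Re z ^ n\<bar> + \<bar>Im z\<bar> * \<bar>Im (z ^ n)\<bar>) * r\<^sup>2"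
    by (rule mult_right_mono) simp
  also have "\<dots> = \<bar>Re z\<bar> * (\<bar>Re (z ^ n) - Re z ^ n\<bar> * r\<^sup>2) + \<bar>Im z\<bar> * (\<bar>Im (z ^ n)\<bar> * r) * r"
    by (simp add: algebra_simps power2_eq_square)
  also have "\<dots> \<le> r * ((real n)\<^sup>2 * (Im z)\<^sup>2 * r ^ n) + \<bar>Im z\<bar> * (real n * \<bar>Im z\<bar> * r ^ n) * r"
  proof (rule add_mono)
    show "\<bar>Re z\<bar> * (\<bar>Re (z ^ n) - Re z ^ n\<bar> * r\<^sup>2) \<le> r * ((real n)\<^sup>2 * (Im z)\<^sup>2 * r ^ n)"
      using Re Suc assms by (intro mult_mono[of "\<bar>Re z\<bar>"]) auto
    show "\<bar>Im z\<bar> * (\<bar>Im (z ^ n)\<bar> * r) * r \<le> \<bar>Im z\<bar> * (real n * \<bar>Im z\<bar> * r ^ n) * r"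
      using assms mult_left_mono[OF Im_power_bound[OF assms, of n], of "\<bar>Im z\<bar>"] by (intro mult_right_mono) auto
  qed
  also have "\<dots> = ((real n)\<^sup>2 + real n) * (Im z)\<^sup>2 * r ^ Suc n"
    by (simp add: algebra_simps power2_eq_square abs_mult_self_eq)
  also have "\<dots> \<le> (real (Suc n))\<^sup>2 * (Im z)\<^sup>2 * r ^ Suc n"
    using assms by (intro mult_right_mono) (auto simp: power2_eq_square algebra_simps)
  finally show ?case .
qed simp

lemma power_diff_bound:
  fixes x y r :: real assumes "\<bar>x\<bar> \<le> r" "\<bar>y\<bar> \<le> r" "r > 0" shows "\<bar>x ^ n - y ^ n\<bar> * r \<le> real n * \<bar>x - y\<bar> * r ^ n"
proof (induction n)
  case (Suc n)
  have "x ^ Suc n - y ^ Suc n = x * (x ^ n - y ^ n) + (x - y) * y ^ n" by (simp add: algebra_simps)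
  hence "\<bar>x ^ Suc n - y ^ Suc n\<bar> \<le> \<bar>x\<bar> * \<bar>x ^ n - y ^ n\<bar> + \<bar>x - y\<bar> * \<bar>y ^ n\<bar>" by (metis abs_mult abs_triangle_ineq)
  hence "\<bar>x ^ Suc n - y ^ Suc n\<bar> * r \<le> (\<bar>x\<bar> * \<bar>x ^ n - y ^ n\<bar> + \<bar>x - y\<bar> * \<bar>y ^ n\<bar>) * r"
    using assms by (intro mult_right_mono) auto
  also have "\<dots> = \<bar>x\<bar> * (\<bar>x ^ n - y ^ n\<bar> * r) + \<bar>x - y\<bar> * \<bar>y ^ n\<bar> * r" by (simp add: algebra_simps)
  also have "\<dots> \<le> r * (real n * \<bar>x - y\<bar> * r ^ n) + \<bar>x - y\<bar> * r ^ n * r"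
  proof (rule add_mono)
    show "\<bar>x\<bar> * (\<bar>x ^ n - y ^ n\<bar> * r) \<le> r * (real n * \<bar>x - y\<bar> * r ^ n)"
      using Suc assms by (intro mult_mono[of "\<bar>x\<bar>"]) auto
    show "\<bar>x - y\<bar> * \<bar>y ^ n\<bar> * r \<le> \<bar>x - y\<bar> * r ^ n * r"
      using assms power_mono[of "\<bar>y\<bar>" r n] by (intro mult_right_mono mult_left_mono) (auto simp: power_abs)
  qed
  also have "\<dots> = real (Suc n) * \<bar>x - y\<bar> * r ^ Suc n" by (simp add: algebra_simps)
  finally show ?case .
qed simp

section \<open>Integrals for the comparison walk\<close>

lemma integral_lorentz_le:
  assumes "n \<ge> (1::nat)" 
  shows "(\<lambda>t. 1 / (1 + real n * t\<^sup>2)) integrable_on {-pi..pi}" "integral {-pi..pi} (\<lambda>t. 1 / (1 + real n * t\<^sup>2)) \<le> pi * real n powr (-1/2)"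
proof -
  define s where "s = sqrt (real n)"
  have s: "s > 0" "s\<^sup>2 = real n" using assms by (auto simp: s_def)
  have "((\<lambda>t. 1 / (1 + real n * t\<^sup>2)) has_integral (arctan (s * pi) / s - arctan (s * (-pi)) / s)) {-pi..pi}"
  proof (rule fundamental_theorem_of_calculus)
    show "((\<lambda>t. arctan (s * t) / s) has_vector_derivative 1 / (1 + real n * t\<^sup>2)) (at t within {-pi..pi})" for t
    proof -
      have "((\<lambda>t. arctan (s * t) / s) has_real_derivative (inverse (1 + (s * t)\<^sup>2) * (s * 1)) / s) (at t within {-pi..pi})"
        by (rule DERIV_cdivide[OF DERIV_chain'[OF DERIV_cmult[OF DERIV_ident] DERIV_arctan, THEN DERIV_cong]]) simp
      moreover have "inverse (1 + (s * t)\<^sup>2) * (s * 1) / s = 1 / (1 + real n * t\<^sup>2)"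
        using s by (simp add: power_mult_distrib divide_inverse)
      ultimately show ?thesis by (simp add: has_real_derivative_iff_has_vector_derivative)
    qed
  qed simp
  hence i: "((\<lambda>t. 1 / (1 + real n * t\<^sup>2)) has_integral (2 * arctan (s * pi) / s)) {-pi..pi}" by (simp add: arctan_minus)
  thus "(\<lambda>t. 1 / (1 + real n * t\<^sup>2)) integrable_on {-pi..pi}" by blast
  have "2 * arctan (s * pi) / s \<le> pi / s" using arctan_ubound[of "s * pi"] s by (intro divide_right_mono) auto
  also have "pi / s = pi * real n powr (-1/2)" using assms powr_minus_divide[of "real n" "1/2"] by (simp add: s_def powr_half_sqrt)
  finally show "integral {-pi..pi} (\<lambda>t. 1 / (1 + real n * t\<^sup>2)) \<le> pi * real n powr (-1/2)"
    using i by (simp add: integral_unique)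
qed

text \<open>\<open>wallis n\<close> is \<open>(2 * n choose n) / 4 ^ n\<close>, the return probability of the comparison walk.\<close>
definition wallis :: "nat \<Rightarrow> real" where "wallis n = (2 * real n - 1) * sqrt_coeff n"

lemma wallis_Suc: "(real n + 1) * wallis (Suc n) = (2 * real n + 1) / 2 * wallis n"
  unfolding wallis_def sqrt_coeff_Suc by (simp add: divide_simps) (simp add: algebra_simps)

text \<open>The function sin(t/2) cos(t/2)^(2n+1) vanishes at both ends of the period; integrating
  its derivative gives for the integrals the same recurrence as \<open>wallis_Suc\<close>.\<close>

lemma wallis_integral: "((\<lambda>t. cos (t/2) ^ (2*n)) has_integral (2 * pi * wallis n)) {-pi..pi}"
proof (induction n)
  case 0
  have "((\<lambda>t. 1::real) has_integral (2 * pi)) {-pi..pi}" using has_integral_const_real[of "1::real" "-pi" pi] by simp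
  thus ?case by (simp add: wallis_def sqrt_coeff_0)
next
  case (Suc n)
  define F where "F t = sin (t/2) * cos (t/2) ^ (2*n+1)" for t :: real
  have "((\<lambda>t. (real n + 1) * cos (t/2) ^ (2 * Suc n) - (2 * real n + 1)/2 * cos (t/2) ^ (2*n)) has_integral (F pi - F (-pi))) {-pi..pi}"
  proof (rule fundamental_theorem_of_calculus)
    fix t
    have "(F has_real_derivative (cos (t/2) * (1/2)) * cos (t/2) ^ (2*n+1) + 
       sin (t/2) * (real (2*n+1) * cos (t/2) ^ (2*n) * (- sin (t/2) * (1/2)))) (at t within {-pi..pi})"
    proof (rule has_field_derivative_at_within)
      have d: "((\<lambda>t. t / 2) has_real_derivative 1/2) (at t)" by (rule DERIV_cdivide[OF DERIV_ident])
      show "(F has_real_derivative (cos (t/2) * (1/2)) * cos (t/2) ^ (2*n+1) + 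
       sin (t/2) * (real (2*n+1) * cos (t/2) ^ (2*n) * (- sin (t/2) * (1/2)))) (at t)"
        unfolding F_def
        by (rule DERIV_cong[OF DERIV_mult[OF DERIV_fun_sin[OF d] DERIV_power[OF DERIV_fun_cos[OF d]]]])
           (simp add: algebra_simps)
    qed
    also have "(cos (t/2) * (1/2)) * cos (t/2) ^ (2*n+1) + sin (t/2) * (real (2*n+1) * cos (t/2) ^ (2*n) * (- sin (t/2) * (1/2)))
      = cos (t/2) ^ (2*n) * ((cos (t/2))\<^sup>2 / 2 - (2 * real n + 1) / 2 * (sin (t/2))\<^sup>2)"
      by (simp add: algebra_simps power2_eq_square)
    also have "(sin (t/2))\<^sup>2 = 1 - (cos (t/2))\<^sup>2" by (rule sin_squared_eq)
    also have "cos (t/2) ^ (2*n) * ((cos (t/2))\<^sup>2 / 2 - (2 * real n + 1) / 2 * (1 - (cos (t/2))\<^sup>2))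
      = (real n + 1) * cos (t/2) ^ (2 * Suc n) - (2 * real n + 1)/2 * cos (t/2) ^ (2*n)"
      by (simp add: field_simps power2_eq_square)
    finally show "(F has_vector_derivative (real n + 1) * cos (t/2) ^ (2 * Suc n) - (2 * real n + 1)/2 * cos (t/2) ^ (2*n)) (at t within {-pi..pi})"
      by (simp add: has_real_derivative_iff_has_vector_derivative)
  qed simp
  moreover have "F pi - F (-pi) = 0" by (simp add: F_def)
  ultimately have "((\<lambda>t. (real n + 1) * cos (t/2) ^ (2 * Suc n) - (2 * real n + 1)/2 * cos (t/2) ^ (2*n)) has_integral 0) {-pi..pi}" by simp
  from has_integral_add[OF this has_integral_mult_right[OF Suc, of "(2 * real n + 1)/2"]]
  have "((\<lambda>t. (real n + 1) * cos (t/2) ^ (2 * Suc n)) has_integral ((2 * real n + 1)/2 * (2 * pi * wallis n))) {-pi..pi}" by simp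
  from has_integral_mult_right[OF this, of "1 / (real n + 1)"]
  have "((\<lambda>t. cos (t/2) ^ (2 * Suc n)) has_integral (1 / (real n + 1) * ((2 * real n + 1)/2 * (2 * pi * wallis n)))) {-pi..pi}"
    by (simp del: mult_Suc_right)
  also have "1 / (real n + 1) * ((2 * real n + 1)/2 * (2 * pi * wallis n)) = 2 * pi * ((2 * real n + 1) / 2 * wallis n) / (real n + 1)"
    by (simp add: field_simps)
  also have "\<dots> = 2 * pi * wallis (Suc n)" unfolding wallis_Suc[symmetric] by (simp add: field_simps)
  finally show ?case .
qed

text \<open>Outside the window the integrand is at most b^n with b = cos(e/2)^2 < 1, which is
  exponentially small.\<close>

lemma wallis_cut:
  assumes "0 < e" "e \<le> pi"
  obtains K where "\<And>n. n \<ge> 1 \<Longrightarrow> \<bar>2 * pi * wallis n - integral {-e..e} (\<lambda>t. cos (t/2) ^ (2*n))\<bar> \<le> K * real n powr (-3/2)"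
proof -
  define b where "b = (1 + cos e) / 2"
  have b1: "b < 1" using cos_monotone_0_pi[of 0 e] assms by (simp add: b_def)
  have b0: "b \<ge> 0" 
  proof -
    have "b = (cos (e/2))\<^sup>2" using cos_double_cos[of "e/2"] by (simp add: b_def)
    thus ?thesis by simp
  qed
  have "(\<lambda>n. b ^ n * real n powr (3/2)) \<longlonglongrightarrow> 0"
  proof (cases "b = 0")
    case False
    hence "b > 0" using b0 by simp
    thus ?thesis using b1 by real_asymp
  next
    case True
    thus ?thesis by (intro tendsto_eventually) (auto simp: eventually_at_top_linorder intro!: exI[of _ 1])
  qed
  then obtain K where K: "K > 0" "\<And>n. n \<ge> 1 \<Longrightarrow> \<bar>b ^ n\<bar> \<le> K * real n powr (-(3/2))"
    using convergent_powr_bound by blast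
  have "\<bar>2 * pi * wallis n - integral {-e..e} (\<lambda>t. cos (t/2) ^ (2*n))\<bar> \<le> 2 * pi * K * real n powr (-3/2)" if n: "n \<ge> 1" for n
  proof -
    let ?f = "\<lambda>t::real. cos (t/2) ^ (2*n)"
    have int: "(?f has_integral integral {-e..e} ?f) {-e..e}"
      by (intro integrable_integral integrable_continuous_real continuous_intros) auto
    have "((\<lambda>t. if t \<in> {-e..e} then ?f t else 0) has_integral integral {-e..e} ?f) {-pi..pi}"
      using int assms by (subst has_integral_restrict) auto
    from has_integral_diff[OF wallis_integral[of n] this]
    have h: "((\<lambda>t. ?f t - (if t \<in> {-e..e} then ?f t else 0)) has_integral (2 * pi * wallis n - integral {-e..e} ?f)) {-pi..pi}" .
    have "norm (2 * pi * wallis n - integral {-e..e} ?f) \<le> b ^ n * measure lborel {-pi..pi}"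
    proof (rule has_integral_bound_real[OF _ finite.emptyI h])
      fix t assume t: "t \<in> {-pi..pi} - {}"
      show "norm (?f t - (if t \<in> {-e..e} then ?f t else 0)) \<le> b ^ n"
      proof (cases "t \<in> {-e..e}")
        case False
        have "cos t = cos \<bar>t\<bar>" by simp
        also have "\<dots> \<le> cos e" using False t assms by (intro cos_monotone_0_pi_le) auto
        finally have "cos t \<le> cos e" .
        moreover have "(cos (t/2))\<^sup>2 = (1 + cos t) / 2" using cos_double_cos[of "t/2"] by simp
        ultimately have "(cos (t/2))\<^sup>2 \<le> b" by (simp add: b_def)
        hence "((cos (t/2))\<^sup>2) ^ n \<le> b ^ n" by (intro power_mono) auto
        thus ?thesis using False b0 by (simp add: power_mult)
      qed (use b0 in auto)
    qed (use b0 in auto)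
    also have "\<dots> = 2 * pi * b ^ n" by simp
    also have "\<dots> \<le> 2 * pi * (K * real n powr (-3/2))" using K(2)[OF n] b0 by (intro mult_left_mono) auto
    finally show ?thesis by simp
  qed
  thus ?thesis using that by blast
qed

section \<open>Centred aperiodic walks and their characteristic function\<close>

locale centred_walk = walk +
  assumes nonneg: "0 \<le> p i"
    and total: "(\<Sum>i\<in>{-int c..int d}. p i) = 1"
    and centred: "(\<Sum>i\<in>{-int c..int d}. of_int i * p i) = 0"
    and ends: "c \<ge> 1" "d \<ge> 1" "p (- int c) \<noteq> 0" "p (int d) \<noteq> 0"
    and aper: "aperiodic p"
begin

lemma total': "(\<Sum>i\<in>steps. p i) = 1" using total by (simp add: steps_def)

lemma centred': "(\<Sum>i\<in>steps. of_int i * p i) = 0" using centred by (simp add: steps_def)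

definition char_fun :: "real \<Rightarrow> complex" where
  "char_fun t = (\<Sum>i\<in>steps. of_real (p i) * cis (of_int i * t))"

definition walk_var :: real where "walk_var = (\<Sum>i\<in>steps. (of_int i)\<^sup>2 * p i)"

text \<open>The comparison walk has variance 1/2, and return probabilities scale with the inverse
  standard deviation; this is the ratio of the two.\<close>

definition kap :: real where "kap = 1 / sqrt (2 * walk_var)"

lemma Re_char_fun: "Re (char_fun t) = (\<Sum>i\<in>steps. p i * cos (of_int i * t))"
  by (simp add: char_fun_def)

lemma Im_char_fun: "Im (char_fun t) = (\<Sum>i\<in>steps. p i * sin (of_int i * t))"
  by (simp add: char_fun_def)

lemma walk_var_pos: "walk_var > 0"
proof -
  have "0 < (of_int (int d))\<^sup>2 * p (int d)" using ends nonneg[of "int d"] by (simp add: less_le)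
  also have "\<dots> \<le> walk_var" unfolding walk_var_def
    by (rule member_le_sum) (auto simp: steps_def nonneg)
  finally show ?thesis .
qed

lemma kap_pos: "kap > 0" using walk_var_pos by (simp add: kap_def)

text \<open>Fourier inversion by induction on n: orthogonality for n = 0, and one more factor of the
  characteristic function shifts k by each jump, as \<open>bridge_Suc\<close> does.\<close>

lemma bridge_fourier:
  "((\<lambda>t. Re (char_fun t ^ n * cis (- (of_int k * t)))) has_integral (2 * pi * bridge n k)) {-pi..pi}"
proof (induction n arbitrary: k)
  case 0
  show ?case
  proof (cases "k = 0")
    case True
    have "((\<lambda>t. 1::real) has_integral (2 * pi)) {-pi..pi}" using has_integral_const_real[of "1::real" "-pi" pi] by simp
    thus ?thesis using True by (simp add: bridge_0)
  next
    case False
    have "((\<lambda>t. cos (of_int k * t)) has_integral (sin (of_int k * pi) / of_int k - sin (of_int k * (-pi)) / of_int k)) {-pi..pi}"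
    proof (rule fundamental_theorem_of_calculus)
      fix t
      have "((\<lambda>t. sin (of_int k * t) / of_int k) has_real_derivative (cos (of_int k * t) * (of_int k * 1)) / of_int k) (at t within {-pi..pi})"
        by (rule has_field_derivative_at_within, rule DERIV_cdivide[OF DERIV_fun_sin[OF DERIV_cmult[OF DERIV_ident]]])
      thus "((\<lambda>t. sin (of_int k * t) / of_int k) has_vector_derivative cos (of_int k * t)) (at t within {-pi..pi})"
        using False by (simp add: has_real_derivative_iff_has_vector_derivative)
    qed simp
    moreover have "sin (of_int k * pi) = 0" by (metis mult.commute sin_npi_int)
    ultimately show ?thesis using False by (simp add: bridge_0)
  qed
next
  case (Suc n)
  have "((\<lambda>t. \<Sum>i\<in>steps. p i * Re (char_fun t ^ n * cis (- (of_int (k - i) * t)))) has_integral 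
      (\<Sum>i\<in>steps. p i * (2 * pi * bridge n (k - i)))) {-pi..pi}"
    by (intro has_integral_sum has_integral_mult_right Suc) simp
  moreover have "(\<Sum>i\<in>steps. p i * Re (char_fun t ^ n * cis (- (of_int (k - i) * t)))) = Re (char_fun t ^ Suc n * cis (- (of_int k * t)))" for t
  proof -
    have "char_fun t ^ Suc n * cis (- (of_int k * t)) = (\<Sum>i\<in>steps. of_real (p i) * (char_fun t ^ n * (cis (of_int i * t) * cis (- (of_int k * t)))))"
      by (subst power_Suc, subst char_fun_def) (simp add: sum_distrib_right sum_distrib_left mult_ac)
    also have "\<dots> = (\<Sum>i\<in>steps. of_real (p i) * (char_fun t ^ n * cis (- (of_int (k - i) * t))))"
      by (simp add: cis_mult algebra_simps)
    finally show ?thesis by simp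
  qed
  moreover have "(\<Sum>i\<in>steps. p i * (2 * pi * bridge n (k - i))) = 2 * pi * bridge (Suc n) k"
    by (simp add: bridge_Suc sum_distrib_left mult_ac)
  ultimately show ?case by simp
qed

text \<open>One minus the squared modulus of the characteristic function, as an average over two
  independent jumps. All terms are non-negative, so a single pair of jumps already gives a lower
  bound.\<close>

definition gap :: "real \<Rightarrow> real" where
  "gap t = (\<Sum>i\<in>steps. \<Sum>j\<in>steps. p i * p j * (1 - cos (of_int (i - j) * t)))"

lemma cmod_char_fun: "(cmod (char_fun t))\<^sup>2 = 1 - gap t"
proof -
  have "(cmod (char_fun t))\<^sup>2 = (\<Sum>i\<in>steps. p i * cos (of_int i * t))\<^sup>2 + (\<Sum>i\<in>steps. p i * sin (of_int i * t))\<^sup>2"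
    by (simp add: cmod_power2 Re_char_fun Im_char_fun)
  also have "\<dots> = (\<Sum>i\<in>steps. \<Sum>j\<in>steps. p i * p j * cos (of_int (i - j) * t))"
    by (simp add: power2_eq_square sum_product sum.distrib[symmetric] left_diff_distrib cos_diff algebra_simps)
  also have "\<dots> = (\<Sum>i\<in>steps. \<Sum>j\<in>steps. p i * p j) - gap t"
    unfolding gap_def sum_subtractf[symmetric] by (simp add: algebra_simps)
  also have "(\<Sum>i\<in>steps. \<Sum>j\<in>steps. p i * p j) = 1" by (simp add: sum_product[symmetric] total')
  finally show ?thesis .
qed

lemma gap_term_le: "i \<in> steps \<Longrightarrow> j \<in> steps \<Longrightarrow> p i * p j * (1 - cos (of_int (i - j) * t)) \<le> gap t"
proof -
  assume i: "i \<in> steps" and j: "j \<in> steps"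
  have nn: "0 \<le> p i * p j * (1 - cos (of_int (i - j) * t))" for i j using nonneg by simp
  have "p i * p j * (1 - cos (of_int (i - j) * t)) \<le> (\<Sum>j\<in>steps. p i * p j * (1 - cos (of_int (i - j) * t)))"
    using j nn by (intro member_le_sum) auto
  also have "\<dots> \<le> gap t" unfolding gap_def using i nn by (intro member_le_sum[of i]) (auto intro!: sum_nonneg)
  finally show ?thesis .
qed

text \<open>If the gap vanishes, every difference of two jumps lies in the subgroup H of integers m
  for which m t is a multiple of 2 pi. Its positive generator g cannot be 1 because |t| \<le> pi,
  and g \<ge> 2 contradicts aperiodicity.\<close>

lemma gap_pos:
  assumes t: "0 < \<bar>t\<bar>" "\<bar>t\<bar> \<le> pi" shows "gap t > 0"
proof (rule ccontr)
  assume "\<not> gap t > 0"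
  define H where "H = {m::int. \<exists>k::int. of_int m * t = of_int k * (2 * pi)}"
  have H_diff: "m - n \<in> H" if "m \<in> H" "n \<in> H" for m n
  proof -
    from that obtain k l :: int where "of_int m * t = of_int k * (2 * pi)" "of_int n * t = of_int l * (2 * pi)"
      unfolding H_def by blast
    hence "of_int (m - n) * t = of_int (k - l) * (2 * pi)" by (simp add: left_diff_distrib)
    thus ?thesis unfolding H_def by blast
  qed
  have H_mult: "m * n \<in> H" if "m \<in> H" for m n
  proof -
    from that obtain k :: int where "of_int m * t = of_int k * (2 * pi)" unfolding H_def by blast
    hence "of_int (m * n) * t = of_int (k * n) * (2 * pi)" by simp
    thus ?thesis unfolding H_def by blast
  qed
  have inH: "i - j \<in> H" if "p i \<noteq> 0" "p j \<noteq> 0" for i j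
  proof -
    have st: "i \<in> steps" "j \<in> steps" using that supp[of i] supp[of j] unfolding steps_def atLeastAtMost_iff by linarith+
    have "p i * p j > 0" using that nonneg[of i] nonneg[of j] by (simp add: less_le)
    moreover have "p i * p j * (1 - cos (of_int (i - j) * t)) \<le> 0" using gap_term_le[OF st, of t] \<open>\<not> gap t > 0\<close> by linarith
    ultimately have "1 - cos (of_int (i - j) * t) \<le> 0" by (metis mult_pos_pos not_le)
    hence "cos (of_int (i - j) * t) = 1" using cos_le_one[of "of_int (i - j) * t"] by linarith
    then obtain k :: int where "of_int (i - j) * t = of_int k * (2 * pi)" 
      unfolding cos_one_2pi_int by auto
    thus ?thesis unfolding H_def by blast
  qed
  define g where "g = (LEAST n::nat. n > 0 \<and> int n \<in> H)"
  have "0 < c + d \<and> int (c + d) \<in> H" using inH[of "int d" "- int c"] ends by (simp add: add.commute)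
  hence g: "g > 0 \<and> int g \<in> H" unfolding g_def by (rule LeastI)
  have dvd: "m mod int g = 0" if "m \<in> H" for m
  proof (rule ccontr)
    assume ne: "m mod int g \<noteq> 0"
    have "m mod int g = m - int g * (m div int g)" by (simp add: minus_mult_div_eq_mod)
    hence "m mod int g \<in> H" using H_diff[OF that H_mult] g by auto
    moreover have "0 \<le> m mod int g" "m mod int g < int g" using g by auto
    ultimately have "0 < nat (m mod int g) \<and> int (nat (m mod int g)) \<in> H" "nat (m mod int g) < g" using ne by auto
    thus False using not_less_Least[of "nat (m mod int g)" "\<lambda>n. n > 0 \<and> int n \<in> H"] unfolding g_def by blast
  qed
  show False
  proof (cases "g = 1")
    case True
    with g have "1 \<in> H" by simp
    then obtain k :: int where k: "t = of_int k * (2 * pi)" unfolding H_def by auto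
    hence "k \<noteq> 0" using t by auto
    hence "1 \<le> \<bar>of_int k :: real\<bar>" by linarith
    hence "1 * (2 * pi) \<le> \<bar>of_int k\<bar> * (2 * pi)" by (intro mult_right_mono) auto
    also have "\<dots> = \<bar>t\<bar>" using k by (simp add: abs_mult)
    finally have "2 * pi \<le> \<bar>t\<bar>" by simp
    thus False using t pi_gt_zero by linarith
  next
    case False
    \<comment> \<open>All jumps are congruent to d modulo g, so P(u) = u^d H(u^g), where H is read
      off from p along this progression.\<close>
    have "p i = (if (i - int d) mod int g = 0 then p (int d + int g * ((i - int d) div int g)) else 0)" for i
    proof (cases "(i - int d) mod int g = 0")
      case True
      hence "int g * ((i - int d) div int g) = i - int d" by auto
      thus ?thesis using True by simp
    next
      case F: False
      hence "i - int d \<notin> H" using dvd by blast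
      hence "p i = 0" using inH[of i "int d"] ends by blast
      thus ?thesis using F by simp
    qed
    hence "\<exists>(b::int) (per::nat) (h::int \<Rightarrow> real). per \<ge> 2 \<and> (\<forall>i. p i = (if (i - b) mod int per = 0 then h ((i - b) div int per) else 0))"
      using False g by (intro exI[of _ "int d"] exI[of _ g] exI[of _ "\<lambda>x. p (int d + int g * x)"]) auto
    thus False using aper unfolding aperiodic_def by blast
  qed
qed

text \<open>Near 0 the pair of extreme jumps alone gives a quadratic gap, as long as |N t| \<le> 2
  allows \<open>one_minus_cos_ge\<close>; on the remaining compact set the gap has a positive
  minimum.\<close>

lemma char_fun_decay:
  obtains a where "a > 0" "\<And>t. \<bar>t\<bar> \<le> pi \<Longrightarrow> cmod (char_fun t) \<le> exp (- a * t\<^sup>2)"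
proof -
  define N where "N = real (c + d)"
  have N: "N > 0" using ends by (simp add: N_def)
  define a1 where "a1 = p (int d) * p (- int c) * N\<^sup>2 / 4"
  have a1: "a1 > 0" using ends nonneg[of "int d"] nonneg[of "- int c"] N by (simp add: a1_def less_le)
  have near: "a1 * t\<^sup>2 \<le> gap t" if "\<bar>t\<bar> \<le> 2 / N" for t
  proof -
    have "\<bar>N * t\<bar> \<le> 2" using that N by (simp add: abs_mult field_simps)
    hence "(N * t)\<^sup>2 / 4 \<le> 1 - cos (N * t)" by (rule one_minus_cos_ge)
    hence "p (int d) * p (- int c) * ((N * t)\<^sup>2 / 4) \<le> p (int d) * p (- int c) * (1 - cos (N * t))"
      using nonneg by (intro mult_left_mono) auto
    also have "\<dots> \<le> gap t" using gap_term_le[of "int d" "- int c" t] by (simp add: steps_def N_def add.commute)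
    finally show ?thesis by (simp add: a1_def power_mult_distrib algebra_simps)
  qed
  define A where "A = {t. 2 / N \<le> \<bar>t\<bar> \<and> \<bar>t\<bar> \<le> pi}"
  obtain m where m: "m > 0" "\<And>t. t \<in> A \<Longrightarrow> m \<le> gap t"
  proof (cases "A = {}")
    case False
    have "compact A"
    proof -
      have "A = {-pi..pi} \<inter> {t. 2 / N \<le> \<bar>t\<bar>}" by (auto simp: A_def)
      moreover have "closed {t::real. 2 / N \<le> \<bar>t\<bar>}" by (intro closed_Collect_le continuous_intros)
      ultimately show ?thesis by (simp add: compact_Int_closed)
    qed
    moreover have "continuous_on A gap" unfolding gap_def by (intro continuous_intros)
    ultimately obtain x where x: "x \<in> A" "\<And>y. y \<in> A \<Longrightarrow> gap x \<le> gap y" using continuous_attains_inf[of A gap] False by blast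
    have "gap x > 0"
    proof (rule gap_pos)
      have "0 < 2 / N" using N by simp
      thus "0 < \<bar>x\<bar>" "\<bar>x\<bar> \<le> pi" using x(1) unfolding A_def by auto
    qed
    thus ?thesis using that x by blast
  qed (use that[of 1] in auto)
  \<comment> \<open>The factor 1/2 pays for passing from the squared modulus, which
    \<open>gap\<close> controls, to the modulus; pi^2 bounds t^2 on the compact part.\<close>
  define a where "a = min a1 (m / pi\<^sup>2) / 2"
  have "a > 0" using a1 m(1) by (simp add: a_def)
  moreover have "cmod (char_fun t) \<le> exp (- a * t\<^sup>2)" if t: "\<bar>t\<bar> \<le> pi" for t
  proof -
    have "2 * a * t\<^sup>2 \<le> gap t"
    proof (cases "\<bar>t\<bar> \<le> 2 / N")
      case True
      have "2 * a * t\<^sup>2 \<le> a1 * t\<^sup>2" by (intro mult_right_mono) (auto simp: a_def)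
      thus ?thesis using near[OF True] by linarith
    next
      case False
      have "t\<^sup>2 \<le> pi\<^sup>2" using t by (metis abs_ge_zero power2_abs power_mono)
      hence "2 * a * t\<^sup>2 \<le> m / pi\<^sup>2 * pi\<^sup>2" using m(1) by (intro mult_mono) (auto simp: a_def)
      also have "\<dots> = m" by simp
      also have "m \<le> gap t" using False t by (intro m) (auto simp: A_def)
      finally show ?thesis .
    qed
    hence "(cmod (char_fun t))\<^sup>2 \<le> 1 + (- 2 * a * t\<^sup>2)" using cmod_char_fun[of t] by simp
    also have "\<dots> \<le> exp (- 2 * a * t\<^sup>2)" by (rule exp_ge_add_one_self)
    also have "\<dots> = (exp (- a * t\<^sup>2))\<^sup>2" by (simp add: power2_eq_square exp_add[symmetric])
    finally show ?thesis by (rule power2_le_imp_le) simp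
  qed
  ultimately show ?thesis using that by blast
qed

text \<open>The linear term of the sine expansion sums to the mean, which is 0.\<close>

lemma Im_char_fun_bound: obtains A where "A \<ge> 0" "\<And>t. \<bar>Im (char_fun t)\<bar> \<le> A * \<bar>t\<bar> ^ 3"
proof -
  define A where "A = (\<Sum>i\<in>steps. p i * \<bar>of_int i\<bar> ^ 3)"
  have "\<bar>Im (char_fun t)\<bar> \<le> A * \<bar>t\<bar> ^ 3" for t
  proof -
    have "Im (char_fun t) = (\<Sum>i\<in>steps. p i * (sin (of_int i * t) - of_int i * t))"
      using centred' by (simp add: Im_char_fun right_diff_distrib sum_subtractf mult_ac sum_distrib_left[symmetric])
    also have "\<bar>\<dots>\<bar> \<le> (\<Sum>i\<in>steps. \<bar>p i * (sin (of_int i * t) - of_int i * t)\<bar>)" by (rule sum_abs)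
    also have "\<dots> \<le> (\<Sum>i\<in>steps. p i * \<bar>of_int i * t\<bar> ^ 3)"
      unfolding abs_mult[of "p _"] abs_of_nonneg[OF nonneg] by (intro sum_mono mult_left_mono sin_approx nonneg)
    also have "\<dots> = A * \<bar>t\<bar> ^ 3" unfolding A_def sum_distrib_right by (intro sum.cong refl) (simp add: abs_mult power_mult_distrib)
    finally show ?thesis .
  qed
  moreover have "A \<ge> 0" unfolding A_def using nonneg by (intro sum_nonneg) auto
  ultimately show ?thesis using that by blast
qed

text \<open>Both functions start with 1 - \<open>walk_var\<close> t^2/2; matching this term
  determines the stretching factor of the comparison walk.\<close>

lemma Re_char_fun_bound: 
  obtains A where "A \<ge> 0" "\<And>t. \<bar>Re (char_fun t) - (cos (sqrt (2 * walk_var) * t / 2))\<^sup>2\<bar> \<le> A * t ^ 4"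
proof -
  define s where "s = sqrt (2 * walk_var)"
  have s2: "s\<^sup>2 = 2 * walk_var" using walk_var_pos by (simp add: s_def)
  define A1 where "A1 = (\<Sum>i\<in>steps. p i * (of_int i) ^ 4)"
  have "\<bar>Re (char_fun t) - (cos (s * t / 2))\<^sup>2\<bar> \<le> (A1 + s ^ 4) * t ^ 4" for t
  proof -
    have "Re (char_fun t) - (1 - walk_var * t\<^sup>2 / 2) = (\<Sum>i\<in>steps. p i * (cos (of_int i * t) - (1 - (of_int i * t)\<^sup>2 / 2)))"
    proof -
      have "(\<Sum>i\<in>steps. p i * (cos (of_int i * t) - (1 - (of_int i * t)\<^sup>2 / 2))) 
        = (\<Sum>i\<in>steps. p i * cos (of_int i * t)) - (\<Sum>i\<in>steps. p i) + (\<Sum>i\<in>steps. (of_int i)\<^sup>2 * p i * (t\<^sup>2 / 2))"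
        unfolding sum_subtractf[symmetric] sum.distrib[symmetric] by (intro sum.cong refl) (simp add: algebra_simps power_mult_distrib)
      also have "(\<Sum>i\<in>steps. (of_int i)\<^sup>2 * p i * (t\<^sup>2 / 2)) = walk_var * (t\<^sup>2 / 2)" by (simp only: walk_var_def sum_distrib_right)
      finally show ?thesis by (simp add: total' Re_char_fun)
    qed
    also have "\<bar>\<dots>\<bar> \<le> (\<Sum>i\<in>steps. \<bar>p i * (cos (of_int i * t) - (1 - (of_int i * t)\<^sup>2 / 2))\<bar>)" by (rule sum_abs)
    also have "\<dots> \<le> (\<Sum>i\<in>steps. p i * (of_int i * t) ^ 4)"
      unfolding abs_mult[of "p _"] abs_of_nonneg[OF nonneg] by (intro sum_mono mult_left_mono cos_approx nonneg)
    also have "\<dots> = A1 * t ^ 4" unfolding A1_def sum_distrib_right by (intro sum.cong refl) (simp add: power_mult_distrib)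
    finally have 1: "\<bar>Re (char_fun t) - (1 - walk_var * t\<^sup>2 / 2)\<bar> \<le> A1 * t ^ 4" .
    have "(cos (s * t / 2))\<^sup>2 = (1 + cos (s * t)) / 2" using cos_double_cos[of "s * t / 2"] by simp
    moreover have "\<bar>cos (s * t) - (1 - (s * t)\<^sup>2 / 2)\<bar> \<le> (s * t) ^ 4" by (rule cos_approx)
    moreover have "(s * t)\<^sup>2 = 2 * walk_var * t\<^sup>2" using s2 by (simp add: power_mult_distrib)
    moreover have "0 \<le> (s * t) ^ 4" by simp
    ultimately have "\<bar>(cos (s * t / 2))\<^sup>2 - (1 - walk_var * t\<^sup>2 / 2)\<bar> \<le> (s * t) ^ 4" by (simp add: abs_le_iff)
    with 1 show ?thesis by (simp add: power_mult_distrib algebra_simps)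
  qed
  moreover have "A1 + s ^ 4 \<ge> 0" unfolding A1_def using nonneg by (intro add_nonneg_nonneg sum_nonneg) auto
  ultimately show ?thesis using that unfolding s_def by blast
qed

end

lemma abs_one_minus_cos_le: "\<bar>cos y - 1\<bar> \<le> y\<^sup>2" for y :: real
proof -
  have "cos y - 1 = - 2 * (sin (y/2))\<^sup>2" using cos_double_sin[of "y/2"] by simp
  hence "\<bar>cos y - 1\<bar> = 2 * \<bar>sin (y/2)\<bar>\<^sup>2" by simp
  also have "\<dots> \<le> 2 * \<bar>y/2\<bar>\<^sup>2" by (intro mult_left_mono power_mono abs_sin_x_le_abs_x) auto
  also have "\<dots> \<le> y\<^sup>2" by (simp add: power_divide)
  finally show ?thesis .
qed

context centred_walk begin

text \<open>Fourier inversion for the walk and for the comparison walk stretched by s, so that both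
  characteristic functions agree to second order at 0. With T = n t^2 the integrands differ by at
  most (1 + k^2)/n times a polynomial in T times exp(-a T); \<open>poly_exp_bound\<close> makes this
  a multiple of 1/(n (1 + T)), whose integral is of order \<open>n powr (-3/2)\<close>.\<close>

lemma local_limit:
  obtains C where "C \<ge> 0" "\<And>n k. n \<ge> 1 \<Longrightarrow> \<bar>bridge n k - kap * wallis n\<bar> \<le> C * (1 + (of_int k)\<^sup>2) * real n powr (-3/2)"
proof -
  define s where "s = sqrt (2 * walk_var)"
  have s: "s > 0" using walk_var_pos by (simp add: s_def)
  \<comment> \<open>On this window |s t| \<le> 2, so \<open>one_minus_cos_ge\<close> applies. Beyond
    it the stretched cosine can return to modulus 1, so the comparison integrand is cut off there
    and \<open>wallis_cut\<close> bounds the loss.\<close>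
  define \<delta> where "\<delta> = min pi (2 / s)"
  have \<delta>: "\<delta> > 0" "\<delta> \<le> pi" "s * \<delta> \<le> 2" using s by (auto simp: \<delta>_def min_def field_simps)
  obtain a0 where a0: "a0 > 0" "\<And>t. \<bar>t\<bar> \<le> pi \<Longrightarrow> cmod (char_fun t) \<le> exp (- a0 * t\<^sup>2)" by (rule char_fun_decay) blast
  obtain A1 where A1: "A1 \<ge> 0" "\<And>t. \<bar>Im (char_fun t)\<bar> \<le> A1 * \<bar>t\<bar> ^ 3" by (rule Im_char_fun_bound) blast
  obtain A2 where A2: "A2 \<ge> 0" "\<And>t. \<bar>Re (char_fun t) - (cos (s * t / 2))\<^sup>2\<bar> \<le> A2 * t ^ 4"
    unfolding s_def by (rule Re_char_fun_bound) blast
  define a where "a = min a0 (s\<^sup>2 / 8)"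
  have a: "a > 0" "a \<le> a0" "a \<le> s\<^sup>2 / 8" using a0 s by (auto simp: a_def)
  obtain K where K: "K > 0" "\<And>T. T \<ge> 0 \<Longrightarrow> (T + T^2 + T^3) * exp (- a * T) \<le> K / (1 + T)" using poly_exp_bound[OF a(1)] by blast
  obtain K3 where K3: "\<And>n. n \<ge> 1 \<Longrightarrow> \<bar>2 * pi * wallis n - integral {-(s*\<delta>)..s*\<delta>} (\<lambda>t. cos (t/2) ^ (2*n))\<bar> \<le> K3 * real n powr (-3/2)"
    using wallis_cut[of "s * \<delta>"] s \<delta> pi_ge_two by (meson mult_pos_pos order_trans)
  \<comment> \<open>Since \<open>R * r t \<ge> 1\<close> on the whole period, the exponents n - 1
    and n - 2 left by the power estimates can be raised to n at the price of a constant.\<close>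
  define R where "R = exp (a * pi\<^sup>2)"
  have R: "R \<ge> 1" using a by (simp add: R_def)
  define r where "r t = exp (- a * t\<^sup>2)" for t
  have r0: "r t > 0" for t by (simp add: r_def)
  have rR: "1 \<le> R * r t" if "\<bar>t\<bar> \<le> pi" for t
  proof -
    have "t\<^sup>2 \<le> pi\<^sup>2" using that by (metis abs_ge_zero power2_abs power_mono)
    hence "a * t\<^sup>2 \<le> a * pi\<^sup>2" using a by (intro mult_left_mono) auto
    thus ?thesis by (simp add: R_def r_def exp_add[symmetric])
  qed
  have cf: "cmod (char_fun t) \<le> r t" if "\<bar>t\<bar> \<le> pi" for t
  proof -
    have "a * t\<^sup>2 \<le> a0 * t\<^sup>2" using a by (intro mult_right_mono) auto
    thus ?thesis using a0(2)[OF that] unfolding r_def by (auto intro: order_trans)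
  qed
  define \<psi> where "\<psi> t = (cos (s * t / 2))\<^sup>2" for t
  have \<psi>: "0 \<le> \<psi> t" "\<psi> t \<le> r t" if "\<bar>t\<bar> \<le> \<delta>" for t
  proof -
    show "0 \<le> \<psi> t" by (simp add: \<psi>_def)
    have "\<bar>s * t\<bar> \<le> 2"
    proof -
      have "\<bar>s * t\<bar> = s * \<bar>t\<bar>" using s by (simp add: abs_mult)
      also have "\<dots> \<le> s * \<delta>" using that s by (intro mult_left_mono) auto
      finally show ?thesis using \<delta> by linarith
    qed
    hence "(s * t)\<^sup>2 / 4 \<le> 1 - cos (s * t)" by (rule one_minus_cos_ge)
    moreover have "\<psi> t = (1 + cos (s * t)) / 2" using cos_double_cos[of "s * t / 2"] by (simp add: \<psi>_def)
    ultimately have "\<psi> t \<le> 1 + (- (s\<^sup>2 / 8 * t\<^sup>2))" by (simp add: power_mult_distrib)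
    also have "\<dots> \<le> 1 + (- a * t\<^sup>2)" using mult_right_mono[OF a(3), of "t\<^sup>2"] by simp
    also have "\<dots> \<le> r t" unfolding r_def by (rule exp_ge_add_one_self)
    finally show "\<psi> t \<le> r t" .
  qed
  define K1 where "K1 = 1 + A1 * R + A1\<^sup>2 * R\<^sup>2 + A2 * R"
  have K1: "K1 \<ge> 0" using A1(1) A2(1) R by (simp add: K1_def)
  define K2 where "K2 = K1 * K + K / \<delta>\<^sup>2"
  have K2: "K2 \<ge> 0" using K1 K by (simp add: K2_def)
  have rn: "r t ^ n = exp (- a * (real n * t\<^sup>2))" for t n
    unfolding r_def by (simp add: exp_of_nat_mult[symmetric] mult_ac)
  have pt: "\<bar>Re (char_fun t ^ n * cis (- (of_int k * t))) - (if t \<in> {-\<delta>..\<delta>} then \<psi> t ^ n else 0)\<bar> 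
      \<le> K2 * (1 + (of_int k)\<^sup>2) / real n * (1 / (1 + real n * t\<^sup>2))"
    if n: "n \<ge> 1" and t: "t \<in> {-pi..pi}" for n k t
  proof -
    define T where "T = real n * t\<^sup>2"
    have T: "T \<ge> 0" by (simp add: T_def)
    have t': "\<bar>t\<bar> \<le> pi" using t by auto
    define z where "z = char_fun t"
    define k' where "k' = real_of_int k"
    have k': "\<bar>k'\<bar> \<le> 1 + k'\<^sup>2" "k'\<^sup>2 \<le> 1 + k'\<^sup>2" "1 \<le> 1 + k'\<^sup>2"
      using zero_le_power2[of "\<bar>k'\<bar> - 1"] by (auto simp: power2_diff)
    have zn: "cmod (z ^ n) \<le> r t ^ n" unfolding norm_power z_def using cf[OF t'] by (intro power_mono) auto
    have Rezn: "\<bar>Re (z ^ n)\<bar> \<le> r t ^ n" using zn abs_Re_le_cmod order_trans by blast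
    show ?thesis
    proof (cases "t \<in> {-\<delta>..\<delta>}")
      case True
      hence td: "\<bar>t\<bar> \<le> \<delta>" by auto
      have Rex: "\<bar>Re z\<bar> \<le> r t" using cf[OF t'] abs_Re_le_cmod[of z] unfolding z_def by linarith
      have e1: "\<bar>Re (z ^ n) * (cos (k' * t) - 1)\<bar> \<le> r t ^ n * (k'\<^sup>2 * t\<^sup>2)"
        unfolding abs_mult using Rezn abs_one_minus_cos_le[of "k' * t"] r0[of t]
        by (intro mult_mono) (auto simp: power_mult_distrib)
      have e2: "\<bar>Im (z ^ n) * sin (k' * t)\<bar> \<le> (real n * (A1 * \<bar>t\<bar> ^ 3) * r t ^ n * R) * (\<bar>k'\<bar> * \<bar>t\<bar>)"
        unfolding abs_mult
      proof (rule mult_mono)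
        have "\<bar>Im (z ^ n)\<bar> \<le> \<bar>Im (z ^ n)\<bar> * (R * r t)" using rR[OF t'] by (simp add: mult_le_cancel_left1)
        also have "\<dots> = \<bar>Im (z ^ n)\<bar> * r t * R" by simp
        also have "\<dots> \<le> real n * \<bar>Im z\<bar> * r t ^ n * R"
          using Im_power_bound[OF cf[OF t'] r0[of t], of n] R unfolding z_def by (intro mult_right_mono) auto
        also have "\<dots> \<le> real n * (A1 * \<bar>t\<bar> ^ 3) * r t ^ n * R"
          using A1(2)[of t] R r0[of t] unfolding z_def by (intro mult_right_mono mult_left_mono) auto
        finally show "\<bar>Im (z ^ n)\<bar> \<le> real n * (A1 * \<bar>t\<bar> ^ 3) * r t ^ n * R" .
        show "\<bar>sin (k' * t)\<bar> \<le> \<bar>k'\<bar> * \<bar>t\<bar>" using abs_sin_x_le_abs_x[of "k' * t"] by (simp add: abs_mult)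
      qed (use A1 R r0[of t] in auto)
      have e3: "\<bar>Re (z ^ n) - Re z ^ n\<bar> \<le> (real n)\<^sup>2 * (A1 * \<bar>t\<bar> ^ 3)\<^sup>2 * r t ^ n * R\<^sup>2"
      proof -
        have "1 \<le> (R * r t)\<^sup>2" using rR[OF t'] by (simp add: one_le_power)
        hence "\<bar>Re (z ^ n) - Re z ^ n\<bar> \<le> \<bar>Re (z ^ n) - Re z ^ n\<bar> * (R * r t)\<^sup>2" by (simp add: mult_le_cancel_left1)
        also have "\<dots> = (\<bar>Re (z ^ n) - Re z ^ n\<bar> * (r t)\<^sup>2) * R\<^sup>2" by (simp add: power_mult_distrib)
        also have "\<dots> \<le> ((real n)\<^sup>2 * (Im z)\<^sup>2 * r t ^ n) * R\<^sup>2"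
          using Re_power_bound[OF cf[OF t'] r0[of t], of n] unfolding z_def by (intro mult_right_mono) auto
        also have "\<dots> \<le> ((real n)\<^sup>2 * (A1 * \<bar>t\<bar> ^ 3)\<^sup>2 * r t ^ n) * R\<^sup>2"
        proof -
          have "(Im z)\<^sup>2 \<le> (A1 * \<bar>t\<bar> ^ 3)\<^sup>2" using A1(2)[of t] unfolding z_def by (metis abs_ge_zero power2_abs power_mono)
          thus ?thesis using r0[of t] by (intro mult_right_mono mult_left_mono) auto
        qed
        finally show ?thesis .
      qed
      have e4: "\<bar>Re z ^ n - \<psi> t ^ n\<bar> \<le> real n * (A2 * t ^ 4) * r t ^ n * R"
      proof -
        have "\<bar>Re z ^ n - \<psi> t ^ n\<bar> \<le> \<bar>Re z ^ n - \<psi> t ^ n\<bar> * (R * r t)" using rR[OF t'] by (simp add: mult_le_cancel_left1)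
        also have "\<dots> = \<bar>Re z ^ n - \<psi> t ^ n\<bar> * r t * R" by simp
        also have "\<dots> \<le> real n * \<bar>Re z - \<psi> t\<bar> * r t ^ n * R"
          using power_diff_bound[OF Rex _ r0[of t], of "\<psi> t" n] \<psi>[OF td] R by (intro mult_right_mono) auto
        also have "\<dots> \<le> real n * (A2 * t ^ 4) * r t ^ n * R"
          using A2(2)[of t] R r0[of t] unfolding z_def \<psi>_def by (intro mult_right_mono mult_left_mono) auto
        finally show ?thesis .
      qed
      \<comment> \<open>Four errors: the cosine and the sine of the shift by k, the imaginary part
        of z, and the difference between the real part and \<psi>.\<close>
      have "Re (z ^ n * cis (- (k' * t))) - \<psi> t ^ n = Re (z ^ n) * (cos (k' * t) - 1) + Im (z ^ n) * sin (k' * t)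
          + (Re (z ^ n) - Re z ^ n) + (Re z ^ n - \<psi> t ^ n)" by (simp add: algebra_simps)
      hence "\<bar>Re (z ^ n * cis (- (k' * t))) - \<psi> t ^ n\<bar> \<le> \<bar>Re (z ^ n) * (cos (k' * t) - 1)\<bar> + \<bar>Im (z ^ n) * sin (k' * t)\<bar>
          + \<bar>Re (z ^ n) - Re z ^ n\<bar> + \<bar>Re z ^ n - \<psi> t ^ n\<bar>" by linarith
      also have "\<dots> \<le> r t ^ n * (k'\<^sup>2 * t\<^sup>2) + (real n * (A1 * \<bar>t\<bar> ^ 3) * r t ^ n * R) * (\<bar>k'\<bar> * \<bar>t\<bar>)
          + (real n)\<^sup>2 * (A1 * \<bar>t\<bar> ^ 3)\<^sup>2 * r t ^ n * R\<^sup>2 + real n * (A2 * t ^ 4) * r t ^ n * R"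
        using e1 e2 e3 e4 by linarith
      finally have W: "\<bar>Re (z ^ n * cis (- (k' * t))) - \<psi> t ^ n\<bar> \<le> \<dots>" .
      have t3: "\<bar>t\<bar> ^ 3 * \<bar>t\<bar> = t ^ 4" by (simp add: power_Suc2[symmetric] del: power_Suc2)
      have t6: "(\<bar>t\<bar> ^ 3)\<^sup>2 = t ^ 6" by (simp add: power_mult[symmetric])
      \<comment> \<open>Multiplying by n groups all powers of t into powers of T: n t^2, n^2 t^4 and
        n^3 t^6.\<close>
      have eq: "real n * (r t ^ n * (k'\<^sup>2 * t\<^sup>2) + (real n * (A1 * \<bar>t\<bar> ^ 3) * r t ^ n * R) * (\<bar>k'\<bar> * \<bar>t\<bar>)
          + (real n)\<^sup>2 * (A1 * \<bar>t\<bar> ^ 3)\<^sup>2 * r t ^ n * R\<^sup>2 + real n * (A2 * t ^ 4) * r t ^ n * R)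
        = r t ^ n * (k'\<^sup>2 * T + \<bar>k'\<bar> * (A1 * R) * T^2 + (A1\<^sup>2 * R\<^sup>2) * T^3 + (A2 * R) * T^2)"
      proof -
        have "(real n * (A1 * \<bar>t\<bar> ^ 3) * r t ^ n * R) * (\<bar>k'\<bar> * \<bar>t\<bar>) = real n * A1 * r t ^ n * R * \<bar>k'\<bar> * t ^ 4"
          using t3 by (simp add: mult_ac)
        moreover have "(A1 * \<bar>t\<bar> ^ 3)\<^sup>2 = A1\<^sup>2 * t ^ 6" by (simp add: power_mult_distrib t6)
        moreover have "T^2 = (real n)\<^sup>2 * t ^ 4" "T^3 = (real n)^3 * t ^ 6"
          by (simp_all add: T_def power_mult_distrib power_mult[symmetric])
        ultimately show ?thesis
          by (simp add: T_def algebra_simps power2_eq_square[of "real n"] power3_eq_cube[of "real n"])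
      qed
      have "real n * \<bar>Re (z ^ n * cis (- (k' * t))) - \<psi> t ^ n\<bar> \<le> r t ^ n * (k'\<^sup>2 * T + \<bar>k'\<bar> * (A1 * R) * T^2 + (A1\<^sup>2 * R\<^sup>2) * T^3 + (A2 * R) * T^2)"
        unfolding eq[symmetric] using W by (rule mult_left_mono) simp
      also have "\<dots> \<le> r t ^ n * ((1 + k'\<^sup>2) * K1 * (T + T^2 + T^3))"
      proof (rule mult_left_mono)
        have b: "y * B * X \<le> (1 + k'\<^sup>2) * B * (T + T^2 + T^3)" if "0 \<le> y" "y \<le> 1 + k'\<^sup>2" "0 \<le> B" "0 \<le> X" "X \<le> T + T^2 + T^3" for y B X
          using that by (intro mult_mono) auto
        have X: "T \<le> T + T^2 + T^3" "T^2 \<le> T + T^2 + T^3" "T^3 \<le> T + T^2 + T^3" using T by auto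
        have "k'\<^sup>2 * 1 * T + \<bar>k'\<bar> * (A1 * R) * T^2 + 1 * (A1\<^sup>2 * R\<^sup>2) * T^3 + 1 * (A2 * R) * T^2
          \<le> (1 + k'\<^sup>2) * 1 * (T + T^2 + T^3) + (1 + k'\<^sup>2) * (A1 * R) * (T + T^2 + T^3) 
            + (1 + k'\<^sup>2) * (A1\<^sup>2 * R\<^sup>2) * (T + T^2 + T^3) + (1 + k'\<^sup>2) * (A2 * R) * (T + T^2 + T^3)"
          using k' A1(1) A2(1) R T X by (intro add_mono b) auto
        also have "\<dots> = (1 + k'\<^sup>2) * K1 * (T + T^2 + T^3)" by (simp add: K1_def algebra_simps)
        finally show "k'\<^sup>2 * T + \<bar>k'\<bar> * (A1 * R) * T^2 + (A1\<^sup>2 * R\<^sup>2) * T^3 + (A2 * R) * T^2 \<le> (1 + k'\<^sup>2) * K1 * (T + T^2 + T^3)" by simp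
      qed (use r0[of t] in auto)
      also have "\<dots> = (1 + k'\<^sup>2) * K1 * ((T + T^2 + T^3) * exp (- a * T))" unfolding rn T_def[symmetric] by simp
      also have "\<dots> \<le> (1 + k'\<^sup>2) * K1 * (K / (1 + T))" using K(2)[OF T] K1 by (intro mult_left_mono) auto
      also have "\<dots> \<le> K2 * (1 + k'\<^sup>2) * (1 / (1 + T))"
      proof -
        have "K1 * K \<le> K2" using K by (simp add: K2_def)
        hence "K1 * K * ((1 + k'\<^sup>2) * (1 / (1 + T))) \<le> K2 * ((1 + k'\<^sup>2) * (1 / (1 + T)))" using T by (intro mult_right_mono) auto
        thus ?thesis by (simp add: mult_ac)
      qed
      finally have "\<bar>Re (z ^ n * cis (- (k' * t))) - \<psi> t ^ n\<bar> \<le> K2 * (1 + k'\<^sup>2) * (1 / (1 + T)) / real n"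
        using n by (subst pos_le_divide_eq) (auto simp: mult.commute[of "real n"])
      thus ?thesis using True unfolding z_def k'_def T_def by (simp add: mult.commute[of "real n" "1 + real n * t\<^sup>2"])
    next
      case False
      hence td: "\<delta> \<le> \<bar>t\<bar>" by auto
      have "\<bar>Re (z ^ n * cis (- (k' * t)))\<bar> \<le> cmod (z ^ n * cis (- (k' * t)))" by (rule abs_Re_le_cmod)
      also have "\<dots> \<le> r t ^ n" using zn by (simp add: norm_mult)
      finally have 1: "\<bar>Re (z ^ n * cis (- (k' * t)))\<bar> \<le> exp (- a * T)" unfolding rn T_def .
      have "\<delta>\<^sup>2 \<le> t\<^sup>2" using td \<delta> by (metis abs_le_square_iff abs_of_pos)
      \<comment> \<open>Away from 0 the factor 1/n comes from n \<le> T/\<delta>^2: one power of T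
        is spent and the exponential pays for it.\<close>
      hence "real n * \<delta>\<^sup>2 \<le> T" by (simp add: T_def mult_left_mono)
      hence "(real n * \<delta>\<^sup>2) * \<bar>Re (z ^ n * cis (- (k' * t)))\<bar> \<le> T * exp (- a * T)" using 1 T by (intro mult_mono) auto
      also have "\<dots> \<le> (T + T^2 + T^3) * exp (- a * T)" using T by (intro mult_right_mono) auto
      also have "\<dots> \<le> K / (1 + T)" by (rule K(2)[OF T])
      finally have "\<bar>Re (z ^ n * cis (- (k' * t)))\<bar> \<le> K / (1 + T) / (real n * \<delta>\<^sup>2)"
        using n \<delta>(1) by (subst pos_le_divide_eq) (simp_all add: mult_ac)
      also have "\<dots> = K / \<delta>\<^sup>2 * (1 / (1 + T) / real n)" by simp
      also have "\<dots> \<le> K2 * (1 + k'\<^sup>2) * (1 / (1 + T) / real n)"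
      proof (rule mult_right_mono)
        have "K / \<delta>\<^sup>2 \<le> K2" using K1 K by (simp add: K2_def)
        also have "K2 \<le> K2 * (1 + k'\<^sup>2)" using K2 by (simp add: mult_le_cancel_left1)
        finally show "K / \<delta>\<^sup>2 \<le> K2 * (1 + k'\<^sup>2)" .
      qed (use T in auto)
      finally show ?thesis using False unfolding z_def k'_def T_def by (auto simp: mult.commute[of "real n" "1 + real n * t\<^sup>2"])
    qed
  qed
  define C where "C = (K2 * pi + \<bar>K3\<bar> / s) / (2 * pi)"
  have "\<bar>bridge n k - kap * wallis n\<bar> \<le> C * (1 + (of_int k)\<^sup>2) * real n powr (-3/2)" if n: "n \<ge> 1" for n k
  proof -
    \<comment> \<open>Stretching the Wallis integral by s turns its integrand into a power of \<psi>
      and contributes the factor 1/s, which is \<open>kap\<close>.\<close>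
    define J where "J = integral {-(s*\<delta>)..s*\<delta>} (\<lambda>t. cos (t/2) ^ (2*n))"
    have "((\<lambda>t. cos (t/2) ^ (2*n)) has_integral J) {-(s*\<delta>)..s*\<delta>}" unfolding J_def
      by (intro integrable_integral integrable_continuous_real continuous_intros) auto
    from has_integral_stretch_real[OF this, of s]
    have "((\<lambda>t. cos (s * t / 2) ^ (2*n)) has_integral (1 / s * J)) ((\<lambda>x. x / s) ` {-(s*\<delta>)..s*\<delta>})"
      using s by (simp add: mult.commute)
    moreover have "(\<lambda>x. x / s) ` {-(s*\<delta>)..s*\<delta>} = {-\<delta>..\<delta>}"
      using s by (auto simp: image_iff field_simps intro!: bexI[of _ "s * _"])
    ultimately have "((\<lambda>t. \<psi> t ^ n) has_integral (J / s)) {-\<delta>..\<delta>}"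
      by (simp add: \<psi>_def power_mult)
    hence "((\<lambda>t. if t \<in> {-\<delta>..\<delta>} then \<psi> t ^ n else 0) has_integral (J / s)) {-pi..pi}"
      using \<delta> by (subst has_integral_restrict) auto
    from has_integral_diff[OF bridge_fourier[of n k] this]
    have h: "((\<lambda>t. Re (char_fun t ^ n * cis (- (of_int k * t))) - (if t \<in> {-\<delta>..\<delta>} then \<psi> t ^ n else 0)) has_integral (2 * pi * bridge n k - J / s)) {-pi..pi}" .
    define Z where "Z = K2 * (1 + (of_int k)\<^sup>2) / real n"
    have Z: "Z \<ge> 0" using K2 by (simp add: Z_def)
    have hg: "((\<lambda>t. Z * (1 / (1 + real n * t\<^sup>2))) has_integral (Z * integral {-pi..pi} (\<lambda>t. 1 / (1 + real n * t\<^sup>2)))) {-pi..pi}"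
      by (intro has_integral_mult_right integrable_integral integral_lorentz_le n)
    have "norm (integral {-pi..pi} (\<lambda>t. Re (char_fun t ^ n * cis (- (of_int k * t))) - (if t \<in> {-\<delta>..\<delta>} then \<psi> t ^ n else 0)))
      \<le> integral {-pi..pi} (\<lambda>t. Z * (1 / (1 + real n * t\<^sup>2)))"
      using pt[OF n, of _ k] unfolding Z_def[symmetric] real_norm_def[symmetric]
      by (intro integral_norm_bound_integral has_integral_integrable[OF h] has_integral_integrable[OF hg])
    hence "\<bar>2 * pi * bridge n k - J / s\<bar> \<le> Z * integral {-pi..pi} (\<lambda>t. 1 / (1 + real n * t\<^sup>2))"
      unfolding integral_unique[OF h] integral_unique[OF hg] by simp
    also have "\<dots> \<le> Z * (pi * real n powr (-1/2))" using integral_lorentz_le(2)[OF n] Z by (rule mult_left_mono)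
    also have "\<dots> = K2 * pi * (1 + (of_int k)\<^sup>2) * (real n powr (-1/2) / real n)" by (simp add: Z_def)
    also have "real n powr (-1/2) / real n = real n powr (-3/2)"
      using n powr_diff[of "real n" "-1/2" 1] by simp
    finally have 1: "\<bar>2 * pi * bridge n k - J / s\<bar> \<le> K2 * pi * (1 + (of_int k)\<^sup>2) * real n powr (-3/2)" .
    have "\<bar>2 * pi * wallis n - J\<bar> \<le> \<bar>K3\<bar> * real n powr (-3/2)"
      unfolding J_def by (rule order_trans[OF K3[OF n]], rule mult_right_mono) auto
    hence "\<bar>2 * pi * wallis n - J\<bar> / s \<le> \<bar>K3\<bar> * real n powr (-3/2) / s" using s by (intro divide_right_mono) auto
    moreover have "\<bar>2 * pi * wallis n - J\<bar> / s = \<bar>2 * pi * wallis n / s - J / s\<bar>" using s 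
      by (metis abs_div_pos diff_divide_distrib)
    ultimately have 2: "\<bar>2 * pi * wallis n / s - J / s\<bar> \<le> \<bar>K3\<bar> / s * real n powr (-3/2)" by simp
    have "\<bar>K3\<bar> / s * real n powr (-3/2) * 1 \<le> \<bar>K3\<bar> / s * real n powr (-3/2) * (1 + (of_int k)\<^sup>2)"
      using s by (intro mult_left_mono) auto
    with 1 2 have "\<bar>2 * pi * bridge n k - 2 * pi * wallis n / s\<bar> \<le> K2 * pi * (1 + (of_int k)\<^sup>2) * real n powr (-3/2)
        + \<bar>K3\<bar> / s * real n powr (-3/2) * (1 + (of_int k)\<^sup>2)" by linarith
    also have "\<dots> = (K2 * pi + \<bar>K3\<bar> / s) * (1 + (of_int k)\<^sup>2) * real n powr (-3/2)"
    proof -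
      have "x * z * w + y * w * z = (x + y) * z * w" for x y z w :: real by (simp add: algebra_simps)
      thus ?thesis .
    qed
    finally have "\<bar>2 * pi * bridge n k - 2 * pi * wallis n / s\<bar> \<le> (K2 * pi + \<bar>K3\<bar> / s) * (1 + (of_int k)\<^sup>2) * real n powr (-3/2)" .
    moreover have "2 * pi * bridge n k - 2 * pi * wallis n / s = 2 * pi * (bridge n k - kap * wallis n)"
      by (simp add: kap_def s_def right_diff_distrib)
    ultimately have "\<bar>2 * pi * (bridge n k - kap * wallis n)\<bar> \<le> (K2 * pi + \<bar>K3\<bar> / s) * (1 + (of_int k)\<^sup>2) * real n powr (-3/2)"
      by (rule back_subst[of "\<lambda>x. \<bar>x\<bar> \<le> _"])
    hence "2 * pi * \<bar>bridge n k - kap * wallis n\<bar> \<le> (K2 * pi + \<bar>K3\<bar> / s) * (1 + (of_int k)\<^sup>2) * real n powr (-3/2)"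
      unfolding abs_mult[of "2 * pi"] by (simp only: abs_of_pos[OF mult_pos_pos[OF zero_less_numeral pi_gt_zero]])
    hence "\<bar>bridge n k - kap * wallis n\<bar> \<le> (K2 * pi + \<bar>K3\<bar> / s) * (1 + (of_int k)\<^sup>2) * real n powr (-3/2) / (2 * pi)"
      by (subst pos_le_divide_eq) (simp_all only: mult.commute mult_pos_pos zero_less_numeral pi_gt_zero)
    thus ?thesis by (simp add: C_def)
  qed
  moreover have "C \<ge> 0" using K2 s by (simp add: C_def)
  ultimately show ?thesis using that by blast
qed

end

section \<open>Meanders of a centred walk\<close>

lemma abs_sum_conv_radius_gt: "abs_sum f \<Longrightarrow> 0 \<le> x \<Longrightarrow> x < 1 \<Longrightarrow> ereal (norm x) < fps_conv_radius f" for x :: real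
  using abs_sum_conv_radius[of f] by (metis abs_of_nonneg ereal_less(3) less_le_trans real_norm_def)

lemma abs_sum_finite_supp: "(\<And>n. n \<ge> N \<Longrightarrow> fps_nth f n = 0) \<Longrightarrow> abs_sum f"
  using coeff_asymp_finite coeff_asymp_abs_sum by blast

lemma abs_sum_add:
  assumes "abs_sum f" "abs_sum g" shows "abs_sum (f + g)"
  unfolding abs_sum_def
proof (rule summable_comparison_test'[of "\<lambda>n. \<bar>fps_nth f n\<bar> + \<bar>fps_nth g n\<bar>" 0])
  show "summable (\<lambda>n. \<bar>fps_nth f n\<bar> + \<bar>fps_nth g n\<bar>)" using assms unfolding abs_sum_def by (rule summable_add)
qed (simp add: abs_triangle_ineq)

text \<open>Needed to sum over k the factor 1 + k^2 in the error of the local limit theorem. One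
  factor s^k of t^k \<le> s^k s^k absorbs the quadratic growth.\<close>

lemma summable_quadratic_geometric:
  assumes "0 \<le> t" "t < (1::real)" shows "summable (\<lambda>k. (1 + (real k)\<^sup>2) * t ^ k)"
proof -
  define s where "s = sqrt ((t + 1) / 2)"
  have s: "0 < s" "s < 1" "t \<le> s\<^sup>2" using assms by (auto simp: s_def)
  have "(\<lambda>k. (1 + (real k)\<^sup>2) * s ^ k) \<longlonglongrightarrow> 0" using s(1,2) by real_asymp
  hence "Bseq (\<lambda>k. (1 + (real k)\<^sup>2) * s ^ k)" using convergent_imp_Bseq convergentI by blast
  then obtain K where K: "\<And>k. \<bar>(1 + (real k)\<^sup>2) * s ^ k\<bar> \<le> K" unfolding Bseq_def by auto
  show ?thesis
  proof (rule summable_comparison_test'[of "\<lambda>k. K * s ^ k" 0])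
    show "summable (\<lambda>k. K * s ^ k)" using s by (intro summable_mult summable_geometric) auto
    fix k :: nat
    have "t ^ k \<le> (s\<^sup>2) ^ k" using assms s by (intro power_mono) auto
    hence "(1 + (real k)\<^sup>2) * t ^ k \<le> (1 + (real k)\<^sup>2) * (s\<^sup>2) ^ k" by (intro mult_left_mono) auto
    also have "\<dots> = ((1 + (real k)\<^sup>2) * s ^ k) * s ^ k" by (simp add: power_mult[symmetric] power2_eq_square power_mult_distrib)
    also have "\<dots> \<le> K * s ^ k" using K[of k] s by (intro mult_right_mono) auto
    finally show "norm ((1 + (real k)\<^sup>2) * t ^ k) \<le> K * s ^ k" using assms by simp
  qed
qed

section \<open>Generating functions of meanders and bridges\<close>

context walk begin

lemma bridge_supp: "k > int (n * d) \<Longrightarrow> bridge n k = 0"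
proof (induction n arbitrary: k)
  case (Suc n)
  show ?case unfolding bridge_Suc
  proof (intro sum.neutral ballI)
    fix i assume "i \<in> steps"
    hence "k - i > int (n * d)" using Suc.prems by (simp add: steps_def algebra_simps)
    thus "p i * bridge n (k - i) = 0" using Suc.IH by simp
  qed
qed (simp add: bridge_0)

lemma bridge_supp_nat: "n * d < k \<Longrightarrow> bridge n (int k) = 0"
  by (rule bridge_supp) (simp only: of_nat_less_iff)

lemma mw_supp: "k > n * d \<Longrightarrow> mw p n k = 0"
proof (induction n arbitrary: k)
  case (Suc n)
  show ?case unfolding mw_Suc
  proof (intro sum.neutral ballI)
    fix i assume "i \<in> steps"
    hence "int k - i > int (n * d)" using Suc.prems by (simp add: steps_def algebra_simps flip: of_nat_less_iff[where ?'a=int])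
    hence "nat (int k - i) > n * d" by linarith
    thus "p i * (if int k - i \<ge> 0 then mw p n (nat (int k - i)) else 0) = 0" using Suc.IH by simp
  qed
qed (simp add: mw_0)

lemma abs_sum_meander_poly: "abs_sum (meander_poly n)"
  by (rule abs_sum_finite_supp[of "n * d + 1"]) (simp add: meander_poly_def mw_supp)

lemma abs_sum_bridge_pos: "abs_sum (bridge_pos n)"
  by (rule abs_sum_finite_supp[of "n * d + 1"]) (simp add: bridge_pos_def bridge_supp_nat)

definition meander_gf :: "real \<Rightarrow> real fps" where
  "meander_gf t = Abs_fps (\<lambda>n. eval_fps (meander_poly n) t)"

text \<open>The logarithm of \<open>meander_gf t\<close>. Division by 0 yields 0, so the constant
  term vanishes as it must.\<close>

definition log_gf :: "real \<Rightarrow> real fps" where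
  "log_gf t = Abs_fps (\<lambda>n. eval_fps (bridge_pos n) t / real n)"

definition log_coeff :: "nat \<Rightarrow> real fps" where
  "log_coeff k = Abs_fps (\<lambda>n. bridge n (int k) / real n)"

lemma Mk_0: "Mk p 0 = meander_gf 0"
  by (rule fps_ext) (simp add: Mk_def meander_gf_def eval_fps_at_0 meander_poly_def)

lemma eval_fps_finite_sum:
  fixes f :: "'a \<Rightarrow> real fps"
  assumes "finite I" "\<And>i. i \<in> I \<Longrightarrow> abs_sum (f i)" "0 \<le> t" "t < 1"
  shows "eval_fps (\<Sum>i\<in>I. f i) t = (\<Sum>i\<in>I. eval_fps (f i) t) \<and> abs_sum (\<Sum>i\<in>I. f i)"
  using assms(1,2)
proof (induction I rule: finite_induct)
  case empty show ?case by (simp add: abs_sum_def)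
next
  case (insert i I)
  have "abs_sum (f i + (\<Sum>i\<in>I. f i))"
    using insert by (intro abs_sum_add) auto
  moreover have "eval_fps (f i + (\<Sum>i\<in>I. f i)) t = eval_fps (f i) t + eval_fps (\<Sum>i\<in>I. f i) t"
    using insert assms by (intro eval_fps_add abs_sum_conv_radius_gt) auto
  ultimately show ?case using insert by simp
qed

lemma meander_gf_deriv:
  assumes t: "0 \<le> t" "t < 1"
  shows "fps_deriv (meander_gf t) = fps_deriv (log_gf t) * meander_gf t"
proof (rule fps_ext)
  fix n
  have ev: "eval_fps (f * g) t = eval_fps f t * eval_fps g t" if "abs_sum f" "abs_sum g" for f g
    using that t by (intro eval_fps_mult abs_sum_conv_radius_gt) auto
  have "eval_fps (of_nat (Suc n) * meander_poly (Suc n)) t = real (Suc n) * eval_fps (meander_poly (Suc n)) t"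
  proof -
    have "abs_sum (fps_const (real (Suc n)))" by (rule abs_sum_finite_supp[of 1]) simp
    thus ?thesis unfolding fps_of_nat[symmetric] using ev abs_sum_meander_poly eval_fps_const by metis
  qed
  hence "real (Suc n) * eval_fps (meander_poly (Suc n)) t = 
      eval_fps (\<Sum>i=1..Suc n. bridge_pos i * meander_poly (Suc n - i)) t" unfolding wiener_hopf_z by simp
  also have "\<dots> = (\<Sum>i=1..Suc n. eval_fps (bridge_pos i * meander_poly (Suc n - i)) t)"
    using t by (intro eval_fps_finite_sum[THEN conjunct1] abs_sum_mult abs_sum_bridge_pos abs_sum_meander_poly) auto
  also have "\<dots> = (\<Sum>i=1..Suc n. eval_fps (bridge_pos i) t * eval_fps (meander_poly (Suc n - i)) t)"
    by (intro sum.cong refl ev abs_sum_bridge_pos abs_sum_meander_poly)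
  also have "\<dots> = (\<Sum>i=0..n. eval_fps (bridge_pos (Suc i)) t * eval_fps (meander_poly (n - i)) t)"
    by (rule sum.reindex_bij_witness[of _ Suc "\<lambda>i. i - 1"]) auto
  finally show "fps_nth (fps_deriv (meander_gf t)) n = fps_nth (fps_deriv (log_gf t) * meander_gf t) n"
    by (simp add: fps_mult_nth meander_gf_def log_gf_def)
qed

text \<open>The coefficient of u^k in \<open>wiener_hopf_u\<close>. It expresses each M_k by
  finitely many products, so no coefficient has to be extracted from an exponential in two
  variables.\<close>

lemma Mk_rec: "fps_const (real k) * Mk p k = (\<Sum>j=1..k. fps_const (real j) * (log_coeff j * Mk p (k - j)))"
proof (rule fps_ext)
  fix n
  have X: "fps_nth (fps_X * fps_deriv f) k = real k * fps_nth f k" for f :: "real fps" and k by (cases k) auto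
  have "real k * mw p n k = fps_nth (fps_X * fps_deriv (meander_poly n)) k" unfolding X by (simp add: meander_poly_def)
  also have "\<dots> = (\<Sum>i=1..n. fps_nth (fps_const (1 / real i) * ((fps_X * fps_deriv (bridge_pos i)) * meander_poly (n - i))) k)"
    unfolding wiener_hopf_u by (simp add: fps_sum_nth mult.assoc)
  also have "\<dots> = (\<Sum>i=1..n. (1 / real i) * (\<Sum>j=0..k. real j * bridge i (int j) * mw p (n - i) (k - j)))"
    by (simp only: fps_mult_left_const_nth fps_mult_nth[of "fps_X * fps_deriv _"] X) (simp add: bridge_pos_def meander_poly_def)
  also have "\<dots> = (\<Sum>i=1..n. \<Sum>j=0..k. real j * (bridge i (int j) / real i * mw p (n - i) (k - j)))"
    by (simp add: sum_distrib_left algebra_simps)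
  \<comment> \<open>The term i = 0 may be added because division by 0 yields 0.\<close>
  also have "\<dots> = (\<Sum>i=0..n. \<Sum>j=0..k. real j * (bridge i (int j) / real i * mw p (n - i) (k - j)))"
    by (rule sum.mono_neutral_left) (auto simp: not_le)
  also have "\<dots> = (\<Sum>j=0..k. \<Sum>i=0..n. real j * (bridge i (int j) / real i * mw p (n - i) (k - j)))" by (rule sum.swap)
  also have "\<dots> = (\<Sum>j=1..k. \<Sum>i=0..n. real j * (bridge i (int j) / real i * mw p (n - i) (k - j)))"
    by (rule sum.mono_neutral_right) (auto simp: not_le)
  also have "\<dots> = fps_nth (\<Sum>j=1..k. fps_const (real j) * (log_coeff j * Mk p (k - j))) n"
    by (simp only: fps_sum_nth fps_mult_left_const_nth fps_mult_nth[of "log_coeff _"]) (simp add: log_coeff_def Mk_def sum_distrib_left)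
  finally show "fps_nth (fps_const (real k) * Mk p k) n = fps_nth (\<Sum>j=1..k. fps_const (real j) * (log_coeff j * Mk p (k - j))) n"
    by (simp add: Mk_def)
qed

end

section \<open>Square-root singularities of the meander series\<close>

context centred_walk begin

lemma bridge_nonneg: "0 \<le> bridge n k"
  by (induction n arbitrary: k) (auto simp: bridge_0 bridge_Suc intro!: sum_nonneg mult_nonneg_nonneg nonneg)

lemma mw_nonneg: "0 \<le> mw p n k"
  unfolding mw_def by (intro sum_nonneg prod_list_nonneg) (auto simp: nonneg)

lemma mw_partial_sum: "(\<Sum>k<K. mw p n k) \<le> 1"
proof (induction n arbitrary: K)
  case 0 thus ?case by (simp add: mw_0 sum.delta)
next
  case (Suc n)
  have "(\<Sum>k<K. mw p (Suc n) k) = (\<Sum>i\<in>steps. p i * (\<Sum>k<K. if int k - i \<ge> 0 then mw p n (nat (int k - i)) else 0))"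
    unfolding mw_Suc sum_distrib_left by (rule sum.swap)
  also have "\<dots> \<le> (\<Sum>i\<in>steps. p i * 1)"
  proof (intro sum_mono mult_left_mono nonneg)
    fix i assume i: "i \<in> steps"
    have "(\<Sum>k<K. if int k - i \<ge> 0 then mw p n (nat (int k - i)) else 0) = (\<Sum>k\<in>{k\<in>{..<K}. int k - i \<ge> 0}. mw p n (nat (int k - i)))"
      by (simp add: sum.inter_filter[symmetric])
    also have "\<dots> = (\<Sum>m\<in>(\<lambda>k. nat (int k - i)) ` {k\<in>{..<K}. int k - i \<ge> 0}. mw p n m)"
      by (subst sum.reindex) (auto simp: inj_on_def)
    \<comment> \<open>A jump i \<ge> -c that ends below K starts below K + c.\<close>
    also have "\<dots> \<le> (\<Sum>m<K + c. mw p n m)"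
      using i by (intro sum_mono2 mw_nonneg) (auto simp: steps_def)
    also have "\<dots> \<le> 1" by (rule Suc.IH)
    finally show "(\<Sum>k<K. if int k - i \<ge> 0 then mw p n (nat (int k - i)) else 0) \<le> 1" .
  qed
  also have "\<dots> = 1" by (simp add: total')
  finally show ?case .
qed

lemma meander_gf_bounds:
  assumes t: "0 \<le> t" "t < 1"
  shows "0 \<le> fps_nth (meander_gf t) n" "fps_nth (meander_gf t) n \<le> 1"
proof -
  have e: "fps_nth (meander_gf t) n = (\<Sum>k<n * d + 1. mw p n k * t ^ k)"
    unfolding meander_gf_def eval_fps_def meander_poly_def
    by (simp del: sum.lessThan_Suc, rule suminf_finite) (auto simp: mw_supp)
  show "0 \<le> fps_nth (meander_gf t) n" unfolding e using t mw_nonneg by (intro sum_nonneg) auto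
  have "fps_nth (meander_gf t) n \<le> (\<Sum>k<n * d + 1. mw p n k)" unfolding e 
    using t mw_nonneg by (intro sum_mono) (simp add: mult_left_le power_le_one)
  thus "fps_nth (meander_gf t) n \<le> 1" using mw_partial_sum[of n "n * d + 1"] by linarith
qed

text \<open>The quotient \<open>wallis n / n\<close> is exactly \<open>2 * sqrt_coeff n\<close>
  minus \<open>sqrt_coeff n / n\<close>, and the latter has the order of an admissible
  error.\<close>

lemma wallis_over_n:
  obtains K where "K \<ge> 0" "\<And>n. n \<ge> 1 \<Longrightarrow> \<bar>wallis n / real n - 2 * sqrt_coeff n\<bar> \<le> K * real n powr (-5/2)"
proof -
  obtain K where K: "K > 0" "\<And>n. n \<ge> 1 \<Longrightarrow> \<bar>sqrt_coeff n\<bar> \<le> K * real n powr (-(3/2))"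
    using convergent_powr_bound[OF sqrt_coeff_lim] by blast
  have "\<bar>wallis n / real n - 2 * sqrt_coeff n\<bar> \<le> K * real n powr (-5/2)" if n: "n \<ge> 1" for n
  proof -
    have "wallis n / real n - 2 * sqrt_coeff n = - (sqrt_coeff n / real n)" using n by (simp add: wallis_def field_simps)
    hence "\<bar>wallis n / real n - 2 * sqrt_coeff n\<bar> = \<bar>sqrt_coeff n\<bar> / real n" by simp
    also have "\<dots> \<le> K * real n powr (-(3/2)) / real n" using K(2)[OF n] by (intro divide_right_mono) auto
    also have "\<dots> = K * real n powr (-5/2)" using n powr_diff[of "real n" "-3/2" 1] by simp
    finally show ?thesis .
  qed
  with K(1) show ?thesis using that[of K] by auto
qed

text \<open>Division by n lifts the error of the local limit theorem from
  \<open>n powr (-3/2)\<close> to \<open>n powr (-5/2)\<close>, exactly what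
  \<open>sqrt_singI\<close> accepts.\<close>

lemma sqrt_sing_log_coeff: "sqrt_sing (log_coeff k) (2 * kap)"
proof -
  obtain C where C: "C \<ge> 0" "\<And>n k. n \<ge> 1 \<Longrightarrow> \<bar>bridge n k - kap * wallis n\<bar> \<le> C * (1 + (of_int k)\<^sup>2) * real n powr (-3/2)"
    by (rule local_limit) blast
  obtain K where K: "K \<ge> 0" "\<And>n. n \<ge> 1 \<Longrightarrow> \<bar>wallis n / real n - 2 * sqrt_coeff n\<bar> \<le> K * real n powr (-5/2)"
    by (rule wallis_over_n) blast
  show ?thesis
  proof (rule sqrt_singI)
    fix n :: nat assume n: "n \<ge> 1"
    have "\<bar>bridge n (int k) / real n - kap * (wallis n / real n)\<bar> = \<bar>bridge n (int k) - kap * wallis n\<bar> / real n"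
      using n by (simp add: diff_divide_distrib[symmetric])
    also have "\<dots> \<le> C * (1 + (real k)\<^sup>2) * real n powr (-3/2) / real n" using C(2)[OF n, of "int k"] by (intro divide_right_mono) auto
    also have "\<dots> = C * (1 + (real k)\<^sup>2) * real n powr (-5/2)" using n powr_diff[of "real n" "-3/2" 1] by simp
    finally have 1: "\<bar>bridge n (int k) / real n - kap * (wallis n / real n)\<bar> \<le> C * (1 + (real k)\<^sup>2) * real n powr (-5/2)" .
    have "\<bar>kap * (wallis n / real n) - 2 * kap * sqrt_coeff n\<bar> = kap * \<bar>wallis n / real n - 2 * sqrt_coeff n\<bar>"
    proof -
      have "kap * (wallis n / real n) - 2 * kap * sqrt_coeff n = kap * (wallis n / real n - 2 * sqrt_coeff n)" by (simp add: algebra_simps)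
      thus ?thesis using kap_pos by (simp only: abs_mult abs_of_pos)
    qed
    also have "\<dots> \<le> kap * (K * real n powr (-5/2))" using K(2)[OF n] kap_pos by (intro mult_left_mono) auto
    finally have 2: "\<bar>kap * (wallis n / real n) - 2 * kap * sqrt_coeff n\<bar> \<le> kap * (K * real n powr (-5/2))" .
    show "\<bar>fps_nth (log_coeff k) n - 2 * kap * sqrt_coeff n\<bar> \<le> (C * (1 + (real k)\<^sup>2) + kap * K) * real n powr (-5/2)"
    proof -
      have "\<bar>bridge n (int k) / real n - 2 * kap * sqrt_coeff n\<bar> \<le> C * (1 + (real k)\<^sup>2) * real n powr (-5/2) + kap * (K * real n powr (-5/2))"
        using 1 2 by linarith
      also have "\<dots> = (C * (1 + (real k)\<^sup>2) + kap * K) * real n powr (-5/2)" by (simp only: distrib_right mult.assoc)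
      finally show ?thesis by (simp add: log_coeff_def)
    qed
  qed
qed

text \<open>Summing the local limit theorem over altitudes with weights t^k produces the geometric
  factor 1/(1 - t); the error 1 + k^2 stays summable because t < 1.\<close>

lemma sqrt_sing_log_gf:
  assumes t: "0 \<le> t" "t < 1" shows "sqrt_sing (log_gf t) (2 * kap / (1 - t))"
proof -
  obtain C where C: "C \<ge> 0" "\<And>n k. n \<ge> 1 \<Longrightarrow> \<bar>bridge n k - kap * wallis n\<bar> \<le> C * (1 + (of_int k)\<^sup>2) * real n powr (-3/2)"
    by (rule local_limit) blast
  obtain K where K: "K \<ge> 0" "\<And>n. n \<ge> 1 \<Longrightarrow> \<bar>wallis n / real n - 2 * sqrt_coeff n\<bar> \<le> K * real n powr (-5/2)"
    by (rule wallis_over_n) blast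
  define S where "S = (\<Sum>k. (1 + (real k)\<^sup>2) * t ^ k)"
  have sS: "summable (\<lambda>k. (1 + (real k)\<^sup>2) * t ^ k)" using t by (rule summable_quadratic_geometric)
  define \<kappa>' where "\<kappa>' = kap / (1 - t)"
  have \<kappa>': "\<kappa>' \<ge> 0" using kap_pos t by (simp add: \<kappa>'_def)
  show ?thesis
  proof (rule sqrt_singI)
    fix n :: nat assume n: "n \<ge> 1"
    define B where "B = eval_fps (bridge_pos n) t"
    have sB: "summable (\<lambda>k. bridge n (int k) * t ^ k)"
      by (rule summable_finite[of "{..n * d}"]) (auto simp: bridge_supp_nat not_le)
    have sg: "summable (\<lambda>k. kap * wallis n * t ^ k)" using t by (intro summable_mult summable_geometric) auto
    have b: "\<bar>bridge n (int k) * t ^ k - kap * wallis n * t ^ k\<bar> \<le> C * real n powr (-3/2) * ((1 + (real k)\<^sup>2) * t ^ k)" for k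
    proof -
      have "\<bar>bridge n (int k) - kap * wallis n\<bar> * t ^ k \<le> C * (1 + (real k)\<^sup>2) * real n powr (-3/2) * t ^ k"
        using C(2)[OF n, of "int k"] t by (intro mult_right_mono) auto
      moreover have "\<bar>bridge n (int k) * t ^ k - kap * wallis n * t ^ k\<bar> = \<bar>bridge n (int k) - kap * wallis n\<bar> * t ^ k"
        using t by (simp only: left_diff_distrib[symmetric] abs_mult) simp
      moreover have "C * (1 + (real k)\<^sup>2) * real n powr (-3/2) * t ^ k = C * real n powr (-3/2) * ((1 + (real k)\<^sup>2) * t ^ k)"
        by (simp only: mult.assoc mult.left_commute)
      ultimately show ?thesis by linarith
    qed
    have sC: "summable (\<lambda>k. C * real n powr (-3/2) * ((1 + (real k)\<^sup>2) * t ^ k))" using sS by (rule summable_mult)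
    have sA: "summable (\<lambda>k. \<bar>bridge n (int k) * t ^ k - kap * wallis n * t ^ k\<bar>)"
      by (rule summable_comparison_test'[OF sC, of 0]) (use b in simp)
    have "(\<Sum>k. kap * wallis n * t ^ k) = \<kappa>' * wallis n"
    proof -
      have "norm t < 1" using t by simp
      from suminf_mult[OF summable_geometric[OF this], of "kap * wallis n"] suminf_geometric[OF this]
      show ?thesis by (simp add: \<kappa>'_def)
    qed
    hence "B - \<kappa>' * wallis n = (\<Sum>k. bridge n (int k) * t ^ k - kap * wallis n * t ^ k)"
      using suminf_diff[OF sB sg] by (simp add: B_def eval_fps_def bridge_pos_def)
    also have "\<bar>\<dots>\<bar> \<le> (\<Sum>k. \<bar>bridge n (int k) * t ^ k - kap * wallis n * t ^ k\<bar>)" by (rule summable_rabs[OF sA])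
    also have "\<dots> \<le> (\<Sum>k. C * real n powr (-3/2) * ((1 + (real k)\<^sup>2) * t ^ k))" by (rule suminf_le[OF b sA sC])
    also have "\<dots> = C * real n powr (-3/2) * S" unfolding S_def by (rule suminf_mult[OF sS])
    finally have "\<bar>B - \<kappa>' * wallis n\<bar> \<le> C * real n powr (-3/2) * S" .
    hence "\<bar>B - \<kappa>' * wallis n\<bar> / real n \<le> C * real n powr (-3/2) * S / real n" by (intro divide_right_mono) auto
    also have "\<dots> = C * S * real n powr (-5/2)" using n powr_diff[of "real n" "-3/2" 1] by simp
    also have "\<bar>B - \<kappa>' * wallis n\<bar> / real n = \<bar>B / real n - \<kappa>' * (wallis n / real n)\<bar>"
      using n by (simp add: diff_divide_distrib[symmetric])
    finally have 1: "\<bar>B / real n - \<kappa>' * (wallis n / real n)\<bar> \<le> C * S * real n powr (-5/2)" .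
    have "\<bar>\<kappa>' * (wallis n / real n) - 2 * \<kappa>' * sqrt_coeff n\<bar> = \<kappa>' * \<bar>wallis n / real n - 2 * sqrt_coeff n\<bar>"
    proof -
      have "\<kappa>' * (wallis n / real n) - 2 * \<kappa>' * sqrt_coeff n = \<kappa>' * (wallis n / real n - 2 * sqrt_coeff n)" by (simp add: algebra_simps)
      thus ?thesis using \<kappa>' by (simp only: abs_mult abs_of_nonneg)
    qed
    also have "\<dots> \<le> \<kappa>' * (K * real n powr (-5/2))" using K(2)[OF n] \<kappa>' by (intro mult_left_mono) auto
    finally have 2: "\<bar>\<kappa>' * (wallis n / real n) - 2 * \<kappa>' * sqrt_coeff n\<bar> \<le> \<kappa>' * (K * real n powr (-5/2))" .
    have "\<bar>B / real n - 2 * \<kappa>' * sqrt_coeff n\<bar> \<le> C * S * real n powr (-5/2) + \<kappa>' * (K * real n powr (-5/2))"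
      using 1 2 by linarith
    also have "\<dots> = (C * S + \<kappa>' * K) * real n powr (-5/2)" by (simp only: distrib_right mult.assoc)
    finally have "\<bar>B / real n - 2 * \<kappa>' * sqrt_coeff n\<bar> \<le> (C * S + \<kappa>' * K) * real n powr (-5/2)" .
    thus "\<bar>fps_nth (log_gf t) n - 2 * kap / (1 - t) * sqrt_coeff n\<bar> \<le> (C * S + \<kappa>' * K) * real n powr (-5/2)"
      unfolding log_gf_def by (simp add: B_def \<kappa>'_def)
  qed
qed

lemma meander_gf_sing:
  assumes t: "0 \<le> t" "t < 1"
  shows "sqrt_sing (meander_gf t) (2 * kap / (1 - t) * fps_total (meander_gf t))" "fps_total (meander_gf t) > 0"
proof -
  have 0: "fps_nth (meander_gf t) 0 = 1"
  proof -
    have "meander_poly 0 = 1" by (rule fps_ext) (simp add: meander_poly_def mw_0)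
    thus ?thesis by (simp add: meander_gf_def)
  qed
  have "0 \<le> fps_nth (log_gf t) n" for n
  proof -
    have "0 \<le> eval_fps (bridge_pos n) t" unfolding eval_fps_def bridge_pos_def
    proof (simp, rule suminf_nonneg)
      show "summable (\<lambda>k. bridge n (int k) * t ^ k)"
        by (rule summable_finite[of "{..n * d}"]) (auto simp: bridge_supp_nat not_le)
      show "0 \<le> bridge n (int k) * t ^ k" for k using t bridge_nonneg by simp
    qed
    thus ?thesis by (simp add: log_gf_def)
  qed
  note e = sqrt_sing_exp[OF meander_gf_deriv[OF t] 0 _ this meander_gf_bounds[OF t] sqrt_sing_log_gf[OF t]]
  show "sqrt_sing (meander_gf t) (2 * kap / (1 - t) * fps_total (meander_gf t))" using e(1) by (simp add: log_gf_def)
  show "fps_total (meander_gf t) > 0" using e(2) by (simp add: log_gf_def)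
qed

text \<open>Induction along \<open>Mk_rec\<close> from the excursions, which are the meanders
  evaluated at t = 0. Existence of \<eta> is enough here; the constants are identified later through
  their generating function.\<close>

lemma Mk_sing: "\<exists>\<eta>. sqrt_sing (Mk p k) \<eta>"
proof (induction k rule: less_induct)
  case (less k)
  show ?case
  proof (cases "k = 0")
    case True
    thus ?thesis unfolding True Mk_0 using meander_gf_sing[of 0] by auto
  next
    case False
    have "\<exists>\<eta>. sqrt_sing (fps_const (real j / real k) * (log_coeff j * Mk p (k - j))) \<eta>" if "j \<in> {1..k}" for j
    proof -
      from less[of "k - j"] that obtain \<eta> where "sqrt_sing (Mk p (k - j)) \<eta>" by auto
      from sqrt_sing_cmult[OF sqrt_sing_mult[OF sqrt_sing_log_coeff this], of "real j / real k"] show ?thesis ..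
    qed
    hence "\<forall>j\<in>{1..k}. \<exists>\<eta>. sqrt_sing (fps_const (real j / real k) * (log_coeff j * Mk p (k - j))) \<eta>" by (rule ballI)
    then obtain \<eta> where "\<forall>j\<in>{1..k}. sqrt_sing (fps_const (real j / real k) * (log_coeff j * Mk p (k - j))) (\<eta> j)"
      using bchoice by metis
    hence "sqrt_sing (fps_const (real j / real k) * (log_coeff j * Mk p (k - j))) (\<eta> j)" if "j \<in> {1..k}" for j using that by (rule bspec)
    hence s: "sqrt_sing (\<Sum>j=1..k. fps_const (real j / real k) * (log_coeff j * Mk p (k - j))) (\<Sum>j=1..k. \<eta> j)"
      by (rule sqrt_sing_sum)
    have "Mk p k = fps_const (1 / real k) * (fps_const (real k) * Mk p k)" using False by (simp add: mult.assoc[symmetric])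
    also have "\<dots> = (\<Sum>j=1..k. fps_const (real j / real k) * (log_coeff j * Mk p (k - j)))"
      unfolding Mk_rec sum_distrib_left by (simp add: mult.assoc[symmetric])
    finally have "sqrt_sing (Mk p k) (\<Sum>j=1..k. \<eta> j)" by (rule ssubst) (rule s)
    thus ?thesis ..
  qed
qed

end

section \<open>Double pole: the renewal theorem\<close>

text \<open>General weights serve two uses: plain averages at a double pole, and weights 1/sqrt i in
  the critical case.\<close>

lemma weighted_cesaro:
  fixes a b x :: "nat \<Rightarrow> real"
  assumes a: "\<And>i. 0 \<le> a i" "\<And>n. (\<Sum>i\<le>n. a i) \<le> K * b n" and b: "filterlim b at_top sequentially" and x: "x \<longlonglongrightarrow> 0"
  shows "(\<lambda>n. (\<Sum>i\<le>n. a i * \<bar>x i\<bar>) / b n) \<longlonglongrightarrow> 0"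
proof (rule LIMSEQ_I)
  fix e :: real assume e: "e > 0"
  define e' where "e' = e / (2 * (\<bar>K\<bar> + 1))"
  have e': "e' > 0" using e by (simp add: e'_def)
  obtain N where N: "\<And>n. n \<ge> N \<Longrightarrow> \<bar>x n\<bar> < e'" using LIMSEQ_D[OF x e'] by auto
  define S where "S = (\<Sum>i\<le>N. a i * \<bar>x i\<bar>)"
  have "eventually (\<lambda>n. b n > 2 * S / e) sequentially" using b by (simp add: filterlim_at_top_dense)
  moreover have "eventually (\<lambda>n. b n > 0) sequentially" using b by (simp add: filterlim_at_top_dense)
  ultimately have "eventually (\<lambda>n. norm ((\<Sum>i\<le>n. a i * \<bar>x i\<bar>) / b n - 0) < e) sequentially"
    using eventually_ge_at_top[of N]
  proof eventually_elim
    case (elim n)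
    have "(\<Sum>i\<le>n. a i * \<bar>x i\<bar>) \<le> S + e' * (\<Sum>i\<le>n. a i)"
    proof -
      have "{..n} = {..N} \<union> {N<..n}" using elim by auto
      hence "(\<Sum>i\<le>n. a i * \<bar>x i\<bar>) = S + (\<Sum>i\<in>{N<..n}. a i * \<bar>x i\<bar>)" unfolding S_def
        by (subst sum.union_disjoint[symmetric]) auto
      also have "(\<Sum>i\<in>{N<..n}. a i * \<bar>x i\<bar>) \<le> (\<Sum>i\<in>{N<..n}. a i * e')"
        using N a by (intro sum_mono mult_left_mono) (auto intro: less_imp_le)
      also have "\<dots> \<le> (\<Sum>i\<le>n. a i * e')" using a e' by (intro sum_mono2) auto
      also have "\<dots> = e' * (\<Sum>i\<le>n. a i)" by (simp add: sum_distrib_left mult.commute)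
      finally show ?thesis by simp
    qed
    also have "e' * (\<Sum>i\<le>n. a i) \<le> e' * (\<bar>K\<bar> * b n)"
    proof (rule mult_left_mono)
      have "K * b n \<le> \<bar>K\<bar> * b n" using elim by (intro mult_right_mono) auto
      thus "(\<Sum>i\<le>n. a i) \<le> \<bar>K\<bar> * b n" using a(2)[of n] by linarith
    qed (use e' in simp)
    also have "e' * (\<bar>K\<bar> * b n) \<le> e / 2 * b n"
    proof -
      have "e' * \<bar>K\<bar> \<le> e / 2" using e by (simp add: e'_def field_simps)
      thus ?thesis using elim mult_right_mono[of "e' * \<bar>K\<bar>" "e/2" "b n"] by (simp add: mult.assoc)
    qed
    finally have "(\<Sum>i\<le>n. a i * \<bar>x i\<bar>) \<le> S + e / 2 * b n" by simp
    moreover have "S < e / 2 * b n" using elim e by (simp add: field_simps)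
    ultimately have "(\<Sum>i\<le>n. a i * \<bar>x i\<bar>) < e * b n" by linarith
    moreover have "0 \<le> (\<Sum>i\<le>n. a i * \<bar>x i\<bar>)" using a by (intro sum_nonneg) auto
    ultimately show ?case using elim by (simp add: field_simps)
  qed
  thus "\<exists>no. \<forall>n\<ge>no. norm ((\<Sum>i\<le>n. a i * \<bar>x i\<bar>) / b n - 0) < e" by (simp add: eventually_at_top_linorder)
qed

lemma bounded_limsup_subseq:
  fixes X :: "nat \<Rightarrow> real"
  assumes "\<And>n. \<bar>X n\<bar> \<le> B"
  obtains L r where "strict_mono r" "(X \<circ> r) \<longlonglongrightarrow> L" "\<And>e. e > 0 \<Longrightarrow> eventually (\<lambda>n. X n \<le> L + e) sequentially"
proof -
  define l where "l = limsup (\<lambda>n. ereal (X n))"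
  obtain r :: "nat \<Rightarrow> nat" where r: "strict_mono r" "((\<lambda>n. ereal (X n)) \<circ> r) \<longlonglongrightarrow> l"
    unfolding l_def using limsup_subseq_lim by blast
  have "l \<le> ereal B" unfolding l_def by (rule Limsup_bounded) (use assms in \<open>auto simp: abs_le_iff\<close>)
  moreover have "ereal (- B) \<le> l"
  proof (rule tendsto_lowerbound[OF r(2)])
    show "\<forall>\<^sub>F i in sequentially. ereal (- B) \<le> ((\<lambda>n. ereal (X n)) \<circ> r) i"
      using assms by (intro always_eventually) (auto simp: abs_le_iff minus_le_iff)
  qed simp
  ultimately obtain L where L: "l = ereal L" by (cases l) auto
  have 1: "(X \<circ> r) \<longlonglongrightarrow> L" using r(2) unfolding L by (simp add: o_def)
  have "eventually (\<lambda>n. X n \<le> L + e) sequentially" if "e > 0" for e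
  proof -
    have "limsup (\<lambda>n. ereal (X n)) < ereal (L + e)" using that unfolding l_def[symmetric] L by simp
    hence "eventually (\<lambda>n. ereal (X n) < ereal (L + e)) sequentially" by (rule Limsup_lessD)
    thus ?thesis by eventually_elim simp
  qed
  with r(1) 1 show ?thesis using that by blast
qed

text \<open>Along r the values reach the upper limit L, yet each is an average of earlier values
  that asymptotically do not exceed L. A lag i of positive weight therefore cannot stay below L; Z
  measures the vanishing excess of the other terms.\<close>

lemma renewal_subseq_shift:
  fixes X Q :: "nat \<Rightarrow> real"
  assumes X: "\<And>n. \<bar>X n\<bar> \<le> B" "\<And>n. n \<ge> 1 \<Longrightarrow> X n = (\<Sum>m\<le>n. Q m * X (n - m))"
    and Q: "\<And>n. 0 \<le> Q n" "Q sums 1" "Q i > 0"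
    and r: "strict_mono r" "(X \<circ> r) \<longlonglongrightarrow> L" "\<And>e. e > 0 \<Longrightarrow> eventually (\<lambda>n. X n \<le> L + e) sequentially"
  shows "(\<lambda>j. X (r j - i)) \<longlonglongrightarrow> L"
proof -
  have B0: "B \<ge> 0" using X(1)[of 0] by linarith
  have sQ: "summable Q" using Q(2) by (simp add: sums_iff)
  have rlim: "filterlim r at_top sequentially" using r(1) by (rule filterlim_subseq)
  have rm: "filterlim (\<lambda>j. r j - m) at_top sequentially" for m
    using filterlim_compose[OF filterlim_minus_const_nat_at_top rlim] by simp
  define Z where "Z j m = max (X (r j - m) - L) 0" for j m
  have Z0: "(\<lambda>j. Z j m) \<longlonglongrightarrow> 0" for m
  proof (rule LIMSEQ_I)
    fix e :: real assume e: "e > 0"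
    have "eventually (\<lambda>n. X n \<le> L + e / 2) sequentially" using r(3)[of "e/2"] e by simp
    hence "eventually (\<lambda>j. X (r j - m) \<le> L + e / 2) sequentially" using rm[of m] by (rule eventually_compose_filterlim)
    hence "eventually (\<lambda>j. norm (Z j m - 0) < e) sequentially" by eventually_elim (use e in \<open>auto simp: Z_def\<close>)
    thus "\<exists>no. \<forall>j\<ge>no. norm (Z j m - 0) < e" by (simp add: eventually_at_top_linorder)
  qed
  have LB: "\<bar>L\<bar> \<le> B"
    by (rule tendsto_upperbound[OF tendsto_rabs[OF r(2)]]) (use X(1) in \<open>auto intro!: always_eventually\<close>)
  define S where "S j = (\<Sum>m. Q m * Z j m)" for j
  have bZ: "\<bar>Q m * Z j m\<bar> \<le> Q m * (2 * B)" for j m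
  proof -
    have "\<bar>Z j m\<bar> \<le> 2 * B" using X(1)[of "r j - m"] LB B0 unfolding Z_def max_def by (auto simp: abs_le_iff)
    thus ?thesis using Q(1)[of m] by (simp add: abs_mult mult_left_mono)
  qed
  have S0: "S \<longlonglongrightarrow> 0"
    using tannery_seq(1)[of "\<lambda>j m. Q m * Z j m" "\<lambda>m. Q m * 0" "\<lambda>m. Q m * (2 * B)"] Z0 bZ sQ
    unfolding S_def by (simp add: tendsto_mult_right_zero summable_mult2)
  define tl where "tl n = 1 - (\<Sum>m\<le>n. Q m)" for n
  have "tl \<longlonglongrightarrow> 1 - 1" unfolding tl_def using Q(2) by (intro tendsto_intros) (simp add: sums_def_le)
  hence tl0: "(\<lambda>j. tl (r j)) \<longlonglongrightarrow> 0" using filterlim_compose[OF _ rlim] by simp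
  define A where "A j = ((X (r j) - L) - S j - \<bar>L\<bar> * \<bar>tl (r j)\<bar>) / Q i" for j
  have "A \<longlonglongrightarrow> ((L - L) - 0 - \<bar>L\<bar> * \<bar>0\<bar>) / Q i" unfolding A_def
    using r(2) S0 tl0 Q(3) by (intro tendsto_intros) (auto simp: o_def)
  hence A0: "A \<longlonglongrightarrow> 0" by simp
  have low: "eventually (\<lambda>j. A j \<le> X (r j - i) - L) sequentially"
    using rlim[unfolded filterlim_at_top, rule_format, of "i + 1"]
  proof eventually_elim
    case (elim j)
    define n where "n = r j"
    have n: "n \<ge> 1" "i \<le> n" using elim by (auto simp: n_def)
    have sS: "summable (\<lambda>m. Q m * Z j m)" 
      by (rule summable_comparison_test'[OF summable_mult2[OF sQ, of "2 * B"], of 0]) (use bZ in auto)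
    have "X n - L = (\<Sum>m\<le>n. Q m * (X (n - m) - L)) - L * tl n"
      unfolding X(2)[OF n(1)] tl_def by (simp add: right_diff_distrib sum_subtractf sum_distrib_left mult.commute)
    also have "(\<Sum>m\<le>n. Q m * (X (n - m) - L)) = Q i * (X (n - i) - L) + (\<Sum>m\<in>{..n} - {i}. Q m * (X (n - m) - L))"
      using n by (subst sum.remove[of _ i]) auto
    also have "(\<Sum>m\<in>{..n} - {i}. Q m * (X (n - m) - L)) \<le> (\<Sum>m\<in>{..n} - {i}. Q m * Z j m)"
      using Q(1) by (intro sum_mono mult_left_mono) (auto simp: Z_def n_def)
    also have "\<dots> \<le> S j" unfolding S_def using Q(1) sS by (intro sum_le_suminf) (auto simp: Z_def)
    finally have "X n - L \<le> Q i * (X (n - i) - L) + S j - L * tl n" by simp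
    moreover have "- (L * tl n) \<le> \<bar>L\<bar> * \<bar>tl n\<bar>" by (metis abs_ge_minus_self abs_mult)
    ultimately have "(X n - L) - S j - \<bar>L\<bar> * \<bar>tl n\<bar> \<le> (X (n - i) - L) * Q i" by (simp add: mult.commute)
    thus ?case unfolding A_def using Q(3) by (simp add: n_def pos_divide_le_eq)
  qed
  have "(\<lambda>j. X (r j - i) - L) \<longlonglongrightarrow> 0"
  proof (rule tendsto_sandwich[OF low _ A0 Z0[of i]])
    show "\<forall>\<^sub>F j in sequentially. X (r j - i) - L \<le> Z j i" by (simp add: Z_def)
  qed
  thus ?thesis by (rule LIM_zero_cancel)
qed

text \<open>Along a subsequence attaining an extreme limit, all lags from N on have the same limit,
  because Q is positive there. The tails t of Q satisfy that their convolution with D is 1, so this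
  limit is the inverse mean for the upper and the lower extreme alike. The radius R makes the tails
  summable.\<close>

lemma renewal_theorem:
  fixes Q :: "real fps"
  assumes Q: "fps_nth Q 0 = 0" "\<And>n. 0 \<le> fps_nth Q n" "fps_nth Q sums 1" "\<And>n. n \<ge> N \<Longrightarrow> fps_nth Q n > 0"
    and R: "R > 1" "summable (\<lambda>n. fps_nth Q n * R ^ n)"
  obtains \<delta> where "\<delta> > 0" "fps_nth (inverse (1 - Q)) \<longlonglongrightarrow> \<delta>" "\<And>n. \<bar>fps_nth (inverse (1 - Q)) n\<bar> \<le> 1"
proof -
  let ?D = "fps_nth (inverse (1 - Q))"
  define t where "t n = 1 - (\<Sum>i\<le>n. fps_nth Q i)" for n
  have sQ: "summable (fps_nth Q)" and tQ: "suminf (fps_nth Q) = 1" using Q(3) by (auto simp: sums_iff)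
  have t0: "t n \<ge> 0" for n unfolding t_def using sum_le_suminf[OF sQ, of "{..n}"] Q(2) tQ by simp
  have D0: "0 \<le> ?D n" for n using renewal_nonneg[OF Q(1,2)] .
  have Drec: "?D n = (\<Sum>m\<le>n. fps_nth Q m * ?D (n - m))" if "n \<ge> 1" for n
    using that by (subst renewal_rec[OF Q(1)]) (simp add: fps_mult_nth_atMost)
  have td: "(\<Sum>i\<le>n. t i * ?D (n - i)) = 1" for n
  proof -
    \<comment> \<open>The tails have the generating function (1 - Q)/(1 - z), so multiplying by 1/(1
      - Q) leaves the constant sequence 1.\<close>
    have "(1 - fps_X) * Abs_fps t = 1 - Q"
    proof (rule fps_ext)
      fix n show "fps_nth ((1 - fps_X) * Abs_fps t) n = fps_nth (1 - Q) n"
        by (cases n) (auto simp: left_diff_distrib t_def Q(1))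
    qed
    hence "(1 - fps_X) * (Abs_fps t * inverse (1 - Q)) = (1 - Q) * inverse (1 - Q)" by (simp add: mult.assoc[symmetric])
    also have "\<dots> = 1" using Q(1) by (intro inverse_mult_eq_1') simp
    finally have e: "(1 - fps_X) * (Abs_fps t * inverse (1 - Q)) = 1" .
    have "fps_nth (Abs_fps t * inverse (1 - Q)) n = 1"
    proof (induction n)
      case 0 show ?case using Q(1) by (simp add: t_def)
    next
      case (Suc n)
      from arg_cong[OF e, of "\<lambda>f. fps_nth f (Suc n)"] Suc show ?case by (simp add: left_diff_distrib)
    qed
    thus ?thesis by (simp add: fps_mult_nth_atMost)
  qed
  have D1: "\<bar>?D n\<bar> \<le> 1" for n
  proof -
    have "t 0 * ?D (n - 0) \<le> (\<Sum>i\<le>n. t i * ?D (n - i))" using t0 D0 by (intro member_le_sum) auto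
    thus ?thesis using td[of n] D0[of n] Q(1) by (simp add: t_def)
  qed
  have st: "summable t"
  proof (rule summable_comparison_test'[of "\<lambda>n. (\<Sum>i. fps_nth Q i * R ^ i) * (1 / R) ^ n" 0])
    show "summable (\<lambda>n. (\<Sum>i. fps_nth Q i * R ^ i) * (1 / R) ^ n)" using R(1) by (intro summable_mult summable_geometric) auto
    fix n
    have "t n = (\<Sum>i. fps_nth Q (i + Suc n))"
      using suminf_split_initial_segment[OF sQ, of "Suc n"] tQ by (simp add: t_def lessThan_Suc_atMost)
    also have "\<dots> \<le> (\<Sum>i. fps_nth Q (i + Suc n) * R ^ (i + Suc n) * (1 / R) ^ n)"
    proof (rule suminf_le)
      show "summable (\<lambda>i. fps_nth Q (i + Suc n))" using sQ summable_iff_shift by blast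
      show "summable (\<lambda>i. fps_nth Q (i + Suc n) * R ^ (i + Suc n) * (1 / R) ^ n)"
        using R(2) summable_iff_shift[of "\<lambda>i. fps_nth Q i * R ^ i" "Suc n"] by (intro summable_mult2) blast
      fix i
      have "1 \<le> R ^ (i + 1)" using R(1) by (intro one_le_power) auto
      also have "R ^ (i + 1) = R ^ (i + Suc n) * (1 / R) ^ n" using R(1) by (simp add: power_add field_simps)
      finally have "fps_nth Q (i + Suc n) * 1 \<le> fps_nth Q (i + Suc n) * (R ^ (i + Suc n) * (1 / R) ^ n)"
        using Q(2) by (intro mult_left_mono) auto
      thus "fps_nth Q (i + Suc n) \<le> fps_nth Q (i + Suc n) * R ^ (i + Suc n) * (1 / R) ^ n" by (simp add: mult.assoc)
    qed
    also have "\<dots> = (\<Sum>i. fps_nth Q (i + Suc n) * R ^ (i + Suc n)) * (1 / R) ^ n"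
      using R(2) summable_iff_shift[of "\<lambda>i. fps_nth Q i * R ^ i" "Suc n"] by (intro suminf_mult2[symmetric]) blast
    also have "\<dots> \<le> (\<Sum>i. fps_nth Q i * R ^ i) * (1 / R) ^ n"
    proof (rule mult_right_mono)
      have "0 \<le> (\<Sum>i<Suc n. fps_nth Q i * R ^ i)" using Q(2) R(1) by (intro sum_nonneg) auto
      thus "(\<Sum>i. fps_nth Q (i + Suc n) * R ^ (i + Suc n)) \<le> (\<Sum>i. fps_nth Q i * R ^ i)"
        using suminf_split_initial_segment[OF R(2), of "Suc n"] by linarith
    qed (use R(1) in auto)
    finally show "norm (t n) \<le> (\<Sum>i. fps_nth Q i * R ^ i) * (1 / R) ^ n" using t0[of n] by simp
  qed
  \<comment> \<open>Here \<tau> is the mean of Q as the sum of its tails, not the saddle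
    point.\<close>
  define \<tau> where "\<tau> = suminf t"
  have "t 0 \<le> \<tau>" unfolding \<tau>_def using sum_le_suminf[OF st, of "{0}"] t0 by simp
  hence \<tau>: "\<tau> \<ge> 1" using Q(1) by (simp add: t_def)
  \<comment> \<open>The sign s covers the lower limit too, as the upper limit of the negated
    sequence.\<close>
  have ext: "L = s / \<tau>" if s: "s = 1 \<or> s = -1" and r: "strict_mono r" "((\<lambda>n. s * ?D n) \<circ> r) \<longlonglongrightarrow> L"
     "\<And>e. e > 0 \<Longrightarrow> eventually (\<lambda>n. s * ?D n \<le> L + e) sequentially" for s L r
  proof -
    have sh: "(\<lambda>j. s * ?D (r j - i)) \<longlonglongrightarrow> L" if "i \<ge> N" for i
    proof (rule renewal_subseq_shift[of "\<lambda>n. s * ?D n" 1 "fps_nth Q" i r L])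
      show "\<bar>s * ?D n\<bar> \<le> 1" for n using D1[of n] s by auto
      show "s * ?D n = (\<Sum>m\<le>n. fps_nth Q m * (s * ?D (n - m)))" if "n \<ge> 1" for n
        by (subst Drec[OF that]) (simp add: sum_distrib_left mult_ac)
    qed (use Q that r in auto)
    have rlim: "filterlim r at_top sequentially" using r(1) by (rule filterlim_subseq)
    \<comment> \<open>Only lags of at least N are known to converge to L, so the tail identity is
      read at the index \<open>r j - N\<close>.\<close>
    define T where "T j i = (if i + N \<le> r j then t i * (s * ?D (r j - N - i)) else 0)" for j i
    have "(\<lambda>j. \<Sum>i. T j i) \<longlonglongrightarrow> (\<Sum>i. t i * L)"
    proof (rule tannery_seq)
      show "(\<lambda>j. T j i) \<longlonglongrightarrow> t i * L" for i
      proof -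
        have "(\<lambda>j. t i * (s * ?D (r j - (N + i)))) \<longlonglongrightarrow> t i * L" by (intro tendsto_intros sh) simp
        moreover have "\<forall>\<^sub>F j in sequentially. t i * (s * ?D (r j - (N + i))) = T j i"
          using rlim[unfolded filterlim_at_top, rule_format, of "i + N"] by eventually_elim (simp add: T_def)
        ultimately show ?thesis by (rule Lim_transform_eventually)
      qed
      show "\<bar>T j i\<bar> \<le> t i" for j i
      proof -
        have "\<bar>t i * (s * ?D (r j - N - i))\<bar> \<le> t i * 1" unfolding abs_mult
          using D1 t0 s by (intro mult_mono) auto
        thus ?thesis using t0[of i] by (auto simp: T_def)
      qed
    qed (rule st)
    moreover have "\<forall>\<^sub>F j in sequentially. (\<Sum>i. T j i) = s"
      using rlim[unfolded filterlim_at_top, rule_format, of N]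
    proof eventually_elim
      case (elim j)
      have "(\<Sum>i. T j i) = (\<Sum>i\<le>r j - N. T j i)" using elim by (intro suminf_finite) (auto simp: T_def)
      also have "\<dots> = (\<Sum>i\<le>r j - N. s * (t i * ?D (r j - N - i)))" using elim by (intro sum.cong) (auto simp: T_def)
      also have "\<dots> = s" using td[of "r j - N"] by (simp add: sum_distrib_left[symmetric])
      finally show ?case .
    qed
    ultimately have "(\<lambda>j. s) \<longlonglongrightarrow> (\<Sum>i. t i * L)" by (rule Lim_transform_eventually)
    hence "s = (\<Sum>i. t i * L)" by (simp add: LIMSEQ_const_iff)
    also have "\<dots> = \<tau> * L" unfolding \<tau>_def by (rule suminf_mult2[OF st, symmetric])
    finally show ?thesis using \<tau> by (simp add: field_simps)
  qed
  have "?D \<longlonglongrightarrow> 1 / \<tau>"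
  proof (rule LIMSEQ_I)
    fix e :: real assume e: "e > 0"
    obtain L r where r: "strict_mono r" "((\<lambda>n. 1 * ?D n) \<circ> r) \<longlonglongrightarrow> L" "\<And>e. e > 0 \<Longrightarrow> eventually (\<lambda>n. 1 * ?D n \<le> L + e) sequentially"
      by (rule bounded_limsup_subseq[of "\<lambda>n. 1 * ?D n" 1]) (use D1 in auto)
    obtain L' r' where r': "strict_mono r'" "((\<lambda>n. -1 * ?D n) \<circ> r') \<longlonglongrightarrow> L'" "\<And>e. e > 0 \<Longrightarrow> eventually (\<lambda>n. -1 * ?D n \<le> L' + e) sequentially"
      by (rule bounded_limsup_subseq[of "\<lambda>n. -1 * ?D n" 1]) (use D1 in auto)
    have L: "L = 1 / \<tau>" "L' = -1 / \<tau>" using ext[OF _ r] ext[OF _ r'] by auto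
    have "eventually (\<lambda>n. ?D n \<le> 1 / \<tau> + e / 2) sequentially" using r(3)[of "e/2"] e L by simp
    moreover have "eventually (\<lambda>n. - ?D n \<le> - 1 / \<tau> + e / 2) sequentially" using r'(3)[of "e/2"] e L by simp
    ultimately have "eventually (\<lambda>n. norm (?D n - 1 / \<tau>) < e) sequentially"
      by eventually_elim (use e in \<open>auto simp: abs_less_iff\<close>)
    thus "\<exists>no. \<forall>n\<ge>no. norm (?D n - 1 / \<tau>) < e" by (simp add: eventually_at_top_linorder)
  qed
  moreover have "1 / \<tau> > 0" using \<tau> by simp
  ultimately show ?thesis using that D1 by blast
qed

lemma conv_linear_limit:
  assumes f: "abs_sum f" and a: "(\<lambda>n. fps_nth a n / real (n + 1)) \<longlonglongrightarrow> A"
  shows "(\<lambda>n. fps_nth (f * a) n / real (n + 1)) \<longlonglongrightarrow> fps_total f * A"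
proof -
  have "Bseq (\<lambda>n. fps_nth a n / real (n + 1))" using a convergent_imp_Bseq convergentI by blast
  then obtain K where K: "\<And>n. \<bar>fps_nth a n / real (n + 1)\<bar> \<le> K" unfolding Bseq_def by auto
  define T where "T n i = (if i \<le> n then fps_nth f i * fps_nth a (n - i) / real (n + 1) else 0)" for n i
  have "(\<lambda>n. \<Sum>i. T n i) \<longlonglongrightarrow> (\<Sum>i. fps_nth f i * A)"
  proof (rule tannery_seq)
    show "(\<lambda>n. T n i) \<longlonglongrightarrow> fps_nth f i * A" for i
    proof (rule LIMSEQ_offset[where k=i])
      have "(\<lambda>n. fps_nth f i * (fps_nth a n / real (n + 1) * (real (n + 1) / real (n + i + 1)))) \<longlonglongrightarrow> fps_nth f i * (A * 1)"
        by (intro tendsto_mult tendsto_const a) real_asymp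
      thus "(\<lambda>n. T (n + i) i) \<longlonglongrightarrow> fps_nth f i * A" by (simp add: T_def)
    qed
    show "\<bar>T n i\<bar> \<le> \<bar>fps_nth f i\<bar> * K" for n i
    proof (cases "i \<le> n")
      case True
      have "\<bar>fps_nth a (n - i)\<bar> / real (n + 1) \<le> \<bar>fps_nth a (n - i)\<bar> / real (n - i + 1)"
        using True by (intro divide_left_mono) auto
      also have "\<dots> \<le> K" using K[of "n - i"] by (simp add: abs_divide)
      finally have "\<bar>fps_nth f i\<bar> * (\<bar>fps_nth a (n - i)\<bar> / real (n + 1)) \<le> \<bar>fps_nth f i\<bar> * K" by (rule mult_left_mono) simp
      thus ?thesis using True by (simp add: T_def abs_mult)
    next
      case False
      have "0 \<le> K" using K[of 0] by linarith
      thus ?thesis using False by (simp add: T_def)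
    qed
    show "summable (\<lambda>i. \<bar>fps_nth f i\<bar> * K)" using f unfolding abs_sum_def by (rule summable_mult2)
  qed
  moreover have "(\<Sum>i. T n i) = fps_nth (f * a) n / real (n + 1)" for n
  proof -
    have "(\<Sum>i. T n i) = (\<Sum>i\<le>n. T n i)" by (rule suminf_finite) (auto simp: T_def)
    also have "\<dots> = (\<Sum>i\<le>n. fps_nth f i * fps_nth a (n - i) / real (n + 1))" by (intro sum.cong) (auto simp: T_def)
    finally show ?thesis by (simp add: fps_mult_nth_atMost sum_divide_distrib)
  qed
  moreover have "(\<Sum>i. fps_nth f i * A) = fps_total f * A"
    unfolding fps_total_def by (rule suminf_mult2[symmetric, OF abs_sum_summable[OF f]])
  ultimately show ?thesis by simp
qed

text \<open>Since D tends to \<delta> > 0, its convolution square grows like \<delta>^2 n, and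
  convolution with a summable series multiplies this growth by the total. The bare series e tends to
  0 and drops out; w is the weight of paths without catastrophe.\<close>

lemma double_pole_ratio:
  fixes Q e f :: "real fps" and w :: real
  assumes Q: "fps_nth Q 0 = 0" "\<And>n. 0 \<le> fps_nth Q n" "fps_nth Q sums 1" "\<And>n. n \<ge> N \<Longrightarrow> fps_nth Q n > 0"
    and R: "R > 1" "summable (\<lambda>n. fps_nth Q n * R ^ n)"
    and e: "abs_sum e" "fps_total e > 0" and f: "abs_sum f"
  defines "G \<equiv> (inverse (1 - Q))\<^sup>2 * e"
  shows "(\<lambda>n. (w * fps_nth e n + fps_nth (f * G) n) / (fps_nth e n + fps_nth (Q * G) n)) \<longlonglongrightarrow> fps_total f"
proof -
  let ?D = "inverse (1 - Q)"
  obtain \<delta> where \<delta>: "\<delta> > 0" "fps_nth ?D \<longlonglongrightarrow> \<delta>" "\<And>n. \<bar>fps_nth ?D n\<bar> \<le> 1" using renewal_theorem[OF Q R] by blast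
  have \<delta>1: "\<delta> \<le> 1" by (rule tendsto_upperbound[OF \<delta>(2)]) (use \<delta>(3) in \<open>auto intro!: always_eventually simp: abs_le_iff\<close>)
  have "(\<lambda>n. fps_nth (?D\<^sup>2) n / real (n + 1) - \<delta>\<^sup>2) \<longlonglongrightarrow> 0"
  proof (rule Lim_null_comparison)
    have ces: "(\<lambda>n. (\<Sum>i\<le>n. 1 * \<bar>fps_nth ?D i - \<delta>\<bar>) / real (n + 1)) \<longlonglongrightarrow> 0"
    proof (rule weighted_cesaro[where K=1])
      show "filterlim (\<lambda>n. real (n + 1)) at_top sequentially" by real_asymp
      show "(\<lambda>n. fps_nth ?D n - \<delta>) \<longlonglongrightarrow> 0" using \<delta>(2) by (simp add: LIM_zero)
    qed auto
    show "(\<lambda>n. 2 * ((\<Sum>i\<le>n. 1 * \<bar>fps_nth ?D i - \<delta>\<bar>) / real (n + 1))) \<longlonglongrightarrow> 0" using tendsto_mult_right_zero[OF ces] .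
    show "\<forall>\<^sub>F n in sequentially. norm (fps_nth (?D\<^sup>2) n / real (n + 1) - \<delta>\<^sup>2) \<le> 2 * ((\<Sum>i\<le>n. 1 * \<bar>fps_nth ?D i - \<delta>\<bar>) / real (n + 1))"
    proof (rule always_eventually, rule allI)
      fix n
      have pt: "\<bar>fps_nth ?D i * fps_nth ?D (n - i) - \<delta>\<^sup>2\<bar> \<le> \<bar>fps_nth ?D i - \<delta>\<bar> + \<bar>fps_nth ?D (n - i) - \<delta>\<bar>" for i
      proof -
        have "fps_nth ?D i * fps_nth ?D (n - i) - \<delta>\<^sup>2 = (fps_nth ?D i - \<delta>) * fps_nth ?D (n - i) + \<delta> * (fps_nth ?D (n - i) - \<delta>)"
          by (simp add: algebra_simps power2_eq_square)
        hence "\<bar>fps_nth ?D i * fps_nth ?D (n - i) - \<delta>\<^sup>2\<bar> \<le> \<bar>fps_nth ?D i - \<delta>\<bar> * \<bar>fps_nth ?D (n - i)\<bar> + \<bar>\<delta>\<bar> * \<bar>fps_nth ?D (n - i) - \<delta>\<bar>"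
          by (metis abs_mult abs_triangle_ineq)
        also have "\<dots> \<le> \<bar>fps_nth ?D i - \<delta>\<bar> * 1 + 1 * \<bar>fps_nth ?D (n - i) - \<delta>\<bar>"
          using \<delta>(3)[of "n - i"] \<delta>(1) \<delta>1 by (intro add_mono mult_left_mono mult_right_mono) auto
        finally show ?thesis by simp
      qed
      have "fps_nth (?D\<^sup>2) n - real (n + 1) * \<delta>\<^sup>2 = (\<Sum>i\<le>n. fps_nth ?D i * fps_nth ?D (n - i) - \<delta>\<^sup>2)"
        by (simp add: power2_eq_square fps_mult_nth_atMost sum_subtractf)
      also have "\<bar>\<dots>\<bar> \<le> (\<Sum>i\<le>n. \<bar>fps_nth ?D i - \<delta>\<bar> + \<bar>fps_nth ?D (n - i) - \<delta>\<bar>)"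
        by (rule order_trans[OF sum_abs]) (intro sum_mono pt)
      also have "\<dots> = (\<Sum>i\<le>n. \<bar>fps_nth ?D i - \<delta>\<bar>) + (\<Sum>i\<le>n. \<bar>fps_nth ?D (n - i) - \<delta>\<bar>)" by (rule sum.distrib)
      also have "(\<Sum>i\<le>n. \<bar>fps_nth ?D (n - i) - \<delta>\<bar>) = (\<Sum>i\<le>n. \<bar>fps_nth ?D i - \<delta>\<bar>)"
        by (rule sum.reindex_bij_witness[of _ "\<lambda>j. n - j" "\<lambda>i. n - i"]) auto
      finally have "\<bar>fps_nth (?D\<^sup>2) n - real (n + 1) * \<delta>\<^sup>2\<bar> / real (n + 1) \<le> 2 * (\<Sum>i\<le>n. \<bar>fps_nth ?D i - \<delta>\<bar>) / real (n + 1)"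
        by (intro divide_right_mono) auto
      moreover have "fps_nth (?D\<^sup>2) n / real (n + 1) - \<delta>\<^sup>2 = (fps_nth (?D\<^sup>2) n - real (n + 1) * \<delta>\<^sup>2) / real (n + 1)"
        by (simp add: field_simps)
      ultimately show "norm (fps_nth (?D\<^sup>2) n / real (n + 1) - \<delta>\<^sup>2) \<le> 2 * ((\<Sum>i\<le>n. 1 * \<bar>fps_nth ?D i - \<delta>\<bar>) / real (n + 1))"
        by (simp add: abs_divide)
    qed
  qed
  hence "(\<lambda>n. fps_nth (?D\<^sup>2) n / real (n + 1)) \<longlonglongrightarrow> \<delta>\<^sup>2" by (rule LIM_zero_cancel)
  from conv_linear_limit[OF e(1) this]
  have G: "(\<lambda>n. fps_nth G n / real (n + 1)) \<longlonglongrightarrow> fps_total e * \<delta>\<^sup>2" by (simp add: G_def mult.commute)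
  have aQ: "abs_sum Q" using Q by (simp add: abs_sum_def sums_iff)
  have tQ: "fps_total Q = 1" using Q(3) by (simp add: fps_total_def sums_iff)
  have e0: "(\<lambda>n. fps_nth e n / real (n + 1)) \<longlonglongrightarrow> 0"
  proof -
    have a: "fps_nth e \<longlonglongrightarrow> 0" using abs_sum_summable[OF e(1)] by (rule summable_LIMSEQ_zero)
    have b: "(\<lambda>n. 1 / real (n + 1)) \<longlonglongrightarrow> 0" by real_asymp
    from tendsto_mult[OF a b] show ?thesis by simp
  qed
  define g where "g = fps_total e * \<delta>\<^sup>2"
  have g: "g > 0" using e \<delta> by (simp add: g_def)
  have "(\<lambda>n. (w * (fps_nth e n / real (n + 1)) + fps_nth (f * G) n / real (n + 1)) / 
     (fps_nth e n / real (n + 1) + fps_nth (Q * G) n / real (n + 1))) \<longlonglongrightarrow> (w * 0 + fps_total f * g) / (0 + fps_total Q * g)"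
    using g tQ conv_linear_limit[OF f G] conv_linear_limit[OF aQ G] e0 unfolding g_def
    by (intro tendsto_intros) auto
  moreover have "(w * (fps_nth e n / real (n + 1)) + fps_nth (f * G) n / real (n + 1)) / 
     (fps_nth e n / real (n + 1) + fps_nth (Q * G) n / real (n + 1)) = 
     (w * fps_nth e n + fps_nth (f * G) n) / (fps_nth e n + fps_nth (Q * G) n)" for n
    by (simp add: add_divide_distrib[symmetric])
  ultimately show ?thesis using g tQ by simp
qed

section \<open>Critical renewal sequences\<close>

text \<open>The easy half of a Tauberian argument: at x = 1 - 1/(n + 2) one has 1/x = 1 + 1/(n + 1),
  so x^i \<ge> exp(-1) for all i \<le> n.\<close>

lemma partial_sum_le_eval:
  fixes a :: "real fps"
  assumes a: "\<And>n. 0 \<le> fps_nth a n" "1 \<le> fps_conv_radius a"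
  shows "(\<Sum>i\<le>n. fps_nth a i) \<le> exp 1 * eval_fps a (1 - 1 / real (n + 2))"
proof -
  define x where "x = 1 - 1 / real (n + 2)"
  have x: "0 < x" "x < 1" by (auto simp: x_def field_simps)
  have xi: "1 \<le> exp 1 * x ^ i" if "i \<le> n" for i
  proof -
    have "(1 / x) ^ i \<le> exp 1"
    proof -
      have e: "1 / x = 1 + 1 / real (n + 1)" by (simp add: x_def field_simps)
      have "(1 / x) ^ i \<le> exp (1 / real (n + 1)) ^ i" unfolding e by (intro power_mono exp_ge_add_one_self) auto
      also have "\<dots> = exp (real i * (1 / real (n + 1)))" by (rule exp_of_nat_mult[symmetric])
      also have "\<dots> \<le> exp 1" using that by (simp add: field_simps)
      finally show ?thesis .
    qed
    thus ?thesis using x by (simp add: power_divide field_simps)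
  qed
  have sm: "summable (\<lambda>i. fps_nth a i * x ^ i)" using conv_radius_unit[OF a(2) x] by (rule summable_fps)
  have "(\<Sum>i\<le>n. fps_nth a i * 1) \<le> (\<Sum>i\<le>n. fps_nth a i * (exp 1 * x ^ i))"
    using xi a(1) by (intro sum_mono mult_left_mono) auto
  also have "\<dots> = exp 1 * (\<Sum>i\<le>n. fps_nth a i * x ^ i)" by (simp add: sum_distrib_left mult_ac)
  also have "\<dots> \<le> exp 1 * eval_fps a x" unfolding eval_fps_def
    using a(1) x sm by (intro mult_left_mono sum_le_suminf) auto
  finally show ?thesis by (simp add: x_def)
qed

lemma inverse_sqrt_half: 
  assumes "n \<le> 4 * m" "1 \<le> m" "1 \<le> n" shows "1 / sqrt (real m) \<le> 2 / sqrt (real n)"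
proof -
  have "sqrt (real n) \<le> sqrt (4 * real m)" using assms by (intro real_sqrt_le_mono) linarith
  also have "\<dots> = 2 * sqrt (real m)" by (simp add: real_sqrt_mult)
  finally show ?thesis using assms by (simp add: field_simps)
qed

lemma sum_inverse_sqrt: "(\<Sum>i\<le>n. 1 / sqrt (real i)) \<le> 2 * sqrt (real n)"
proof -
  have "(\<Sum>i\<le>n. 1 / sqrt (real i)) = (\<Sum>i=1..n. 1 / sqrt (real i))"
    by (rule sum.mono_neutral_right) (auto simp: not_le)
  also have "\<dots> = (\<Sum>i=1..n. real i powr (-1/2))"
  proof (intro sum.cong refl)
    fix i assume "i \<in> {1..n}"
    thus "1 / sqrt (real i) = real i powr (-1/2)"
      using powr_minus_divide[of "real i" "1/2"] by (simp add: powr_half_sqrt)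
  qed
  also have "\<dots> \<le> 2 * sqrt (real n)" by (rule sum_inverse_sqrt_le)
  finally show ?thesis .
qed

text \<open>The bounds \<open>Qlo\<close> and \<open>Qhi\<close> express a square-root expansion at
  Q(1) = 1 with positive \<eta>; they control partial sums of D and of its convolution square v,
  while \<open>Qasy\<close> enters through recurrences.\<close>

locale critical_renewal =
  fixes Q :: "real fps" and l c C :: real
  assumes Q0: "fps_nth Q 0 = 0" and Qnn: "\<And>n. 0 \<le> fps_nth Q n" and Qasy: "coeff_asymp Q l" and l: "l > 0"
    and Qtot: "fps_total Q = 1" and c: "c > 0"
    and Qlo: "\<And>x. 0 < x \<Longrightarrow> x < 1 \<Longrightarrow> c * sqrt (1 - x) \<le> 1 - eval_fps Q x"
    and Qhi: "\<And>x. 0 < x \<Longrightarrow> x < 1 \<Longrightarrow> 1 - eval_fps Q x \<le> C * sqrt (1 - x)"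
begin

definition D where "D = fps_nth (inverse (1 - Q))"
definition v where "v = fps_nth ((inverse (1 - Q))\<^sup>2)"
definition ell where "ell n = real n * fps_nth Q n"

lemma Qlt: assumes "0 < x" "x < 1" shows "0 < 1 - eval_fps Q x"
proof -
  have "0 < c * sqrt (1 - x)" using c assms by simp
  thus ?thesis using Qlo[OF assms] by linarith
qed

lemma sQ: "summable (fps_nth Q)" by (rule abs_sum_summable[OF coeff_asymp_abs_sum[OF Qasy]])

lemma D_nonneg: "0 \<le> D n" unfolding D_def by (rule renewal_nonneg[OF Q0 Qnn])

lemma D_rec: "D n = (if n = 0 then 1 else 0) + (\<Sum>i\<le>n. fps_nth Q i * D (n - i))"
  unfolding D_def by (subst renewal_rec[OF Q0]) (simp add: fps_mult_nth_atMost)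

lemma D_0: "D 0 = 1" using D_rec[of 0] Q0 by simp

lemma D_le_1: "D n \<le> 1"
proof (induction n rule: less_induct)
  case (less n)
  show ?case
  proof (cases "n = 0")
    case False
    have "D n = (\<Sum>i\<le>n. fps_nth Q i * D (n - i))" using D_rec[of n] False by simp
    also have "\<dots> \<le> (\<Sum>i\<le>n. fps_nth Q i * 1)"
    proof (rule sum_mono)
      fix i assume "i \<in> {..n}"
      thus "fps_nth Q i * D (n - i) \<le> fps_nth Q i * 1"
        using less[of "n - i"] Q0 Qnn[of i] False by (cases "i = 0") (auto simp: mult_left_le)
    qed
    also have "\<dots> \<le> 1" using sum_le_suminf[OF sQ, of "{..n}"] Qnn Qtot by (simp add: fps_total_def)
    finally show ?thesis .
  qed (simp add: D_0)
qed

lemma v_conv: "v n = (\<Sum>i\<le>n. D i * D (n - i))"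
  by (simp add: v_def D_def power2_eq_square fps_mult_nth_atMost)

lemma v_nonneg: "0 \<le> v n" unfolding v_conv using D_nonneg by (intro sum_nonneg) auto

lemma v_0: "v 0 = 1" by (simp add: v_conv D_0)

lemma radius_D: "1 \<le> fps_conv_radius (inverse (1 - Q))"
  by (rule bounded_coeff_conv_radius[of _ 1]) (use D_nonneg D_le_1 in \<open>simp add: D_def\<close>)

lemma eval_D: assumes x: "0 < x" "x < 1" shows "eval_fps (inverse (1 - Q)) x = 1 / (1 - eval_fps Q x)"
proof -
  have rQ: "1 \<le> fps_conv_radius Q" using coeff_asymp_abs_sum[OF Qasy] by (rule abs_sum_conv_radius)
  have "eval_fps (inverse (1 - Q)) x = eval_fps (1 + Q * inverse (1 - Q)) x"
    by (rule arg_cong[OF renewal_rec[OF Q0], of "\<lambda>f. eval_fps f x"])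
  also have "\<dots> = 1 + eval_fps (Q * inverse (1 - Q)) x"
  proof -
    have "ereal (norm x) < fps_conv_radius (Q * inverse (1 - Q))"
      using conv_radius_unit[OF rQ x] conv_radius_unit[OF radius_D x] fps_conv_radius_mult[of Q "inverse (1 - Q)"]
      by (metis less_le_trans min_less_iff_conj)
    thus ?thesis by (subst eval_fps_add) auto
  qed
  also have "eval_fps (Q * inverse (1 - Q)) x = eval_fps Q x * eval_fps (inverse (1 - Q)) x"
    by (rule eval_fps_mult[OF conv_radius_unit[OF rQ x] conv_radius_unit[OF radius_D x]])
  finally have "eval_fps (inverse (1 - Q)) x * (1 - eval_fps Q x) = 1" by (simp add: algebra_simps)
  moreover note Qlt[OF x]
  ultimately show ?thesis by (simp add: field_simps)
qed

lemma radius_v: "1 \<le> fps_conv_radius ((inverse (1 - Q))\<^sup>2)"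
  using fps_conv_radius_mult[of "inverse (1 - Q)" "inverse (1 - Q)"] radius_D unfolding power2_eq_square
  by (auto intro: order_trans)

lemma eval_v: assumes x: "0 < x" "x < 1" shows "eval_fps ((inverse (1 - Q))\<^sup>2) x = (1 / (1 - eval_fps Q x))\<^sup>2"
  unfolding power2_eq_square
  by (subst eval_fps_mult[OF conv_radius_unit[OF radius_D x] conv_radius_unit[OF radius_D x]]) (simp add: eval_D[OF x])

text \<open>\<open>partial_sum_le_eval\<close> is applied where 1 - x = 1/(n + 2); there
  \<open>Qlo\<close> bounds 1/(1 - Q(x)) by a multiple of sqrt (n + 2).\<close>

lemma D_sum: obtains K where "K > 0" "\<And>n. n \<ge> 1 \<Longrightarrow> (\<Sum>i\<le>n. D i) \<le> K * sqrt (real n)"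
proof
  show "exp 1 * (2 / c) > 0" using c by simp
  fix n :: nat assume n: "n \<ge> 1"
  define x where "x = 1 - 1 / real (n + 2)"
  have x: "0 < x" "x < 1" by (auto simp: x_def field_simps)
  have s: "sqrt (1 - x) = 1 / sqrt (real (n + 2))" by (simp add: x_def real_sqrt_divide)
  have "1 / (1 - eval_fps Q x) \<le> 1 / (c * sqrt (1 - x))" using Qlo[OF x] Qlt[OF x] c x by (intro divide_left_mono) auto
  also have "\<dots> = sqrt (real (n + 2)) / c" unfolding s by simp
  also have "\<dots> \<le> (2 * sqrt (real n)) / c"
  proof (rule divide_right_mono)
    have "sqrt (real (n + 2)) \<le> sqrt (4 * real n)" using n by (intro real_sqrt_le_mono) auto
    thus "sqrt (real (n + 2)) \<le> 2 * sqrt (real n)" by (simp add: real_sqrt_mult)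
  qed (use c in simp)
  finally have 1: "eval_fps (inverse (1 - Q)) x \<le> 2 * sqrt (real n) / c" using eval_D[OF x] by simp
  have "(\<Sum>i\<le>n. D i) \<le> exp 1 * eval_fps (inverse (1 - Q)) x"
    using partial_sum_le_eval[of "inverse (1 - Q)" n] D_nonneg radius_D by (simp add: D_def x_def)
  also have "\<dots> \<le> exp 1 * (2 * sqrt (real n) / c)" using 1 by (intro mult_left_mono) auto
  finally show "(\<Sum>i\<le>n. D i) \<le> exp 1 * (2 / c) * sqrt (real n)" by simp
qed

lemma v_sum: obtains K where "K > 0" "\<And>n. n \<ge> 1 \<Longrightarrow> (\<Sum>i\<le>n. v i) \<le> K * real n"
proof
  show "exp 1 * (3 / c\<^sup>2) > 0" using c by simp
  fix n :: nat assume n: "n \<ge> 1"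
  define x where "x = 1 - 1 / real (n + 2)"
  have x: "0 < x" "x < 1" by (auto simp: x_def field_simps)
  have "1 / (1 - eval_fps Q x) \<le> 1 / (c * sqrt (1 - x))" using Qlo[OF x] Qlt[OF x] c x by (intro divide_left_mono) auto
  moreover have "0 \<le> 1 / (1 - eval_fps Q x)" using Qlt[OF x] by simp
  ultimately have "(1 / (1 - eval_fps Q x))\<^sup>2 \<le> (1 / (c * sqrt (1 - x)))\<^sup>2" by (rule power_mono)
  also have "\<dots> = real (n + 2) / c\<^sup>2" using x by (simp add: power_divide power_mult_distrib x_def field_simps)
  also have "\<dots> \<le> 3 * real n / c\<^sup>2" using n by (intro divide_right_mono) auto
  finally have 1: "eval_fps ((inverse (1 - Q))\<^sup>2) x \<le> 3 * real n / c\<^sup>2" using eval_v[OF x] by simp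
  have "(\<Sum>i\<le>n. v i) \<le> exp 1 * eval_fps ((inverse (1 - Q))\<^sup>2) x"
    using partial_sum_le_eval[of "(inverse (1 - Q))\<^sup>2" n] v_nonneg radius_v by (simp add: v_def x_def)
  also have "\<dots> \<le> exp 1 * (3 * real n / c\<^sup>2)" using 1 by (intro mult_left_mono) auto
  finally show "(\<Sum>i\<le>n. v i) \<le> exp 1 * (3 / c\<^sup>2) * real n" by simp
qed

lemma ell_nonneg: "0 \<le> ell n" using Qnn by (simp add: ell_def)

lemma ell_lim: "(\<lambda>n. ell n * sqrt (real n)) \<longlonglongrightarrow> l"
proof -
  have "ell n * sqrt (real n) = fps_nth Q n * real n powr (3/2)" for n
    using powr_mult_base[of "real n" "1/2"] by (simp add: ell_def powr_half_sqrt[symmetric] mult_ac)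
  thus ?thesis using Qasy by (simp add: coeff_asymp_def)
qed

lemma ell_bound: obtains K where "K > 0" "\<And>n. n \<ge> 1 \<Longrightarrow> ell n \<le> K / sqrt (real n)"
proof -
  have "Bseq (\<lambda>n. ell n * sqrt (real n))" using ell_lim convergent_imp_Bseq convergentI by blast
  then obtain K where K: "K > 0" "\<And>n. \<bar>ell n * sqrt (real n)\<bar> \<le> K" unfolding Bseq_def by auto
  have "ell n \<le> K / sqrt (real n)" if "n \<ge> 1" for n
    using K(2)[of n] that by (simp add: field_simps abs_le_iff)
  with K(1) show ?thesis using that by blast
qed

text \<open>The logarithmic derivative again. D is no longer summable, so this recurrence is used
  directly, together with bounds on the averages of v.\<close>

lemma nD: "real n * D n = (\<Sum>i=1..n. ell i * v (n - i))"
proof -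
  have "fps_deriv (inverse (1 - Q)) = - fps_deriv (1 - Q) * (inverse (1 - Q))\<^sup>2" using Q0 by (intro fps_inverse_deriv) simp
  hence "fps_X * fps_deriv (inverse (1 - Q)) = (fps_X * fps_deriv Q) * (inverse (1 - Q))\<^sup>2" by (simp add: mult.assoc)
  from arg_cong[OF this, of "\<lambda>h. fps_nth h n"] 
  have "real n * D n = (\<Sum>i\<le>n. fps_nth (fps_X * fps_deriv Q) i * v (n - i))"
    unfolding fps_mult_nth_atMost[of "fps_X * fps_deriv Q"] v_def D_def by (cases n) auto
  moreover have "fps_nth (fps_X * fps_deriv Q) i = ell i" for i by (cases i) (auto simp: ell_def)
  ultimately have "real n * D n = (\<Sum>i\<le>n. ell i * v (n - i))" by simp
  also have "\<dots> = (\<Sum>i=1..n. ell i * v (n - i))"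
    unfolding atLeast0AtMost[symmetric] by (subst sum.atLeast_Suc_atMost) (auto simp: ell_def)
  finally show ?thesis .
qed

text \<open>
  The indices \<open>i < s\<^sup>2 * n\<close> in the recurrence for \<open>n * D n\<close> contribute at most half of the claimed bound
  when \<open>s\<close> is small, which closes a strong induction; the other indices only need the mean growth of \<open>v\<close>.
\<close>
lemma D_v_bounds: obtains Y V where "Y > 0" "\<And>n. n \<ge> 1 \<Longrightarrow> D n \<le> Y / sqrt (real n)" "V > 0" "\<And>n. v n \<le> V"
proof -
  obtain KD where KD: "KD > 0" "\<And>n. n \<ge> 1 \<Longrightarrow> (\<Sum>i\<le>n. D i) \<le> KD * sqrt (real n)" by (rule D_sum) blast
  obtain Kv where Kv: "Kv > 0" "\<And>n. n \<ge> 1 \<Longrightarrow> (\<Sum>i\<le>n. v i) \<le> Kv * real n" by (rule v_sum) blast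
  obtain C0 where C0: "C0 > 0" "\<And>n. n \<ge> 1 \<Longrightarrow> ell n \<le> C0 / sqrt (real n)" by (rule ell_bound) blast
  define K' where "K' = 4 * KD"
  \<comment> \<open>One of the two indices is at least m/2, where D is at most
    \<open>2 * Y / sqrt m\<close>, and the other one is summed by \<open>D_sum\<close>. That K' does
    not depend on Y lets the induction close.\<close>
  have vm: "v m \<le> K' * Y" if m: "m \<ge> 1" and Y: "Y \<ge> 0" "\<And>i. 1 \<le> i \<Longrightarrow> i \<le> m \<Longrightarrow> D i \<le> Y / sqrt (real i)" for m Y
  proof -
    have b: "D i \<le> 2 * Y / sqrt (real m)" if "1 \<le> i" "i \<le> m" "m \<le> 2 * i" for i
    proof -
      have "D i \<le> Y * (1 / sqrt (real i))" using Y(2)[OF that(1,2)] by simp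
      also have "\<dots> \<le> Y * (2 / sqrt (real m))" using that Y m by (intro mult_left_mono inverse_sqrt_half) auto
      finally show ?thesis by (simp add: mult.commute)
    qed
    have "D i * D (m - i) \<le> 2 * Y / sqrt (real m) * (D i + D (m - i))" if i: "i \<le> m" for i
    proof -
      have "m \<le> 2 * i \<and> 1 \<le> i \<or> m \<le> 2 * (m - i) \<and> 1 \<le> m - i" using m i by auto
      thus ?thesis
      proof
        assume "m \<le> 2 * i \<and> 1 \<le> i"
        hence "D i * D (m - i) \<le> 2 * Y / sqrt (real m) * D (m - i)" using b i D_nonneg by (intro mult_right_mono) auto
        moreover have "0 \<le> 2 * Y / sqrt (real m) * D i" using Y(1) D_nonneg by simp
        ultimately show ?thesis by (simp add: distrib_left)
      next
        assume "m \<le> 2 * (m - i) \<and> 1 \<le> m - i"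
        hence "D i * D (m - i) \<le> D i * (2 * Y / sqrt (real m))" using b D_nonneg by (intro mult_left_mono) auto
        moreover have "0 \<le> 2 * Y / sqrt (real m) * D (m - i)" using Y(1) D_nonneg by simp
        ultimately show ?thesis by (simp add: distrib_left mult.commute add_divide_distrib)
      qed
    qed
    hence "v m \<le> (\<Sum>i\<le>m. 2 * Y / sqrt (real m) * (D i + D (m - i)))" unfolding v_conv by (intro sum_mono) auto
    also have "\<dots> = 2 * Y / sqrt (real m) * ((\<Sum>i\<le>m. D i) + (\<Sum>i\<le>m. D (m - i)))" by (simp only: sum.distrib sum_distrib_left[symmetric])
    also have "(\<Sum>i\<le>m. D (m - i)) = (\<Sum>i\<le>m. D i)"
      by (rule sum.reindex_bij_witness[of _ "\<lambda>j. m - j" "\<lambda>i. m - i"]) auto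
    also have "2 * Y / sqrt (real m) * ((\<Sum>i\<le>m. D i) + (\<Sum>i\<le>m. D i)) \<le> 2 * Y / sqrt (real m) * (2 * (KD * sqrt (real m)))"
      using KD(2)[OF m] Y(1) by (intro mult_left_mono) auto
    also have "\<dots> = K' * Y" using m by (simp add: K'_def)
    finally show ?thesis .
  qed
  have K': "K' > 0" using KD by (simp add: K'_def)
  define s where "s = 1 / (4 * K' * C0 + 2)"
  have s: "0 < s" "s < 1" "2 * K' * C0 * s \<le> 1/2"
    using K' C0 by (auto simp: s_def field_simps add_pos_pos)
  \<comment> \<open>Chosen after s, so that the large indices contribute exactly
    \<open>Y / 2 * sqrt n\<close>.\<close>
  define Y where "Y = 2 * C0 * Kv / s"
  have Y: "Y > 0" using C0 Kv s by (simp add: Y_def)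
  have DY: "n \<ge> 1 \<longrightarrow> D n \<le> Y / sqrt (real n)" for n
  proof (induction n rule: less_induct)
    case (less n)
    show ?case
    proof
      assume n: "n \<ge> 1"
      define I where "I = {i \<in> {1..n}. real i < s\<^sup>2 * real n}"
      have s2: "s\<^sup>2 < 1" using s by (simp add: power_less_one_iff)
      have pt: "ell i * v (n - i) \<le> C0 / (s * sqrt (real n)) * v (n - i) + (if i \<in> I then K' * Y * ell i else 0)"
        if i: "i \<in> {1..n}" for i
      proof (cases "i \<in> I")
        case True
        have "s\<^sup>2 * real n \<le> 1 * real n" using s2 by (intro mult_right_mono) auto
        moreover have "real i < s\<^sup>2 * real n" using True unfolding I_def by simp
        ultimately have "real i < real n" by linarith
        hence "1 \<le> n - i" by auto
        moreover have "D j \<le> Y / sqrt (real j)" if "1 \<le> j" "j \<le> n - i" for j using less[of j] that i by auto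
        ultimately have "v (n - i) \<le> K' * Y" using Y by (intro vm) auto
        hence "ell i * v (n - i) \<le> ell i * (K' * Y)" using ell_nonneg by (rule mult_left_mono)
        hence "ell i * v (n - i) \<le> K' * Y * ell i" by (simp only: mult.commute[of "ell i"])
        moreover have "0 \<le> C0 / (s * sqrt (real n)) * v (n - i)" using C0 s v_nonneg by simp
        ultimately show ?thesis using True by simp
      next
        case False
        hence "s\<^sup>2 * real n \<le> real i" using i by (auto simp: I_def)
        hence "sqrt (s\<^sup>2 * real n) \<le> sqrt (real i)" by (rule real_sqrt_le_mono)
        hence sn: "s * sqrt (real n) \<le> sqrt (real i)" using s by (simp add: real_sqrt_mult)
        have "ell i \<le> C0 / sqrt (real i)" using C0 i by auto
        also have "\<dots> \<le> C0 / (s * sqrt (real n))" using sn C0 s n i by (intro divide_left_mono) auto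
        finally have "ell i * v (n - i) \<le> C0 / (s * sqrt (real n)) * v (n - i)" using v_nonneg by (rule mult_right_mono)
        thus ?thesis using False by simp
      qed
      have sv: "(\<Sum>i=1..n. v (n - i)) \<le> Kv * real n"
      proof -
        have "(\<Sum>i=1..n. v (n - i)) = (\<Sum>j<n. v j)"
          by (rule sum.reindex_bij_witness[of _ "\<lambda>j. n - j" "\<lambda>i. n - i"]) auto
        also have "\<dots> \<le> (\<Sum>j\<le>n. v j)" using v_nonneg by (intro sum_mono2) auto
        finally show ?thesis using Kv(2)[OF n] by linarith
      qed
      have sl: "(\<Sum>i\<in>I. ell i) \<le> C0 * (2 * (s * sqrt (real n)))"
      proof -
        define N where "N = nat \<lfloor>s\<^sup>2 * real n\<rfloor>"
        have "(\<Sum>i\<in>I. ell i) \<le> (\<Sum>i\<in>I. C0 * (1 / sqrt (real i)))" using C0(2) by (intro sum_mono) (auto simp: I_def)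
        also have "\<dots> \<le> (\<Sum>i\<le>N. C0 * (1 / sqrt (real i)))"
          using C0 by (intro sum_mono2) (auto simp: I_def N_def le_nat_iff le_floor_iff)
        also have "\<dots> = C0 * (\<Sum>i\<le>N. 1 / sqrt (real i))" by (simp only: sum_distrib_left)
        also have "\<dots> \<le> C0 * (2 * sqrt (real N))" using sum_inverse_sqrt C0 by (intro mult_left_mono) auto
        also have "\<dots> \<le> C0 * (2 * (s * sqrt (real n)))"
        proof -
          have "real N \<le> s\<^sup>2 * real n" by (simp add: N_def)
          hence "sqrt (real N) \<le> sqrt (s\<^sup>2 * real n)" by (rule real_sqrt_le_mono)
          also have "\<dots> = s * sqrt (real n)" using s by (simp add: real_sqrt_mult)
          finally show ?thesis using C0 by simp
        qed
        finally show ?thesis .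
      qed
      have "real n * D n \<le> (\<Sum>i=1..n. C0 / (s * sqrt (real n)) * v (n - i) + (if i \<in> I then K' * Y * ell i else 0))"
        unfolding nD by (intro sum_mono pt)
      also have "\<dots> = C0 / (s * sqrt (real n)) * (\<Sum>i=1..n. v (n - i)) + (\<Sum>i=1..n. if i \<in> I then K' * Y * ell i else 0)"
        by (simp only: sum.distrib sum_distrib_left)
      also have "(\<Sum>i=1..n. if i \<in> I then K' * Y * ell i else 0) = K' * Y * (\<Sum>i\<in>I. ell i)"
      proof -
        have "(\<Sum>i=1..n. if i \<in> I then K' * Y * ell i else 0) = (\<Sum>i\<in>{1..n} \<inter> I. K' * Y * ell i)" by (rule sum.inter_restrict[symmetric]) simp
        also have "{1..n} \<inter> I = I" by (auto simp: I_def)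
        finally show ?thesis by (simp only: sum_distrib_left)
      qed
      also have "C0 / (s * sqrt (real n)) * (\<Sum>i=1..n. v (n - i)) + K' * Y * (\<Sum>i\<in>I. ell i)
         \<le> C0 / (s * sqrt (real n)) * (Kv * real n) + K' * Y * (C0 * (2 * (s * sqrt (real n))))"
        using sv sl C0 s K' Y by (intro add_mono mult_left_mono) auto
      also have "C0 / (s * sqrt (real n)) * (Kv * real n) = Y / 2 * sqrt (real n)"
      proof -
        have "real n / sqrt (real n) = sqrt (real n)" by (rule real_div_sqrt) simp
        moreover have "C0 / (s * sqrt (real n)) * (Kv * real n) = C0 * Kv / s * (real n / sqrt (real n))" by simp
        ultimately show ?thesis by (simp add: Y_def)
      qed
      also have "K' * Y * (C0 * (2 * (s * sqrt (real n)))) = (2 * K' * C0 * s) * (Y * sqrt (real n))" by simp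
      also have "Y / 2 * sqrt (real n) + (2 * K' * C0 * s) * (Y * sqrt (real n)) \<le> Y / 2 * sqrt (real n) + 1/2 * (Y * sqrt (real n))"
        using s(3) Y by (intro add_left_mono mult_right_mono) auto
      finally have "real n * D n \<le> Y * sqrt (real n)" by simp
      moreover have "real n * D n = D n * sqrt (real n) * sqrt (real n)" by simp
      ultimately have "D n * sqrt (real n) * sqrt (real n) \<le> Y * sqrt (real n)" by linarith
      moreover have "0 < sqrt (real n)" using n by simp
      ultimately have "D n * sqrt (real n) \<le> Y" by (simp only: mult_le_cancel_right_pos)
      thus "D n \<le> Y / sqrt (real n)" using n by (simp add: pos_le_divide_eq)
    qed
  qed
  have Vb: "v n \<le> 1 + K' * Y" for n
  proof (cases "n = 0")
    case False
    hence "v n \<le> K' * Y" using DY Y by (intro vm) auto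
    thus ?thesis by simp
  qed (use v_0 K' Y in simp)
  have V0: "1 + K' * Y > 0" using K' Y by (simp add: add_pos_pos)
  show ?thesis by (rule that[OF Y DY[rule_format] V0 Vb])
qed

end

lemma sqrt_nat_at_top: "filterlim (\<lambda>n. sqrt (real n)) at_top sequentially"
  by (rule filterlim_compose[OF sqrt_at_top filterlim_real_sequentially])

context critical_renewal begin

lemma D_lim: "D \<longlonglongrightarrow> 0"
proof -
  obtain Y V where Y: "Y > 0" "\<And>n. n \<ge> 1 \<Longrightarrow> D n \<le> Y / sqrt (real n)" "V > 0" "\<And>n. v n \<le> V" by (rule D_v_bounds) blast
  show ?thesis
  proof (rule Lim_null_comparison)
    show "\<forall>\<^sub>F n in sequentially. norm (D n) \<le> Y / sqrt (real n)"
      using eventually_ge_at_top[of 1] by eventually_elim (use Y D_nonneg in auto)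
    show "(\<lambda>n. Y / sqrt (real n)) \<longlonglongrightarrow> 0" by (rule tendsto_divide_0[OF tendsto_const filterlim_at_top_imp_at_infinity[OF sqrt_nat_at_top]])
  qed
qed

text \<open>Subtracting the recurrences for \<open>n * D n\<close> at n and n - 1 leaves the
  increments of \<open>ell\<close> convolved with the bounded v. As \<open>ell i\<close> is l/sqrt i
  up to a factor tending to 1, its increments are o(1/sqrt i) and sum to o(sqrt n) by
  \<open>weighted_cesaro\<close>.\<close>

lemma D_diff_lim: "(\<lambda>n. sqrt (real n) * (D n - D (n - 1))) \<longlonglongrightarrow> 0"
proof -
  obtain Y V where Y: "Y > 0" "\<And>n. n \<ge> 1 \<Longrightarrow> D n \<le> Y / sqrt (real n)" "V > 0" "\<And>n. v n \<le> V" by (rule D_v_bounds) blast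
  define x where "x i = (ell i - ell (i - 1)) * sqrt (real i)" for i
  have x0: "x \<longlonglongrightarrow> 0"
  proof (rule LIMSEQ_offset[where k=1])
    have "(\<lambda>i. ell (i + 1) * sqrt (real (i + 1)) - (ell i * sqrt (real i)) * sqrt (real (i + 1) / real i)) \<longlonglongrightarrow> l - l * 1"
    proof (intro tendsto_diff tendsto_mult ell_lim)
      show "(\<lambda>i. ell (i + 1) * sqrt (real (i + 1))) \<longlonglongrightarrow> l" using LIMSEQ_ignore_initial_segment[OF ell_lim, of 1] .
      show "(\<lambda>i. sqrt (real (i + 1) / real i)) \<longlonglongrightarrow> 1" by real_asymp
    qed
    moreover have "\<forall>\<^sub>F i in sequentially. ell (i + 1) * sqrt (real (i + 1)) - (ell i * sqrt (real i)) * sqrt (real (i + 1) / real i) = x (i + 1)"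
      using eventually_ge_at_top[of 1]
    proof eventually_elim
      case (elim i)
      have "sqrt (real i) * sqrt (real (i + 1) / real i) = sqrt (real (i + 1))"
        using elim by (simp only: real_sqrt_mult[symmetric]) simp
      hence "(ell i * sqrt (real i)) * sqrt (real (i + 1) / real i) = ell i * sqrt (real (i + 1))" by (simp only: mult.assoc)
      thus ?case unfolding x_def left_diff_distrib by simp
    qed
    ultimately show "(\<lambda>i. x (i + 1)) \<longlonglongrightarrow> 0" using Lim_transform_eventually by fastforce
  qed
  have W: "(\<lambda>n. (\<Sum>i\<le>n. 1 / sqrt (real i) * \<bar>x i\<bar>) / sqrt (real n)) \<longlonglongrightarrow> 0"
    by (rule weighted_cesaro[OF _ sum_inverse_sqrt sqrt_nat_at_top x0]) simp
  show ?thesis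
  proof (rule Lim_null_comparison)
    show "(\<lambda>n. V * ((\<Sum>i\<le>n. 1 / sqrt (real i) * \<bar>x i\<bar>) / sqrt (real n)) + 1 / sqrt (real n)) \<longlonglongrightarrow> 0"
    proof -
      have "(\<lambda>n. 1 / sqrt (real n)) \<longlonglongrightarrow> 0" by (rule tendsto_divide_0[OF tendsto_const filterlim_at_top_imp_at_infinity[OF sqrt_nat_at_top]])
      from tendsto_add[OF tendsto_mult_right_zero[OF W] this] show ?thesis by simp
    qed
    show "\<forall>\<^sub>F n in sequentially. norm (sqrt (real n) * (D n - D (n - 1))) \<le> V * ((\<Sum>i\<le>n. 1 / sqrt (real i) * \<bar>x i\<bar>) / sqrt (real n)) + 1 / sqrt (real n)"
      using eventually_ge_at_top[of 1]
    proof eventually_elim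
      case (elim n)
      have xi: "1 / sqrt (real i) * \<bar>x i\<bar> = \<bar>ell i - ell (i - 1)\<bar>" if "i \<ge> 1" for i using that by (simp add: x_def abs_mult)
      have "real (n - 1) * D (n - 1) = (\<Sum>i=1..n. ell (i - 1) * v (n - i))"
      proof -
        have "(\<Sum>i=1..n. ell (i - 1) * v (n - i)) = (\<Sum>i=0..n - 1. ell i * v (n - 1 - i))"
          using elim by (intro sum.reindex_bij_witness[of _ Suc "\<lambda>i. i - 1"]) auto
        also have "\<dots> = (\<Sum>i=1..n - 1. ell i * v (n - 1 - i))"
          by (subst sum.atLeast_Suc_atMost) (auto simp: ell_def)
        finally show ?thesis using nD[of "n - 1"] by simp
      qed
      hence "real n * D n - real (n - 1) * D (n - 1) = (\<Sum>i=1..n. (ell i - ell (i - 1)) * v (n - i))"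
        unfolding nD[of n] by (simp add: sum_subtractf left_diff_distrib)
      hence "\<bar>real n * D n - real (n - 1) * D (n - 1)\<bar> \<le> (\<Sum>i=1..n. \<bar>(ell i - ell (i - 1)) * v (n - i)\<bar>)" by simp
      also have "\<dots> \<le> (\<Sum>i=1..n. (1 / sqrt (real i) * \<bar>x i\<bar>) * V)"
      proof (rule sum_mono)
        fix i assume "i \<in> {1..n}"
        thus "\<bar>(ell i - ell (i - 1)) * v (n - i)\<bar> \<le> (1 / sqrt (real i) * \<bar>x i\<bar>) * V"
          using xi[of i] Y(4)[of "n - i"] v_nonneg[of "n - i"] by (simp only: abs_mult) (auto intro!: mult_mono)
      qed
      also have "\<dots> = V * (\<Sum>i=1..n. 1 / sqrt (real i) * \<bar>x i\<bar>)" by (simp only: sum_distrib_left mult.commute)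
      also have "\<dots> \<le> V * (\<Sum>i\<le>n. 1 / sqrt (real i) * \<bar>x i\<bar>)"
        using Y(3) by (intro mult_left_mono sum_mono2) auto
      finally have 1: "\<bar>real n * D n - real (n - 1) * D (n - 1)\<bar> \<le> V * (\<Sum>i\<le>n. 1 / sqrt (real i) * \<bar>x i\<bar>)" .
      have "sqrt (real n) * (D n - D (n - 1)) = (real n * (D n - D (n - 1))) / sqrt (real n)"
        using real_div_sqrt[of "real n"] by (metis mult.commute of_nat_0_le_iff times_divide_eq_left)
      also have "real n * (D n - D (n - 1)) = (real n * D n - real (n - 1) * D (n - 1)) - D (n - 1)"
        using elim by (simp add: algebra_simps of_nat_diff)
      finally have "\<bar>sqrt (real n) * (D n - D (n - 1))\<bar> = \<bar>(real n * D n - real (n - 1) * D (n - 1)) - D (n - 1)\<bar> / sqrt (real n)"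
        by (simp only: abs_divide) simp
      also have "\<dots> \<le> (V * (\<Sum>i\<le>n. 1 / sqrt (real i) * \<bar>x i\<bar>) + 1) / sqrt (real n)"
      proof (rule divide_right_mono)
        show "\<bar>(real n * D n - real (n - 1) * D (n - 1)) - D (n - 1)\<bar> \<le> V * (\<Sum>i\<le>n. 1 / sqrt (real i) * \<bar>x i\<bar>) + 1"
          using 1 D_nonneg[of "n - 1"] D_le_1[of "n - 1"] by linarith
      qed simp
      finally show ?case by (simp add: add_divide_distrib)
    qed
  qed
qed

text \<open>The increments of the factor at index at least about n/2 are o(1/sqrt n), while the
  other factor sums to order sqrt n.\<close>

lemma half_diff_lim:
  assumes h: "\<And>n. h n \<le> (n + 1) div 2"
  shows "(\<lambda>n. \<Sum>i<h n. D i * (D (n - i) - D (n - i - 1))) \<longlonglongrightarrow> 0"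
proof (rule LIMSEQ_I)
  fix e :: real assume e: "e > 0"
  obtain KD where KD: "KD > 0" "\<And>n. n \<ge> 1 \<Longrightarrow> (\<Sum>i\<le>n. D i) \<le> KD * sqrt (real n)" by (rule D_sum) blast
  define e' where "e' = e / (4 * KD)"
  have e': "e' > 0" using e KD by (simp add: e'_def)
  obtain N where N: "\<And>m. m \<ge> N \<Longrightarrow> \<bar>sqrt (real m) * (D m - D (m - 1))\<bar> < e'" using LIMSEQ_D[OF D_diff_lim e'] by auto
  have "norm ((\<Sum>i<h n. D i * (D (n - i) - D (n - i - 1))) - 0) < e" if n: "n \<ge> 2 * N + 1" for n
  proof -
    have "\<bar>\<Sum>i<h n. D i * (D (n - i) - D (n - i - 1))\<bar> \<le> (\<Sum>i<h n. \<bar>D i * (D (n - i) - D (n - i - 1))\<bar>)" by (rule sum_abs)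
    also have "\<dots> \<le> (\<Sum>i<h n. D i * (2 * e' / sqrt (real n)))"
    proof (rule sum_mono)
      fix i assume "i \<in> {..<h n}"
      hence i: "i < (n + 1) div 2" using h[of n] by auto
      hence m: "n - i \<ge> N" "n - i \<ge> 1" "n \<le> 4 * (n - i)" using n by auto
      have "sqrt (real (n - i)) * \<bar>D (n - i) - D (n - i - 1)\<bar> \<le> e'" using N[OF m(1)] by (simp add: abs_mult)
      hence "\<bar>D (n - i) - D (n - i - 1)\<bar> \<le> e' * (1 / sqrt (real (n - i)))" using m(2) by (simp add: pos_le_divide_eq mult.commute)
      also have "\<dots> \<le> e' * (2 / sqrt (real n))" using e' m n by (intro mult_left_mono inverse_sqrt_half) auto
      finally have "\<bar>D (n - i) - D (n - i - 1)\<bar> \<le> 2 * e' / sqrt (real n)" by (simp add: mult.commute)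
      from mult_left_mono[OF this D_nonneg[of i]]
      show "\<bar>D i * (D (n - i) - D (n - i - 1))\<bar> \<le> D i * (2 * e' / sqrt (real n))"
        unfolding abs_mult using D_nonneg[of i] by simp
    qed
    also have "\<dots> = (\<Sum>i<h n. D i) * (2 * e' / sqrt (real n))" by (simp only: sum_distrib_right)
    also have "\<dots> \<le> (KD * sqrt (real n)) * (2 * e' / sqrt (real n))"
    proof (rule mult_right_mono)
      have "(\<Sum>i<h n. D i) \<le> (\<Sum>i\<le>n. D i)" using D_nonneg h[of n] n by (intro sum_mono2) auto
      also have "\<dots> \<le> KD * sqrt (real n)" using n by (intro KD) auto
      finally show "(\<Sum>i<h n. D i) \<le> KD * sqrt (real n)" .
    qed (use e' in auto)
    also have "\<dots> = e / 2" using n KD by (simp add: e'_def)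
    finally show ?thesis using e by simp
  qed
  thus "\<exists>no. \<forall>n\<ge>no. norm ((\<Sum>i<h n. D i * (D (n - i) - D (n - i - 1))) - 0) < e" by blast
qed

text \<open>Both convolutions are cut in the middle so that the increment always falls on the factor
  with the large index; the cuts for n and n - 1 differ by the single term
  \<open>D (n div 2) * D (n - n div 2)\<close>.\<close>

lemma v_diff_lim: "(\<lambda>n. v n - v (n - 1)) \<longlonglongrightarrow> 0"
proof -
  have half: "filterlim (\<lambda>n::nat. n div 2) at_top sequentially"
    unfolding filterlim_at_top eventually_at_top_linorder
  proof (intro allI exI impI)
    fix Z n :: nat assume "2 * Z \<le> n" thus "Z \<le> n div 2" by linarith
  qed
  have "(\<lambda>n. D (n div 2)) \<longlonglongrightarrow> 0" by (rule filterlim_compose[OF D_lim half])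
  hence bd: "(\<lambda>n. D (n div 2) * D (n - n div 2)) \<longlonglongrightarrow> 0"
  proof (rule Lim_null_comparison[rotated])
    show "\<forall>\<^sub>F n in sequentially. norm (D (n div 2) * D (n - n div 2)) \<le> D (n div 2)"
      using D_nonneg D_le_1 by (intro always_eventually) (simp add: mult_left_le)
  qed
  have "(\<lambda>n. (\<Sum>i<(n + 1) div 2. D i * (D (n - i) - D (n - i - 1))) + (\<Sum>i<n div 2. D i * (D (n - i) - D (n - i - 1))) + D (n div 2) * D (n - n div 2)) \<longlonglongrightarrow> 0 + 0 + 0"
    by (intro tendsto_add half_diff_lim bd) auto
  moreover have "\<forall>\<^sub>F n in sequentially. (\<Sum>i<(n + 1) div 2. D i * (D (n - i) - D (n - i - 1))) + (\<Sum>i<n div 2. D i * (D (n - i) - D (n - i - 1))) + D (n div 2) * D (n - n div 2) = v n - v (n - 1)"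
    using eventually_ge_at_top[of 1]
  proof eventually_elim
    case (elim n)
    have "v n = (\<Sum>i<n div 2 + 1. D i * D (n - i)) + (\<Sum>j<(n+1) div 2. D j * D (n - j))" unfolding v_conv by (rule conv_split)
    moreover have "v (n - 1) = (\<Sum>i<(n + 1) div 2. D i * D (n - i - 1)) + (\<Sum>j<n div 2. D j * D (n - j - 1))"
    proof -
      have "(n - 1) div 2 + 1 = (n + 1) div 2" "(n - 1 + 1) div 2 = n div 2" using elim by auto
      thus ?thesis using conv_split[of D D "n - 1"] unfolding v_conv by (simp add: diff_commute)
    qed
    ultimately show ?case by (simp add: right_diff_distrib sum_subtractf)
  qed
  ultimately show ?thesis using Lim_transform_eventually by fastforce
qed

text \<open>At x = 1 - K/(n + 1) the bound \<open>Qhi\<close> makes the value of the squared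
  quasi-inverse at least (n + 1)/(C^2 K). As v is bounded by V, the coefficients beyond n contribute
  at most V exp(-K) (n + 1)/K, less than half of it for large K.\<close>

lemma v_sum_lower: obtains a N where "a > 0" "\<And>n. n \<ge> N \<Longrightarrow> a * real (n + 1) \<le> (\<Sum>i\<le>n. v i)"
proof -
  obtain Y V where Y: "Y > 0" "\<And>n. n \<ge> 1 \<Longrightarrow> D n \<le> Y / sqrt (real n)" "V > 0" "\<And>n. v n \<le> V" by (rule D_v_bounds) blast
  have Cp: "C > 0"
  proof -
    have "0 < C * sqrt (1 - 1/2)" using Qlt[of "1/2"] Qhi[of "1/2"] by linarith
    thus ?thesis by (simp add: zero_less_mult_iff)
  qed
  have "(\<lambda>k::nat. V * exp (- real k)) \<longlonglongrightarrow> 0" by real_asymp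
  from order_tendstoD(2)[OF this, of "1 / (2 * C\<^sup>2)"] Cp
  have "eventually (\<lambda>k::nat. V * exp (- real k) < 1 / (2 * C\<^sup>2)) sequentially" by simp
  then obtain K0 where K0: "\<And>k. k \<ge> K0 \<Longrightarrow> V * exp (- real k) < 1 / (2 * C\<^sup>2)" by (auto simp: eventually_at_top_linorder)
  define K where "K = K0 + 1"
  have K: "K \<ge> 1" "V * exp (- real K) < 1 / (2 * C\<^sup>2)" using K0[of K] by (auto simp: K_def)
  have "1 / (2 * C\<^sup>2 * real K) * real (n + 1) \<le> (\<Sum>i\<le>n. v i)" if n: "n \<ge> K" for n
  proof -
    define x where "x = 1 - real K / real (n + 1)"
    have x: "0 < x" "x < 1" using n K by (auto simp: x_def field_simps)
    have sv: "summable (\<lambda>i. v i * x ^ i)" unfolding v_def using conv_radius_unit[OF radius_v x] by (rule summable_fps)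
    have sg: "summable (\<lambda>i. V * x ^ (n + 1) * x ^ i)" using x by (intro summable_mult summable_geometric) auto
    have "eval_fps ((inverse (1 - Q))\<^sup>2) x = (\<Sum>i. v i * x ^ i)" by (simp add: eval_fps_def v_def)
    also have "\<dots> = (\<Sum>i. v (i + (n + 1)) * x ^ (i + (n + 1))) + (\<Sum>i<n + 1. v i * x ^ i)"
      by (rule suminf_split_initial_segment[OF sv])
    also have "(\<Sum>i. v (i + (n + 1)) * x ^ (i + (n + 1))) \<le> (\<Sum>i. V * x ^ (n + 1) * x ^ i)"
    proof (rule suminf_le)
      show "v (i + (n + 1)) * x ^ (i + (n + 1)) \<le> V * x ^ (n + 1) * x ^ i" for i
        using mult_right_mono[OF Y(4)[of "i + (n + 1)"], of "x ^ (i + (n + 1))"] x by (simp add: power_add mult_ac)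
      show "summable (\<lambda>i. v (i + (n + 1)) * x ^ (i + (n + 1)))" using summable_ignore_initial_segment[OF sv] .
    qed (rule sg)
    also have "(\<Sum>i. V * x ^ (n + 1) * x ^ i) = V * x ^ (n + 1) / (1 - x)"
    proof -
      have "norm x < 1" using x by simp
      from suminf_mult[OF summable_geometric[OF this], of "V * x ^ (n + 1)"] suminf_geometric[OF this] show ?thesis by simp
    qed
    also have "(\<Sum>i<n + 1. v i * x ^ i) \<le> (\<Sum>i\<le>n. v i)"
    proof -
      have "(\<Sum>i<n + 1. v i * x ^ i) = (\<Sum>i\<le>n. v i * x ^ i)" by (simp add: lessThan_Suc_atMost del: sum.lessThan_Suc)
      also have "\<dots> \<le> (\<Sum>i\<le>n. v i)" using v_nonneg x by (intro sum_mono) (simp add: mult_left_le power_le_one)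
      finally show ?thesis .
    qed
    finally have 1: "(1 / (1 - eval_fps Q x))\<^sup>2 \<le> V * x ^ (n + 1) / (1 - x) + (\<Sum>i\<le>n. v i)" using eval_v[OF x] by simp
    have xn: "x ^ (n + 1) \<le> exp (- real K)"
    proof -
      have "x \<le> exp (- (real K / real (n + 1)))" using exp_ge_add_one_self[of "- (real K / real (n + 1))"] by (simp add: x_def)
      hence "x ^ (n + 1) \<le> exp (- (real K / real (n + 1))) ^ (n + 1)" using x by (intro power_mono) auto
      also have "\<dots> = exp (real (n + 1) * (- (real K / real (n + 1))))" by (rule exp_of_nat_mult[symmetric])
      also have "\<dots> = exp (- real K)" by simp
      finally show ?thesis .
    qed
    have "1 / (C\<^sup>2 * (1 - x)) \<le> (1 / (1 - eval_fps Q x))\<^sup>2"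
    proof -
      have "1 / (C * sqrt (1 - x)) \<le> 1 / (1 - eval_fps Q x)" using Qhi[OF x] Qlt[OF x] Cp x by (intro divide_left_mono) auto
      hence "(1 / (C * sqrt (1 - x)))\<^sup>2 \<le> (1 / (1 - eval_fps Q x))\<^sup>2" using Cp x by (intro power_mono) auto
      thus ?thesis using x by (simp add: power_divide power_mult_distrib)
    qed
    with 1 have "1 / (C\<^sup>2 * (1 - x)) - V * x ^ (n + 1) / (1 - x) \<le> (\<Sum>i\<le>n. v i)" by linarith
    moreover have "V * x ^ (n + 1) / (1 - x) \<le> 1 / (2 * C\<^sup>2) / (1 - x)"
    proof (rule divide_right_mono)
      have "V * x ^ (n + 1) \<le> V * exp (- real K)" using xn Y(3) by (intro mult_left_mono) auto
      thus "V * x ^ (n + 1) \<le> 1 / (2 * C\<^sup>2)" using K(2) by linarith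
    qed (use x in simp)
    moreover have "1 / (C\<^sup>2 * (1 - x)) - 1 / (2 * C\<^sup>2) / (1 - x) = 1 / (2 * C\<^sup>2) / (1 - x)"
      using x Cp by (simp add: field_simps)
    moreover have "1 / (2 * C\<^sup>2) / (1 - x) = 1 / (2 * C\<^sup>2 * real K) * real (n + 1)" by (simp add: x_def)
    ultimately show ?thesis by linarith
  qed
  moreover have "1 / (2 * C\<^sup>2 * real K) > 0" using Cp K by simp
  ultimately show ?thesis using that by blast
qed

text \<open>From averages to single terms in two rounds: the recurrence for \<open>n * D n\<close>,
  whose kernel \<open>ell\<close> is at least of order 1/sqrt n, gives D n \<ge> b/sqrt n, and then
  v n has at least n/2 summands not below b^2/n.\<close>

lemma v_lower: obtains a N where "a > 0" "\<And>n. n \<ge> N \<Longrightarrow> a \<le> v n"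
proof -
  obtain a N where a: "a > 0" "\<And>n. n \<ge> N \<Longrightarrow> a * real (n + 1) \<le> (\<Sum>i\<le>n. v i)" by (rule v_sum_lower) blast
  have "eventually (\<lambda>n. ell n * sqrt (real n) > l / 2) sequentially" using order_tendstoD(1)[OF ell_lim, of "l/2"] l by simp
  then obtain I where I: "\<And>n. n \<ge> I \<Longrightarrow> ell n * sqrt (real n) > l / 2" by (auto simp: eventually_at_top_linorder)
  define J where "J = I + N + 1"
  define b where "b = l / 2 * a / 2"
  have b: "b > 0" using l a by (simp add: b_def)
  have Dlow: "b / sqrt (real n) \<le> D n" if n: "n \<ge> 2 * J" for n
  proof -
    have n1: "n \<ge> 1" "J \<le> n" "n - J \<ge> N" using n by (auto simp: J_def)
    have "l / 2 / sqrt (real n) * (\<Sum>i\<le>n - J. v i) = (\<Sum>i\<in>{J..n}. l / 2 / sqrt (real n) * v (n - i))"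
    proof -
      have "(\<Sum>i\<le>n - J. v i) = (\<Sum>i\<in>{J..n}. v (n - i))"
        using n1 by (intro sum.reindex_bij_witness[of _ "\<lambda>i. n - i" "\<lambda>i. n - i"]) auto
      thus ?thesis by (simp only: sum_distrib_left)
    qed
    also have "\<dots> \<le> (\<Sum>i\<in>{J..n}. ell i * v (n - i))"
    proof (intro sum_mono mult_right_mono v_nonneg)
      fix i assume i: "i \<in> {J..n}"
      hence "l / 2 / sqrt (real i) \<le> ell i" using I[of i] by (simp add: J_def field_simps)
      moreover have "l / 2 / sqrt (real n) \<le> l / 2 / sqrt (real i)" using i l by (intro divide_left_mono) (auto simp: J_def)
      ultimately show "l / 2 / sqrt (real n) \<le> ell i" by linarith
    qed
    also have "\<dots> \<le> (\<Sum>i=1..n. ell i * v (n - i))" using ell_nonneg v_nonneg by (intro sum_mono2) (auto simp: J_def)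
    finally have "l / 2 / sqrt (real n) * (\<Sum>i\<le>n - J. v i) \<le> real n * D n" by (simp add: nD)
    moreover have "l / 2 / sqrt (real n) * (a * (real n / 2)) \<le> l / 2 / sqrt (real n) * (\<Sum>i\<le>n - J. v i)"
    proof (rule mult_left_mono)
      have "a * (real n / 2) \<le> a * real (n - J + 1)" using a(1) n by (intro mult_left_mono) auto
      thus "a * (real n / 2) \<le> (\<Sum>i\<le>n - J. v i)" using a(2)[OF n1(3)] by linarith
    qed (use l in auto)
    ultimately have "real n * (b / sqrt (real n)) \<le> real n * D n" by (simp add: b_def mult_ac)
    moreover have "0 < real n" using n1 by simp
    ultimately show ?thesis by (simp only: mult_le_cancel_left_pos)
  qed
  have "b\<^sup>2 / 2 \<le> v n" if n: "n \<ge> 8 * J" for n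
  proof -
    have J1: "J \<ge> 1" by (simp add: J_def)
    have "b\<^sup>2 / 2 \<le> real (card {2 * J..n - 2 * J}) * (b\<^sup>2 / real n)"
    proof -
      have "real n / 2 \<le> real (card {2 * J..n - 2 * J})" using n by simp
      hence "real n / 2 * (b\<^sup>2 / real n) \<le> real (card {2 * J..n - 2 * J}) * (b\<^sup>2 / real n)" by (intro mult_right_mono) auto
      thus ?thesis using n J1 by simp
    qed
    also have "\<dots> = (\<Sum>i\<in>{2 * J..n - 2 * J}. b\<^sup>2 / real n)" by simp
    also have "\<dots> \<le> (\<Sum>i\<in>{2 * J..n - 2 * J}. D i * D (n - i))"
    proof (rule sum_mono)
      fix i assume i: "i \<in> {2 * J..n - 2 * J}"
      hence ii: "2 * J \<le> i" "2 * J \<le> n - i" "i \<le> n" using n J1 by auto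
      have bb: "b / sqrt (real n) \<le> D j" if "2 * J \<le> j" "j \<le> n" for j
      proof -
        have "b / sqrt (real n) \<le> b / sqrt (real j)" using that b J1 by (intro divide_left_mono) auto
        thus ?thesis using Dlow[OF that(1)] by linarith
      qed
      have "b\<^sup>2 / real n = (b / sqrt (real n)) * (b / sqrt (real n))" by (simp add: power2_eq_square)
      also have "\<dots> \<le> D i * D (n - i)" using bb[of i] bb[of "n - i"] ii b D_nonneg by (intro mult_mono) auto
      finally show "b\<^sup>2 / real n \<le> D i * D (n - i)" .
    qed
    also have "\<dots> \<le> v n" unfolding v_conv using D_nonneg by (intro sum_mono2) auto
    finally show ?thesis .
  qed
  moreover have "b\<^sup>2 / 2 > 0" using b by simp
  ultimately show ?thesis using that by blast
qed

text \<open>Instead of a limit for the coefficients g of G, it suffices that they are bounded,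
  bounded away from 0 and have vanishing increments: convolution with a summable h then gives
  \<open>fps_total h * g n\<close> up to o(1), and g n cancels in the quotient.\<close>

lemma critical_ratio:
  fixes e f :: "real fps" and w :: real
  assumes e: "abs_sum e" "\<And>n. 0 \<le> fps_nth e n" "fps_nth e 0 > 0" and f: "abs_sum f"
  defines "G \<equiv> (inverse (1 - Q))\<^sup>2 * e"
  shows "(\<lambda>n. (w * fps_nth e n + fps_nth (f * G) n) / (fps_nth e n + fps_nth (Q * G) n)) \<longlonglongrightarrow> fps_total f"
proof -
  obtain Y V where Y: "Y > 0" "\<And>n. n \<ge> 1 \<Longrightarrow> D n \<le> Y / sqrt (real n)" "V > 0" "\<And>n. v n \<le> V" by (rule D_v_bounds) blast
  obtain a N where a: "a > 0" "\<And>n. n \<ge> N \<Longrightarrow> a \<le> v n" by (rule v_lower) blast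
  define g where "g = fps_nth G"
  have gc: "g n = (\<Sum>i\<le>n. fps_nth e i * v (n - i))" for n
    unfolding g_def G_def v_def by (subst mult.commute) (rule fps_mult_nth_atMost)
  have g0: "0 \<le> g n" for n unfolding gc using e v_nonneg by (intro sum_nonneg) auto
  have gV: "g n \<le> fps_total e * V" for n
  proof -
    have "g n \<le> (\<Sum>i\<le>n. fps_nth e i * V)" unfolding gc using e Y by (intro sum_mono mult_left_mono) auto
    also have "\<dots> = (\<Sum>i\<le>n. fps_nth e i) * V" by (simp only: sum_distrib_right)
    also have "\<dots> \<le> fps_total e * V" unfolding fps_total_def
      using e abs_sum_summable[OF e(1)] Y by (intro mult_right_mono sum_le_suminf) auto
    finally show ?thesis .
  qed
  define g1 where "g1 = fps_nth e 0 * a"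
  have g1: "g1 > 0" using e a by (simp add: g1_def)
  have glow: "g1 \<le> g n" if "n \<ge> N" for n
  proof -
    have "g1 \<le> fps_nth e 0 * v (n - 0)" using a(2)[OF that] e by (simp add: g1_def)
    also have "\<dots> \<le> g n" unfolding gc using e v_nonneg by (intro member_le_sum) auto
    finally show ?thesis .
  qed
  have gdiff: "(\<lambda>n. g n - g (n - 1)) \<longlonglongrightarrow> 0"
  proof -
    define T where "T n i = (if i \<le> n then fps_nth e i * (v (n - i) - (if i < n then v (n - i - 1) else 0)) else 0)" for n i
    have "(\<lambda>n. \<Sum>i. T n i) \<longlonglongrightarrow> (\<Sum>i. fps_nth e i * 0)"
    proof (rule tannery_seq)
      show "(\<lambda>n. T n i) \<longlonglongrightarrow> fps_nth e i * 0" for i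
      proof -
        have "(\<lambda>n. fps_nth e i * (v (n - i) - v (n - i - 1))) \<longlonglongrightarrow> fps_nth e i * 0"
          by (intro tendsto_mult tendsto_const filterlim_compose[OF v_diff_lim filterlim_minus_const_nat_at_top])
        moreover have "\<forall>\<^sub>F n in sequentially. fps_nth e i * (v (n - i) - v (n - i - 1)) = T n i"
          using eventually_gt_at_top[of i] by eventually_elim (simp add: T_def)
        ultimately show ?thesis by (rule Lim_transform_eventually)
      qed
      show "\<bar>T n i\<bar> \<le> \<bar>fps_nth e i\<bar> * V" for n i
      proof -
        have "\<bar>v (n - i) - (if i < n then v (n - i - 1) else 0)\<bar> \<le> V"
          using v_nonneg[of "n - i"] v_nonneg[of "n - i - 1"] Y(4)[of "n - i"] Y(4)[of "n - i - 1"] by auto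
        hence "\<bar>fps_nth e i\<bar> * \<bar>v (n - i) - (if i < n then v (n - i - 1) else 0)\<bar> \<le> \<bar>fps_nth e i\<bar> * V" by (rule mult_left_mono) simp
        thus ?thesis using Y(3) by (simp add: T_def abs_mult)
      qed
      show "summable (\<lambda>i. \<bar>fps_nth e i\<bar> * V)" using e(1) unfolding abs_sum_def by (rule summable_mult2)
    qed
    moreover have "\<forall>\<^sub>F n in sequentially. (\<Sum>i. T n i) = g n - g (n - 1)"
      using eventually_ge_at_top[of 1]
    proof eventually_elim
      case (elim n)
      have "(\<Sum>i. T n i) = (\<Sum>i\<le>n. T n i)" by (rule suminf_finite) (auto simp: T_def)
      also have "\<dots> = (\<Sum>i\<le>n. fps_nth e i * v (n - i) - (if i < n then fps_nth e i * v (n - i - 1) else 0))"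
        by (intro sum.cong) (auto simp: T_def right_diff_distrib)
      also have "\<dots> = g n - (\<Sum>i\<le>n. if i < n then fps_nth e i * v (n - i - 1) else 0)" by (simp only: sum_subtractf gc)
      also have "(\<Sum>i\<le>n. if i < n then fps_nth e i * v (n - i - 1) else 0) = (\<Sum>i\<le>n - 1. fps_nth e i * v (n - i - 1))"
        using elim by (intro sum.mono_neutral_cong_right) auto
      also have "\<dots> = g (n - 1)" unfolding gc by (simp add: diff_commute)
      finally show ?case .
    qed
    ultimately show ?thesis using Lim_transform_eventually by fastforce
  qed
  have gshift: "(\<lambda>n. g (n - i) - g n) \<longlonglongrightarrow> 0" for i
  proof (induction i)
    case (Suc i)
    have "(\<lambda>n. g (n - i - 1) - g (n - i)) \<longlonglongrightarrow> 0"
      using tendsto_minus[OF filterlim_compose[OF gdiff filterlim_minus_const_nat_at_top[of i]]] by simp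
    from tendsto_add[OF this Suc] show ?case by simp
  qed simp
  have conv: "(\<lambda>n. fps_nth (h * G) n - fps_total h * g n) \<longlonglongrightarrow> 0" if h: "abs_sum h" for h
  proof -
    define T where "T n i = fps_nth h i * ((if i \<le> n then g (n - i) else 0) - g n)" for n i
    have "(\<lambda>n. \<Sum>i. T n i) \<longlonglongrightarrow> (\<Sum>i. fps_nth h i * 0)"
    proof (rule tannery_seq)
      show "(\<lambda>n. T n i) \<longlonglongrightarrow> fps_nth h i * 0" for i
      proof -
        have "(\<lambda>n. fps_nth h i * (g (n - i) - g n)) \<longlonglongrightarrow> fps_nth h i * 0" by (intro tendsto_mult tendsto_const gshift)
        moreover have "\<forall>\<^sub>F n in sequentially. fps_nth h i * (g (n - i) - g n) = T n i"
          using eventually_ge_at_top[of i] by eventually_elim (simp add: T_def)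
        ultimately show ?thesis by (rule Lim_transform_eventually)
      qed
      show "\<bar>T n i\<bar> \<le> \<bar>fps_nth h i\<bar> * (fps_total e * V)" for n i
      proof -
        have "\<bar>(if i \<le> n then g (n - i) else 0) - g n\<bar> \<le> fps_total e * V"
          using g0[of n] g0[of "n - i"] gV[of n] gV[of "n - i"] by auto
        thus ?thesis unfolding T_def abs_mult by (rule mult_left_mono) simp
      qed
      show "summable (\<lambda>i. \<bar>fps_nth h i\<bar> * (fps_total e * V))" using h unfolding abs_sum_def by (rule summable_mult2)
    qed
    moreover have "(\<Sum>i. T n i) = fps_nth (h * G) n - fps_total h * g n" for n
    proof -
      have s1: "summable (\<lambda>i. fps_nth h i * (if i \<le> n then g (n - i) else 0))" by (rule summable_finite[of "{..n}"]) auto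
      have s2: "summable (\<lambda>i. fps_nth h i * g n)" using abs_sum_summable[OF h] by (rule summable_mult2)
      have "(\<Sum>i. T n i) = (\<Sum>i. fps_nth h i * (if i \<le> n then g (n - i) else 0)) - (\<Sum>i. fps_nth h i * g n)"
        unfolding T_def right_diff_distrib by (rule suminf_diff[OF s1 s2, symmetric])
      also have "(\<Sum>i. fps_nth h i * (if i \<le> n then g (n - i) else 0)) = (\<Sum>i\<le>n. fps_nth h i * (if i \<le> n then g (n - i) else 0))"
        by (rule suminf_finite) auto
      also have "\<dots> = fps_nth (h * G) n" unfolding fps_mult_nth_atMost g_def by (intro sum.cong) auto
      also have "(\<Sum>i. fps_nth h i * g n) = fps_total h * g n"
        unfolding fps_total_def by (rule suminf_mult2[symmetric, OF abs_sum_summable[OF h]])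
      finally show ?thesis .
    qed
    ultimately show ?thesis by simp
  qed
  have e0: "fps_nth e \<longlonglongrightarrow> 0" using abs_sum_summable[OF e(1)] by (rule summable_LIMSEQ_zero)
  have dv: "(\<lambda>n. x n / g n) \<longlonglongrightarrow> 0" if "x \<longlonglongrightarrow> 0" for x :: "nat \<Rightarrow> real"
  proof (rule Lim_null_comparison)
    show "(\<lambda>n. \<bar>x n\<bar> / g1) \<longlonglongrightarrow> 0" using tendsto_divide[OF tendsto_rabs[OF that] tendsto_const[of g1]] g1 by simp
    show "\<forall>\<^sub>F n in sequentially. norm (x n / g n) \<le> \<bar>x n\<bar> / g1"
      using eventually_ge_at_top[of N]
    proof eventually_elim
      case (elim n)
      have "g n > 0" using glow[OF elim] g1 by linarith
      thus ?case using glow[OF elim] g1 by (simp add: abs_divide divide_left_mono)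
    qed
  qed
  have aQ: "abs_sum Q" by (rule coeff_asymp_abs_sum[OF Qasy])
  have "(\<lambda>n. (w * (fps_nth e n / g n) + (fps_nth (f * G) n - fps_total f * g n) / g n + fps_total f) / 
      (fps_nth e n / g n + (fps_nth (Q * G) n - fps_total Q * g n) / g n + 1)) \<longlonglongrightarrow> (w * 0 + 0 + fps_total f) / (0 + 0 + 1)"
    by (intro tendsto_intros dv conv f aQ e0) auto
  moreover have "\<forall>\<^sub>F n in sequentially. (w * (fps_nth e n / g n) + (fps_nth (f * G) n - fps_total f * g n) / g n + fps_total f) / 
      (fps_nth e n / g n + (fps_nth (Q * G) n - fps_total Q * g n) / g n + 1)
      = (w * fps_nth e n + fps_nth (f * G) n) / (fps_nth e n + fps_nth (Q * G) n)"
    using eventually_ge_at_top[of N]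
  proof eventually_elim
    case (elim n)
    have gp: "g n \<noteq> 0" using glow[OF elim] g1 by linarith
    have "w * (fps_nth e n / g n) + (fps_nth (f * G) n - fps_total f * g n) / g n + fps_total f = (w * fps_nth e n + fps_nth (f * G) n) / g n"
      using gp by (simp add: field_simps)
    moreover have "fps_nth e n / g n + (fps_nth (Q * G) n - fps_total Q * g n) / g n + 1 = (fps_nth e n + fps_nth (Q * G) n) / g n"
      using gp Qtot by (simp add: field_simps)
    ultimately show ?case using gp by simp
  qed
  ultimately show ?thesis using Lim_transform_eventually by fastforce
qed

end

section \<open>Rescaling and the square-root expansion\<close>

text \<open>Tonelli's theorem for series, obtained from Tannery's theorem applied to the number of
  inner terms.\<close>

lemma nonneg_double_sum:
  fixes a :: "nat \<Rightarrow> nat \<Rightarrow> real"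
  assumes a: "\<And>n k. 0 \<le> a n k" "\<And>n. (\<lambda>k. a n k) sums b n" and b: "summable b"
  shows "summable (\<lambda>n. a n k)" "(\<lambda>k. \<Sum>n. a n k) sums (\<Sum>n. b n)"
proof -
  have le: "(\<Sum>k\<in>K. a n k) \<le> b n" if "finite K" for n K
    using sum_le_suminf[OF sums_summable[OF a(2)[of n]], of K] a(1) sums_unique[OF a(2)[of n]] that by auto
  have b0: "0 \<le> b n" for n using le[of "{}" n] by simp
  have s: "summable (\<lambda>n. a n k)" for k
    by (rule summable_comparison_test'[OF b, of 0]) (use le[of "{k}"] a(1) in auto)
  show "summable (\<lambda>n. a n k)" by (rule s)
  have "(\<lambda>K. \<Sum>n. (\<Sum>k<K. a n k)) \<longlonglongrightarrow> (\<Sum>n. b n)"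
  proof (rule tannery_seq)
    show "(\<lambda>K. \<Sum>k<K. a n k) \<longlonglongrightarrow> b n" for n using a(2)[of n] by (simp add: sums_def)
    show "\<bar>\<Sum>k<K. a n k\<bar> \<le> b n" for K n using le[of "{..<K}" n] a(1) by (simp add: sum_nonneg)
  qed (rule b)
  moreover have "(\<Sum>n. (\<Sum>k<K. a n k)) = (\<Sum>k<K. \<Sum>n. a n k)" for K
    by (rule suminf_sum) (rule s)
  ultimately show "(\<lambda>k. \<Sum>n. a n k) sums (\<Sum>n. b n)" by (simp add: sums_def)
qed

section \<open>Rescaling the variable z\<close>

definition fps_rescale :: "real \<Rightarrow> real fps \<Rightarrow> real fps" where
  "fps_rescale r f = Abs_fps (\<lambda>n. fps_nth f n * r ^ n)"

lemma fps_rescale_nth [simp]: "fps_nth (fps_rescale r f) n = fps_nth f n * r ^ n"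
  by (simp add: fps_rescale_def)

lemma fps_rescale_mult: "fps_rescale r (f * g) = fps_rescale r f * fps_rescale r g"
proof (rule fps_ext)
  fix n
  have "fps_nth f i * fps_nth g (n - i) * r ^ n = (fps_nth f i * r ^ i) * (fps_nth g (n - i) * r ^ (n - i))" if "i \<le> n" for i
    using that power_add[of r i "n - i"] by (simp add: mult_ac)
  thus "fps_nth (fps_rescale r (f * g)) n = fps_nth (fps_rescale r f * fps_rescale r g) n"
    unfolding fps_mult_nth fps_rescale_nth sum_distrib_right by (intro sum.cong refl) simp
qed

lemma fps_rescale_inverse:
  assumes "fps_nth f 0 \<noteq> 0" shows "fps_rescale r (inverse f) = inverse (fps_rescale r f)"
proof -
  have "fps_rescale r f * fps_rescale r (inverse f) = fps_rescale r (f * inverse f)" by (simp add: fps_rescale_mult)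
  also have "f * inverse f = 1" using assms by (rule inverse_mult_eq_1')
  also have "fps_rescale r 1 = 1" by (rule fps_ext) simp
  finally show ?thesis by (simp add: fps_inverse_unique)
qed

lemma fps_rescale_one_minus: "fps_rescale r (1 - f) = 1 - fps_rescale r f"
  by (rule fps_ext) (simp add: left_diff_distrib)

lemma eval_fps_rescale: "eval_fps (fps_rescale r f) x = eval_fps f (r * x)"
  by (simp add: eval_fps_def power_mult_distrib mult.assoc)

lemma fps_total_rescale: "fps_total (fps_rescale r f) = eval_fps f r"
  by (simp add: fps_total_def eval_fps_def)

text \<open>Two admissible constants differ by a factor whose product with sqrt (1 - z/r) is O(1 -
  z/r), which forces the factor to be 0; hence the description in \<open>eta\<close> is
  definite.\<close>

lemma sqrt_expansion_unique:
  fixes F :: "real \<Rightarrow> real"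
  assumes r: "r > 0" and F: "\<And>z. 0 < z \<Longrightarrow> z < r \<Longrightarrow> \<bar>F z - (A - h * sqrt (1 - z / r))\<bar> \<le> K * (1 - z / r)"
  shows "(THE e. (\<lambda>z. F z - (A - e * sqrt (1 - z / r))) \<in> O[at_left r](\<lambda>z. 1 - z / r)) = h"
proof -
  have ev: "\<forall>\<^sub>F z in at_left r. 0 < z \<and> z < r"
    using r by (auto simp: eventually_at_left_field intro: exI[of _ 0])
  have h: "(\<lambda>z. F z - (A - h * sqrt (1 - z / r))) \<in> O[at_left r](\<lambda>z. 1 - z / r)"
  proof (rule bigoI[where c=K])
    show "\<forall>\<^sub>F z in at_left r. norm (F z - (A - h * sqrt (1 - z / r))) \<le> K * norm (1 - z / r)"
      using ev by eventually_elim (use F r in auto)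
  qed
  have "e = h" if e: "(\<lambda>z. F z - (A - e * sqrt (1 - z / r))) \<in> O[at_left r](\<lambda>z. 1 - z / r)" for e
  proof -
    have "(\<lambda>z. (F z - (A - e * sqrt (1 - z / r))) - (F z - (A - h * sqrt (1 - z / r)))) \<in> O[at_left r](\<lambda>z. 1 - z / r)"
      by (rule sum_in_bigo(2)[OF e h])
    also have "(\<lambda>z. (F z - (A - e * sqrt (1 - z / r))) - (F z - (A - h * sqrt (1 - z / r)))) = (\<lambda>z. (e - h) * sqrt (1 - z / r))"
      by (simp add: algebra_simps)
    finally obtain c where c: "c > 0" "\<forall>\<^sub>F z in at_left r. norm ((e - h) * sqrt (1 - z / r)) \<le> c * norm (1 - z / r)"
      by (elim landau_o.bigE) auto
    from c(2) ev have "\<forall>\<^sub>F z in at_left r. \<bar>e - h\<bar> \<le> c * sqrt (1 - z / r)"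
    proof eventually_elim
      case (elim z)
      define s where "s = sqrt (1 - z / r)"
      have s: "s > 0" "1 - z / r = s * s" using elim r by (auto simp: s_def)
      have "\<bar>e - h\<bar> * s \<le> c * s * s" using elim s unfolding s_def[symmetric] by (simp add: abs_mult)
      thus ?case using s unfolding s_def[symmetric] by (simp only: mult_le_cancel_right_pos)
    qed
    moreover have "((\<lambda>z. c * sqrt (1 - z / r)) \<longlongrightarrow> c * sqrt (1 - r / r)) (at_left r)"
      using r by (intro tendsto_intros) auto
    ultimately have "\<bar>e - h\<bar> \<le> c * sqrt (1 - r / r)" by (intro tendsto_lowerbound) auto
    thus ?thesis using r by simp
  qed
  with h show ?thesis
    by (rule the_equality[of "\<lambda>e. (\<lambda>z. F z - (A - e * sqrt (1 - z / r))) \<in> O[at_left r](\<lambda>z. 1 - z / r)"])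
qed

text \<open>Near 1 the main term of the expansion dominates its error; away from 1 monotonicity
  keeps Q below its value at x1.\<close>

lemma sqrt_sing_critical_bounds:
  assumes s: "sqrt_sing Q \<eta>" and Q: "\<And>n. 0 \<le> fps_nth Q n" "fps_total Q = 1" and \<eta>: "\<eta> > 0"
  obtains c C where "c > 0" "\<And>x. 0 < x \<Longrightarrow> x < 1 \<Longrightarrow> c * sqrt (1 - x) \<le> 1 - eval_fps Q x"
    "\<And>x. 0 < x \<Longrightarrow> x < 1 \<Longrightarrow> 1 - eval_fps Q x \<le> C * sqrt (1 - x)"
proof -
  obtain K where K: "K \<ge> 0" "\<And>x. 0 < x \<Longrightarrow> x < 1 \<Longrightarrow> \<bar>eval_fps Q x - (1 - \<eta> * sqrt (1 - x))\<bar> \<le> K * (1 - x)"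
    using sqrt_singE[OF s] unfolding Q(2) by blast
  have aQ: "abs_sum Q" using s by (rule sqrt_sing_abs_sum)
  have le: "1 - x \<le> sqrt (1 - x)" if "0 < x" "x < 1" for x :: real
  proof -
    have "sqrt (1 - x) * sqrt (1 - x) \<le> 1 * sqrt (1 - x)" using that by (intro mult_right_mono) auto
    thus ?thesis using that by simp
  qed
  have hi: "1 - eval_fps Q x \<le> (\<eta> + K) * sqrt (1 - x)" if x: "0 < x" "x < 1" for x
  proof -
    have "K * (1 - x) \<le> K * sqrt (1 - x)" using le[OF x] K(1) by (rule mult_left_mono)
    thus ?thesis using K(2)[OF x] by (simp add: algebra_simps abs_le_iff)
  qed
  \<comment> \<open>As long as sqrt (1 - x) \<le> b, the error K (1 - x) is at most half of the main
    term.\<close>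
  define b where "b = min (1/2) (\<eta> / (2 * (K + 1)))"
  have b: "0 < b" "b < 1" using \<eta> K(1) by (auto simp: b_def)
  have b': "(K + 1) * b \<le> \<eta> / 2"
  proof -
    have "(K + 1) * b \<le> (K + 1) * (\<eta> / (2 * (K + 1)))" using K(1) by (intro mult_left_mono) (auto simp: b_def)
    also have "\<dots> = \<eta> / 2"
    proof -
      define m where "m = K + 1"
      have "m \<noteq> 0" using K(1) by (simp add: m_def)
      thus ?thesis unfolding m_def[symmetric] by simp
    qed
    finally show ?thesis .
  qed
  have near: "\<eta> / 2 * sqrt (1 - x) \<le> 1 - eval_fps Q x" if x: "0 < x" "x < 1" "sqrt (1 - x) \<le> b" for x
  proof -
    define t where "t = sqrt (1 - x)"
    have t: "0 \<le> t" "t * t = 1 - x" "t \<le> b" using x by (auto simp: t_def)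
    have "K * t \<le> (K + 1) * b" using t K(1) b by (intro mult_mono) auto
    hence "K * t \<le> \<eta> / 2" using b' by linarith
    hence "K * t * t \<le> \<eta> / 2 * t" using t by (intro mult_right_mono) auto
    moreover have "\<bar>eval_fps Q x - (1 - \<eta> * t)\<bar> \<le> K * t * t"
      using K(2)[OF x(1,2)] t(2) by (simp add: t_def mult.assoc)
    ultimately have "\<eta> / 2 * t \<le> 1 - eval_fps Q x" by linarith
    thus ?thesis by (simp add: t_def)
  qed
  define x1 where "x1 = 1 - b\<^sup>2"
  have b2: "0 < b\<^sup>2" "b\<^sup>2 < 1" using b by (auto simp: power_less_one_iff)
  have x1: "0 < x1" "x1 < 1" "sqrt (1 - x1) = b" using b b2 by (auto simp: x1_def)
  define c where "c = min (\<eta> / 2) (\<eta> / 2 * b)"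
  have "c > 0" using \<eta> b by (simp add: c_def)
  moreover have "c * sqrt (1 - x) \<le> 1 - eval_fps Q x" if x: "0 < x" "x < 1" for x
  proof (cases "sqrt (1 - x) \<le> b")
    case True
    have "c * sqrt (1 - x) \<le> \<eta> / 2 * sqrt (1 - x)" using x by (intro mult_right_mono) (auto simp: c_def)
    thus ?thesis using near[OF x True] by linarith
  next
    case False
    hence "sqrt (1 - x1) < sqrt (1 - x)" using x1 by simp
    hence xx: "x < x1" by simp
    have "eval_fps Q x \<le> eval_fps Q x1" unfolding eval_fps_def
    proof (rule suminf_le)
      show "fps_nth Q n * x ^ n \<le> fps_nth Q n * x1 ^ n" for n using Q(1) x xx by (intro mult_left_mono power_mono) auto
      show "summable (\<lambda>n. fps_nth Q n * x ^ n)" "summable (\<lambda>n. fps_nth Q n * x1 ^ n)"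
        using conv_radius_unit[OF abs_sum_conv_radius[OF aQ]] x x1 by (auto intro!: summable_fps)
    qed
    moreover have "\<eta> / 2 * b \<le> 1 - eval_fps Q x1" using near[of x1] x1 by simp
    moreover have "c * sqrt (1 - x) \<le> \<eta> / 2 * b * 1" using x \<eta> b by (intro mult_mono) (auto simp: c_def)
    ultimately show ?thesis by linarith
  qed
  ultimately show ?thesis using hi that by blast
qed

text \<open>The product rule for the constants, repeated. The quasi-inverse has constant l d^2, its
  square 2 l d^3; this is the origin of \<open>2 * et * Dr ^ 3\<close> in
  \<open>omega\<close>.\<close>

lemma subcritical_coeff:
  fixes Q e f :: "real fps"
  assumes Q: "fps_nth Q 0 = 0" "\<And>n. 0 \<le> fps_nth Q n" "coeff_asymp Q l" "fps_total Q < 1"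
    and e: "coeff_asymp e le" and f: "coeff_asymp f lf"
  defines "d \<equiv> 1 / (1 - fps_total Q)"
  shows "coeff_asymp (f * ((inverse (1 - Q))\<^sup>2 * e)) 
    (lf * (d\<^sup>2 * fps_total e) + (2 * l * d ^ 3 * fps_total e + le * d\<^sup>2) * fps_total f)"
proof -
  have sQ: "summable (fps_nth Q)" by (rule abs_sum_summable[OF coeff_asymp_abs_sum[OF Q(3)]])
  have tD: "fps_total (inverse (1 - Q)) = d" unfolding d_def by (rule renewal_summable(2)[OF Q(1,2) sQ Q(4)])
  have cD: "coeff_asymp (inverse (1 - Q)) (l * d\<^sup>2)" using coeff_asymp_renewal[OF Q] unfolding tD .
  note aD = coeff_asymp_abs_sum[OF cD]
  have cD2: "coeff_asymp ((inverse (1 - Q))\<^sup>2) (2 * l * d ^ 3)"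
    using coeff_asymp_mult[OF cD cD] unfolding tD by (simp add: power2_eq_square power3_eq_cube mult_ac)
  have tD2: "fps_total ((inverse (1 - Q))\<^sup>2) = d\<^sup>2" unfolding power2_eq_square fps_total_mult[OF aD aD] tD ..
  note aD2 = coeff_asymp_abs_sum[OF cD2]
  have cG: "coeff_asymp ((inverse (1 - Q))\<^sup>2 * e) (2 * l * d ^ 3 * fps_total e + le * d\<^sup>2)"
    using coeff_asymp_mult[OF cD2 e] unfolding tD2 .
  have tG: "fps_total ((inverse (1 - Q))\<^sup>2 * e) = d\<^sup>2 * fps_total e"
    unfolding fps_total_mult[OF aD2 coeff_asymp_abs_sum[OF e]] tD2 ..
  show ?thesis using coeff_asymp_mult[OF f cG] unfolding tG .
qed

section \<open>Walks with catastrophes\<close>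

locale catastrophe_walk = walk p c d for p c d +
  fixes q :: real
  assumes c1: "c \<ge> 1" and d1: "d \<ge> 1" and pnn: "0 \<le> p i"
    and pends: "p (- int c) \<noteq> 0" "p (int d) \<noteq> 0" and paper: "aperiodic p" and q: "q > 0"
begin

section \<open>The jump polynomial and its saddle point\<close>

abbreviation P where "P \<equiv> jump_poly p c d"

text \<open>This is x P'(x), which has the same positive zeros as P' and is proportional to the mean
  jump after tilting by x.\<close>

definition drift :: "real \<Rightarrow> real" where "drift x = (\<Sum>i\<in>steps. of_int i * p i * x powi i)"

lemma P_eq: "P x = (\<Sum>i\<in>steps. p i * x powi i)" by (simp add: jump_poly_def steps_def)

lemma ppos: "p (- int c) > 0" "p (int d) > 0" using pends pnn by (simp_all add: less_le)

lemma P_pos: assumes "x > 0" shows "P x > 0"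
proof -
  have "0 < p (int d) * x powi int d" using ppos assms by simp
  also have "\<dots> \<le> P x" unfolding P_eq by (rule member_le_sum) (use assms pnn in \<open>auto simp: steps_def\<close>)
  finally show ?thesis .
qed

lemma P_deriv: assumes "x > 0" shows "(P has_real_derivative drift x / x) (at x)"
proof -
  have "((\<lambda>x. \<Sum>i\<in>steps. p i * x powi i) has_real_derivative (\<Sum>i\<in>steps. p i * (of_int i * x powi (i - 1) * 1))) (at x)"
    using assms by (intro DERIV_sum DERIV_cmult DERIV_power_int DERIV_ident) auto
  moreover have "(\<Sum>i\<in>steps. p i * (of_int i * x powi (i - 1) * 1)) = drift x / x"
    using assms by (simp add: drift_def sum_divide_distrib power_int_diff mult_ac)
  moreover have "P = (\<lambda>x. \<Sum>i\<in>steps. p i * x powi i)" using P_eq by blast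
  ultimately show ?thesis by simp
qed

lemma deriv_P: "x > 0 \<Longrightarrow> deriv P x = drift x / x"
  using P_deriv by (rule DERIV_imp_deriv)

text \<open>For negative i a negative coefficient meets a decreasing power, so every term is
  non-decreasing; the term i = d is strict because d \<ge> 1.\<close>

lemma drift_mono: assumes "0 < x" "x < y" shows "drift x < drift y"
  unfolding drift_def
proof (rule sum_strict_mono_ex1)
  show "\<forall>i\<in>steps. of_int i * p i * x powi i \<le> of_int i * p i * y powi i"
  proof
    fix i assume "i \<in> steps"
    show "of_int i * p i * x powi i \<le> of_int i * p i * y powi i"
    proof (cases "i \<ge> 0")
      case True
      thus ?thesis using assms pnn[of i] by (intro mult_left_mono power_int_mono) auto
    next
      case False
      hence "y powi i \<le> x powi i" using assms by (intro power_int_antimono) auto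
      moreover have "of_int i * p i \<le> 0" using False pnn[of i] by (simp add: mult_nonpos_nonneg)
      ultimately show ?thesis by (intro mult_left_mono_neg)
    qed
  qed
  have "of_int (int d) * p (int d) * x powi (int d) < of_int (int d) * p (int d) * y powi (int d)"
    using assms d1 ppos by (intro mult_strict_left_mono power_int_strict_mono) auto
  thus "\<exists>i\<in>steps. of_int i * p i * x powi i < of_int i * p i * y powi i" by (intro bexI[of _ "int d"]) (auto simp: steps_def)
qed simp

text \<open>The jump d dominates for large x and the jump -c near 0; explicit bounds from these two
  jumps give the signs for the intermediate value theorem.\<close>

lemma drift_zero_exists: "\<exists>x>0. drift x = 0"
proof -
  define A where "A = (\<Sum>i\<in>steps. p i)"
  have A0: "A \<ge> 0" unfolding A_def using pnn by (intro sum_nonneg) auto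
  have hi: "p (int d) * x - real c * A \<le> drift x" if x: "x \<ge> 1" for x
  proof -
    have "(\<Sum>i\<in>steps. (if i = int d then p i * x else 0) - real c * p i) \<le> drift x" unfolding drift_def
    proof (rule sum_mono)
      fix i assume i: "i \<in> steps"
      show "(if i = int d then p i * x else 0) - real c * p i \<le> of_int i * p i * x powi i"
      proof (cases "i = int d")
        case True
        have "x powi 1 \<le> x powi int d" using x d1 by (intro power_int_increasing) auto
        hence "1 * (p i * x) \<le> real d * (p i * x powi int d)" using d1 pnn[of i] x by (intro mult_mono mult_left_mono) auto
        moreover have "0 \<le> real c * p i" using pnn by simp
        ultimately show ?thesis using True by (simp add: mult.assoc)
      next
        case False
        show ?thesis
        proof (cases "i \<ge> 0")
          case True
          have "0 \<le> of_int i * p i * x powi i" using True x pnn[of i] by simp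
          moreover have "0 \<le> real c * p i" using pnn by simp
          ultimately show ?thesis using False by simp
        next
          case neg: False
          have "x powi i \<le> x powi 0" using neg x by (intro power_int_increasing) auto
          hence "(- of_int i * p i) * x powi i \<le> (real c * p i) * 1" using neg i pnn[of i] x
            by (intro mult_mono mult_right_mono) (auto simp: steps_def mult_nonpos_nonneg)
          thus ?thesis using False by simp
        qed
      qed
    qed
    moreover have "(\<Sum>i\<in>steps. (if i = int d then p i * x else 0) - real c * p i) = p (int d) * x - real c * A"
      unfolding sum_subtractf A_def sum_distrib_left by (simp add: sum.delta steps_def)
    ultimately show ?thesis by simp
  qed
  have lo: "drift x \<le> real d * A - p (- int c) * (1 / x)" if x: "0 < x" "x \<le> 1" for x
  proof -
    have "drift x \<le> (\<Sum>i\<in>steps. real d * p i - (if i = - int c then p i * (1 / x) else 0))" unfolding drift_def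
    proof (rule sum_mono)
      fix i assume i: "i \<in> steps"
      show "of_int i * p i * x powi i \<le> real d * p i - (if i = - int c then p i * (1 / x) else 0)"
      proof (cases "i = - int c")
        case True
        have "x powi (-1) \<le> x powi (- int c)" using x c1 by (intro power_int_decreasing) auto
        hence "1 / x \<le> x powi (- int c)" by (simp add: power_int_minus divide_inverse)
        hence "1 * (p i * (1 / x)) \<le> real c * (p i * x powi (- int c))" using c1 pnn[of i] x by (intro mult_mono mult_left_mono) auto
        moreover have "0 \<le> real d * p i" using pnn by simp
        ultimately show ?thesis using True by (simp add: mult.assoc)
      next
        case False
        show ?thesis
        proof (cases "i \<le> 0")
          case True
          have "of_int i * p i * x powi i \<le> 0" using True x pnn[of i] by (simp add: mult_nonpos_nonneg)
          moreover have "0 \<le> real d * p i" using pnn by simp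
          ultimately show ?thesis using False by simp
        next
          case ps: False
          have "x powi i \<le> 1" using ps x by (intro power_int_le_one) auto
          hence "(of_int i * p i) * x powi i \<le> (real d * p i) * 1" using ps i pnn[of i] x
            by (intro mult_mono mult_right_mono) (auto simp: steps_def)
          thus ?thesis using False by simp
        qed
      qed
    qed
    also have "\<dots> = real d * A - p (- int c) * (1 / x)"
      unfolding sum_subtractf A_def sum_distrib_left by (simp add: sum.delta steps_def)
    finally show ?thesis .
  qed
  \<comment> \<open>Chosen so that the lower bound at x1 equals \<open>p (int d)\<close>; y does the
    same for the upper bound at 1/y.\<close>
  define x1 where "x1 = 1 + real c * A / p (int d)"
  have x1: "x1 \<ge> 1" using A0 ppos by (simp add: x1_def)
  have "p (int d) * x1 - real c * A = p (int d)" using ppos by (simp add: x1_def field_simps)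
  hence h1: "drift x1 > 0" using hi[OF x1] ppos by linarith
  define y where "y = 1 + real d * A / p (- int c)"
  have y: "y \<ge> 1" using A0 ppos by (simp add: y_def)
  have "real d * A - p (- int c) * (1 / (1 / y)) = - p (- int c)" using ppos by (simp add: y_def field_simps)
  hence h2: "drift (1 / y) < 0" using lo[of "1 / y"] y ppos by simp
  have yx: "1 / y \<le> x1"
  proof -
    have "1 / y \<le> 1" using y by simp
    thus ?thesis using x1 by linarith
  qed
  have "\<exists>x\<ge>1 / y. x \<le> x1 \<and> drift x = 0"
  proof (rule IVT')
    show "continuous_on {1 / y..x1} drift" unfolding drift_def
      using y by (intro continuous_intros) (auto simp: field_simps)
  qed (use h1 h2 yx in auto)
  thus ?thesis using y by (metis divide_pos_pos less_le_trans zero_less_one)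
qed

definition \<tau> where "\<tau> = tau p c d"
definition \<rho> where "\<rho> = rho p c d"

text \<open>By strict monotonicity of \<open>drift\<close> the infimum in \<open>tau\<close> runs
  over a single point.\<close>

lemma tau_props: "\<tau> > 0" "drift \<tau> = 0"
proof -
  obtain x where x: "x > 0" "drift x = 0" using drift_zero_exists by blast
  have uniq: "t = x" if "t > 0" "drift t = 0" for t
    using drift_mono[of t x] drift_mono[of x t] that x by (cases t x rule: linorder_cases) auto
  have "{t. 0 < t \<and> deriv P t = 0} = {x}"
  proof (intro equalityI subsetI)
    fix t assume "t \<in> {t. 0 < t \<and> deriv P t = 0}"
    hence "t > 0" "drift t = 0" using deriv_P[of t] by auto
    thus "t \<in> {x}" using uniq by blast
  next
    fix t assume "t \<in> {x}"
    thus "t \<in> {t. 0 < t \<and> deriv P t = 0}" using x deriv_P[of x] by simp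
  qed
  hence "\<tau> = x" by (simp add: \<tau>_def tau_def)
  thus "\<tau> > 0" "drift \<tau> = 0" using x by auto
qed

lemma rho_props: "\<rho> > 0" "\<rho> * P \<tau> = 1"
  using P_pos[OF tau_props(1)] by (auto simp: \<rho>_def rho_def \<tau>_def)

text \<open>Differentiating x P'(x)/x leaves a second moment, because the first moment vanishes at
  \<tau>.\<close>

lemma deriv2_P: "deriv (deriv P) \<tau> = (\<Sum>i\<in>steps. (of_int i)\<^sup>2 * p i * \<tau> powi i) / \<tau>\<^sup>2"
proof -
  have "((\<lambda>x. drift x / x) has_real_derivative ((\<Sum>i\<in>steps. (of_int i * p i) * (of_int i * \<tau> powi (i - 1) * 1)) * \<tau> - drift \<tau> * 1) / (\<tau> * \<tau>)) (at \<tau>)"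
    unfolding drift_def using tau_props(1)
    by (intro DERIV_divide DERIV_sum DERIV_cmult DERIV_power_int DERIV_ident) auto
  moreover have "\<forall>\<^sub>F x in nhds \<tau>. deriv P x = drift x / x"
    using eventually_nhds_in_open[of "{0<..}" \<tau>] tau_props(1) by (auto elim!: eventually_mono simp: deriv_P)
  ultimately have "(deriv P has_real_derivative ((\<Sum>i\<in>steps. (of_int i * p i) * (of_int i * \<tau> powi (i - 1) * 1)) * \<tau> - drift \<tau> * 1) / (\<tau> * \<tau>)) (at \<tau>)"
    by (subst DERIV_cong_ev[OF refl _ refl])
  hence "deriv (deriv P) \<tau> = ((\<Sum>i\<in>steps. (of_int i * p i) * (of_int i * \<tau> powi (i - 1) * 1)) * \<tau> - drift \<tau> * 1) / (\<tau> * \<tau>)"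
    by (rule DERIV_imp_deriv)
  also have "(\<Sum>i\<in>steps. (of_int i * p i) * (of_int i * \<tau> powi (i - 1) * 1)) * \<tau> = (\<Sum>i\<in>steps. (of_int i)\<^sup>2 * p i * \<tau> powi i)"
    unfolding sum_distrib_right using tau_props(1) by (intro sum.cong refl) (simp add: power_int_diff power2_eq_square mult_ac)
  finally show ?thesis using tau_props by (simp add: power2_eq_square)
qed

section \<open>Exponential tilting\<close>

definition pt :: "int \<Rightarrow> real" where "pt i = p i * \<tau> powi i * \<rho>"

lemma pt_nz: "pt i \<noteq> 0 \<longleftrightarrow> p i \<noteq> 0" using tau_props rho_props by (simp add: pt_def)

sublocale tilt: centred_walk pt c d
proof
  show "pt i = 0" if "i < - int c \<or> i > int d" for i using supp[OF that] by (simp add: pt_def)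
  show "0 \<le> pt i" for i using pnn[of i] tau_props rho_props by (simp add: pt_def)
  have "(\<Sum>i\<in>{-int c..int d}. pt i) = P \<tau> * \<rho>" by (simp add: pt_def jump_poly_def sum_distrib_right)
  thus "(\<Sum>i\<in>{-int c..int d}. pt i) = 1" using rho_props by (simp add: mult.commute)
  have "(\<Sum>i\<in>{-int c..int d}. of_int i * pt i) = drift \<tau> * \<rho>" 
    unfolding pt_def drift_def steps_def sum_distrib_right by (intro sum.cong refl) simp
  thus "(\<Sum>i\<in>{-int c..int d}. of_int i * pt i) = 0" using tau_props by simp
  show "pt (- int c) \<noteq> 0" "pt (int d) \<noteq> 0" using pends by (auto simp: pt_nz)
  show "aperiodic pt"
  proof (rule ccontr)
    assume "\<not> aperiodic pt"
    then obtain b :: int and per :: nat and h where h: "per \<ge> 2" "\<And>i. pt i = (if (i - b) mod int per = 0 then h ((i - b) div int per) else 0)"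
      unfolding aperiodic_def by blast
    have "p i = (if (i - b) mod int per = 0 then p (b + int per * ((i - b) div int per)) else 0)" for i
    proof (cases "(i - b) mod int per = 0")
      case True
      hence "int per * ((i - b) div int per) = i - b" by auto
      thus ?thesis using True by simp
    next
      case False
      hence "pt i = 0" using h(2)[of i] by simp
      thus ?thesis using False pt_nz[of i] by auto
    qed
    hence "\<exists>(b::int) (per::nat) (h::int \<Rightarrow> real). per \<ge> 2 \<and> (\<forall>i. p i = (if (i - b) mod int per = 0 then h ((i - b) div int per) else 0))"
      using h(1) by (intro exI[of _ b] exI[of _ per] exI[of _ "\<lambda>x. p (b + int per * x)"]) auto
    thus False using paper unfolding aperiodic_def by blast
  qed
qed (use c1 d1 in auto)

text \<open>The tilted walk has variance \<rho> \<tau>^2 P''(\<tau>) with \<rho> = 1/P(\<tau>), so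
  that C/\<tau> = sqrt (2/\<open>walk_var\<close>).\<close>

lemma C_over_tau: "sqrt (2 * P \<tau> / deriv (deriv P) \<tau>) / \<tau> = 2 * tilt.kap"
proof -
  have "tilt.walk_var = \<rho> * (\<Sum>i\<in>steps. (of_int i)\<^sup>2 * p i * \<tau> powi i)"
    unfolding tilt.walk_var_def pt_def sum_distrib_left tilt.steps_def steps_def by (intro sum.cong refl) (simp add: mult_ac)
  hence v: "(\<Sum>i\<in>steps. (of_int i)\<^sup>2 * p i * \<tau> powi i) = tilt.walk_var * P \<tau>"
  proof -
    have "tilt.walk_var * P \<tau> = (\<rho> * P \<tau>) * (\<Sum>i\<in>steps. (of_int i)\<^sup>2 * p i * \<tau> powi i)"
      using \<open>tilt.walk_var = _\<close> by simp
    thus ?thesis using rho_props by simp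
  qed
  have Pp: "P \<tau> > 0" using P_pos tau_props by blast
  have "2 * P \<tau> / deriv (deriv P) \<tau> = 2 * \<tau>\<^sup>2 / tilt.walk_var"
    unfolding deriv2_P v using Pp by simp
  hence "sqrt (2 * P \<tau> / deriv (deriv P) \<tau>) / \<tau> = sqrt (2 / tilt.walk_var)"
    using tau_props by (simp add: real_sqrt_mult real_sqrt_divide)
  also have "\<dots> = 2 * tilt.kap"
  proof -
    define w where "w = tilt.walk_var"
    have w: "w > 0" using tilt.walk_var_pos by (simp add: w_def)
    have "sqrt (2 / w) = sqrt ((2 * 2) / (2 * w))" by simp
    also have "\<dots> = 2 / sqrt (2 * w)" by (simp only: real_sqrt_divide real_sqrt_mult_self) simp
    finally show ?thesis by (simp add: tilt.kap_def w_def)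
  qed
  finally show ?thesis .
qed

lemma mw_nonneg: "0 \<le> mw p n k"
  unfolding mw_def by (intro sum_nonneg prod_list_nonneg) (auto simp: pnn)

text \<open>Along a path the powers of \<tau> multiply to \<tau>^k and each step adds a factor
  \<rho>, so tilting changes a weight only through endpoint and length.\<close>

lemma mw_tilt: "mw pt n k = mw p n k * \<tau> ^ k * \<rho> ^ n"
proof (induction n arbitrary: k)
  case 0 thus ?case by (simp add: mw_0 tilt.mw_0)
next
  case (Suc n)
  have "mw pt (Suc n) k = (\<Sum>i\<in>steps. pt i * (if int k - i \<ge> 0 then mw pt n (nat (int k - i)) else 0))"
    by (simp add: tilt.mw_Suc tilt.steps_def steps_def)
  also have "\<dots> = (\<Sum>i\<in>steps. (p i * (if int k - i \<ge> 0 then mw p n (nat (int k - i)) else 0)) * (\<tau> ^ k * \<rho> ^ Suc n))"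
  proof (intro sum.cong refl)
    fix i assume "i \<in> steps"
    show "pt i * (if int k - i \<ge> 0 then mw pt n (nat (int k - i)) else 0) = (p i * (if int k - i \<ge> 0 then mw p n (nat (int k - i)) else 0)) * (\<tau> ^ k * \<rho> ^ Suc n)"
    proof (cases "int k - i \<ge> 0")
      case True
      have "\<tau> powi i * \<tau> ^ nat (int k - i) = \<tau> powi i * \<tau> powi (int k - i)" using True by (simp add: power_int_def)
      also have "\<dots> = \<tau> ^ k" using tau_props by (simp add: power_int_add[symmetric])
      finally show ?thesis using True by (simp add: Suc pt_def mult_ac)
    qed simp
  qed
  also have "\<dots> = mw p (Suc n) k * \<tau> ^ k * \<rho> ^ Suc n" by (simp add: mw_Suc sum_distrib_right mult.assoc)
  finally show ?case .
qed

section \<open>Coefficients of the catastrophe series Q and of A\<close>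

definition cat :: "nat \<Rightarrow> bool" where "cat k \<longleftrightarrow> k > 0 \<and> p (- int k) = 0"

text \<open>The length n includes the catastrophe itself, so the meander before it has length n -
  1.\<close>

definition Qc :: "nat \<Rightarrow> nat \<Rightarrow> real" where
  "Qc n k = (if n > 0 \<and> cat k then q * mw p (n - 1) k else 0)"

text \<open>\<open>Qu u\<close> and \<open>Qk k\<close> are two slices of the same double series:
  the first governs D and \<open>eta\<close>, the second the limiting probabilities.\<close>

definition Qu :: "real \<Rightarrow> real fps" where "Qu u = Abs_fps (\<lambda>n. \<Sum>k. Qc n k * u ^ k)"

definition Qk :: "nat \<Rightarrow> real fps" where "Qk k = Abs_fps (\<lambda>n. Qc n k)"

lemma finite_J: "finite {j::nat. 0 < j \<and> p (- int j) \<noteq> 0}"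
proof (rule finite_subset)
  show "{j::nat. 0 < j \<and> p (- int j) \<noteq> 0} \<subseteq> {..c}" using supp by force
qed simp

lemma Qser_nth: "fps_nth (fps_nth (Qser p q) n) k = Qc n k"
proof -
  have s: "fps_nth (fps_const (fps_X ^ j) * liftz f) n = fps_X ^ j * fps_const (fps_nth f n)" for j n and f :: "real fps"
    by (simp add: liftz_def)
  have X: "fps_nth (fps_X ^ j * fps_const y) k = (if k = j then y else 0)" for j k and y :: real
    by (auto simp: fps_X_power_mult_nth)
  have "fps_nth (fps_nth (Qser p q) (Suc n)) k = q * (mw p n k - (if k = 0 then mw p n 0 else 0) - (\<Sum>j\<in>{j::nat. 0 < j \<and> p (- int j) \<noteq> 0}. if k = j then mw p n j else 0))" for n
    unfolding Qser_def mult.assoc fps_X_mult_nth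
    by (simp add: fps_sum_nth s X Mser_def liftz_def Eser_def Mk_def) (intro disjI2 sum.cong refl, simp)
  also have "\<dots> n = Qc (Suc n) k" for n
    using finite_J by (simp add: Qc_def cat_def sum.delta)
  finally have 1: "fps_nth (fps_nth (Qser p q) (Suc n)) k = Qc (Suc n) k" for n .
  have 0: "fps_nth (fps_nth (Qser p q) 0) k = Qc 0 k" by (simp add: Qser_def Qc_def mult.assoc)
  show ?thesis using 0 1 by (cases n) auto
qed

lemma Qc_nonneg: "0 \<le> Qc n k" using q mw_nonneg by (simp add: Qc_def)

lemma Qc_supp: "k > n * d \<Longrightarrow> Qc n k = 0"
proof -
  assume k: "k > n * d"
  have "(n - 1) * d \<le> n * d" by (intro mult_right_mono) auto
  hence "(n - 1) * d < k" using k by linarith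
  thus ?thesis using mw_supp[of "n - 1" k] by (simp add: Qc_def)
qed

lemma Qc_sums: "(\<lambda>k. Qc n k * u ^ k) sums fps_nth (Qu u) n"
  unfolding Qu_def fps_nth_Abs_fps
  by (rule summable_sums, rule summable_finite[of "{..n * d}"]) (auto simp: Qc_supp not_le)

lemma Qfun_eval: "Qfun p q z u = eval_fps (Qu u) z"
  by (simp add: Qfun_def Qser_nth eval_fps_def Qu_def)

lemma at_u1_Qser: "at_u1 (Qser p q) = Qu 1"
  by (simp add: at_u1_def Qser_nth Qu_def)

lemma Qu_nonneg: "u \<ge> 0 \<Longrightarrow> 0 \<le> fps_nth (Qu u) n"
  unfolding Qu_def fps_nth_Abs_fps
  by (rule suminf_nonneg[OF sums_summable[OF Qc_sums]]) (simp add: Qc_nonneg)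

lemma Qk_le: "fps_nth (Qk k) n \<le> fps_nth (Qu 1) n"
  using sum_le_suminf[OF sums_summable[OF Qc_sums[of n 1]], of "{k}"] Qc_nonneg sums_unique[OF Qc_sums[of n 1]]
  by (simp add: Qk_def)

lemma Qu_0: "fps_nth (Qu u) 0 = 0" by (simp add: Qu_def Qc_def)

definition Gs :: "real fps" where "Gs = (inverse (1 - Qu 1))\<^sup>2 * Eser p"

lemma Aser_nth: "fps_nth (fps_nth (Aser p q) n) k = (if k = 0 then 1 else 0) * fps_nth (Eser p) n + fps_nth (Qk k * Gs) n"
proof -
  have "Dser p q = inverse (1 - Qu 1)" by (simp add: Dser_def at_u1_Qser)
  hence "fps_nth (fps_nth (Qser p q * liftz ((Dser p q)\<^sup>2 * Eser p)) n) k = (\<Sum>i=0..n. Qc i k * fps_nth Gs (n - i))"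
    by (simp add: fps_mult_nth[of "Qser p q"] fps_sum_nth liftz_def Gs_def Qser_nth)
  moreover have "fps_nth (Qk k * Gs) n = (\<Sum>i=0..n. Qc i k * fps_nth Gs (n - i))" by (simp add: fps_mult_nth Qk_def)
  moreover have "fps_nth (fps_nth (liftz (Eser p)) n) k = (if k = 0 then 1 else 0) * fps_nth (Eser p) n" by (simp add: liftz_def)
  ultimately show ?thesis by (simp only: Aser_def fps_add_nth)
qed

lemma at_u1_Aser: "fps_nth (at_u1 (Aser p q)) n = fps_nth (Eser p) n + fps_nth (Qu 1 * Gs) n"
proof -
  have "(\<lambda>k. (if k = 0 then 1 else 0) * fps_nth (Eser p) n) sums fps_nth (Eser p) n"
    using sums_finite[of "{0::nat}" "\<lambda>k. (if k = 0 then 1 else 0) * fps_nth (Eser p) n"] by simp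
  moreover have "(\<lambda>k. \<Sum>i=0..n. Qc i k * fps_nth Gs (n - i)) sums (\<Sum>i=0..n. fps_nth (Qu 1) i * fps_nth Gs (n - i))"
    using Qc_sums[of _ 1] by (intro sums_sum sums_mult2) simp
  ultimately have "(\<lambda>k. fps_nth (fps_nth (Aser p q) n) k) sums (fps_nth (Eser p) n + fps_nth (Qu 1 * Gs) n)"
    unfolding Aser_nth fps_mult_nth Qk_def fps_nth_Abs_fps by (rule sums_add)
  thus ?thesis by (simp add: at_u1_def sums_iff)
qed

text \<open>The factor r^n cancels in the quotient, so the series may be studied at the radius of
  their dominant singularity. Excursions without catastrophe contribute to k = 0 only.\<close>

lemma prob_X_rescale:
  assumes r: "r > 0"
  shows "prob_X p q n k = ((if k = 0 then 1 else 0) * fps_nth (fps_rescale r (Eser p)) n + 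
      fps_nth (fps_rescale r (Qk k) * ((inverse (1 - fps_rescale r (Qu 1)))\<^sup>2 * fps_rescale r (Eser p))) n) /
    (fps_nth (fps_rescale r (Eser p)) n + 
      fps_nth (fps_rescale r (Qu 1) * ((inverse (1 - fps_rescale r (Qu 1)))\<^sup>2 * fps_rescale r (Eser p))) n)"
proof -
  have G: "(inverse (1 - fps_rescale r (Qu 1)))\<^sup>2 * fps_rescale r (Eser p) = fps_rescale r Gs"
    unfolding Gs_def fps_rescale_mult power2_eq_square
    by (subst (1 2) fps_rescale_inverse) (auto simp: Qu_0 fps_rescale_one_minus)
  show ?thesis unfolding G fps_rescale_mult[symmetric] fps_rescale_nth prob_X_def Aser_nth at_u1_Aser
    using r by (simp add: distrib_right[symmetric] mult.assoc[symmetric])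
qed

lemma Qk_double_sum:
  assumes z: "z \<ge> 0" "summable (\<lambda>n. fps_nth (Qu u) n * z ^ n)" and u: "u \<ge> 0"
  shows "(\<lambda>k. eval_fps (Qk k) z * u ^ k) sums Qfun p q z u"
proof -
  have "(\<lambda>k. \<Sum>n. Qc n k * u ^ k * z ^ n) sums (\<Sum>n. fps_nth (Qu u) n * z ^ n)"
    using Qc_nonneg u z by (intro nonneg_double_sum(2) sums_mult2 Qc_sums) auto
  moreover have "(\<Sum>n. Qc n k * u ^ k * z ^ n) = eval_fps (Qk k) z * u ^ k" for k
  \<comment> \<open>Summability of \<open>Qk k\<close> is obtained by dividing by u^k; if u^k = 0,
    both sides vanish.\<close>
  proof (cases "u ^ k = 0")
    case False
    have "summable (\<lambda>n. Qc n k * u ^ k * z ^ n)"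
      using Qc_nonneg u z by (intro nonneg_double_sum(1)[OF _ sums_mult2[OF Qc_sums] z(2)]) auto
    moreover have "Qc n k * u ^ k * z ^ n * (1 / u ^ k) = Qc n k * z ^ n" for n using False by (simp del: power_eq_0_iff)
    ultimately have "summable (\<lambda>n. Qc n k * z ^ n)" using summable_mult2[of "\<lambda>n. Qc n k * u ^ k * z ^ n" "1 / u ^ k"] by (simp only:)
    from suminf_mult2[OF this, of "u ^ k"] show ?thesis by (simp add: eval_fps_def Qk_def mult_ac)
  next
    case True
    show ?thesis unfolding True by simp
  qed
  ultimately show ?thesis by (simp add: Qfun_eval eval_fps_def)
qed

end

section \<open>Convergence, positivity and monotonicity of Q\<close>

context catastrophe_walk begin

lemma Eser_eq: "Eser p = Mk p 0" by (simp add: Eser_def)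

lemma rescale_Mk: "fps_rescale \<rho> (Mk p k) = fps_const (1 / \<tau> ^ k) * Mk pt k"
  by (rule fps_ext) (use tau_props in \<open>simp add: Mk_def mw_tilt\<close>)

lemma rescale_E: "fps_rescale \<rho> (Eser p) = tilt.meander_gf 0"
  unfolding Eser_eq rescale_Mk tilt.Mk_0 by simp

lemma Mk_summable: assumes "0 \<le> z" "z \<le> \<rho>" shows "summable (\<lambda>n. mw p n k * z ^ n)"
proof -
  obtain \<eta> where "sqrt_sing (Mk pt k) \<eta>" using tilt.Mk_sing by blast
  hence "abs_sum (fps_rescale \<rho> (Mk p k))" unfolding rescale_Mk using sqrt_sing_abs_sum[OF sqrt_sing_cmult] by blast
  hence "summable (\<lambda>n. \<bar>mw p n k * \<rho> ^ n\<bar>)" by (simp add: abs_sum_def Mk_def)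
  thus ?thesis
  proof (rule summable_comparison_test'[of _ 0])
    fix n
    show "norm (mw p n k * z ^ n) \<le> \<bar>mw p n k * \<rho> ^ n\<bar>"
      using assms power_mono[of z \<rho> n] mw_nonneg[of n k] by (simp add: abs_mult mult_left_mono)
  qed
qed

lemma abs_sum_rescale_E: assumes "0 \<le> z" "z \<le> \<rho>" shows "abs_sum (fps_rescale z (Eser p))" "fps_total (fps_rescale z (Eser p)) > 0"
proof -
  have s: "summable (\<lambda>n. mw p n 0 * z ^ n)" using assms by (rule Mk_summable)
  thus "abs_sum (fps_rescale z (Eser p))" using assms mw_nonneg by (simp add: abs_sum_def Eser_eq Mk_def abs_mult)
  have "(\<Sum>n\<in>{0}. mw p n 0 * z ^ n) \<le> (\<Sum>n. mw p n 0 * z ^ n)" using mw_nonneg assms by (intro sum_le_suminf s) auto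
  thus "fps_total (fps_rescale z (Eser p)) > 0" by (simp add: fps_total_def Eser_eq Mk_def mw_0)
qed

lemma E_lim: "(\<lambda>n. mw pt n 0 * real n powr (3/2)) \<longlonglongrightarrow> 2 * tilt.kap * fps_total (tilt.meander_gf 0) * sqrt_const"
  and E_lim_pos: "2 * tilt.kap * fps_total (tilt.meander_gf 0) * sqrt_const > 0"
proof -
  have "coeff_asymp (tilt.meander_gf 0) (2 * tilt.kap / (1 - 0) * fps_total (tilt.meander_gf 0) * sqrt_const)"
    using tilt.meander_gf_sing(1)[of 0] unfolding sqrt_sing_def by simp
  thus "(\<lambda>n. mw pt n 0 * real n powr (3/2)) \<longlonglongrightarrow> 2 * tilt.kap * fps_total (tilt.meander_gf 0) * sqrt_const"
    unfolding tilt.Mk_0[symmetric] coeff_asymp_def by (simp add: Mk_def)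
  show "2 * tilt.kap * fps_total (tilt.meander_gf 0) * sqrt_const > 0"
    using tilt.kap_pos tilt.meander_gf_sing(2)[of 0] sqrt_const_pos by simp
qed

lemma mw_climb: "p (int d) ^ a * mw p n 0 \<le> mw p (n + a) (a * d)"
proof (induction a)
  case (Suc a)
  have "p (int d) ^ Suc a * mw p n 0 \<le> p (int d) * mw p (n + a) (a * d)"
    using mult_left_mono[OF Suc pnn[of "int d"]] by (simp add: mult.assoc)
  also have "\<dots> = p (int d) * (if int (Suc a * d) - int d \<ge> 0 then mw p (n + a) (nat (int (Suc a * d) - int d)) else 0)"
  proof -
    have e: "int (Suc a * d) - int d = int (a * d)" by simp
    show ?thesis by (simp only: e nat_int of_nat_0_le_iff if_True)
  qed
  also have "\<dots> \<le> mw p (n + Suc a) (Suc a * d)" unfolding add_Suc_right mw_Suc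
    by (rule member_le_sum) (auto simp: steps_def pnn mw_nonneg)
  finally show ?case .
qed simp

text \<open>After an excursion, c + 1 jumps of size d lead above c, where no jump returns exactly to
  0 and a catastrophe is possible. So Q is at least of the size of the excursion series, which
  yields positive coefficients and \<eta> > 0.\<close>

lemma Qu_lower: obtains a K where "K > 0" "\<And>n. K * mw p n 0 \<le> fps_nth (Qu 1) (n + a)"
proof -
  define a where "a = c + 1"
  have "c < a * d"
  proof -
    have "a * 1 \<le> a * d" using d1 by (intro mult_left_mono) auto
    thus ?thesis by (simp add: a_def)
  qed
  hence "- int (a * d) < - int c" by (simp only: neg_less_iff_less of_nat_less_iff)
  hence pz: "p (- int (a * d)) = 0" using supp by blast
  have "cat (a * d)" unfolding cat_def by (rule conjI[OF _ pz]) (use \<open>c < a * d\<close> in linarith)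
  have "q * p (int d) ^ a * mw p n 0 \<le> fps_nth (Qu 1) (n + (a + 1))" for n
  proof -
    have "q * (p (int d) ^ a * mw p n 0) \<le> q * mw p (n + a) (a * d)" using mw_climb q by (intro mult_left_mono) auto
    also have "\<dots> = fps_nth (Qk (a * d)) (n + (a + 1))" using \<open>cat (a * d)\<close> by (simp add: Qk_def Qc_def)
    also have "\<dots> \<le> fps_nth (Qu 1) (n + (a + 1))" by (rule Qk_le)
    finally show ?thesis by (simp add: mult.assoc)
  qed
  moreover have "q * p (int d) ^ a > 0" using q ppos by simp
  ultimately show ?thesis using that by blast
qed

text \<open>Excursions of every large length exist because the constant in their asymptotics is
  positive.\<close>

lemma Qu_pos: obtains N where "\<And>n. n \<ge> N \<Longrightarrow> fps_nth (Qu 1) n > 0"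
proof -
  obtain a K where K: "K > 0" "\<And>n. K * mw p n 0 \<le> fps_nth (Qu 1) (n + a)" by (rule Qu_lower) blast
  have "eventually (\<lambda>n. mw pt n 0 * real n powr (3/2) > 0) sequentially"
    using order_tendstoD(1)[OF E_lim E_lim_pos] .
  then obtain N where N: "\<And>n. n \<ge> N \<Longrightarrow> mw pt n 0 * real n powr (3/2) > 0" by (auto simp: eventually_at_top_linorder)
  have "fps_nth (Qu 1) n > 0" if "n \<ge> N + a" for n
  proof -
    have "mw pt (n - a) 0 > 0" using N[of "n - a"] that tilt.mw_nonneg[of "n - a" 0] by (auto simp: zero_less_mult_iff)
    hence "mw p (n - a) 0 > 0" using mw_nonneg[of "n - a" 0] unfolding mw_tilt by (auto simp: zero_less_mult_iff)
    hence "0 < K * mw p (n - a) 0" using K by simp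
    thus ?thesis using K(2)[of "n - a"] that by simp
  qed
  thus ?thesis using that by blast
qed

lemma Qu_mono: assumes "0 \<le> u" "u \<le> u'" shows "fps_nth (Qu u) n \<le> fps_nth (Qu u') n"
  by (rule sums_le[OF _ Qc_sums Qc_sums]) (use assms Qc_nonneg in \<open>auto intro!: mult_left_mono power_mono\<close>)

lemma Qu_summable_mono:
  assumes "0 \<le> z" "z \<le> z'" "0 \<le> u" "u \<le> u'" "summable (\<lambda>n. fps_nth (Qu u') n * z' ^ n)"
  shows "summable (\<lambda>n. fps_nth (Qu u) n * z ^ n)"
  by (rule summable_comparison_test'[OF assms(5), of 0])
     (use assms Qu_mono[OF assms(3,4)] Qu_nonneg[OF assms(3)] Qu_nonneg[of u'] in \<open>auto intro!: mult_mono power_mono simp: abs_mult\<close>)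

lemma eval_Qu_strict:
  assumes "0 \<le> z" "z < z'" "summable (\<lambda>n. fps_nth (Qu 1) n * z' ^ n)"
  shows "eval_fps (Qu 1) z < eval_fps (Qu 1) z'"
proof -
  obtain N where N: "\<And>n. n \<ge> N \<Longrightarrow> fps_nth (Qu 1) n > 0" by (rule Qu_pos) blast
  have s: "summable (\<lambda>n. fps_nth (Qu 1) n * z ^ n)" using assms by (intro Qu_summable_mono[of z z' 1 1]) auto
  have "0 < (\<Sum>n. fps_nth (Qu 1) n * z' ^ n - fps_nth (Qu 1) n * z ^ n)"
  proof (rule suminf_pos2[of _ "N + 1"])
    show "summable (\<lambda>n. fps_nth (Qu 1) n * z' ^ n - fps_nth (Qu 1) n * z ^ n)" by (rule summable_diff[OF assms(3) s])
    show "0 \<le> fps_nth (Qu 1) n * z' ^ n - fps_nth (Qu 1) n * z ^ n" for n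
      using Qu_nonneg[of 1 n] assms power_mono[of z z' n] by (simp add: mult_left_mono)
    show "0 < fps_nth (Qu 1) (N + 1) * z' ^ (N + 1) - fps_nth (Qu 1) (N + 1) * z ^ (N + 1)"
      using N[of "N + 1"] assms power_strict_mono[of z z' "N + 1"] by simp
  qed
  thus ?thesis using suminf_diff[OF assms(3) s] by (simp add: eval_fps_def)
qed

lemma Qk_abs_sum:
  assumes "0 \<le> z" "summable (\<lambda>n. fps_nth (Qu 1) n * z ^ n)" shows "abs_sum (fps_rescale z (Qk k))"
  unfolding abs_sum_def
proof (rule summable_comparison_test'[OF assms(2), of 0])
  fix n
  have "0 \<le> fps_nth (Qk k) n" by (simp add: Qk_def Qc_nonneg)
  thus "norm \<bar>fps_nth (fps_rescale z (Qk k)) n\<bar> \<le> fps_nth (Qu 1) n * z ^ n"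
    using Qk_le[of k n] assms(1) by (simp add: abs_mult mult_right_mono)
qed

text \<open>
  Beyond the radius of convergence \<open>Qfun\<close> is a junk value and could equal 1, so only minimality of \<open>z0\<close> is claimed.
\<close>
lemma rho0_eqI:
  assumes "0 < z0" "z0 \<le> \<rho>" "summable (\<lambda>n. fps_nth (Qu 1) n * z0 ^ n)" "eval_fps (Qu 1) z0 = 1"
  shows "rho0_exists p c d q" "rho0 p c d q = z0"
proof -
  have in0: "z0 \<in> {z. 0 < z \<and> z \<le> rho p c d \<and> 1 - Qfun p q z 1 = 0}"
    using assms by (simp add: Qfun_eval \<rho>_def)
  thus "rho0_exists p c d q" unfolding rho0_exists_def by blast
  show "rho0 p c d q = z0" unfolding rho0_def
  proof (rule cInf_eq_minimum[OF in0])
    fix z assume z: "z \<in> {z. 0 < z \<and> z \<le> rho p c d \<and> 1 - Qfun p q z 1 = 0}"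
    show "z0 \<le> z"
    proof (rule ccontr)
      assume "\<not> z0 \<le> z"
      hence "eval_fps (Qu 1) z < eval_fps (Qu 1) z0" using z by (intro eval_Qu_strict assms(3)) auto
      thus False using z assms(4) by (simp add: Qfun_eval)
    qed
  qed
qed

section \<open>The supercritical case\<close>

definition limit_law :: bool where
  "limit_law \<longleftrightarrow> (\<exists>w :: nat \<Rightarrow> real. (\<forall>u\<in>{0..1}. (\<lambda>k. w k * u ^ k) sums omega p c d q u) \<and> (\<forall>k. (\<lambda>n. prob_X p q n k) \<longlonglongrightarrow> w k))"

lemma rho0_limit_law:
  assumes z0: "0 < z0" "z0 \<le> \<rho>" "summable (\<lambda>n. fps_nth (Qu 1) n * z0 ^ n)" "eval_fps (Qu 1) z0 = 1"
    and lim: "\<And>k. (\<lambda>n. prob_X p q n k) \<longlonglongrightarrow> eval_fps (Qk k) z0"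
  shows limit_law
  unfolding limit_law_def
proof (intro exI[of _ "\<lambda>k. eval_fps (Qk k) z0"] conjI allI ballI lim)
  fix u :: real assume u: "u \<in> {0..1}"
  have "(\<lambda>k. eval_fps (Qk k) z0 * u ^ k) sums Qfun p q z0 u"
    using z0 u by (intro Qk_double_sum Qu_summable_mono[of z0 z0 u 1]) auto
  thus "(\<lambda>k. eval_fps (Qk k) z0 * u ^ k) sums omega p c d q u" using rho0_eqI[OF z0] by (simp add: omega_def)
qed

text \<open>A partial sum above 1 is meaningful even where Q diverges, which covers z1 = 1/P(1) as
  well as z1 = \<rho>. By continuity some z2 < z1 still has Q(z2) > 1, so the root z0 lies strictly
  inside the disc and z2/z0 is the R > 1 of the renewal theorem.\<close>

lemma supercritical:
  assumes z1: "0 < z1" "z1 \<le> \<rho>" and big: "(\<Sum>n<N. fps_nth (Qu 1) n * z1 ^ n) > 1"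
    and sm: "\<And>z. 0 \<le> z \<Longrightarrow> z < z1 \<Longrightarrow> summable (\<lambda>n. fps_nth (Qu 1) n * z ^ n)"
  shows limit_law
proof -
  have "((\<lambda>z. \<Sum>n<N. fps_nth (Qu 1) n * z ^ n) \<longlongrightarrow> (\<Sum>n<N. fps_nth (Qu 1) n * z1 ^ n)) (at_left z1)"
    by (intro tendsto_intros)
  from order_tendstoD(1)[OF this big] have "\<forall>\<^sub>F z in at_left z1. 1 < (\<Sum>n<N. fps_nth (Qu 1) n * z ^ n)" .
  moreover have "\<forall>\<^sub>F z in at_left z1. 0 < z \<and> z < z1"
    using z1 by (auto simp: eventually_at_left_field intro: exI[of _ 0])
  ultimately have "\<forall>\<^sub>F z in at_left z1. 1 < (\<Sum>n<N. fps_nth (Qu 1) n * z ^ n) \<and> 0 < z \<and> z < z1" by eventually_elim auto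
  from eventually_happens'[OF _ this] obtain z2 where z2: "1 < (\<Sum>n<N. fps_nth (Qu 1) n * z2 ^ n)" "0 < z2" "z2 < z1" by auto
  have s2: "summable (\<lambda>n. fps_nth (Qu 1) n * z2 ^ n)" using z2 by (intro sm) auto
  have big2: "eval_fps (Qu 1) z2 > 1"
    using sum_le_suminf[OF s2, of "{..<N}"] z2 Qu_nonneg[of 1] by (simp add: eval_fps_def)
  have cont: "continuous_on {0..z2} (eval_fps (Qu 1))"
  proof (rule continuous_on_subset[OF continuous_on_eval_fps])
    \<comment> \<open>A point of convergence beyond z2, so that [0,z2] lies in the open disc of
      convergence.\<close>
    define z3 where "z3 = (z2 + z1) / 2"
    have z3: "z2 < z3" "z3 < z1" "0 < z3" using z2 by (auto simp: z3_def)
    have r: "ereal z3 \<le> fps_conv_radius (Qu 1)" unfolding fps_conv_radius_def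
      using conv_radius_geI[OF sm[of z3]] z3 by simp
    show "{0..z2} \<subseteq> eball 0 (fps_conv_radius (Qu 1))"
    proof
      fix z assume "z \<in> {0..z2}"
      hence "ereal (norm z) < ereal z3" using z3 by auto
      hence "ereal (norm z) < fps_conv_radius (Qu 1)" using r by (rule less_le_trans)
      thus "z \<in> eball 0 (fps_conv_radius (Qu 1))" by (simp add: in_eball_iff)
    qed
  qed
  have e0: "eval_fps (Qu 1) 0 = 0" by (simp add: eval_fps_at_0 Qu_0)
  obtain z0 where z0: "0 \<le> z0" "z0 \<le> z2" "eval_fps (Qu 1) z0 = 1"
    using IVT'[of "eval_fps (Qu 1)" 0 1 z2] e0 big2 z2 cont by auto
  have z0p: "0 < z0" using z0 e0 by (cases "z0 = 0") auto
  have z0l: "z0 < z2" using z0 big2 by (cases "z0 = z2") auto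
  have s0: "summable (\<lambda>n. fps_nth (Qu 1) n * z0 ^ n)" using z0 z2 by (intro sm) auto
  have z\<rho>: "z0 \<le> \<rho>" using z0l z2 z1 by linarith
  show ?thesis
  proof (rule rho0_limit_law[OF z0p z\<rho> s0 z0(3)])
    fix k
    obtain N' where N': "\<And>n. n \<ge> N' \<Longrightarrow> fps_nth (Qu 1) n > 0" by (rule Qu_pos) blast
    have "(\<lambda>n. ((if k = 0 then 1 else 0) * fps_nth (fps_rescale z0 (Eser p)) n + 
        fps_nth (fps_rescale z0 (Qk k) * ((inverse (1 - fps_rescale z0 (Qu 1)))\<^sup>2 * fps_rescale z0 (Eser p))) n) /
      (fps_nth (fps_rescale z0 (Eser p)) n + 
        fps_nth (fps_rescale z0 (Qu 1) * ((inverse (1 - fps_rescale z0 (Qu 1)))\<^sup>2 * fps_rescale z0 (Eser p))) n))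
      \<longlonglongrightarrow> fps_total (fps_rescale z0 (Qk k))"
    proof (rule double_pole_ratio)
      show "fps_nth (fps_rescale z0 (Qu 1)) 0 = 0" by (simp add: Qu_0)
      show "0 \<le> fps_nth (fps_rescale z0 (Qu 1)) n" for n using Qu_nonneg[of 1 n] z0p by simp
      show "fps_nth (fps_rescale z0 (Qu 1)) sums 1" 
      proof -
        have "fps_nth (fps_rescale z0 (Qu 1)) = (\<lambda>n. fps_nth (Qu 1) n * z0 ^ n)" by (rule ext) simp
        thus ?thesis using s0 z0(3) by (simp add: sums_iff eval_fps_def)
      qed
      show "fps_nth (fps_rescale z0 (Qu 1)) n > 0" if "n \<ge> N'" for n using N'[OF that] z0p by simp
      show "z2 / z0 > 1" using z0l z0p by simp
      show "summable (\<lambda>n. fps_nth (fps_rescale z0 (Qu 1)) n * (z2 / z0) ^ n)"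
        using s2 z0p by (simp add: power_divide)
      show "abs_sum (fps_rescale z0 (Eser p))" "fps_total (fps_rescale z0 (Eser p)) > 0"
        using abs_sum_rescale_E[of z0] z0p z\<rho> by auto
      show "abs_sum (fps_rescale z0 (Qk k))" using z0p s0 by (intro Qk_abs_sum) auto
    qed
    thus "(\<lambda>n. prob_X p q n k) \<longlonglongrightarrow> eval_fps (Qk k) z0"
      unfolding prob_X_rescale[OF z0p, symmetric] fps_total_rescale .
  qed
qed

section \<open>Non-negative drift: the case \<tau> \<le> 1\<close>

definition mp :: "nat \<Rightarrow> real \<Rightarrow> real" where "mp n u = (\<Sum>k\<le>n * d. mw p n k * u ^ k)"

text \<open>The negative powers of u in P(u) \<open>mp n u\<close>: the steps that leave the
  half-line at time n + 1.\<close>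

definition loss :: "nat \<Rightarrow> real \<Rightarrow> real" where
  "loss n u = (\<Sum>i\<in>steps. \<Sum>m\<le>n * d. if int m + i < 0 then p i * mw p n m * u powi (int m + i) else 0)"

lemma mp_Suc: assumes u: "u > 0" shows "mp (Suc n) u = P u * mp n u - loss n u"
proof -
  have "mp (Suc n) u = (\<Sum>i\<in>steps. \<Sum>k\<le>Suc n * d. if int k - i \<ge> 0 then p i * mw p n (nat (int k - i)) * u ^ k else 0)"
    unfolding mp_def mw_Suc sum_distrib_right by (subst sum.swap) (intro sum.cong refl, simp)
  also have "\<dots> = (\<Sum>i\<in>steps. \<Sum>m\<le>n * d. if int m + i \<ge> 0 then p i * mw p n m * u powi (int m + i) else 0)"
  proof (rule sum.cong[OF refl])
    fix i assume i: "i \<in> steps"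
    show "(\<Sum>k\<le>Suc n * d. if int k - i \<ge> 0 then p i * mw p n (nat (int k - i)) * u ^ k else 0) =
      (\<Sum>m\<le>n * d. if int m + i \<ge> 0 then p i * mw p n m * u powi (int m + i) else 0)"
    proof -
      define S2 where "S2 = {k \<in> {..Suc n * d}. int k - i \<ge> 0 \<and> nat (int k - i) \<le> n * d}"
      define T2 where "T2 = {m \<in> {..n * d}. int m + i \<ge> 0}"
      have "(\<Sum>k\<le>Suc n * d. if int k - i \<ge> 0 then p i * mw p n (nat (int k - i)) * u ^ k else 0) = (\<Sum>k\<in>S2. p i * mw p n (nat (int k - i)) * u ^ k)"
      proof (rule sum.mono_neutral_cong_right)
        have "m \<le> n * d" if "mw p n m \<noteq> 0" for m using mw_supp[of n m] that by (meson not_le)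
        thus "\<forall>k\<in>{..Suc n * d} - S2. (if int k - i \<ge> 0 then p i * mw p n (nat (int k - i)) * u ^ k else 0) = 0"
          by (auto simp: S2_def)
      qed (auto simp: S2_def)
      also have "\<dots> = (\<Sum>m\<in>T2. p i * mw p n m * u powi (int m + i))"
      proof (rule sum.reindex_bij_witness[of _ "\<lambda>m. nat (int m + i)" "\<lambda>k. nat (int k - i)"])
        fix m assume m: "m \<in> T2"
        have "i \<le> int d" using i by (simp add: steps_def)
        moreover have "int m \<le> int (n * d)" using m unfolding of_nat_le_iff T2_def by simp
        ultimately have "int m + i \<le> int (Suc n * d)" by simp
        hence "nat (int m + i) \<le> Suc n * d" by linarith
        thus "nat (int m + i) \<in> S2" using m by (auto simp: S2_def T2_def)
      qed (auto simp: S2_def T2_def)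
      also have "\<dots> = (\<Sum>m\<le>n * d. if int m + i \<ge> 0 then p i * mw p n m * u powi (int m + i) else 0)"
        by (rule sum.mono_neutral_cong_left) (auto simp: T2_def)
      finally show ?thesis .
    qed
  qed
  finally have 1: "mp (Suc n) u = \<dots>" .
  have "P u * mp n u = (\<Sum>i\<in>steps. \<Sum>m\<le>n * d. p i * mw p n m * u powi (int m + i))"
    unfolding P_eq mp_def sum_product using u by (intro sum.cong refl) (simp add: power_int_add mult_ac)
  also have "\<dots> = mp (Suc n) u + loss n u" unfolding 1 loss_def sum.distrib[symmetric] by (intro sum.cong refl) auto
  finally show ?thesis by simp
qed

text \<open>A step out of the half-line ends at altitude -1 or lower, and u \<le> 1, so each term
  gains at least the factor 1/u.\<close>

lemma loss_ge: assumes u: "0 < u" "u \<le> 1" shows "loss n 1 / u \<le> loss n u"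
  unfolding loss_def sum_divide_distrib
proof (intro sum_mono)
  fix i m
  show "(if int m + i < 0 then p i * mw p n m * 1 powi (int m + i) else 0) / u \<le> (if int m + i < 0 then p i * mw p n m * u powi (int m + i) else 0)"
  proof (cases "int m + i < 0")
    case True
    have "u powi (-1) \<le> u powi (int m + i)" using True u by (intro power_int_decreasing) auto
    hence "1 / u \<le> u powi (int m + i)" by (simp add: power_int_minus divide_inverse)
    hence "(p i * mw p n m) * (1 / u) \<le> (p i * mw p n m) * u powi (int m + i)" using pnn mw_nonneg by (intro mult_left_mono) auto
    thus ?thesis using True by simp
  qed simp
qed

lemma loss_nonneg: "0 \<le> loss n 1"
  unfolding loss_def using pnn mw_nonneg by (intro sum_nonneg) auto

lemma mp_nonneg: "0 \<le> u \<Longrightarrow> 0 \<le> mp n u" unfolding mp_def using mw_nonneg by (intro sum_nonneg) auto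

lemma mp_le: "mp n 1 \<le> P 1 ^ n"
proof (induction n)
  case 0 show ?case by (simp add: mp_def mw_0)
next
  case (Suc n)
  have "mp (Suc n) 1 \<le> P 1 * mp n 1" using mp_Suc[of 1 n] loss_nonneg[of n] by simp
  also have "\<dots> \<le> P 1 * P 1 ^ n" using Suc P_pos[of 1] by (intro mult_left_mono) auto
  finally show ?case by simp
qed

lemma Qu_1_eq: "fps_nth (Qu 1) (Suc n) = q * (\<Sum>k\<le>n * d. if cat k then mw p n k else 0)"
proof -
  have "fps_nth (Qu 1) (Suc n) = (\<Sum>k. Qc (Suc n) k)" by (simp add: Qu_def)
  also have "\<dots> = (\<Sum>k\<le>n * d. Qc (Suc n) k)" by (rule suminf_finite) (auto simp: Qc_def mw_supp not_le)
  also have "\<dots> = q * (\<Sum>k\<le>n * d. if cat k then mw p n k else 0)"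
    unfolding sum_distrib_left by (intro sum.cong refl) (auto simp: Qc_def)
  finally show ?thesis .
qed

text \<open>
  If \<open>Q\<close> converged at \<open>1 / P 1\<close>, the walk weighted by \<open>p i / P 1\<close> would have a finite mean exit time from
  the half-line, and comparing the kernel equation at \<open>u < 1\<close> and at \<open>1\<close> would make its drift negative.
\<close>
lemma tau_le_1_limit_law: assumes t1: "\<tau> \<le> 1" shows limit_law
proof -
  define z1 where "z1 = 1 / P 1"
  have P1: "P 1 > 0" by (rule P_pos) simp
  have z1: "z1 > 0" "z1 * P 1 = 1" using P1 by (auto simp: z1_def)
  have drift1: "drift x \<ge> 0" if "\<tau> \<le> x" for x
    using drift_mono[of \<tau> x] tau_props that by (cases "\<tau> = x") auto
  have "P \<tau> \<le> P 1"
  proof (rule DERIV_nonneg_imp_nondecreasing[OF t1])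
    fix x assume "\<tau> \<le> x" "x \<le> 1"
    hence "x > 0" using tau_props by linarith
    thus "\<exists>y. (P has_real_derivative y) (at x) \<and> y \<ge> 0" using P_deriv[of x] drift1[OF \<open>\<tau> \<le> x\<close>] by auto
  qed
  hence z\<rho>: "z1 \<le> \<rho>" using P_pos[OF tau_props(1)] by (simp add: z1_def \<rho>_def rho_def \<tau>_def frac_le)
  have Qle: "fps_nth (Qu 1) (Suc n) \<le> q * mp n 1" for n
    unfolding Qu_1_eq mp_def using q mw_nonneg by (intro mult_left_mono sum_mono) auto
  have sm: "summable (\<lambda>n. fps_nth (Qu 1) n * z ^ n)" if z: "0 \<le> z" "z < z1" for z
  proof -
    have "summable (\<lambda>n. fps_nth (Qu 1) (Suc n) * z ^ Suc n)"
    proof (rule summable_comparison_test'[of "\<lambda>n. (q * z) * (P 1 * z) ^ n" 0])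
      have "P 1 * z < P 1 * z1" using z P1 by simp
      hence "norm (P 1 * z) < 1" using z z1 P1 by (simp add: abs_mult mult.commute)
      thus "summable (\<lambda>n. (q * z) * (P 1 * z) ^ n)" by (intro summable_mult summable_geometric)
      fix n
      have "fps_nth (Qu 1) (Suc n) \<le> q * P 1 ^ n" using Qle[of n] mult_left_mono[OF mp_le[of n], of q] q by linarith
      hence "fps_nth (Qu 1) (Suc n) * z ^ Suc n \<le> q * P 1 ^ n * z ^ Suc n" using z by (intro mult_right_mono) auto
      thus "norm (fps_nth (Qu 1) (Suc n) * z ^ Suc n) \<le> (q * z) * (P 1 * z) ^ n"
        using Qu_nonneg[of 1 "Suc n"] z by (simp add: power_mult_distrib mult_ac)
    qed
    thus ?thesis using summable_Suc_iff[of "\<lambda>n. fps_nth (Qu 1) n * z ^ n"] by blast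
  qed
  have ns: "\<not> summable (\<lambda>n. fps_nth (Qu 1) n * z1 ^ n)"
  proof
    assume s: "summable (\<lambda>n. fps_nth (Qu 1) n * z1 ^ n)"
    have s1: "summable (\<lambda>n. mp n 1 * z1 ^ n)"
    proof (rule summable_comparison_test'[of "\<lambda>n. (1 / (q * z1)) * (fps_nth (Qu 1) (Suc n) * z1 ^ Suc n) + (\<Sum>j\<le>c. mw p n j * z1 ^ n)" 0])
      show "summable (\<lambda>n. (1 / (q * z1)) * (fps_nth (Qu 1) (Suc n) * z1 ^ Suc n) + (\<Sum>j\<le>c. mw p n j * z1 ^ n))"
        using s summable_Suc_iff[of "\<lambda>n. fps_nth (Qu 1) n * z1 ^ n"] z1 z\<rho>
        by (intro summable_add summable_mult summable_sum Mk_summable) auto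
      fix n
      have "mp n 1 \<le> (\<Sum>k\<le>n * d. if cat k then mw p n k else 0) + (\<Sum>j\<le>c. mw p n j)"
      proof -
        have "mp n 1 = (\<Sum>k\<le>n * d. if cat k then mw p n k else 0) + (\<Sum>k\<le>n * d. if cat k then 0 else mw p n k)"
          unfolding mp_def sum.distrib[symmetric] by (intro sum.cong) auto
        also have "(\<Sum>k\<le>n * d. if cat k then 0 else mw p n k) = (\<Sum>k\<in>{k\<in>{..n * d}. \<not> cat k}. mw p n k)"
          by (subst sum.inter_filter) (auto intro!: sum.cong)
        also have "\<dots> \<le> (\<Sum>j\<le>c. mw p n j)"
        proof (rule sum_mono2)
          show "{k\<in>{..n * d}. \<not> cat k} \<subseteq> {..c}" using supp by (force simp: cat_def)
        qed (auto simp: mw_nonneg)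
        finally show ?thesis by simp
      qed
      also have "(\<Sum>k\<le>n * d. if cat k then mw p n k else 0) = fps_nth (Qu 1) (Suc n) / q" using q by (simp add: Qu_1_eq)
      finally have "mp n 1 * z1 ^ n \<le> (fps_nth (Qu 1) (Suc n) / q + (\<Sum>j\<le>c. mw p n j)) * z1 ^ n" using z1 by (intro mult_right_mono) auto
      also have "\<dots> = (1 / (q * z1)) * (fps_nth (Qu 1) (Suc n) * z1 ^ Suc n) + (\<Sum>j\<le>c. mw p n j * z1 ^ n)"
        using z1 by (simp add: distrib_right sum_distrib_right)
      finally show "norm (mp n 1 * z1 ^ n) \<le> (1 / (q * z1)) * (fps_nth (Qu 1) (Suc n) * z1 ^ Suc n) + (\<Sum>j\<le>c. mw p n j * z1 ^ n)"
        using z1 mp_nonneg[of 1 n] by simp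
    qed
    define A where "A = (\<Sum>n. mp n 1 * z1 ^ n)"
    have mp0: "mp 0 u = 1" for u by (simp add: mp_def mw_0)
    have "(\<Sum>n\<in>{0}. mp n 1 * z1 ^ n) \<le> A" unfolding A_def using mp_nonneg z1 by (intro sum_le_suminf s1) auto
    hence A1: "A \<ge> 1" by (simp add: mp0)
    \<comment> \<open>Since z1 P(1) = 1, the kernel equation summed at 1 says that the total loss
      weighs exactly 1. At u it weighs at least 1/u by \<open>loss_ge\<close>, which bounds (P(u) z1
      - 1) M(z1,u) from below.\<close>
    have key: "P u * z1 - 1 \<ge> (1 - u) / A" if u: "0 < u" "u < 1" for u
    proof -
      have mpu: "mp n u \<le> mp n 1" for n unfolding mp_def
        using u mw_nonneg by (intro sum_mono mult_left_mono) (auto simp: power_le_one)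
      have s2: "summable (\<lambda>n. mp n u * z1 ^ n)"
        by (rule summable_comparison_test'[OF s1, of 0]) (use mpu mp_nonneg[of u] u z1 in \<open>auto intro!: mult_right_mono\<close>)
      define S where "S = (\<Sum>n. mp n u * z1 ^ n)"
      have SA: "S \<le> A" unfolding S_def A_def using mpu z1 by (intro suminf_le s1 s2 mult_right_mono) auto
      have S0: "S \<ge> 0" unfolding S_def using mp_nonneg[of u] u z1 by (intro suminf_nonneg s2) auto
      have pt: "(mp (Suc n) u - P u * mp n u) * z1 ^ Suc n \<le> (1 / u) * ((mp (Suc n) 1 - P 1 * mp n 1) * z1 ^ Suc n)" for n
      proof -
        have "mp (Suc n) u - P u * mp n u \<le> (1 / u) * (mp (Suc n) 1 - P 1 * mp n 1)"
          using mp_Suc[OF u(1), of n] mp_Suc[of 1 n] loss_ge[of u n] u by simp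
        hence "(mp (Suc n) u - P u * mp n u) * z1 ^ Suc n \<le> (1 / u) * (mp (Suc n) 1 - P 1 * mp n 1) * z1 ^ Suc n"
          using z1 by (intro mult_right_mono) auto
        thus ?thesis by (simp only: mult.assoc)
      qed
      have sh: "(\<lambda>n. (mp (Suc n) v - P v * mp n v) * z1 ^ Suc n) sums (((\<Sum>n. mp n v * z1 ^ n) - 1) - P v * z1 * (\<Sum>n. mp n v * z1 ^ n))"
        if "summable (\<lambda>n. mp n v * z1 ^ n)" for v
      proof -
        have "(\<lambda>n. mp n v * z1 ^ n) sums (\<Sum>n. mp n v * z1 ^ n)" using that by (rule summable_sums)
        moreover from this have "(\<lambda>n. mp (Suc n) v * z1 ^ Suc n) sums ((\<Sum>n. mp n v * z1 ^ n) - mp 0 v * z1 ^ 0)"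
          by (subst sums_Suc_iff) simp
        ultimately have "(\<lambda>n. mp (Suc n) v * z1 ^ Suc n - P v * z1 * (mp n v * z1 ^ n)) sums 
           (((\<Sum>n. mp n v * z1 ^ n) - mp 0 v * z1 ^ 0) - P v * z1 * (\<Sum>n. mp n v * z1 ^ n))"
          by (intro sums_diff sums_mult)
        thus ?thesis by (simp add: mp0 algebra_simps)
      qed
      have "(S - 1) - P u * z1 * S \<le> (1 / u) * ((A - 1) - P 1 * z1 * A)"
        unfolding S_def A_def by (rule sums_le[OF pt sh[OF s2] sums_mult[OF sh[OF s1]]])
      also have "\<dots> = - (1 / u)" using z1 by (simp add: mult.commute[of "P 1"])
      finally have "1 / u - 1 \<le> (P u * z1 - 1) * S" by (simp add: algebra_simps)
      moreover have "1 - u \<le> 1 / u - 1"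
      proof -
        have "0 \<le> (1 - u) * (1 - u) / u" using u by simp
        also have "(1 - u) * (1 - u) / u = 1 / u - 1 - (1 - u)" using u by (simp add: field_simps)
        finally show ?thesis by simp
      qed
      ultimately have 1: "1 - u \<le> (P u * z1 - 1) * S" by linarith
      have "P u * z1 - 1 > 0"
      proof (rule ccontr)
        assume "\<not> P u * z1 - 1 > 0"
        hence "(P u * z1 - 1) * S \<le> 0" using S0 by (intro mult_nonpos_nonneg) auto
        thus False using 1 u by linarith
      qed
      hence "(P u * z1 - 1) * S \<le> (P u * z1 - 1) * A" using SA by (intro mult_left_mono) auto
      hence "1 - u \<le> (P u * z1 - 1) * A" using 1 by linarith
      thus ?thesis using A1 by (simp add: pos_divide_le_eq)
    qed
    \<comment> \<open>Division by u - 1 < 0 turns the bound \<open>key\<close> into P'(1) \<le>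
      -P(1)/A < 0, against the non-negative drift.\<close>
    have "((\<lambda>u. (P u - P 1) / (u - 1)) \<longlongrightarrow> drift 1 / 1) (at_left 1)"
      using P_deriv[of 1] unfolding has_field_derivative_iff by (simp add: filterlim_at_split)
    moreover have "\<forall>\<^sub>F u in at_left (1::real). (P u - P 1) / (u - 1) \<le> - (P 1 / A)"
    proof -
      have "(P u - P 1) / (u - 1) \<le> - (P 1 / A)" if u: "0 < u" "u < 1" for u
      proof -
        have "(1 - u) / A * P 1 \<le> (P u * z1 - 1) * P 1" using key[OF u] P1 by (intro mult_right_mono) auto
        also have "(P u * z1 - 1) * P 1 = P u - P 1" using z1 by (simp add: left_diff_distrib mult.assoc)
        finally have "P 1 / A * (1 - u) \<le> P u - P 1" by (simp add: mult.commute)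
        hence "- (P 1 / A) * (u - 1) \<le> P u - P 1" by (simp only: mult_minus_left right_diff_distrib minus_diff_eq)
        thus ?thesis using u by (subst neg_divide_le_eq) simp_all
      qed
      thus ?thesis by (auto simp: eventually_at_left_field intro!: exI[of _ 0])
    qed
    ultimately have "drift 1 / 1 \<le> - (P 1 / A)" by (rule tendsto_upperbound) simp
    moreover have "P 1 / A > 0" using P1 A1 by simp
    ultimately show False using drift1[of 1] t1 by simp
  qed
  have "\<exists>N. (\<Sum>n<N. fps_nth (Qu 1) n * z1 ^ n) > 1"
  proof (rule ccontr)
    assume "\<nexists>N. (\<Sum>n<N. fps_nth (Qu 1) n * z1 ^ n) > 1"
    hence "(\<Sum>n<N. fps_nth (Qu 1) n * z1 ^ n) \<le> 1" for N by (simp add: not_less)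
    hence "summable (\<lambda>n. fps_nth (Qu 1) n * z1 ^ n)" using Qu_nonneg[of 1] z1 by (intro summableI_nonneg_bounded[of _ 1]) auto
    thus False using ns by blast
  qed
  then obtain N where "(\<Sum>n<N. fps_nth (Qu 1) n * z1 ^ n) > 1" ..
  from supercritical[OF z1(1) z\<rho> this sm] show ?thesis .
qed

end

section \<open>Negative drift: the case \<tau> > 1\<close>

lemma sqrt_sing_diff: "sqrt_sing f a \<Longrightarrow> sqrt_sing g b \<Longrightarrow> sqrt_sing (f - g) (a - b)"
  using sqrt_sing_add[of f a "fps_const (-1) * g" "-1 * b"] sqrt_sing_cmult[of g b "-1"] 
  by (simp flip: fps_const_neg)

context catastrophe_walk begin

text \<open>Tilting replaces u by u/\<tau>, which is below 1 for u < \<tau>; there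
  \<open>meander_gf\<close> has its square-root expansion.\<close>

lemma rescale_Qu:
  assumes u: "0 \<le> u" "u < \<tau>"
  shows "fps_rescale \<rho> (Qu u) = fps_X * (fps_const (q * \<rho>) * (tilt.meander_gf (u / \<tau>) - Mk pt 0 - 
     (\<Sum>j\<in>{j. 0 < j \<and> p (- int j) \<noteq> 0}. fps_const ((u / \<tau>) ^ j) * Mk pt j)))"
proof (rule fps_ext)
  fix n
  define J where "J = {j::nat. 0 < j \<and> p (- int j) \<noteq> 0}"
  have fJ: "finite J" using finite_J by (simp add: J_def)
  show "fps_nth (fps_rescale \<rho> (Qu u)) n = fps_nth (fps_X * (fps_const (q * \<rho>) * (tilt.meander_gf (u / \<tau>) - Mk pt 0 - 
     (\<Sum>j\<in>{j. 0 < j \<and> p (- int j) \<noteq> 0}. fps_const ((u / \<tau>) ^ j) * Mk pt j)))) n"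
  proof (cases n)
    case 0 thus ?thesis by (simp add: Qu_0)
  next
    case (Suc m)
    define t where "t = u / \<tau>"
    have s1: "(\<lambda>k. mw pt m k * t ^ k) sums eval_fps (tilt.meander_poly m) t"
      unfolding eval_fps_def tilt.meander_poly_def fps_nth_Abs_fps
      by (rule summable_sums, rule summable_finite[of "{..m * d}"]) (auto simp: tilt.mw_supp not_le)
    have s2: "(\<lambda>k. if k = 0 then mw pt m k * t ^ k else 0) sums mw pt m 0"
      using sums_single[of 0 "\<lambda>k. mw pt m k * t ^ k"] by simp
    have s3: "(\<lambda>k. if k \<in> J then mw pt m k * t ^ k else 0) sums (\<Sum>j\<in>J. mw pt m j * t ^ j)"
      using fJ by (rule sums_If_finite_set)
    have "(\<lambda>k. Qc (Suc m) k * u ^ k * \<rho> ^ Suc m) sums (fps_nth (Qu u) (Suc m) * \<rho> ^ Suc m)"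
      by (intro sums_mult2 Qc_sums)
    moreover have "Qc (Suc m) k * u ^ k * \<rho> ^ Suc m = q * \<rho> * (mw pt m k * t ^ k - (if k = 0 then mw pt m k * t ^ k else 0) - (if k \<in> J then mw pt m k * t ^ k else 0))" for k
    proof -
      have "mw pt m k * t ^ k = mw p m k * u ^ k * \<rho> ^ m" using tau_props by (simp add: mw_tilt t_def power_divide)
      thus ?thesis by (auto simp: Qc_def cat_def J_def)
    qed
    ultimately have "(\<lambda>k. q * \<rho> * (mw pt m k * t ^ k - (if k = 0 then mw pt m k * t ^ k else 0) - (if k \<in> J then mw pt m k * t ^ k else 0))) sums (fps_nth (Qu u) (Suc m) * \<rho> ^ Suc m)" by (simp only:)
    moreover have "(\<lambda>k. q * \<rho> * (mw pt m k * t ^ k - (if k = 0 then mw pt m k * t ^ k else 0) - (if k \<in> J then mw pt m k * t ^ k else 0))) sums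
      (q * \<rho> * (eval_fps (tilt.meander_poly m) t - mw pt m 0 - (\<Sum>j\<in>J. mw pt m j * t ^ j)))"
      by (intro sums_mult sums_diff s1 s2 s3)
    ultimately have "fps_nth (Qu u) (Suc m) * \<rho> ^ Suc m = q * \<rho> * (eval_fps (tilt.meander_poly m) t - mw pt m 0 - (\<Sum>j\<in>J. mw pt m j * t ^ j))"
      by (rule sums_unique2)
    thus ?thesis unfolding Suc J_def[symmetric] t_def[symmetric]
      by (simp add: tilt.meander_gf_def Mk_def fps_sum_nth mult.commute)
  qed
qed

lemma sing_Qu: assumes u: "0 \<le> u" "u < \<tau>" shows "\<exists>\<eta>. sqrt_sing (fps_rescale \<rho> (Qu u)) \<eta>"
proof -
  define t where "t = u / \<tau>"
  have t: "0 \<le> t" "t < 1" using u by (auto simp: t_def)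
  obtain \<eta> where \<eta>: "\<And>k. sqrt_sing (Mk pt k) (\<eta> k)" using tilt.Mk_sing by metis
  have "sqrt_sing (\<Sum>j\<in>{j. 0 < j \<and> p (- int j) \<noteq> 0}. fps_const (t ^ j) * Mk pt j) (\<Sum>j\<in>{j. 0 < j \<and> p (- int j) \<noteq> 0}. t ^ j * \<eta> j)"
    by (intro sqrt_sing_sum sqrt_sing_cmult \<eta>)
  from sqrt_sing_X_mult[OF sqrt_sing_cmult[OF sqrt_sing_diff[OF sqrt_sing_diff[OF tilt.meander_gf_sing(1)[OF t] \<eta>[of 0]] this], of "q * \<rho>"]]
  show ?thesis unfolding rescale_Qu[OF u] t_def[symmetric] ..
qed

lemma sing_Qk: "\<exists>\<eta>. sqrt_sing (fps_rescale \<rho> (Qk k)) \<eta>"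
proof -
  obtain \<eta> where \<eta>: "sqrt_sing (Mk pt k) \<eta>" using tilt.Mk_sing by blast
  have "fps_rescale \<rho> (Qk k) = fps_X * (fps_const (if cat k then q * \<rho> / \<tau> ^ k else 0) * Mk pt k)"
  proof (rule fps_ext)
    fix n show "fps_nth (fps_rescale \<rho> (Qk k)) n = fps_nth (fps_X * (fps_const (if cat k then q * \<rho> / \<tau> ^ k else 0) * Mk pt k)) n"
      using tau_props by (cases n) (auto simp: Qk_def Qc_def Mk_def mw_tilt)
  qed
  thus ?thesis using sqrt_sing_X_mult[OF sqrt_sing_cmult[OF \<eta>]] by metis
qed

text \<open>Rescaling by \<rho> turns the expansion at 1 into the one that defines
  \<open>eta\<close>, whose uniqueness identifies the two constants.\<close>

lemma eta_eq:
  assumes "sqrt_sing (fps_rescale \<rho> (Qu u)) h" shows "eta p c d q u = h"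
proof -
  obtain K where K: "\<And>x. 0 < x \<Longrightarrow> x < 1 \<Longrightarrow> \<bar>eval_fps (fps_rescale \<rho> (Qu u)) x - (fps_total (fps_rescale \<rho> (Qu u)) - h * sqrt (1 - x))\<bar> \<le> K * (1 - x)"
    using sqrt_singE[OF assms] by blast
  show ?thesis unfolding eta_def \<rho>_def[symmetric]
  proof (rule sqrt_expansion_unique[OF rho_props(1)])
    fix z assume z: "0 < z" "z < \<rho>"
    have "eval_fps (fps_rescale \<rho> (Qu u)) (z / \<rho>) = Qfun p q z u" using rho_props by (simp add: eval_fps_rescale Qfun_eval)
    thus "\<bar>Qfun p q z u - (Qfun p q \<rho> u - h * sqrt (1 - z / \<rho>))\<bar> \<le> K * (1 - z / \<rho>)"
      using K[of "z / \<rho>"] z by (simp add: fps_total_rescale Qfun_eval)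
  qed
qed

text \<open>\<open>Qu_lower\<close> bounds the coefficients of Q below by shifted excursions, whose
  asymptotic constant is positive.\<close>

lemma eta_pos:
  assumes "sqrt_sing (fps_rescale \<rho> (Qu 1)) \<eta>" shows "\<eta> > 0"
proof -
  obtain a K where K: "K > 0" "\<And>n. K * mw p n 0 \<le> fps_nth (Qu 1) (n + a)" by (rule Qu_lower) blast
  define L where "L = 2 * tilt.kap * fps_total (tilt.meander_gf 0) * sqrt_const"
  have "(\<lambda>n. fps_nth (fps_rescale \<rho> (Qu 1)) n * real n powr (3/2)) \<longlonglongrightarrow> \<eta> * sqrt_const"
    using assms by (simp add: sqrt_sing_def coeff_asymp_def)
  hence lim1: "(\<lambda>n. fps_nth (fps_rescale \<rho> (Qu 1)) (n + a) * real (n + a) powr (3/2)) \<longlonglongrightarrow> \<eta> * sqrt_const" by (rule LIMSEQ_ignore_initial_segment)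
  have lim2: "(\<lambda>n. (K * \<rho> ^ a) * (mw pt n 0 * real n powr (3/2))) \<longlonglongrightarrow> (K * \<rho> ^ a) * L"
    unfolding L_def by (intro tendsto_mult_left E_lim)
  have "(K * \<rho> ^ a) * L \<le> \<eta> * sqrt_const"
  proof (rule LIMSEQ_le[OF lim2 lim1])
    have "(K * \<rho> ^ a) * (mw pt n 0 * real n powr (3/2)) \<le> fps_nth (fps_rescale \<rho> (Qu 1)) (n + a) * real (n + a) powr (3/2)" for n
    proof -
      have "(K * \<rho> ^ a) * (mw pt n 0 * real n powr (3/2)) = ((K * mw p n 0) * \<rho> ^ (n + a)) * real n powr (3/2)"
        by (simp add: mw_tilt power_add mult_ac)
      also have "\<dots> \<le> (fps_nth (Qu 1) (n + a) * \<rho> ^ (n + a)) * real (n + a) powr (3/2)"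
        using K(2)[of n] K(1) rho_props(1) Qu_nonneg[of 1 "n + a"] by (intro mult_mono powr_mono2) auto
      finally show ?thesis by simp
    qed
    thus "\<exists>N. \<forall>n\<ge>N. (K * \<rho> ^ a) * (mw pt n 0 * real n powr (3/2)) \<le> fps_nth (fps_rescale \<rho> (Qu 1)) (n + a) * real (n + a) powr (3/2)" by blast
  qed
  moreover have "(K * \<rho> ^ a) * L > 0" 
  proof -
    have "L > 0" unfolding L_def by (rule E_lim_pos)
    thus ?thesis using K(1) rho_props(1) by simp
  qed
  ultimately have "0 < \<eta> * sqrt_const" by linarith
  thus ?thesis using sqrt_const_pos by (simp add: zero_less_mult_iff)
qed

text \<open>Q converges at \<rho> with a square-root expansion, and its value there decides: above 1
  there is a root inside the disc, at 1 the root coincides with the singularity, below 1 there is no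
  root and all singularities are of square-root type.\<close>

lemma tau_gt_1_limit_law: assumes t1: "\<tau> > 1" shows limit_law
proof -
  define Q where "Q = fps_rescale \<rho> (Qu 1)"
  define e where "e = fps_rescale \<rho> (Eser p)"
  obtain \<eta> where \<eta>: "sqrt_sing Q \<eta>" using sing_Qu[of 1] t1 unfolding Q_def by auto
  have \<eta>p: "\<eta> > 0" using eta_pos \<eta> unfolding Q_def by blast
  have aQ: "abs_sum Q" using \<eta> by (rule sqrt_sing_abs_sum)
  have Q0: "fps_nth Q 0 = 0" by (simp add: Q_def Qu_0)
  have Qnn: "0 \<le> fps_nth Q n" for n using Qu_nonneg[of 1 n] rho_props by (simp add: Q_def)
  have s\<rho>: "summable (\<lambda>n. fps_nth (Qu 1) n * \<rho> ^ n)" 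
  proof -
    have "fps_nth Q = (\<lambda>n. fps_nth (Qu 1) n * \<rho> ^ n)" unfolding Q_def by (rule ext) simp
    thus ?thesis using abs_sum_summable[OF aQ] by simp
  qed
  have tQ: "fps_total Q = eval_fps (Qu 1) \<rho>" by (simp add: Q_def fps_total_rescale)
  have sm: "summable (\<lambda>n. fps_nth (Qu u) n * z ^ n)" if "0 \<le> z" "z \<le> \<rho>" "0 \<le> u" "u \<le> 1" for z u
    using that s\<rho> by (intro Qu_summable_mono[of z \<rho> u 1]) auto
  have e0: "abs_sum e" "fps_total e > 0" using abs_sum_rescale_E[of \<rho>] rho_props by (auto simp: e_def)
  have prob: "prob_X p q n k = ((if k = 0 then 1 else 0) * fps_nth e n + fps_nth (fps_rescale \<rho> (Qk k) * ((inverse (1 - Q))\<^sup>2 * e)) n) /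
    (fps_nth e n + fps_nth (Q * ((inverse (1 - Q))\<^sup>2 * e)) n)" for n k
    using prob_X_rescale[OF rho_props(1), of n k] by (simp only: Q_def e_def)
  consider "fps_total Q > 1" | "fps_total Q = 1" | "fps_total Q < 1" by linarith
  thus ?thesis
  proof cases
    case 1
    have "(\<lambda>N. \<Sum>n<N. fps_nth (Qu 1) n * \<rho> ^ n) \<longlonglongrightarrow> eval_fps (Qu 1) \<rho>"
      unfolding eval_fps_def by (rule summable_LIMSEQ[OF s\<rho>])
    from order_tendstoD(1)[OF this, of 1] 1 tQ obtain N where "(\<Sum>n<N. fps_nth (Qu 1) n * \<rho> ^ n) > 1"
      by (auto simp: eventually_at_top_linorder)
    from supercritical[OF rho_props(1) order_refl this] sm show ?thesis by auto
  next
    case 2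
    obtain a C where C: "a > 0" "\<And>x. 0 < x \<Longrightarrow> x < 1 \<Longrightarrow> a * sqrt (1 - x) \<le> 1 - eval_fps Q x"
      "\<And>x. 0 < x \<Longrightarrow> x < 1 \<Longrightarrow> 1 - eval_fps Q x \<le> C * sqrt (1 - x)"
      using sqrt_sing_critical_bounds[OF \<eta> Qnn 2 \<eta>p] by blast
    interpret critical_renewal Q "\<eta> * sqrt_const" a C
      using Q0 Qnn \<eta> \<eta>p sqrt_const_pos 2 C by unfold_locales (auto simp: sqrt_sing_def)
    show ?thesis
    proof (rule rho0_limit_law[OF rho_props(1) order_refl s\<rho>])
      show "eval_fps (Qu 1) \<rho> = 1" using 2 tQ by simp
      fix k
      have "(\<lambda>n. ((if k = 0 then 1 else 0) * fps_nth e n + fps_nth (fps_rescale \<rho> (Qk k) * ((inverse (1 - Q))\<^sup>2 * e)) n) /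
         (fps_nth e n + fps_nth (Q * ((inverse (1 - Q))\<^sup>2 * e)) n)) \<longlonglongrightarrow> fps_total (fps_rescale \<rho> (Qk k))"
      proof (rule critical_ratio[OF e0(1)])
        show "0 \<le> fps_nth e n" for n using mw_nonneg rho_props by (simp add: e_def Eser_eq Mk_def)
        show "0 < fps_nth e 0" by (simp add: e_def Eser_eq Mk_def mw_0)
        show "abs_sum (fps_rescale \<rho> (Qk k))" using rho_props s\<rho> by (intro Qk_abs_sum) auto
      qed
      thus "(\<lambda>n. prob_X p q n k) \<longlonglongrightarrow> eval_fps (Qk k) \<rho>" unfolding prob fps_total_rescale .
    qed
  next
    case 3
    have ne: "\<not> rho0_exists p c d q"
    proof
      assume "rho0_exists p c d q"
      then obtain z where z: "0 < z" "z \<le> \<rho>" "eval_fps (Qu 1) z = 1" unfolding rho0_exists_def by (auto simp: Qfun_eval \<rho>_def)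
      have "eval_fps (Qu 1) z \<le> eval_fps (Qu 1) \<rho>"
        using eval_Qu_strict[OF _ _ s\<rho>, of z] z by (cases "z = \<rho>") auto
      thus False using z 3 tQ by linarith
    qed
    define dr where "dr = 1 / (1 - fps_total Q)"
    have dr: "dr > 0" using 3 by (simp add: dr_def)
    define \<kappa> where "\<kappa> = 2 * tilt.kap"
    have \<kappa>: "\<kappa> > 0" using tilt.kap_pos by (simp add: \<kappa>_def)
    \<comment> \<open>The coefficient of Q(\<rho>,u) in \<open>omega\<close>, with \<kappa> =
      C/\<tau> and dr = D(\<rho>).\<close>
    define W where "W = \<kappa> * dr\<^sup>2 + 2 * \<eta> * dr ^ 3"
    define den where "den = \<kappa> + W * fps_total Q + \<eta> * dr\<^sup>2"
    have ce: "coeff_asymp e (\<kappa> * fps_total e * sqrt_const)"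
      using tilt.meander_gf_sing(1)[of 0] unfolding e_def rescale_E sqrt_sing_def \<kappa>_def by simp
    have cQ: "coeff_asymp Q (\<eta> * sqrt_const)" using \<eta> by (simp add: sqrt_sing_def)
    define s where "s = sqrt_const * fps_total e"
    have s: "s > 0" using sqrt_const_pos e0 by (simp add: s_def)
    have cf: "coeff_asymp (f * ((inverse (1 - Q))\<^sup>2 * e)) (s * (h * dr\<^sup>2 + W * fps_total f))" if "sqrt_sing f h" for f h
    proof -
      have "coeff_asymp f (h * sqrt_const)" using that by (simp add: sqrt_sing_def)
      from subcritical_coeff[OF Q0 Qnn cQ 3 ce this] show ?thesis
        unfolding dr_def[symmetric] by (simp add: s_def W_def algebra_simps)
    qed
    obtain h where h: "\<And>k. sqrt_sing (fps_rescale \<rho> (Qk k)) (h k)" using sing_Qk by metis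
    \<comment> \<open>The coefficient of u^k in \<open>omega\<close>. The square-root constants h k
      of \<open>Qk k\<close> stand for the coefficients of \<eta>(u), which is verified
      below.\<close>
    define w where "w k = ((if k = 0 then 1 else 0) * \<kappa> + W * eval_fps (Qk k) \<rho> + h k * dr\<^sup>2) / den" for k
    have W: "W \<ge> 0" using \<kappa> dr \<eta>p by (simp add: W_def)
    have tQ0: "fps_total Q \<ge> 0" unfolding fps_total_def using abs_sum_summable[OF aQ] Qnn by (rule suminf_nonneg)
    have den: "den > 0" unfolding den_def using \<kappa> W tQ0 \<eta>p dr by (intro add_pos_nonneg) auto
    have lim: "(\<lambda>n. prob_X p q n k) \<longlonglongrightarrow> w k" for k
    proof -
      have 1: "coeff_asymp (fps_const (if k = 0 then 1 else 0) * e + fps_rescale \<rho> (Qk k) * ((inverse (1 - Q))\<^sup>2 * e))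
         ((if k = 0 then 1 else 0) * (\<kappa> * fps_total e * sqrt_const) + s * (h k * dr\<^sup>2 + W * eval_fps (Qk k) \<rho>))"
        using coeff_asymp_add[OF coeff_asymp_cmult[OF ce] cf[OF h[of k]]] unfolding fps_total_rescale .
      have 2: "coeff_asymp (e + Q * ((inverse (1 - Q))\<^sup>2 * e)) (\<kappa> * fps_total e * sqrt_const + s * (\<eta> * dr\<^sup>2 + W * fps_total Q))"
        using coeff_asymp_add[OF ce cf[OF \<eta>]] .
      have l2: "\<kappa> * fps_total e * sqrt_const + s * (\<eta> * dr\<^sup>2 + W * fps_total Q) = s * den" by (simp add: s_def den_def algebra_simps)
      have l1: "(if k = 0 then 1 else 0) * (\<kappa> * fps_total e * sqrt_const) + s * (h k * dr\<^sup>2 + W * eval_fps (Qk k) \<rho>) = s * (w k * den)"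
      proof -
        have "w k * den = (if k = 0 then 1 else 0) * \<kappa> + W * eval_fps (Qk k) \<rho> + h k * dr\<^sup>2" using den by (simp add: w_def)
        thus ?thesis by (simp add: s_def algebra_simps)
      qed
      have "(\<lambda>n. (fps_nth (fps_const (if k = 0 then 1 else 0) * e + fps_rescale \<rho> (Qk k) * ((inverse (1 - Q))\<^sup>2 * e)) n * real n powr (3/2)) /
         (fps_nth (e + Q * ((inverse (1 - Q))\<^sup>2 * e)) n * real n powr (3/2))) \<longlonglongrightarrow> s * (w k * den) / (s * den)"
        using 1 2 s den unfolding coeff_asymp_def l1 l2 by (intro tendsto_divide) auto
      moreover have "\<forall>\<^sub>F n in sequentially. (fps_nth (fps_const (if k = 0 then 1 else 0) * e + fps_rescale \<rho> (Qk k) * ((inverse (1 - Q))\<^sup>2 * e)) n * real n powr (3/2)) /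
         (fps_nth (e + Q * ((inverse (1 - Q))\<^sup>2 * e)) n * real n powr (3/2)) = prob_X p q n k"
        using eventually_gt_at_top[of 0] by eventually_elim (simp add: prob)
      ultimately have "(\<lambda>n. prob_X p q n k) \<longlonglongrightarrow> s * (w k * den) / (s * den)" by (rule Lim_transform_eventually)
      thus ?thesis using s den by simp
    qed
    have sums: "(\<lambda>k. w k * u ^ k) sums omega p c d q u" if u: "u \<in> {0..1}" for u
    proof -
      obtain \<eta>u where \<eta>u: "sqrt_sing (fps_rescale \<rho> (Qu u)) \<eta>u" using sing_Qu[of u] u t1 by auto
      \<comment> \<open>Room between 1 and \<tau>: the expansion at r > 1 gives bounds decaying like
        r^(-k), uniform in n, so the sum over k and the limit in n commute even for u = 1.\<close>
      define r where "r = (1 + \<tau>) / 2"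
      have r: "1 < r" "r < \<tau>" using t1 by (auto simp: r_def)
      obtain \<eta>r where \<eta>r: "sqrt_sing (fps_rescale \<rho> (Qu r)) \<eta>r" using sing_Qu[of r] r by auto
      have "(\<lambda>n. fps_nth (fps_rescale \<rho> (Qu r)) n * real n powr (3/2)) \<longlonglongrightarrow> \<eta>r * sqrt_const"
        using \<eta>r by (simp add: sqrt_sing_def coeff_asymp_def)
      hence "Bseq (\<lambda>n. fps_nth (fps_rescale \<rho> (Qu r)) n * real n powr (3/2))" using convergent_imp_Bseq convergentI by blast
      then obtain B where B: "\<And>n. \<bar>fps_nth (fps_rescale \<rho> (Qu r)) n * real n powr (3/2)\<bar> \<le> B" unfolding Bseq_def by auto
      define T where "T n k = fps_nth (fps_rescale \<rho> (Qk k)) n * u ^ k * real n powr (3/2)" for n k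
      have Tlim: "(\<lambda>n. T n k) \<longlonglongrightarrow> (h k * sqrt_const) * u ^ k" for k
      proof -
        have "(\<lambda>n. fps_nth (fps_rescale \<rho> (Qk k)) n * real n powr (3/2) * u ^ k) \<longlonglongrightarrow> (h k * sqrt_const) * u ^ k"
          using h[of k] by (intro tendsto_mult_right) (simp add: sqrt_sing_def coeff_asymp_def)
        thus ?thesis by (simp add: T_def mult_ac)
      qed
      have Tb: "\<bar>T n k\<bar> \<le> B * (1 / r) ^ k" for n k
      proof -
        have nn: "0 \<le> fps_nth (Qk k) n" by (simp add: Qk_def Qc_nonneg)
        have "fps_nth (Qk k) n * r ^ k \<le> fps_nth (Qu r) n"
          using sum_le_suminf[OF sums_summable[OF Qc_sums[of n r]], of "{k}"] Qc_nonneg r sums_unique[OF Qc_sums[of n r]]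
          by (simp add: Qk_def)
        hence "fps_nth (Qk k) n * r ^ k * \<rho> ^ n * real n powr (3/2) \<le> fps_nth (Qu r) n * \<rho> ^ n * real n powr (3/2)"
          using rho_props by (intro mult_right_mono) auto
        also have "\<dots> \<le> B" using B[of n] by (simp add: abs_le_iff)
        finally have b: "fps_nth (Qk k) n * r ^ k * \<rho> ^ n * real n powr (3/2) \<le> B" .
        have "\<bar>T n k\<bar> = (fps_nth (Qk k) n * \<rho> ^ n * real n powr (3/2)) * u ^ k"
          using nn u rho_props by (simp add: T_def abs_mult)
        also have "\<dots> \<le> (fps_nth (Qk k) n * \<rho> ^ n * real n powr (3/2)) * 1"
          using nn u rho_props by (intro mult_left_mono) (auto simp: power_le_one)
        also have "\<dots> = (fps_nth (Qk k) n * r ^ k * \<rho> ^ n * real n powr (3/2)) * (1 / r) ^ k"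
          using r by (simp add: power_divide)
        also have "\<dots> \<le> B * (1 / r) ^ k" using b r by (intro mult_right_mono) auto
        finally show ?thesis .
      qed
      have Bs: "summable (\<lambda>k. B * (1 / r) ^ k)" using r by (intro summable_mult summable_geometric) auto
      note tan = tannery_seq[OF Tlim Tb Bs]
      have "(\<Sum>k. T n k) = fps_nth (fps_rescale \<rho> (Qu u)) n * real n powr (3/2)" for n
      proof -
        have "(\<lambda>k. Qc n k * u ^ k * (\<rho> ^ n * real n powr (3/2))) sums (fps_nth (Qu u) n * (\<rho> ^ n * real n powr (3/2)))"
          by (intro sums_mult2 Qc_sums)
        hence "(\<lambda>k. T n k) sums (fps_nth (fps_rescale \<rho> (Qu u)) n * real n powr (3/2))" by (simp add: T_def Qk_def mult_ac)
        thus ?thesis by (simp add: sums_iff)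
      qed
      hence "(\<lambda>n. fps_nth (fps_rescale \<rho> (Qu u)) n * real n powr (3/2)) \<longlonglongrightarrow> (\<Sum>k. (h k * sqrt_const) * u ^ k)" using tan(1) by simp
      moreover have "(\<lambda>n. fps_nth (fps_rescale \<rho> (Qu u)) n * real n powr (3/2)) \<longlonglongrightarrow> \<eta>u * sqrt_const"
        using \<eta>u by (simp add: sqrt_sing_def coeff_asymp_def)
      \<comment> \<open>The same coefficients have two limits, termwise in k and as a whole; hence
        \<eta>(u) is the generating function of h.\<close>
      ultimately have eq: "(\<Sum>k. (h k * sqrt_const) * u ^ k) = \<eta>u * sqrt_const" by (rule LIMSEQ_unique)
      have "(\<lambda>k. (h k * sqrt_const) * u ^ k) sums (\<eta>u * sqrt_const)"
        using summable_sums[OF summable_rabs_cancel[OF tan(2)]] unfolding eq .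
      from sums_mult2[OF this, of "1 / sqrt_const"] have hs: "(\<lambda>k. h k * u ^ k) sums \<eta>u"
        using sqrt_const_pos by simp
      have Qs: "(\<lambda>k. eval_fps (Qk k) \<rho> * u ^ k) sums Qfun p q \<rho> u"
        using rho_props u by (intro Qk_double_sum sm) auto
      have ks: "(\<lambda>k. if k = 0 then \<kappa> else 0) sums \<kappa>" using sums_single[of 0 "\<lambda>_. \<kappa>"] by simp
      have "(\<lambda>k. ((if k = 0 then \<kappa> else 0) + W * (eval_fps (Qk k) \<rho> * u ^ k) + (h k * u ^ k) * dr\<^sup>2) / den) sums 
         ((\<kappa> + W * Qfun p q \<rho> u + \<eta>u * dr\<^sup>2) / den)"
        by (intro sums_divide sums_add sums_mult sums_mult2 hs Qs ks)
      moreover have "((if k = 0 then \<kappa> else 0) + W * (eval_fps (Qk k) \<rho> * u ^ k) + (h k * u ^ k) * dr\<^sup>2) / den = w k * u ^ k" for k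
        by (cases "k = 0") (auto simp: w_def algebra_simps)
      moreover have "omega p c d q u = (\<kappa> + W * Qfun p q \<rho> u + \<eta>u * dr\<^sup>2) / den"
        using ne C_over_tau eta_eq[OF \<eta>u] eta_eq[OF \<eta>[unfolded Q_def]]
        unfolding omega_def Let_def \<tau>_def[symmetric] \<rho>_def[symmetric]
        by (simp add: den_def W_def dr_def \<kappa>_def tQ Qfun_eval)
      ultimately show ?thesis by simp
    qed
    show ?thesis unfolding limit_law_def using sums lim by blast
  qed
qed

lemma limit_law_holds: limit_law
  using tau_gt_1_limit_law tau_le_1_limit_law by linarith

end

theorem theorem4p21:
  fixes p :: "int \<Rightarrow> real" and c d :: nat and q :: real
  assumes "c \<ge> 1" and "d \<ge> 1"
    and "\<forall>i. 0 \<le> p i"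
    and "\<forall>i. (i < - int c \<or> i > int d) \<longrightarrow> p i = 0"
    and "p (- int c) \<noteq> 0" and "p (int d) \<noteq> 0"
    and "aperiodic p"
    and "q > 0"
  shows "\<exists>w :: nat \<Rightarrow> real.
           (\<forall>u\<in>{0..1}. (\<lambda>k. w k * u ^ k) sums omega p c d q u) \<and>
           (\<forall>k. (\<lambda>n. prob_X p q n k) \<longlonglongrightarrow> w k)"
proof -
  interpret catastrophe_walk p c d q using assms by unfold_locales auto
  show ?thesis using limit_law_holds unfolding limit_law_def .
qed

end
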